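(* Let $\alpha>-1$, $m\ge 0$, $\nu>0$, and let $\Phi$ and $P_tf$ be as defined in the context. For every $f\in L^1(\Phi)$ the function $u(t,x)=P_tf(x)$ is defined by an absolutely convergent integral, and: (i) $u\in C^\infty((0,\infty)\times\mathbb{R}_+)$ and $u$ satisfies the partial differential equation $$u_{tt}+\frac{1-2\nu}{t}\,u_t=\mathbb{L}u\qquad\text{in }(0,\infty)\times\mathbb{R}_+ ;$$ (ii) $\lim_{t\to0^+}u(t,x)=f(x)$ for a.e. $x\in\mathbb{R}_+$. Conversely, if a (measurable) function $f\ge 0$ on $\mathbb{R}_+$ is such that the integral defining $P_tf(x)$ is finite for some $(t,x)\in(0,\infty)\times\mathbb{R}_+$, then $f$ must necessarily belong to $L^1(\Phi)$.
   Context: $\mathbb{R}_+=(0,\infty)$. The Laguerre operator (acting in the variable $y\in\mathbb{R}_+$) is $$\mathbb{L}=-y\,\partial_{yy}-(\alpha+1-y)\,\partial_y+m .$$ Let $L_n^\alpha$, $n=0,1,2,\dots$, be the normalized Laguerre polynomials: $L^\alpha_n$ has degree $n$ and $\{L_n^\alpha\}_{n\ge0}$ is orthonormal in $L^2(\mathbb{R}_+,y^\alpha e^{-y}dy)$; they satisfy $\mathbb{L}L_n^\alpha=(n+m)L_n^\alpha$. The heat semigroup is $$[e^{-u\mathbb{L}}f](x)=\int_0^\infty e^{-u\mathbb{L}}(x,y)\,f(y)\,y^\alpha e^{-y}\,dy,\qquad e^{-u\mathbb{L}}(x,y)=\sum_{n=0}^\infty e^{-(n+m)u}L_n^\alpha(x)L_n^\alpha(y),\quad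 u>0 .$$ The Poisson-like integral of a function $f:\mathbb{R}_+\to\mathbb{C}$ is $$P_tf(x)=\frac{t^{2\nu}}{4^\nu\Gamma(\nu)}\int_0^\infty e^{-\frac{t^2}{4u}}\,[e^{-u\mathbb{L}}f](x)\,\frac{du}{u^{1+\nu}},\qquad t>0 .$$ (Absolute convergence/finiteness refers to this expression as an iterated integral in $u$ and $y$.) The function $\Phi$ on $\mathbb{R}_+$ is $$\Phi(y)=\frac{y^\alpha e^{-y}}{(1+y)^m[\ln(e+y)]^{1+\nu}}\ \text{ if }m>0,\qquad \Phi(y)=\frac{y^\alpha e^{-y}}{[\ln(e+y)]^{\nu}}\ \text{ if }m=0,$$ and $f\in L^1(\Phi)$ means that $f$ is measurable and $\int_0^\infty|f(y)|\Phi(y)\,dy<\infty$. *)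

theory Defs
  imports "HOL-Analysis.Analysis" "HOL-Computational_Algebra.Polynomial"
begin

text \<open>
  The orthonormality conditions together with the degree condition determine each \<open>L n\<close> up to
  sign, and the kernel below only involves the products \<open>L n x * L n y\<close>, so nothing depends on
  the choice of \<open>L\<close>.
\<close>
definition normalized_laguerre :: "real \<Rightarrow> (nat \<Rightarrow> real poly) \<Rightarrow> bool" where
  "normalized_laguerre \<alpha> L \<longleftrightarrow>
     (\<forall>n. degree (L n) = n) \<and>
     (\<forall>i j. (LINT y:{0<..}|lebesgue. poly (L i) y * poly (L j) y * (y powr \<alpha> * exp (- y)))
              = (if i = j then 1 else 0))"

definition laguerre_op :: "real \<Rightarrow> real \<Rightarrow> (real \<Rightarrow> complex) \<Rightarrow> real \<Rightarrow> complex" where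
  "laguerre_op \<alpha> m g y =
     - (y *\<^sub>R vector_derivative (\<lambda>z. vector_derivative g (at z)) (at y))
     - (\<alpha> + 1 - y) *\<^sub>R vector_derivative g (at y)
     + m *\<^sub>R g y"

definition heat_kernel ::
  "real \<Rightarrow> (nat \<Rightarrow> real poly) \<Rightarrow> real \<Rightarrow> real \<Rightarrow> real \<Rightarrow> real" where
  "heat_kernel m L u x y = (\<Sum>n. exp (- (real n + m) * u) * poly (L n) x * poly (L n) y)"

definition heat_semigroup ::
  "real \<Rightarrow> real \<Rightarrow> (nat \<Rightarrow> real poly) \<Rightarrow> real \<Rightarrow> (real \<Rightarrow> complex) \<Rightarrow> real \<Rightarrow> complex" where
  "heat_semigroup \<alpha> m L u f x =
     (LINT y:{0<..}|lebesgue. (heat_kernel m L u x y * (y powr \<alpha> * exp (- y))) *\<^sub>R f y)"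

definition poisson_integral ::
  "real \<Rightarrow> real \<Rightarrow> real \<Rightarrow> (nat \<Rightarrow> real poly) \<Rightarrow> real \<Rightarrow> (real \<Rightarrow> complex) \<Rightarrow> real \<Rightarrow> complex" where
  "poisson_integral \<alpha> m \<nu> L t f x =
     (t powr (2 * \<nu>) / (4 powr \<nu> * Gamma \<nu>)) *\<^sub>R
     (LINT u:{0<..}|lebesgue.
        (exp (- (t\<^sup>2 / (4 * u))) / u powr (1 + \<nu>)) *\<^sub>R heat_semigroup \<alpha> m L u f x)"

text \<open>
  The iterated integral of the absolute value of the integrand of \<^const>\<open>poisson_integral\<close>,
  computed in \<open>[0, \<infinity>]\<close>, is finite.
\<close>
definition poisson_abs_convergent ::
  "real \<Rightarrow> real \<Rightarrow> real \<Rightarrow> (nat \<Rightarrow> real poly) \<Rightarrow> real \<Rightarrow> (real \<Rightarrow> complex) \<Rightarrow> real \<Rightarrow> bool" where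
  "poisson_abs_convergent \<alpha> m \<nu> L t f x \<longleftrightarrow>
     (\<integral>\<^sup>+u\<in>{0<..}. ennreal (exp (- (t\<^sup>2 / (4 * u))) / u powr (1 + \<nu>)) *
        (\<integral>\<^sup>+y\<in>{0<..}. ennreal (\<bar>heat_kernel m L u x y\<bar> * (y powr \<alpha> * exp (- y)) * norm (f y))
           \<partial>lebesgue) \<partial>lebesgue) < \<infinity>"

definition \<Phi> :: "real \<Rightarrow> real \<Rightarrow> real \<Rightarrow> real \<Rightarrow> real" where
  "\<Phi> \<alpha> m \<nu> y =
     (if m > 0 then y powr \<alpha> * exp (- y) / ((1 + y) powr m * ln (exp 1 + y) powr (1 + \<nu>))
      else y powr \<alpha> * exp (- y) / ln (exp 1 + y) powr \<nu>)"

definition L1_Phi :: "real \<Rightarrow> real \<Rightarrow> real \<Rightarrow> (real \<Rightarrow> complex) set" where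
  "L1_Phi \<alpha> m \<nu> =
     {f. f \<in> borel_measurable (lebesgue_on {0<..}) \<and>
         (\<integral>\<^sup>+y\<in>{0<..}. ennreal (norm (f y) * \<Phi> \<alpha> m \<nu> y) \<partial>lebesgue) < \<infinity>}"

text \<open>\<open>C_k_on k S f\<close>: \<open>f\<close> is of class \<open>C\<^sup>k\<close> on the open set \<open>S\<close>.\<close>
fun C_k_on ::
  "nat \<Rightarrow> 'a::real_normed_vector set \<Rightarrow> ('a \<Rightarrow> 'b::real_normed_vector) \<Rightarrow> bool" where
  "C_k_on 0 S f \<longleftrightarrow> continuous_on S f"
| "C_k_on (Suc k) S f \<longleftrightarrow>
     (\<forall>p\<in>S. f differentiable (at p)) \<and>
     (\<forall>v. C_k_on k S (\<lambda>p. frechet_derivative f (at p) v))"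

definition C_infinity_on ::
  "'a::real_normed_vector set \<Rightarrow> ('a \<Rightarrow> 'b::real_normed_vector) \<Rightarrow> bool" where
  "C_infinity_on S f \<longleftrightarrow> (\<forall>k. C_k_on k S f)"

end

theory Submission
  imports Defs "HOL-Complex_Analysis.Complex_Analysis" "HOL-Real_Asymp.Real_Asymp"
begin

text \<open>
  By the Hille-Hardy formula the heat kernel is an elementary factor times a modified Bessel
  function. A Riccati inequality for the logarithmic derivative of the latter gives two-sided
  bounds, and integrating them in \<open>u\<close> shows that, for fixed \<open>t\<close> and \<open>x\<close>, the Poisson kernel is
  comparable to \<open>\<Phi>\<close>. With Tonelli's theorem this yields absolute convergence on \<open>L1_Phi\<close> and the
  converse.

  The integrand in \<open>(u, y)\<close> extends holomorphically in \<open>t\<close> and in \<open>x\<close> with locally uniform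
  integrable majorants, so Cauchy estimates permit differentiation under the integral to any order.
  The weight \<open>w = t\<^bsup>2\<nu>\<^esup> exp(-t\<^sup>2/4u) / u\<^bsup>1+\<nu>\<^esup>\<close> satisfies \<open>w\<^sub>t\<^sub>t + (1 - 2\<nu>)/t w\<^sub>t = w\<^sub>u\<close> and the heat kernel
  \<open>k\<close> satisfies \<open>k\<^sub>u = - \<bbbL>\<^sub>x k\<close>; hence the equation reduces to \<open>\<integral> \<partial>\<^sub>u (w k) du = 0\<close>.

  For the boundary limit it suffices that \<open>e\<^bsup>-u\<bbbL>\<^esup> f (x) \<rightarrow> f x\<close> as \<open>u \<rightarrow> 0\<close>, because the normalized weight
  concentrates at \<open>u = 0\<close>. This holds wherever the primitive of \<open>f\<close> has derivative \<open>f x\<close>: integrating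
  by parts near \<open>x\<close>, one needs \<open>\<integral> \<bar>\<partial>\<^sub>y k\<bar> \<bar>y - x\<bar> dy\<close> to stay bounded, which follows from the bound on the
  logarithmic derivative and the second moment of the kernel about \<open>x\<close>.
\<close>

section \<open>The modified Bessel series\<close>

text \<open>The shape of \<open>\<Phi>\<close> reflects that, for fixed x, y enters the kernel
  essentially through exp (-u) y. The kernel is negligible until u reaches ln y and of order exp (-m
  u) afterwards, so the Poisson kernel behaves like the integral of u^(-1-\<nu>) exp (-m u) beyond
  ln y: y^(-m) (ln y)^(-1-\<nu>) for m > 0, while for m = 0 integrating the bare power gains a
  logarithm. Hence the two cases. The Riccati bounds fix the logarithmic derivative of the Bessel
  series up to an additive constant. This precision matters twice: the exponent must be exactly 2
  sqrt z to complete a square with the other exponentials, and near y = x the error must stay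
  bounded although the main terms, which cancel, are each of size 1/u. At the boundary no maximal
  function appears: one-sided smallness of the primitive of f - f x at x takes the place of the
  Lebesgue point property. As f need not be Lebesgue integrable near 0, all local arguments stay on
  compact intervals inside the open half line.\<close>

definition bessel_coeff :: "real \<Rightarrow> nat \<Rightarrow> real" where
  "bessel_coeff a k = 1 / (fact k * Gamma (real k + a))"

text \<open>
  In terms of the modified Bessel function, \<open>bessel a z = z\<^bsup>(1-a)/2\<^esup> I\<^bsub>a-1\<^esub>(2 \<surd>z)\<close>.
\<close>

definition bessel :: "real \<Rightarrow> 'a::{real_normed_field,banach} \<Rightarrow> 'a" where
  "bessel a z = (\<Sum>k. of_real (bessel_coeff a k) * z ^ k)"

lemma bessel_coeff_pos: "a > 0 \<Longrightarrow> bessel_coeff a k > 0"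
  by (simp add: bessel_coeff_def Gamma_real_pos)

lemma bessel_coeff_Suc: "a > 0 \<Longrightarrow> bessel_coeff a (Suc k) = bessel_coeff a k / ((real k + 1) * (real k + a))"
  using Gamma_plus1[of "real k + a"]
  by (simp add: bessel_coeff_def add_ac nonpos_Ints_def)

lemma bessel_coeff_diffs: "bessel_coeff (a + 1) k = (real k + 1) * bessel_coeff a (Suc k)"
  by (auto simp: bessel_coeff_def add_ac divide_simps)

lemma bessel_coeff_recurrence:
  assumes "a > 0"
  shows "bessel_coeff a k = (real k + a) * bessel_coeff (a + 1) k"
  by (subst bessel_coeff_diffs, subst bessel_coeff_Suc[OF assms]) (use assms in auto)

lemma bessel_summable_norm:
  fixes z :: "'a::{real_normed_field,banach}"
  assumes "a > 0"
  shows "summable (\<lambda>k. norm (of_real (bessel_coeff a k) * z ^ k))"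
\<comment> \<open>The ratio of consecutive terms is norm z / ((n + 1) (n + a)). Taking n >= 1 as
  well ensures n + a >= 1 for small a, so that the denominator is at least n + 1 >= 2 norm
  z.\<close>
proof (rule summable_ratio_test[where c="1/2" and N="nat \<lceil>2 * norm z\<rceil> + 1"])
  fix n assume "n \<ge> nat \<lceil>2 * norm z\<rceil> + 1"
  hence n: "2 * norm z \<le> real n" "n \<ge> 1" by linarith+
  have "(real n + 1) * (real n + a) \<ge> (real n + 1) * 1"
    by (intro mult_left_mono) (use n assms in auto)
  from order_trans[OF _ this, of "2 * norm z"] have "2 * norm z \<le> (real n + 1) * (real n + a)"
    using n by simp
  hence "norm z / ((real n + 1) * (real n + a)) \<le> 1/2"
    using n assms by (simp add: divide_simps add_pos_nonneg)
  hence "norm (of_real (bessel_coeff a n) * z ^ n) * (norm z / ((real n + 1) * (real n + a)))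
     \<le> norm (of_real (bessel_coeff a n) * z ^ n) * (1/2)"
    by (intro mult_left_mono) auto
  moreover have nb: "norm (of_real (bessel_coeff a k) * z ^ k) = bessel_coeff a k * norm z ^ k" for k
    using bessel_coeff_pos[OF assms, of k] by (simp add: norm_mult norm_power)
  ultimately show "norm (norm (of_real (bessel_coeff a (Suc n)) * z ^ Suc n))
      \<le> 1/2 * norm (norm (of_real (bessel_coeff a n) * z ^ n))"
    unfolding real_norm_def abs_norm_cancel unfolding nb
    by (simp add: bessel_coeff_Suc[OF assms] mult_ac)
qed simp

lemma bessel_summable:
  fixes z :: "'a::{real_normed_field,banach}"
  assumes "a > 0"
  shows "summable (\<lambda>k. of_real (bessel_coeff a k) * z ^ k)"
  using bessel_summable_norm[OF assms] by (rule summable_norm_cancel)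

lemma bessel_sums:
  fixes z :: "'a::{real_normed_field,banach}"
  assumes "a > 0"
  shows "(\<lambda>k. of_real (bessel_coeff a k) * z ^ k) sums bessel a z"
  unfolding bessel_def by (rule summable_sums[OF bessel_summable[OF assms]])

lemma bessel_of_real:
  assumes "a > 0"
  shows "bessel a (of_real z :: 'a::{real_normed_field,banach}) = of_real (bessel a z)"
proof -
  have "(\<lambda>k. of_real (of_real (bessel_coeff a k) * z ^ k) :: 'a) sums of_real (bessel a z)"
    using bessel_sums[OF assms, of z] by (subst sums_of_real_iff)
  thus ?thesis using bessel_sums[OF assms, of "of_real z :: 'a"] by (simp add: sums_iff)
qed

lemma norm_bessel_le:
  fixes z :: "'a::{real_normed_field,banach}"
  assumes "a > 0"
  shows "norm (bessel a z) \<le> bessel a (norm z)"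
proof -
  have "norm (bessel a z) \<le> (\<Sum>k. norm (of_real (bessel_coeff a k) * z ^ k))"
    unfolding bessel_def by (rule summable_norm[OF bessel_summable_norm[OF assms]])
  also have "\<dots> = bessel a (norm z)"
    unfolding bessel_def using bessel_coeff_pos[OF assms]
    by (simp add: norm_mult norm_power less_imp_le abs_of_pos)
  finally show ?thesis .
qed

lemma bessel_mono:
  fixes x y :: real
  assumes "a > 0" "0 \<le> x" "x \<le> y"
  shows "bessel a x \<le> bessel a y"
  unfolding bessel_def
  by (intro suminf_le bessel_summable assms)
     (use assms bessel_coeff_pos[OF assms(1)] in \<open>auto intro!: mult_left_mono power_mono simp: less_imp_le\<close>)

lemma bessel_0: "bessel a (0::'a::{real_normed_field,banach}) = of_real (1 / Gamma a)"
proof -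
  have "(\<lambda>k. of_real (bessel_coeff a k) * (0::'a) ^ k) sums (of_real (bessel_coeff a 0))"
    using powser_sums_zero[of "\<lambda>k. of_real (bessel_coeff a k) :: 'a"] by simp
  thus ?thesis by (simp add: bessel_def sums_iff bessel_coeff_def)
qed

lemma bessel_pos:
  fixes x :: real
  assumes "a > 0" "0 \<le> x"
  shows "bessel a x > 0"
proof -
  have "0 < bessel a (0::real)" using Gamma_real_pos[OF assms(1)] by (simp add: bessel_0)
  also have "\<dots> \<le> bessel a x" using bessel_mono[OF assms(1) order_refl assms(2)] .
  finally show ?thesis .
qed

lemma DERIV_bessel:
  fixes z :: "'a::{real_normed_field,banach}"
  assumes "a > 0"
  shows "(bessel a has_field_derivative bessel (a + 1) z) (at z)"
proof -
  have "diffs (\<lambda>k. of_real (bessel_coeff a k) :: 'a) = (\<lambda>k. of_real (bessel_coeff (a + 1) k))"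
    by (rule ext) (simp add: diffs_def bessel_coeff_diffs)
  thus ?thesis
    using termdiffs_strong_converges_everywhere[OF bessel_summable[OF assms], of z]
    by (simp add: bessel_def[abs_def])
qed

lemma DERIV_bessel_chain [derivative_intros]:
  fixes f :: "'a \<Rightarrow> 'a::{real_normed_field,banach}"
  assumes "a > 0" "(f has_field_derivative f') (at x within S)"
  shows "((\<lambda>x. bessel a (f x)) has_field_derivative bessel (a + 1) (f x) * f') (at x within S)"
  by (rule DERIV_chain'[OF assms(2) DERIV_bessel[OF assms(1)]])

lemma isCont_bessel: "a > 0 \<Longrightarrow> isCont (bessel a) (z::'a::{real_normed_field,banach})"
  using DERIV_bessel by (rule DERIV_isCont)

lemma continuous_on_bessel:
  fixes f :: "'b::topological_space \<Rightarrow> 'a::{real_normed_field,banach}"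
  assumes "a > 0" "continuous_on S f"
  shows "continuous_on S (\<lambda>x. bessel a (f x))"
  by (rule continuous_on_compose2[of UNIV "bessel a"])
     (use assms isCont_bessel in \<open>auto intro: continuous_at_imp_continuous_on\<close>)

text \<open>Differentiation raises the parameter by one, so this is the differential equation z J''
  + a J' = J of J = \<open>bessel a\<close>. Coefficientwise it is
  \<open>bessel_coeff_recurrence\<close>: the term with factor k comes from z J'', the term with
  factor a from a J'.\<close>

lemma bessel_ode:
  fixes z :: "'a::{real_normed_field,banach}"
  assumes "a > 0"
  shows "z * bessel (a + 2) z + of_real a * bessel (a + 1) z = bessel a z"
proof -
  define f where "f k = of_real (real k * bessel_coeff (a + 1) k) * z ^ k" for k
  have "(\<lambda>k. z * (of_real (bessel_coeff (a + 2) k) * z ^ k)) sums (z * bessel (a + 2) z)"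
    using bessel_sums[of "a + 2" z] assms by (intro sums_mult) auto
  also have "(\<lambda>k. z * (of_real (bessel_coeff (a + 2) k) * z ^ k)) = (\<lambda>k. f (Suc k))"
    using bessel_coeff_diffs[of "a + 1"] by (auto simp: f_def mult_ac add_ac)
  finally have "f sums (z * bessel (a + 2) z)"
    by (subst (asm) sums_Suc_iff) (simp add: f_def)
  moreover have "(\<lambda>k. of_real a * (of_real (bessel_coeff (a + 1) k) * z ^ k)) sums (of_real a * bessel (a + 1) z)"
    using bessel_sums[of "a + 1" z] assms by (intro sums_mult) auto
  ultimately have "(\<lambda>k. f k + of_real a * (of_real (bessel_coeff (a + 1) k) * z ^ k))
      sums (z * bessel (a + 2) z + of_real a * bessel (a + 1) z)"
    by (rule sums_add)
  also have "(\<lambda>k. f k + of_real a * (of_real (bessel_coeff (a + 1) k) * z ^ k)) = (\<lambda>k. of_real (bessel_coeff a k) * z ^ k)"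
    by (rule ext, subst bessel_coeff_recurrence[OF assms]) (simp add: f_def algebra_simps)
  finally show ?thesis using bessel_sums[OF assms, of z] by (simp add: sums_iff)
qed

text \<open>
  With \<open>E\<close> the difference of the two sides, the differential equation of \<open>bessel\<close> makes \<open>z\<^sup>a E\<close>
  nondecreasing from \<open>0\<close>.
\<close>

lemma bessel_riccati:
  fixes z :: real
  assumes a: "a > 0" and z: "z > 0"
  shows "(bessel a z)\<^sup>2 \<le> z * (bessel (a + 1) z)\<^sup>2 + a * bessel a z * bessel (a + 1) z"
proof -
  define E where "E w = w * (bessel (a + 1) w)\<^sup>2 + a * bessel a w * bessel (a + 1) w - (bessel a w)\<^sup>2" for w :: real
  have ode: "w * bessel (a + 2) w = bessel a w - a * bessel (a + 1) w" for w :: real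
    using bessel_ode[OF a, of w] by simp
  have dE: "(E has_field_derivative ((1 - a) * (bessel (a + 1) w)\<^sup>2 + a * bessel a w * bessel (a + 2) w)) (at w)" for w :: real
  proof -
    have *: "(bessel (a + 1) has_field_derivative bessel (a + 2) w) (at w)"
      using DERIV_bessel[of "a + 1" w] a by (simp add: add_ac)
    have "2 * bessel (a + 1) w * (w * bessel (a + 2) w) + (bessel (a + 1) w)\<^sup>2
        + a * (bessel a w * bessel (a + 2) w + bessel (a + 1) w * bessel (a + 1) w) - 2 * bessel a w * bessel (a + 1) w
       = (1 - a) * (bessel (a + 1) w)\<^sup>2 + a * bessel a w * bessel (a + 2) w"
      unfolding ode by (simp add: algebra_simps power2_eq_square)
    thus ?thesis unfolding E_def
      by - (rule DERIV_cong, (rule derivative_eq_intros refl DERIV_bessel[OF a] *)+,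
        simp add: algebra_simps power2_eq_square)
  qed
  \<comment> \<open>The left side is w^(1-a) times the derivative of w^a E. The product of
    \<open>bessel a\<close> and \<open>bessel (a + 2)\<close> cancels through the differential
    equation, and only a nonnegative square survives.\<close>
  have key: "w * ((1 - a) * (bessel (a + 1) w)\<^sup>2 + a * bessel a w * bessel (a + 2) w) + a * E w = w * (bessel (a + 1) w)\<^sup>2" for w :: real
  proof -
    have "w * ((1 - a) * (bessel (a + 1) w)\<^sup>2 + a * bessel a w * bessel (a + 2) w)
        = w * (1 - a) * (bessel (a + 1) w)\<^sup>2 + a * bessel a w * (w * bessel (a + 2) w)"
      by (simp add: algebra_simps)
    thus ?thesis unfolding ode E_def by (simp add: algebra_simps power2_eq_square)
  qed
  define h where "h w = w powr a * E w" for w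
  have dh: "(h has_field_derivative (w powr a * (bessel (a + 1) w)\<^sup>2)) (at w)" if "w > 0" for w
  proof -
    define D where "D = (1 - a) * (bessel (a + 1) w)\<^sup>2 + a * bessel a w * bessel (a + 2) w"
    have "(h has_field_derivative (a * w powr (a - 1) * E w + D * w powr a)) (at w)"
      unfolding h_def D_def using that
      by (auto intro!: derivative_eq_intros dE simp: algebra_simps)
    also have "w powr (a - 1) = w powr a / w" using that by (simp add: powr_diff)
    also have "a * (w powr a / w) * E w + D * w powr a = w powr a / w * (w * D + a * E w)"
      using that by (simp add: field_simps)
    also have "\<dots> = w powr a * (bessel (a + 1) w)\<^sup>2"
      using key[of w] that by (simp add: D_def)
    finally show ?thesis .
  qed
  have contE: "continuous_on {0..z} E"
    using dE by (intro continuous_at_imp_continuous_on ballI) (auto intro: DERIV_isCont)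
  \<comment> \<open>At 0 the power \<open>w powr a\<close> is continuous with value 0 because a > 0,
    but it need not be differentiable there; monotonicity therefore uses the derivative on the open
    interval only.\<close>
  have "continuous_on {0..z} h"
    unfolding h_def using a by (intro continuous_on_mult contE continuous_on_powr') (auto intro!: continuous_intros)
  hence "h 0 \<le> h z"
    using dh z by (intro DERIV_nonneg_imp_increasing_open[of 0 z h]) (auto intro!: exI)
  hence "0 \<le> z powr a * E z" by (simp add: h_def)
  hence "E z \<ge> 0" using z by (simp add: zero_le_mult_iff)
  thus ?thesis by (simp add: E_def)
qed

text \<open>For v = z J' / J the Riccati inequality reads z <= v (v + a), which is violated when v <
  sqrt z - a.\<close>

lemma bessel_log_deriv_lower:
  fixes z :: real
  assumes a: "a > 0" and z: "z > 0"
  shows "sqrt z - a \<le> z * bessel (a + 1) z / bessel a z"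
proof (rule ccontr)
  define v where "v = z * bessel (a + 1) z / bessel a z"
  assume "\<not> sqrt z - a \<le> z * bessel (a + 1) z / bessel a z"
  hence v: "v < sqrt z - a" by (simp add: v_def)
  have p: "bessel a z > 0" "bessel (a + 1) z > 0" using bessel_pos a z by auto
  have v0: "v > 0" using p z by (simp add: v_def)
  have "z * (bessel a z)\<^sup>2 \<le> z * (z * (bessel (a + 1) z)\<^sup>2 + a * bessel a z * bessel (a + 1) z)"
    using bessel_riccati[OF a z] z by (intro mult_left_mono) auto
  hence "z \<le> v * (v + a)" using p
    by (simp add: v_def field_simps power2_eq_square)
  also have "\<dots> < (sqrt z - a) * sqrt z"
    using v v0 a by (intro mult_strict_mono) auto
  also have "\<dots> \<le> z" using a z by (simp add: algebra_simps)
  finally show False by simp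
qed

text \<open>The Riccati inequality at parameter a + 1, with \<open>bessel (a + 2)\<close> eliminated
  by the differential equation, becomes an upper bound v^2 <= z + \<bar>1 - a\<bar> v for the same v
  = z J' / J. Solving it loses only an additive constant against sqrt z.\<close>

lemma bessel_log_deriv_upper:
  fixes z :: real
  assumes a: "a > 0" and z: "z > 0"
  shows "z * bessel (a + 1) z / bessel a z \<le> sqrt z + \<bar>1 - a\<bar>"
proof (rule ccontr)
  define v where "v = z * bessel (a + 1) z / bessel a z"
  assume "\<not> z * bessel (a + 1) z / bessel a z \<le> sqrt z + \<bar>1 - a\<bar>"
  hence v: "v > sqrt z + \<bar>1 - a\<bar>" by (simp add: v_def)
  have p: "bessel a z > 0" "bessel (a + 1) z > 0" using bessel_pos a z by auto
  have v0: "v > 0" using p z by (simp add: v_def)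
  define J J1 J2 where "J = bessel a z" and "J1 = bessel (a + 1) z" and "J2 = bessel (a + 2) z"
  have ode: "z * J2 = J - a * J1" using bessel_ode[OF a, of z] by (simp add: J_def J1_def J2_def)
  have "J1\<^sup>2 \<le> z * J2\<^sup>2 + (a + 1) * J1 * J2"
    using bessel_riccati[of "a + 1" z] a z by (simp add: J1_def J2_def add_ac)
  hence "z * J1\<^sup>2 \<le> z * (z * J2\<^sup>2 + (a + 1) * J1 * J2)"
    using z by (intro mult_left_mono) auto
  also have "\<dots> = (z * J2)\<^sup>2 + (a + 1) * J1 * (z * J2)" by (simp add: algebra_simps power2_eq_square)
  also have "\<dots> = J\<^sup>2 + (1 - a) * J * J1 - a * J1\<^sup>2"
    unfolding ode by (simp add: algebra_simps power2_eq_square)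
  finally have "z * J1\<^sup>2 \<le> J\<^sup>2 + (1 - a) * J * J1 - a * J1\<^sup>2" .
  also have "\<dots> \<le> J\<^sup>2 + \<bar>1 - a\<bar> * (J * J1)"
  proof -
    have "(1 - a) * (J * J1) \<le> \<bar>1 - a\<bar> * (J * J1)"
      using p by (intro mult_right_mono) (auto simp: J_def J1_def)
    moreover have "a * J1\<^sup>2 \<ge> 0" using a by simp
    ultimately show ?thesis by (simp add: mult.assoc)
  qed
  finally have "z * (z * J1\<^sup>2) \<le> z * (J\<^sup>2 + \<bar>1 - a\<bar> * (J * J1))" using z by (intro mult_left_mono) auto
  moreover have "z * J1 = v * J" using p by (simp add: v_def J_def J1_def)
  ultimately have "(v * J)\<^sup>2 \<le> z * J\<^sup>2 + \<bar>1 - a\<bar> * J * (v * J)"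
    by (metis (no_types, lifting) distrib_left mult.assoc mult.left_commute power2_eq_square)
  hence "v\<^sup>2 * J\<^sup>2 \<le> (z + \<bar>1 - a\<bar> * v) * J\<^sup>2" by (simp add: algebra_simps power2_eq_square)
  hence "v\<^sup>2 \<le> z + \<bar>1 - a\<bar> * v" using p by (simp add: J_def)
  hence "v * (v - \<bar>1 - a\<bar>) \<le> z" by (simp add: algebra_simps power2_eq_square)
  moreover have "(sqrt z + \<bar>1 - a\<bar>) * sqrt z < v * (v - \<bar>1 - a\<bar>)"
    using v v0 z by (intro mult_strict_mono) auto
  moreover have "z \<le> (sqrt z + \<bar>1 - a\<bar>) * sqrt z" using z by (simp add: algebra_simps)
  ultimately show False by linarith
qed

text \<open>Integrating J' / J <= q / w + 1 / sqrt w from 1 to z produces the power and the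
  exponential; on [0, 1] monotonicity suffices. The exponent 2 sqrt z is exact, the power is not,
  but powers are absorbed by exponentials later.\<close>

lemma bessel_upper:
  assumes a: "a > 0"
  obtains C where "C > 0" "\<And>z::real. z \<ge> 0 \<Longrightarrow> bessel a z \<le> C * (1 + z) powr \<bar>1 - a\<bar> * exp (2 * sqrt z)"
proof (rule that)
  define q where "q = \<bar>1 - a\<bar>"
  show "bessel a (1::real) > 0" using bessel_pos[OF a, of 1] by simp
  fix z :: real assume z: "z \<ge> 0"
  show "bessel a z \<le> bessel a 1 * (1 + z) powr \<bar>1 - a\<bar> * exp (2 * sqrt z)"
  proof (cases "z \<le> 1")
    case True
    have "bessel a z \<le> bessel a 1 * 1 * 1" using bessel_mono[OF a z True] by simp
    also have "\<dots> \<le> bessel a 1 * (1 + z) powr \<bar>1 - a\<bar> * exp (2 * sqrt z)"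
      by (intro mult_mono) (use z bessel_pos[OF a, of 1] in \<open>auto intro!: ge_one_powr_ge_zero\<close>)
    finally show ?thesis .
  next
    case False
    define g where "g w = ln (bessel a w) - q * ln w - 2 * sqrt w" for w :: real
    have "g z \<le> g 1"
    proof (rule DERIV_nonpos_imp_nonincreasing[of 1 z g])
      show "1 \<le> z" using False by simp
      fix w :: real assume w: "1 \<le> w" "w \<le> z"
      have p: "bessel a w > 0" using bessel_pos[OF a] w by simp
      have "w * bessel (a + 1) w / bessel a w \<le> sqrt w + q"
        using bessel_log_deriv_upper[OF a, of w] w by (simp add: q_def)
      hence "(w * bessel (a + 1) w / bessel a w) / w \<le> (sqrt w + q) / w"
        using w by (intro divide_right_mono) auto
      moreover have "sqrt w / w = 1 / sqrt w" using w by (simp add: divide_simps)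
      ultimately have "bessel (a + 1) w / bessel a w - q / w - 1 / sqrt w \<le> 0"
        using w by (simp add: add_divide_distrib)
      moreover have "(g has_field_derivative (bessel (a + 1) w / bessel a w - q / w - 1 / sqrt w)) (at w)"
        unfolding g_def using w p a
        by (auto intro!: derivative_eq_intros simp: divide_simps)
      ultimately show "\<exists>y. (g has_real_derivative y) (at w) \<and> y \<le> 0" by blast
    qed
    hence "ln (bessel a z) \<le> ln (bessel a 1) + q * ln z + 2 * sqrt z" by (simp add: g_def)
    hence "exp (ln (bessel a z)) \<le> exp (ln (bessel a 1) + q * ln z + 2 * sqrt z)" by simp
    also have "\<dots> = bessel a 1 * z powr q * exp (2 * sqrt z)"
      using False bessel_pos[OF a, of 1] by (simp add: exp_add powr_def)
    also have "\<dots> \<le> bessel a 1 * (1 + z) powr q * exp (2 * sqrt z)"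
      using False bessel_pos[OF a, of 1] by (auto intro!: mult_mono powr_mono2 simp: q_def)
    finally show ?thesis using bessel_pos[OF a, of z] z by (simp add: q_def)
  qed
qed

section \<open>Laguerre polynomials and the Hille-Hardy formula\<close>

lemma abs_summable_TimesI:
  fixes g :: "nat \<Rightarrow> nat \<Rightarrow> real"
  assumes "\<And>k. (\<lambda>p. gg k p) sums G k" "summable G" "\<And>k p. \<bar>g k p\<bar> \<le> gg k p"
  shows "(\<lambda>x. norm ((\<lambda>(k, p). g k p) x)) summable_on (UNIV \<times> UNIV)"
proof -
  have gg0: "gg k p \<ge> 0" for k p using assms(3)[of k p] by linarith
  have sg: "(\<lambda>p. gg k p) summable_on UNIV" for k
    using summable_nonneg_imp_summable_on[of "gg k"] assms(1)[of k] gg0 by (auto simp: sums_iff)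
  have ig: "infsum (gg k) UNIV = G k" for k
    using assms(1)[of k] sg[of k] gg0
    by (metis has_sum_imp_sums has_sum_infsum sums_unique2)
  have G0: "G k \<ge> 0" for k unfolding ig[symmetric] by (rule infsum_nonneg) (use gg0 in auto)
  have "(\<lambda>x. norm ((\<lambda>(k, p). gg k p) x)) summable_on (UNIV \<times> UNIV)"
    unfolding Infinite_Sum.abs_summable_on_Sigma_iff
    using sg gg0 summable_nonneg_imp_summable_on[OF assms(2)] G0 by (simp add: ig)
  thus ?thesis
    by (rule Infinite_Sum.abs_summable_on_comparison_test) (use assms(3) gg0 in \<open>auto simp: abs_of_nonneg\<close>)
qed

lemma bij_betw_diag: "bij_betw (\<lambda>(n, k). (k, n - k)) (Sigma UNIV (\<lambda>n::nat. {..n})) (UNIV \<times> UNIV)"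
  by (rule bij_betw_byWitness[where f' = "\<lambda>(k, p). (k + p, k)"]) auto

text \<open>An absolutely summable family may be summed in any order. Absolute summability is
  certified by a majorant \<open>gg\<close> with known row sums; in the applications this is the
  same family at arguments chosen so that all terms are nonnegative.\<close>

lemma sums_diag_of_rows:
  fixes g :: "nat \<Rightarrow> nat \<Rightarrow> real"
  assumes "\<And>k. (\<lambda>p. gg k p) sums G k" "summable G" "\<And>k p. \<bar>g k p\<bar> \<le> gg k p"
    and "\<And>k. g k sums h k" "h sums S"
  shows "(\<lambda>n. \<Sum>k\<le>n. g k (n - k)) sums S"
proof -
  have "(\<lambda>x. norm ((\<lambda>(k, p). g k p) x)) summable_on (UNIV \<times> UNIV)"
    by (rule abs_summable_TimesI[OF assms(1-3)])
  hence sm: "(\<lambda>(k, p). g k p) summable_on (UNIV \<times> UNIV)"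
    by (rule abs_summable_summable)
  define S' where "S' = infsum (\<lambda>(k, p). g k p) (UNIV \<times> UNIV)"
  have hs: "((\<lambda>(k, p). g k p) has_sum S') (UNIV \<times> UNIV)"
    unfolding S'_def using sm by (rule has_sum_infsum)
  have gs: "g k summable_on UNIV" for k
    using summable_on_Sigma_banach[OF sm] summable_on_SigmaD1[OF sm, of k] by auto
  have gk: "(g k has_sum h k) UNIV" for k
    using assms(4)[of k] gs[of k] by (metis has_sum_imp_sums has_sum_infsum sums_unique2)
  have "(h has_sum S') UNIV"
    by (rule has_sum_SigmaD[OF hs]) (use gk in auto)
  hence "S' = S" using assms(5) by (metis has_sum_imp_sums sums_unique2)
  have "((\<lambda>(n, k). g k (n - k)) has_sum S) (Sigma UNIV (\<lambda>n. {..n}))"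
    using has_sum_reindex_bij_betw[OF bij_betw_diag, of "\<lambda>(k, p). g k p" S'] hs \<open>S' = S\<close>
    by (simp add: case_prod_unfold)
  hence "((\<lambda>n. \<Sum>k\<le>n. g k (n - k)) has_sum S) UNIV"
    by (rule has_sum_SigmaD) (auto intro: has_sum_finiteI)
  thus ?thesis by (rule has_sum_imp_sums)
qed

text \<open>The converse rearrangement, with absolute summability now checked on the diagonals. It
  is used where the diagonal sums are binomial expansions and the row sums are the unknown
  quantity.\<close>

lemma sums_rows_of_diag:
  fixes g :: "nat \<Rightarrow> nat \<Rightarrow> real"
  assumes "summable (\<lambda>n. \<Sum>k\<le>n. \<bar>g k (n - k)\<bar>)" "(\<lambda>n. \<Sum>k\<le>n. g k (n - k)) sums S"
  shows "summable (g k)" "(\<lambda>k. suminf (g k)) sums S"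
proof -
  let ?D = "Sigma UNIV (\<lambda>n::nat. {..n})"
  have "(\<lambda>n. \<Sum>k\<le>n. \<bar>g k (n - k)\<bar>) summable_on UNIV"
    by (rule summable_nonneg_imp_summable_on[OF assms(1)]) (auto intro: sum_nonneg)
  hence "(\<lambda>x. norm ((\<lambda>(n, k). g k (n - k)) x)) summable_on ?D"
    unfolding Infinite_Sum.abs_summable_on_Sigma_iff by simp
  hence sm: "(\<lambda>(n, k). g k (n - k)) summable_on ?D"
    by (rule abs_summable_summable)
  define S' where "S' = infsum (\<lambda>(n, k). g k (n - k)) ?D"
  have hs: "((\<lambda>(n, k). g k (n - k)) has_sum S') ?D"
    unfolding S'_def using sm by (rule has_sum_infsum)
  have "((\<lambda>n. \<Sum>k\<le>n. g k (n - k)) has_sum S') UNIV"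
    by (rule has_sum_SigmaD[OF hs]) (auto intro: has_sum_finiteI)
  hence "S' = S" using assms(2) by (metis has_sum_imp_sums sums_unique2)
  hence hs': "((\<lambda>(k, p). g k p) has_sum S) (UNIV \<times> UNIV)"
    using has_sum_reindex_bij_betw[OF bij_betw_diag, of "\<lambda>(k, p). g k p" S'] hs
    by (simp add: case_prod_unfold)
  hence sm': "(\<lambda>(k, p). g k p) summable_on (UNIV \<times> UNIV)" by (auto simp: summable_on_def)
  have gs: "g k summable_on UNIV" for k
    using summable_on_SigmaD1[OF sm', of k] by auto
  hence gk: "g k sums suminf (g k)" for k
    using summable_on_imp_summable summable_sums by blast
  show "summable (g k)" using gk by (simp add: sums_iff)
  have gk': "(g k has_sum suminf (g k)) UNIV" for k
    using gk[of k] gs[of k] by (metis has_sum_imp_sums has_sum_infsum sums_unique2)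
  have "((\<lambda>k. suminf (g k)) has_sum S) UNIV"
    by (rule has_sum_SigmaD[OF hs']) (use gk' in auto)
  thus "(\<lambda>k. suminf (g k)) sums S" by (rule has_sum_imp_sums)
qed

text \<open>
  The classical polynomial \<open>L\<^sub>n\<close> of parameter \<open>\<alpha> = a - 1\<close>, with squared norm
  \<open>\<Gamma>(n + a) / n!\<close>.
\<close>

definition laguerre :: "real \<Rightarrow> nat \<Rightarrow> real \<Rightarrow> real" where
  "laguerre a n x = (\<Sum>k\<le>n. Gamma (real n + a) / (fact k * fact (n - k) * Gamma (real k + a)) * (- x) ^ k)"

text \<open>The coefficients alternate in sign, so at a nonpositive argument every term is
  nonnegative. This supplies the majorants for the rearrangements.\<close>

lemma abs_laguerre_le:
  assumes "a > 0"
  shows "\<bar>laguerre a n x\<bar> \<le> laguerre a n (- \<bar>x\<bar>)"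
proof -
  have "\<bar>laguerre a n x\<bar> \<le> (\<Sum>k\<le>n. \<bar>Gamma (real n + a) / (fact k * fact (n - k) * Gamma (real k + a)) * (- x) ^ k\<bar>)"
    unfolding laguerre_def by (rule sum_abs)
  also have "\<dots> = laguerre a n (- \<bar>x\<bar>)"
    unfolding laguerre_def using assms
    by (intro sum.cong refl) (auto simp: abs_mult power_abs Gamma_real_pos abs_of_pos)
  finally show ?thesis .
qed

section \<open>Generating functions and the Hille-Hardy formula\<close>

lemma negative_binomial_sums:
  assumes b: "b > 0" and r: "\<bar>r\<bar> < (1::real)"
  shows "(\<lambda>p. Gamma (real p + b) / (fact p * Gamma b) * r ^ p) sums ((1 - r) powr (- b))"
proof -
  have "((- b) gchoose p) * (- r) ^ p = Gamma (real p + b) / (fact p * Gamma b) * r ^ p" for p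
  proof -
    have "b \<notin> \<int>\<^sub>\<le>\<^sub>0" using b by (auto elim!: nonpos_Ints_cases)
    hence "Gamma (real p + b) / Gamma b = pochhammer b p"
      using pochhammer_Gamma[of b p] by (simp add: add_ac)
    note this[symmetric]
    thus ?thesis by (simp add: gbinomial_pochhammer power_minus[of r] field_simps)
  qed
  thus ?thesis using gen_binomial_real[of "- r" "- b"] r by simp
qed

text \<open>With the power k of x fixed and n = k + p, the sum over p is a negative binomial series
  with value (1 - r)^(-(k + a)); the remaining sum over k is the exponential series of - x r / (1 -
  r).\<close>

lemma laguerre_generating_sums:
  assumes a: "a > 0" and r: "\<bar>r\<bar> < 1"
  shows "(\<lambda>n. laguerre a n x * r ^ n) sums ((1 - r) powr (- a) * exp (- (x * r / (1 - r))))"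
proof -
  define g where "g x r k p = ((- x) * r) ^ k / fact k * (Gamma (real p + (real k + a)) / (fact p * Gamma (real k + a)) * r ^ p)" for x r :: real and k p
  have row: "g x r k sums (((- x) * r) ^ k / fact k * (1 - r) powr (- (real k + a)))" if "\<bar>r\<bar> < 1" for x r k
    unfolding g_def using that a by (intro sums_mult negative_binomial_sums) auto
  have tot: "(\<lambda>k. ((- x) * r) ^ k / fact k * (1 - r) powr (- (real k + a))) sums ((1 - r) powr (- a) * exp (- (x * r / (1 - r))))"
    if "\<bar>r\<bar> < 1" for x r :: real
  proof -
    have "(\<lambda>k. (1 - r) powr (- a) * ((- (x * r / (1 - r))) ^ k /\<^sub>R fact k)) sums ((1 - r) powr (- a) * exp (- (x * r / (1 - r))))"
      by (intro sums_mult exp_converges)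
    also have "(\<lambda>k. (1 - r) powr (- a) * ((- (x * r / (1 - r))) ^ k /\<^sub>R fact k)) = (\<lambda>k. ((- x) * r) ^ k / fact k * (1 - r) powr (- (real k + a)))"
    proof
      fix k
      have "(1 - r) powr (- (real k + a)) = (1 - r) powr (- a) / (1 - r) ^ k"
        using that by (simp add: powr_diff[symmetric] powr_realpow[symmetric] algebra_simps)
      moreover have "(- (x * r / (1 - r))) ^ k = ((- x) * r) ^ k / (1 - r) ^ k"
        by (simp add: power_divide[symmetric])
      ultimately show "(1 - r) powr (- a) * ((- (x * r / (1 - r))) ^ k /\<^sub>R fact k) = ((- x) * r) ^ k / fact k * (1 - r) powr (- (real k + a))"
        by (simp add: field_simps)
    qed
    finally show ?thesis .
  qed
  have "(\<lambda>n. \<Sum>k\<le>n. g x r k (n - k)) sums ((1 - r) powr (- a) * exp (- (x * r / (1 - r))))"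
  proof (rule sums_diag_of_rows)
    show "g (- \<bar>x\<bar>) \<bar>r\<bar> k sums (((- (- \<bar>x\<bar>)) * \<bar>r\<bar>) ^ k / fact k * (1 - \<bar>r\<bar>) powr (- (real k + a)))" for k
      by (rule row) (use r in auto)
    show "summable (\<lambda>k. ((- (- \<bar>x\<bar>)) * \<bar>r\<bar>) ^ k / fact k * (1 - \<bar>r\<bar>) powr (- (real k + a)))"
      using tot[of "\<bar>r\<bar>" "- \<bar>x\<bar>"] r by (auto simp: sums_iff)
    have "Gamma (real p + (real k + a)) > 0" "Gamma (real k + a) > 0" for k p using a by (auto intro!: Gamma_real_pos)
    thus "\<bar>g x r k p\<bar> \<le> g (- \<bar>x\<bar>) \<bar>r\<bar> k p" for k p
      by (simp add: g_def abs_mult power_abs abs_of_pos)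
    show "g x r k sums (((- x) * r) ^ k / fact k * (1 - r) powr (- (real k + a)))" for k
      by (rule row[OF r])
    show "(\<lambda>k. ((- x) * r) ^ k / fact k * (1 - r) powr (- (real k + a))) sums ((1 - r) powr (- a) * exp (- (x * r / (1 - r))))"
      by (rule tot[OF r])
  qed
  also have "(\<lambda>n. \<Sum>k\<le>n. g x r k (n - k)) = (\<lambda>n. laguerre a n x * r ^ n)"
    unfolding laguerre_def sum_distrib_right
  proof (intro ext sum.cong refl)
    fix n k :: nat assume "k \<in> {..n}"
    hence k: "k \<le> n" by simp
    have "real (n - k) + (real k + a) = real n + a" using k by (simp add: of_nat_diff)
    moreover have "r ^ n = r ^ k * r ^ (n - k)" using k by (simp add: power_add[symmetric])
    ultimately show "g x r k (n - k) = Gamma (real n + a) / (fact k * fact (n - k) * Gamma (real k + a)) * (- x) ^ k * r ^ n"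
      by (simp only: g_def power_mult_distrib) (simp add: field_simps)
  qed
  finally show ?thesis .
qed

text \<open>The left side is the Cauchy product of the exponential series of s with the Bessel
  series at - x s; the division by the Gamma value cancels the one in the numerator of the Laguerre
  coefficients.\<close>

lemma laguerre_bessel_sums:
  assumes a: "a > 0"
  shows "(\<lambda>k. s ^ k * laguerre a k x / Gamma (real k + a)) sums (exp s * bessel a (- (x * s)))"
proof -
  define g where "g x s j p = bessel_coeff a j * (- (x * s)) ^ j * (s ^ p /\<^sub>R fact p)" for x s :: real and j p
  have row: "g x s j sums (bessel_coeff a j * (- (x * s)) ^ j * exp s)" for x s j
    unfolding g_def by (intro sums_mult exp_converges)
  have tot: "(\<lambda>j. bessel_coeff a j * (- (x * s)) ^ j * exp s) sums (exp s * bessel a (- (x * s)))" for x s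
    using sums_mult2[OF bessel_sums[OF a, of "- (x * s)"], of "exp s"] by (simp add: mult_ac)
  have "(\<lambda>n. \<Sum>k\<le>n. g x s k (n - k)) sums (exp s * bessel a (- (x * s)))"
  proof (rule sums_diag_of_rows)
    show "g (- \<bar>x\<bar>) \<bar>s\<bar> k sums (bessel_coeff a k * (- ((- \<bar>x\<bar>) * \<bar>s\<bar>)) ^ k * exp \<bar>s\<bar>)" for k
      by (rule row)
    show "summable (\<lambda>k. bessel_coeff a k * (- ((- \<bar>x\<bar>) * \<bar>s\<bar>)) ^ k * exp \<bar>s\<bar>)"
      using tot[of "- \<bar>x\<bar>" "\<bar>s\<bar>"] by (auto simp: sums_iff)
    show "\<bar>g x s k p\<bar> \<le> g (- \<bar>x\<bar>) \<bar>s\<bar> k p" for k p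
      using bessel_coeff_pos[OF a, of k] by (simp add: g_def abs_mult power_abs abs_of_pos)
    show "g x s k sums (bessel_coeff a k * (- (x * s)) ^ k * exp s)" for k by (rule row)
  qed (rule tot)
  also have "(\<lambda>n. \<Sum>k\<le>n. g x s k (n - k)) = (\<lambda>n. s ^ n * laguerre a n x / Gamma (real n + a))"
    unfolding laguerre_def sum_distrib_left sum_divide_distrib
  proof (intro ext sum.cong refl)
    fix n k :: nat assume "k \<in> {..n}"
    hence k: "k \<le> n" by simp
    have "s ^ n = s ^ k * s ^ (n - k)" using k by (simp add: power_add[symmetric])
    moreover have "(- (x * s)) ^ k = (- x) ^ k * s ^ k" by (simp add: power_mult_distrib[symmetric])
    moreover have "Gamma (real n + a) > 0" using a by (auto intro!: Gamma_real_pos)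
    ultimately show "g x s k (n - k) = s ^ n * (Gamma (real n + a) / (fact k * fact (n - k) * Gamma (real k + a)) * (- x) ^ k) / Gamma (real n + a)"
      by (simp only: g_def bessel_coeff_def) (simp add: field_simps)
  qed
  finally show ?thesis .
qed

lemma powser_zero_imp_coeff_0:
  fixes c :: "nat \<Rightarrow> real"
  assumes "e > 0" "\<And>s. s \<noteq> 0 \<Longrightarrow> \<bar>s\<bar> < e \<Longrightarrow> (\<lambda>k. c k * s ^ k) sums 0"
  shows "c 0 = 0"
proof -
  have "((\<lambda>s::real. 0::real) \<longlongrightarrow> c 0) (at 0)"
    by (rule powser_limit_0_strong[OF assms(1)]) (use assms(2) in auto)
  thus ?thesis by (simp add: tendsto_const_iff)
qed

text \<open>The induction divides by s after the first coefficient is known to vanish. Asking for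
  the sums only at s \<noteq> 0 is what makes the hypothesis stable under this division.\<close>

lemma powser_zero_imp_coeff_zero:
  fixes c :: "nat \<Rightarrow> real"
  assumes "e > 0" "\<And>s. s \<noteq> 0 \<Longrightarrow> \<bar>s\<bar> < e \<Longrightarrow> (\<lambda>k. c k * s ^ k) sums 0"
  shows "c k = 0"
  using assms(2)
proof (induction k arbitrary: c)
  case 0
  thus ?case by (rule powser_zero_imp_coeff_0[OF assms(1)])
next
  case (Suc k)
  have zero: "c 0 = 0" by (rule powser_zero_imp_coeff_0[OF assms(1) Suc.prems])
  have "(\<lambda>k. c (Suc k) * s ^ k) sums 0" if "s \<noteq> 0" "\<bar>s\<bar> < e" for s
  proof -
    have "(\<lambda>k. c (Suc k) * s ^ Suc k) sums 0"
      using Suc.prems[OF that] zero by (subst sums_Suc_iff) simp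
    from sums_mult[OF this, of "1 / s"] show ?thesis using that by (simp add: field_simps)
  qed
  thus ?case by (rule Suc.IH)
qed

text \<open>Both sides are the coefficient of s^k in the generating function at r + s. Binomial
  expansion of (r + s)^n gives the left one. For the right one, 1 - (r + s) = (1 - r) (1 - \<sigma>)
  with \<sigma> = s / (1 - r), which turns the function into a factor independent of s times a
  generating function at argument x / (1 - r) and variable \<sigma>.\<close>

lemma laguerre_shift_sums:
  assumes a: "a > 0" and r: "0 \<le> r" "r < 1"
  shows "(\<lambda>p. real ((k + p) choose k) * laguerre a (k + p) x * r ^ p) sums
           ((1 - r) powr (- a) / (1 - r) ^ k * exp (- (x * r / (1 - r))) * laguerre a k (x / (1 - r)))"
proof -
  define b where "b k p = real ((k + p) choose k) * laguerre a (k + p) x * r ^ p" for k p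
  define d where "d k = (1 - r) powr (- a) / (1 - r) ^ k * exp (- (x * r / (1 - r))) * laguerre a k (x / (1 - r))" for k
  have main: "summable (\<lambda>p. b k p * s ^ k)" "(\<lambda>k. (\<Sum>p. b k p * s ^ k)) sums (\<Sum>k. d k * s ^ k)"
     "summable (\<lambda>k. d k * s ^ k)"
    if s: "\<bar>s\<bar> < (1 - r) / 2" for s k
  proof -
    define g where "g k p = b k p * s ^ k" for k p
    have rs: "\<bar>r + s\<bar> < 1" "r + \<bar>s\<bar> < 1" "\<bar>s\<bar> < 1 - r" using s r by (auto simp: abs_if split: if_splits)
    have expand: "(\<Sum>k\<le>n. real (n choose k) * laguerre a n y * t ^ k * r ^ (n - k)) = laguerre a n y * (r + t) ^ n" for n y t
      by (simp add: binomial_ring[of t r n, simplified add.commute[of t r]] sum_distrib_left mult_ac)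
    have 1: "summable (\<lambda>n. \<Sum>k\<le>n. \<bar>g k (n - k)\<bar>)"
    proof (rule summable_comparison_test'[where N=0])
      show "summable (\<lambda>n. laguerre a n (- \<bar>x\<bar>) * (r + \<bar>s\<bar>) ^ n)"
        using laguerre_generating_sums[OF a, of "r + \<bar>s\<bar>" "- \<bar>x\<bar>"] rs r by (auto simp: sums_iff)
      fix n :: nat
      have "(\<Sum>k\<le>n. \<bar>g k (n - k)\<bar>) \<le> (\<Sum>k\<le>n. real (n choose k) * laguerre a n (- \<bar>x\<bar>) * \<bar>s\<bar> ^ k * r ^ (n - k))"
      proof (rule sum_mono)
        fix k assume "k \<in> {..n}"
        hence "\<bar>g k (n - k)\<bar> = real (n choose k) * \<bar>laguerre a n x\<bar> * \<bar>s\<bar> ^ k * r ^ (n - k)"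
          using r by (simp add: g_def b_def abs_mult power_abs)
        also have "\<dots> \<le> real (n choose k) * laguerre a n (- \<bar>x\<bar>) * \<bar>s\<bar> ^ k * r ^ (n - k)"
          using r abs_laguerre_le[OF a] by (intro mult_right_mono mult_left_mono) auto
        finally show "\<bar>g k (n - k)\<bar> \<le> real (n choose k) * laguerre a n (- \<bar>x\<bar>) * \<bar>s\<bar> ^ k * r ^ (n - k)" .
      qed
      thus "norm (\<Sum>k\<le>n. \<bar>g k (n - k)\<bar>) \<le> laguerre a n (- \<bar>x\<bar>) * (r + \<bar>s\<bar>) ^ n"
        unfolding expand by (simp add: sum_nonneg)
    qed
    have "(\<lambda>n. \<Sum>k\<le>n. g k (n - k)) = (\<lambda>n. laguerre a n x * (r + s) ^ n)"
      unfolding expand[symmetric] by (intro ext sum.cong refl) (simp add: g_def b_def)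
    hence 2: "(\<lambda>n. \<Sum>k\<le>n. g k (n - k)) sums ((1 - (r + s)) powr (- a) * exp (- (x * (r + s) / (1 - (r + s)))))"
      using laguerre_generating_sums[OF a rs(1), of x] by simp
    define \<sigma> where "\<sigma> = s / (1 - r)"
    have \<sigma>: "\<bar>\<sigma>\<bar> < 1" using rs r by (simp add: \<sigma>_def abs_divide)
    have "(\<lambda>k. (1 - r) powr (- a) * exp (- (x * r / (1 - r))) * (laguerre a k (x / (1 - r)) * \<sigma> ^ k)) sums
       ((1 - r) powr (- a) * exp (- (x * r / (1 - r))) * ((1 - \<sigma>) powr (- a) * exp (- ((x / (1 - r)) * \<sigma> / (1 - \<sigma>)))))"
      by (intro sums_mult laguerre_generating_sums a \<sigma>)
    also have "(\<lambda>k. (1 - r) powr (- a) * exp (- (x * r / (1 - r))) * (laguerre a k (x / (1 - r)) * \<sigma> ^ k)) = (\<lambda>k. d k * s ^ k)"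
      by (simp add: d_def \<sigma>_def power_divide mult_ac)
    also have "(1 - r) powr (- a) * exp (- (x * r / (1 - r))) * ((1 - \<sigma>) powr (- a) * exp (- ((x / (1 - r)) * \<sigma> / (1 - \<sigma>))))
       = ((1 - r) powr (- a) * (1 - \<sigma>) powr (- a)) * (exp (- (x * r / (1 - r))) * exp (- ((x / (1 - r)) * \<sigma> / (1 - \<sigma>))))"
      by (simp add: mult_ac)
    also have "(1 - r) powr (- a) * (1 - \<sigma>) powr (- a) = (1 - (r + s)) powr (- a)"
    proof -
      have "(1 - r) * (1 - \<sigma>) = 1 - (r + s)" using r by (simp add: \<sigma>_def field_simps)
      thus ?thesis using r \<sigma> by (subst powr_mult[symmetric]) auto
    qed
    also have "exp (- (x * r / (1 - r))) * exp (- ((x / (1 - r)) * \<sigma> / (1 - \<sigma>))) = exp (- (x * (r + s) / (1 - (r + s))))"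
    proof -
      have nz: "1 - r \<noteq> 0" "1 - r - s \<noteq> 0" using rs r by auto
      have e1: "1 - \<sigma> = (1 - r - s) / (1 - r)" using nz by (simp add: \<sigma>_def field_simps)
      have "(x / (1 - r)) * \<sigma> / (1 - \<sigma>) = x * s / ((1 - r) * (1 - r - s))"
        unfolding e1 using nz by (simp add: \<sigma>_def)
      moreover have "x * r / (1 - r) + x * s / ((1 - r) * (1 - r - s)) = x * (r + s) / (1 - r - s)"
      proof -
        define A B where "A = 1 - r" and "B = 1 - r - s"
        have AB: "A \<noteq> 0" "B \<noteq> 0" using nz by (auto simp: A_def B_def)
        have "x * r / A + x * s / (A * B) = (x * (r * B + s)) / (A * B)"
          using AB by (simp add: field_simps)
        also have "r * B + s = (r + s) * A" by (simp add: A_def B_def algebra_simps)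
        also have "x * ((r + s) * A) / (A * B) = x * (r + s) / B" using AB by simp
        finally show ?thesis by (simp add: A_def B_def)
      qed
      ultimately have "x * r / (1 - r) + (x / (1 - r)) * \<sigma> / (1 - \<sigma>) = x * (r + s) / (1 - (r + s))"
        by (simp add: diff_diff_eq)
      thus ?thesis by (simp flip: exp_add)
    qed
    finally have 3: "(\<lambda>k. d k * s ^ k) sums ((1 - (r + s)) powr (- a) * exp (- (x * (r + s) / (1 - (r + s)))))" .
    show "summable (\<lambda>p. b k p * s ^ k)" using sums_rows_of_diag(1)[OF 1 2, of k] by (simp add: g_def)
    show "(\<lambda>k. (\<Sum>p. b k p * s ^ k)) sums (\<Sum>k. d k * s ^ k)"
      using sums_rows_of_diag(2)[OF 1 2] 3 by (simp add: g_def sums_iff)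
    show "summable (\<lambda>k. d k * s ^ k)" using 3 by (simp add: sums_iff)
  qed
  \<comment> \<open>The rows are known to be summable with an extra factor s^k, so any single
    nonzero s in the admissible range, here (1 - r) / 4, removes the factor.\<close>
  have sb: "summable (b k)" for k
  proof -
    have "summable (\<lambda>p. b k p * ((1 - r) / 4) ^ k)" using main(1)[of "(1 - r) / 4" k] r by simp
    from summable_mult2[OF this, of "1 / ((1 - r) / 4) ^ k"] show ?thesis using r by simp
  qed
  have "(suminf (b k) - d k) = 0" for k
  proof (rule powser_zero_imp_coeff_zero[of "(1 - r) / 2"])
    fix s :: real assume s: "\<bar>s\<bar> < (1 - r) / 2"
    have "(\<lambda>k. (\<Sum>p. b k p * s ^ k) - d k * s ^ k) sums ((\<Sum>k. d k * s ^ k) - (\<Sum>k. d k * s ^ k))"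
      by (intro sums_diff main(2) summable_sums main(3) s)
    also have "(\<lambda>k. (\<Sum>p. b k p * s ^ k) - d k * s ^ k) = (\<lambda>k. (suminf (b k) - d k) * s ^ k)"
      using suminf_mult2[OF sb] by (simp add: algebra_simps)
    finally show "(\<lambda>k. (suminf (b k) - d k) * s ^ k) sums 0" by simp
  qed (use r in auto)
  thus ?thesis using summable_sums[OF sb[of k]] by (simp add: b_def[abs_def] d_def)
qed

text \<open>Expanding only the second polynomial, in powers y^k, leaves for each k a shifted series
  in the first one, evaluated by \<open>laguerre_shift_sums\<close>. The outer sum over k is then
  the mixed Laguerre-Bessel generating function at s = - y r / (1 - r). The majorant is the same
  double family at - \<bar>x\<bar> and - \<bar>y\<bar>.\<close>

lemma hille_hardy:
  assumes a: "a > 0" and r: "0 \<le> r" "r < 1"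
  shows "(\<lambda>n. fact n / Gamma (real n + a) * laguerre a n x * laguerre a n y * r ^ n) sums
     ((1 - r) powr (- a) * exp (- ((x + y) * r / (1 - r))) * bessel a (x * y * r / (1 - r)\<^sup>2))"
proof -
  define g where "g x y k p = real ((k + p) choose k) * laguerre a (k + p) x * r ^ p * ((- y * r) ^ k / Gamma (real k + a))" for x y k p
  define h where "h x y k = (1 - r) powr (- a) / (1 - r) ^ k * exp (- (x * r / (1 - r))) * laguerre a k (x / (1 - r)) * ((- y * r) ^ k / Gamma (real k + a))" for x y k
  have row: "g x y k sums h x y k" for x y k
    unfolding g_def h_def by (intro sums_mult2 laguerre_shift_sums a r)
  have tot: "h x y sums ((1 - r) powr (- a) * exp (- ((x + y) * r / (1 - r))) * bessel a (x * y * r / (1 - r)\<^sup>2))" for x y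
  proof -
    let ?s = "- (y * r / (1 - r))"
    have "(\<lambda>k. (1 - r) powr (- a) * exp (- (x * r / (1 - r))) * (?s ^ k * laguerre a k (x / (1 - r)) / Gamma (real k + a))) sums
       ((1 - r) powr (- a) * exp (- (x * r / (1 - r))) * (exp ?s * bessel a (- (x / (1 - r) * ?s))))"
      by (intro sums_mult laguerre_bessel_sums a)
    also have "(\<lambda>k. (1 - r) powr (- a) * exp (- (x * r / (1 - r))) * (?s ^ k * laguerre a k (x / (1 - r)) / Gamma (real k + a))) = h x y"
    proof
      fix k
      have "?s ^ k = (- y * r) ^ k / (1 - r) ^ k" by (simp add: power_divide[symmetric])
      thus "(1 - r) powr (- a) * exp (- (x * r / (1 - r))) * (?s ^ k * laguerre a k (x / (1 - r)) / Gamma (real k + a)) = h x y k"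
        by (simp add: h_def)
    qed
    also have "- (x / (1 - r) * ?s) = x * y * r / (1 - r)\<^sup>2" by (simp add: power2_eq_square)
    also have "(1 - r) powr (- a) * exp (- (x * r / (1 - r))) * (exp ?s * bessel a (x * y * r / (1 - r)\<^sup>2))
        = (1 - r) powr (- a) * (exp (- (x * r / (1 - r))) * exp ?s) * bessel a (x * y * r / (1 - r)\<^sup>2)" by simp
    also have "exp (- (x * r / (1 - r))) * exp ?s = exp (- ((x + y) * r / (1 - r)))"
      by (simp add: exp_add[symmetric] ring_distribs add_divide_distrib)
    finally show ?thesis .
  qed
  have "(\<lambda>n. \<Sum>k\<le>n. g x y k (n - k)) sums ((1 - r) powr (- a) * exp (- ((x + y) * r / (1 - r))) * bessel a (x * y * r / (1 - r)\<^sup>2))"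
  proof (rule sums_diag_of_rows)
    show "g (- \<bar>x\<bar>) (- \<bar>y\<bar>) k sums h (- \<bar>x\<bar>) (- \<bar>y\<bar>) k" for k by (rule row)
    show "summable (h (- \<bar>x\<bar>) (- \<bar>y\<bar>))" using tot by (auto simp: sums_iff)
    show "\<bar>g x y k p\<bar> \<le> g (- \<bar>x\<bar>) (- \<bar>y\<bar>) k p" for k p
    proof -
      have G: "Gamma (real k + a) > 0" using a by (auto intro!: Gamma_real_pos)
      have "\<bar>g x y k p\<bar> = real ((k + p) choose k) * \<bar>laguerre a (k + p) x\<bar> * r ^ p * ((\<bar>y\<bar> * r) ^ k / Gamma (real k + a))"
        using G r by (simp add: g_def abs_mult power_abs)
      also have "\<dots> \<le> real ((k + p) choose k) * laguerre a (k + p) (- \<bar>x\<bar>) * r ^ p * ((\<bar>y\<bar> * r) ^ k / Gamma (real k + a))"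
        using G r abs_laguerre_le[OF a] by (intro mult_right_mono mult_left_mono) auto
      finally show ?thesis by (simp add: g_def)
    qed
  qed (rule row tot)+
  also have "(\<lambda>n. \<Sum>k\<le>n. g x y k (n - k)) = (\<lambda>n. fact n / Gamma (real n + a) * laguerre a n x * laguerre a n y * r ^ n)"
  proof
    fix n
    have Gn: "Gamma (real n + a) > 0" using a by (auto intro!: Gamma_real_pos)
    have "fact n / Gamma (real n + a) * laguerre a n x * laguerre a n y * r ^ n
      = (\<Sum>k\<le>n. fact n / Gamma (real n + a) * laguerre a n x * (Gamma (real n + a) / (fact k * fact (n - k) * Gamma (real k + a)) * (- y) ^ k) * r ^ n)"
      unfolding laguerre_def[of a n y] by (simp add: sum_distrib_left sum_distrib_right)
    also have "\<dots> = (\<Sum>k\<le>n. g x y k (n - k))"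
    proof (intro sum.cong refl)
      fix k assume "k \<in> {..n}"
      hence k: "k \<le> n" by simp
      have "r ^ n = r ^ k * r ^ (n - k)" using k by (simp add: power_add[symmetric])
      moreover have "(- y * r) ^ k = (- y) ^ k * r ^ k" by (simp only: power_mult_distrib)
      ultimately show "fact n / Gamma (real n + a) * laguerre a n x * (Gamma (real n + a) / (fact k * fact (n - k) * Gamma (real k + a)) * (- y) ^ k) * r ^ n = g x y k (n - k)"
        using k Gn by (simp only: g_def binomial_fact[OF k] le_add_diff_inverse) (simp add: field_simps)
    qed
    finally show "(\<Sum>k\<le>n. g x y k (n - k)) = fact n / Gamma (real n + a) * laguerre a n x * laguerre a n y * r ^ n" by simp
  qed
  finally show ?thesis .
qed


section \<open>Gamma integrals and orthogonality of the Laguerre polynomials\<close>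

lemma has_bochner_integral_gamma_scaled:
  fixes s A :: real
  assumes "s > 0" "A > 0"
  shows "has_bochner_integral (lebesgue_on {0<..}) (\<lambda>t. t powr (s - 1) * exp (- (A * t))) (Gamma s * A powr (- s))"
proof -
  define f where "f t = indicator {0<..} t * (t powr (s - 1) / exp t)" for t :: real
  have [measurable]: "f \<in> borel_measurable borel" unfolding f_def by measurable
  have "Gamma s > 0" using assms by (simp add: Gamma_real_pos)
  have "(\<integral>\<^sup>+t. ennreal (f t) \<partial>lborel) = ennreal (Gamma s)"
    unfolding Gamma_conv_nn_integral_real[OF assms(1)] f_def
    by (rule nn_integral_cong_AE, rule AE_mp[OF AE_lborel_singleton[of 0]], rule AE_I2) (auto simp: indicator_def)
  hence "has_bochner_integral lborel f (Gamma s)"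
    using \<open>Gamma s > 0\<close> by (intro has_bochner_integral_nn_integral) (auto simp: f_def)
  hence "has_bochner_integral lborel (\<lambda>t. f (0 + A * t)) (Gamma s /\<^sub>R \<bar>A\<bar>)"
    using assms by (subst lborel_has_bochner_integral_real_affine_iff[symmetric]) auto
  hence "has_bochner_integral lborel (\<lambda>t. A powr (1 - s) * f (A * t)) (A powr (1 - s) * (Gamma s /\<^sub>R \<bar>A\<bar>))"
    by (intro has_bochner_integral_mult_right) auto
  also have "A powr (1 - s) * (Gamma s /\<^sub>R \<bar>A\<bar>) = Gamma s * A powr (- s)"
    using assms by (simp add: powr_diff powr_minus field_simps)
  also have "(\<lambda>t. A powr (1 - s) * f (A * t)) = (\<lambda>t. indicator {0<..} t *\<^sub>R (t powr (s - 1) * exp (- (A * t))))"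
  proof
    fix t :: real
    show "A powr (1 - s) * f (A * t) = indicator {0<..} t *\<^sub>R (t powr (s - 1) * exp (- (A * t)))"
    proof (cases "t > 0")
      case True
      have "A powr (1 - s) * (A * t) powr (s - 1) = t powr (s - 1)"
        using True assms by (simp add: powr_mult powr_add[symmetric])
      thus ?thesis using True assms by (simp add: f_def exp_minus divide_inverse)
    qed (use assms in \<open>auto simp: f_def indicator_def zero_less_mult_iff\<close>)
  qed
  finally have "has_bochner_integral lebesgue (\<lambda>t. indicator {0<..} t *\<^sub>R (t powr (s - 1) * exp (- (A * t)))) (Gamma s * A powr (- s))"
    by (simp add: has_bochner_integral_iff integrable_completion integral_completion)
  thus ?thesis by (subst has_bochner_integral_restrict_space) auto
qed

lemma LINT_Ioi_eq:
  fixes f :: "real \<Rightarrow> 'b::{banach, second_countable_topology}"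
  shows "(LINT y:{0<..}|lebesgue. f y) = (\<integral>y. f y \<partial>lebesgue_on {0<..})"
  unfolding set_lebesgue_integral_def by (subst integral_restrict_space) auto

text \<open>Up to sign this is the n-th finite difference of a polynomial of degree i in k. A
  forward difference of \<open>pochhammer\<close> is again a multiple of a
  \<open>pochhammer\<close>, of degree one less and with a increased by one, which is why a is
  generalized in the induction.\<close>

lemma alternating_binomial_pochhammer:
  "(\<Sum>k\<le>n. (- 1) ^ k * real (n choose k) * pochhammer (real k + a) i) = (if i = n then (- 1) ^ n * fact n else 0)"
  if "i \<le> n" for a :: real
  using that
proof (induction n arbitrary: a i)
  case 0
  thus ?case by simp
next
  case (Suc n)
  define f where "f k = pochhammer (real k + a) i" for k
  have "(\<Sum>k\<le>Suc n. (- 1) ^ k * real (Suc n choose k) * f k)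
      = f 0 + (\<Sum>k\<le>n. (- 1) ^ Suc k * real (Suc n choose Suc k) * f (Suc k))"
    by (subst sum.atMost_Suc_shift) simp
  also have "(\<Sum>k\<le>n. (- 1) ^ Suc k * real (Suc n choose Suc k) * f (Suc k))
     = (\<Sum>k\<le>n. (- 1) ^ Suc k * real (n choose k) * f (Suc k)) + (\<Sum>k\<le>n. (- 1) ^ Suc k * real (n choose Suc k) * f (Suc k))"
    by (simp add: sum.distrib[symmetric] algebra_simps)
  also have "f 0 + \<dots> = (\<Sum>k\<le>n. (- 1) ^ Suc k * real (n choose k) * f (Suc k)) + (\<Sum>k\<le>Suc n. (- 1) ^ k * real (n choose k) * f k)"
    by (subst sum.atMost_Suc_shift[of _ n]) simp
  also have "\<dots> = (\<Sum>k\<le>n. (- 1) ^ k * real (n choose k) * (f k - f (Suc k)))"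
    by (simp add: binomial_eq_0 sum.distrib[symmetric] algebra_simps sum_subtractf sum_negf)
  finally have *: "(\<Sum>k\<le>Suc n. (- 1) ^ k * real (Suc n choose k) * f k) = (\<Sum>k\<le>n. (- 1) ^ k * real (n choose k) * (f k - f (Suc k)))" .
  show ?case
  proof (cases i)
    case 0
    thus ?thesis using * by (simp add: f_def)
  next
    case (Suc j)
    have "f k - f (Suc k) = - real (Suc j) * pochhammer (real k + (a + 1)) j" for k
      unfolding f_def Suc by (subst pochhammer_rec, subst pochhammer_rec') (simp add: algebra_simps)
    hence "(\<Sum>k\<le>Suc n. (- 1) ^ k * real (Suc n choose k) * f k)
        = - real (Suc j) * (\<Sum>k\<le>n. (- 1) ^ k * real (n choose k) * pochhammer (real k + (a + 1)) j)"
      unfolding * by (simp add: sum_distrib_left mult_ac)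
    also have "\<dots> = - real (Suc j) * (if j = n then (- 1) ^ n * fact n else 0)"
      using Suc.IH[of j "a + 1"] Suc.prems \<open>i = Suc j\<close> by simp
    also have "\<dots> = (if i = Suc n then (- 1) ^ Suc n * fact (Suc n) else 0)"
      by (simp add: Suc algebra_simps)
    finally show ?thesis by (simp only: f_def)
  qed
qed

definition laguerre_poly :: "real \<Rightarrow> nat \<Rightarrow> real poly" where
  "laguerre_poly a n = (\<Sum>k\<le>n. monom (Gamma (real n + a) / (fact k * fact (n - k) * Gamma (real k + a)) * (- 1) ^ k) k)"

lemma poly_laguerre_poly: "poly (laguerre_poly a n) x = laguerre a n x"
  unfolding laguerre_poly_def laguerre_def by (simp add: poly_sum poly_monom power_minus[of x] mult_ac)

lemma coeff_laguerre_poly: "coeff (laguerre_poly a n) i = (if i \<le> n then Gamma (real n + a) / (fact i * fact (n - i) * Gamma (real i + a)) * (- 1) ^ i else 0)"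
  unfolding laguerre_poly_def by (simp add: coeff_sum)

lemma degree_laguerre_poly: assumes "a > 0" shows "degree (laguerre_poly a n) = n"
proof (rule antisym)
  show "degree (laguerre_poly a n) \<le> n" by (rule degree_le) (simp add: coeff_laguerre_poly)
  have "Gamma (real n + a) > 0" using assms by (auto intro!: Gamma_real_pos)
  thus "n \<le> degree (laguerre_poly a n)" by (intro le_degree) (simp add: coeff_laguerre_poly)
qed

text \<open>
  The integral of \<open>p\<close> against \<open>y\<^bsup>a-1\<^esup> e\<^bsup>-y\<^esup>\<close> on \<open>(0, \<infinity>)\<close>, written as an algebraic functional.
\<close>

definition gamma_moment :: "real \<Rightarrow> real poly \<Rightarrow> real" where
  "gamma_moment a p = (\<Sum>i\<le>degree p. coeff p i * Gamma (real i + a))"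

lemma gamma_moment_eq:
  assumes "degree p \<le> n"
  shows "gamma_moment a p = (\<Sum>i\<le>n. coeff p i * Gamma (real i + a))"
  unfolding gamma_moment_def by (rule sum.mono_neutral_left) (use assms in \<open>auto simp: not_le coeff_eq_0\<close>)

lemma gamma_moment_add: "gamma_moment a (p + q) = gamma_moment a p + gamma_moment a q"
proof -
  let ?n = "max (degree p) (degree q)"
  have "degree (p + q) \<le> ?n" by (rule degree_add_le) auto
  thus ?thesis by (simp add: gamma_moment_eq[of _ ?n] sum.distrib algebra_simps)
qed

lemma gamma_moment_smult: "gamma_moment a (smult c p) = c * gamma_moment a p"
  by (simp add: gamma_moment_eq[of _ "degree p"] degree_smult_le sum_distrib_left mult_ac)

lemma gamma_moment_sum: "gamma_moment a (sum f I) = (\<Sum>i\<in>I. gamma_moment a (f i))"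
  by (induction I rule: infinite_finite_induct) (auto simp: gamma_moment_add gamma_moment_def[of _ 0])

lemma gamma_moment_monom: "gamma_moment a (monom c k) = c * Gamma (real k + a)"
  by (subst gamma_moment_eq[OF degree_monom_le]) (simp add: if_distrib[of "\<lambda>x. x * _"] cong: if_cong)

lemma has_bochner_integral_gamma_moment:
  assumes a: "a > 0"
  shows "has_bochner_integral (lebesgue_on {0<..}) (\<lambda>y. poly p y * (y powr (a - 1) * exp (- y))) (gamma_moment a p)"
proof -
  have "has_bochner_integral (lebesgue_on {0<..}) (\<lambda>y. \<Sum>i\<le>degree p. coeff p i * (y powr (real i + a - 1) * exp (- (1 * y)))) (\<Sum>i\<le>degree p. coeff p i * (Gamma (real i + a) * 1 powr (- (real i + a))))"
    using a by (intro has_bochner_integral_sum has_bochner_integral_mult_right has_bochner_integral_gamma_scaled) auto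
  also have "?this \<longleftrightarrow> ?thesis"
  proof (rule has_bochner_integral_cong[OF refl])
    fix y :: real assume "y \<in> space (lebesgue_on {0<..})"
    hence y: "y > 0" by simp
    have "y powr (real i + a - 1) = y ^ i * y powr (a - 1)" for i
      using y powr_add[of y "real i" "a - 1"] by (simp add: powr_realpow add_diff_eq)
    thus "(\<Sum>i\<le>degree p. coeff p i * (y powr (real i + a - 1) * exp (- (1 * y)))) = poly p y * (y powr (a - 1) * exp (- y))"
      unfolding poly_altdef sum_distrib_right by (intro sum.cong refl) (simp add: mult_ac)
  qed (simp add: gamma_moment_def)
  finally show ?thesis .
qed

text \<open>Multiplication by y^i shifts the Gamma arguments, and each quotient of Gamma values
  becomes a \<open>pochhammer\<close> of degree i in k; the moment is thus an n-th finite
  difference.\<close>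

lemma gamma_moment_laguerre_poly_monom:
  assumes a: "a > 0" and i: "i \<le> n"
  shows "gamma_moment a (laguerre_poly a n * monom 1 i) = (if i = n then (- 1) ^ n * Gamma (real n + a) else 0)"
proof -
  have G: "Gamma (real k + a) > 0" for k using a by (auto intro!: Gamma_real_pos)
  have "gamma_moment a (laguerre_poly a n * monom 1 i) = (\<Sum>k\<le>n. Gamma (real n + a) / (fact k * fact (n - k) * Gamma (real k + a)) * (- 1) ^ k * Gamma (real (k + i) + a))"
    unfolding laguerre_poly_def sum_distrib_right gamma_moment_sum mult_monom gamma_moment_monom by simp
  also have "\<dots> = (\<Sum>k\<le>n. Gamma (real n + a) / fact n * ((- 1) ^ k * real (n choose k) * pochhammer (real k + a) i))"
  proof (intro sum.cong refl)
    fix k assume "k \<in> {..n}"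
    hence k: "k \<le> n" by simp
    have "real k + a \<notin> \<int>\<^sub>\<le>\<^sub>0" using a by (auto elim!: nonpos_Ints_cases)
    hence "Gamma (real (k + i) + a) = pochhammer (real k + a) i * Gamma (real k + a)"
      using pochhammer_Gamma[of "real k + a" i] G[of k] by (simp add: add_ac)
    thus "Gamma (real n + a) / (fact k * fact (n - k) * Gamma (real k + a)) * (- 1) ^ k * Gamma (real (k + i) + a)
        = Gamma (real n + a) / fact n * ((- 1) ^ k * real (n choose k) * pochhammer (real k + a) i)"
      using G[of k] by (simp add: binomial_fact[OF k])
  qed
  also have "\<dots> = Gamma (real n + a) / fact n * (if i = n then (- 1) ^ n * fact n else 0)"
    unfolding sum_distrib_left[symmetric] alternating_binomial_pochhammer[OF i] ..
  finally show ?thesis by simp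
qed

lemma gamma_moment_laguerre_poly_mult:
  assumes a: "a > 0" and d: "degree p \<le> n"
  shows "gamma_moment a (laguerre_poly a n * p) = (- 1) ^ n * Gamma (real n + a) * coeff p n"
proof -
  have p: "p = (\<Sum>i\<le>n. smult (coeff p i) (monom 1 i))"
    using poly_as_sum_of_monoms'[OF d] by (simp add: smult_monom)
  have "gamma_moment a (laguerre_poly a n * p) = (\<Sum>i\<le>n. coeff p i * gamma_moment a (laguerre_poly a n * monom 1 i))"
    by (subst p) (simp add: sum_distrib_left gamma_moment_sum gamma_moment_smult del: smult_monom)
  also have "\<dots> = (\<Sum>i\<le>n. coeff p i * (if i = n then (- 1) ^ n * Gamma (real n + a) else 0))"
    by (intro sum.cong refl) (simp add: gamma_moment_laguerre_poly_monom[OF a])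
  finally show ?thesis by (simp add: if_distrib[of "\<lambda>t. _ * t"] cong: if_cong)
qed

text \<open>Leading coefficients are removed one after another. The condition on L 0 excludes the
  zero polynomial, whose degree is also 0.\<close>

lemma poly_span_of_degrees:
  fixes L :: "nat \<Rightarrow> 'a::field poly"
  assumes "\<And>i. degree (L i) = i" "L 0 \<noteq> 0" "\<And>i. i \<ge> n \<Longrightarrow> coeff q i = 0"
  shows "\<exists>c. q = (\<Sum>i<n. smult (c i) (L i))"
  using assms(3)
proof (induction n arbitrary: q)
  case 0
  thus ?case by (auto intro: poly_eqI)
next
  case (Suc n)
  have "L n \<noteq> 0" using assms(1)[of n] assms(2) by (cases n) auto
  hence nz: "coeff (L n) n \<noteq> 0" using leading_coeff_0_iff[of "L n"] assms(1)[of n] by simp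
  define q' where "q' = q - smult (coeff q n / coeff (L n) n) (L n)"
  have "coeff q' i = 0" if "i \<ge> n" for i
    using that nz Suc.prems[of i] assms(1)[of n] by (cases "i = n") (auto simp: q'_def coeff_eq_0)
  from Suc.IH[OF this] obtain c where c: "q' = (\<Sum>i<n. smult (c i) (L i))" by blast
  have "q = (\<Sum>i<Suc n. smult ((c(n := coeff q n / coeff (L n) n)) i) (L i))"
    using c by (simp add: q'_def algebra_simps)
  thus ?case by blast
qed

text \<open>Subtracting the multiple of \<open>laguerre_poly a n\<close> with the same leading
  coefficient leaves a combination of L 0, ..., L (n - 1). Pairing with L j isolates its j-th
  coefficient, and it vanishes because both L n and \<open>laguerre_poly a n\<close> are orthogonal
  to everything of lower degree. The product of two values involves only the square of the
  proportionality factor, which the normalization determines; the sign disappears.\<close>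

lemma normalized_laguerre_eq:
  assumes "\<alpha> > -1" and L: "normalized_laguerre \<alpha> L"
  defines "a \<equiv> \<alpha> + 1"
  shows "poly (L n) x * poly (L n) y = fact n / Gamma (real n + a) * laguerre a n x * laguerre a n y"
proof -
  have a: "a > 0" using assms by simp
  have deg: "degree (L i) = i" for i using L by (simp add: normalized_laguerre_def)
  have orth: "gamma_moment a (L i * L j) = (if i = j then 1 else 0)" for i j
  proof -
    have "gamma_moment a (L i * L j) = (LINT y:{0<..}|lebesgue. poly (L i) y * poly (L j) y * (y powr \<alpha> * exp (- y)))"
      using has_bochner_integral_integral_eq[OF has_bochner_integral_gamma_moment[OF a, of "L i * L j"]]
      by (simp add: LINT_Ioi_eq a_def)
    thus ?thesis using L by (simp add: normalized_laguerre_def)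
  qed
  have L0: "L 0 \<noteq> 0" using orth[of 0 0] by (auto simp: gamma_moment_def)
  define g where "g = coeff (laguerre_poly a n) n"
  have G: "Gamma (real n + a) > 0" using a by (auto intro!: Gamma_real_pos)
  have g: "g = (- 1) ^ n / fact n" using G by (simp add: g_def coeff_laguerre_poly)
  hence g0: "g \<noteq> 0" by simp
  define l where "l = coeff (L n) n / g"
  define q where "q = L n - smult l (laguerre_poly a n)"
  have "coeff q i = 0" if "i \<ge> n" for i
    using that g0 deg[of n] degree_laguerre_poly[OF a, of n]
    by (cases "i = n") (auto simp: q_def l_def g_def coeff_eq_0)
  then obtain c where c: "q = (\<Sum>i<n. smult (c i) (L i))"
    using poly_span_of_degrees[of L n q] deg L0 by blast
  have "c j = 0" if j: "j < n" for j
  proof -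
    have "gamma_moment a (q * L j) = (\<Sum>i<n. c i * gamma_moment a (L i * L j))"
      unfolding c sum_distrib_right gamma_moment_sum by (simp add: gamma_moment_smult)
    also have "\<dots> = c j" using j by (simp add: orth if_distrib cong: if_cong)
    finally have 1: "gamma_moment a (q * L j) = c j" .
    have "q * L j + smult l (laguerre_poly a n * L j) = L n * L j" by (simp add: q_def algebra_simps)
    from arg_cong[OF this, of "gamma_moment a"] have "c j + l * gamma_moment a (laguerre_poly a n * L j) = gamma_moment a (L n * L j)"
      by (simp add: gamma_moment_add gamma_moment_smult 1)
    thus "c j = 0" using j deg[of j] by (simp add: orth gamma_moment_laguerre_poly_mult[OF a] coeff_eq_0)
  qed
  hence "q = 0" unfolding c by simp
  hence Ln: "L n = smult l (laguerre_poly a n)" by (simp add: q_def)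
  have "1 = gamma_moment a (L n * L n)" by (simp add: orth)
  also have "\<dots> = l * (l * gamma_moment a (laguerre_poly a n * laguerre_poly a n))"
    unfolding Ln by (simp add: gamma_moment_smult)
  also have "gamma_moment a (laguerre_poly a n * laguerre_poly a n) = Gamma (real n + a) / fact n"
    by (subst gamma_moment_laguerre_poly_mult[OF a]) (use degree_laguerre_poly[OF a, of n] g in \<open>auto simp: g_def power_mult_distrib[symmetric]\<close>)
  finally have "l * l = fact n / Gamma (real n + a)" using G by (simp add: field_simps)
  moreover have "poly (L n) x * poly (L n) y = (l * l) * laguerre a n x * laguerre a n y"
    unfolding Ln by (simp add: poly_laguerre_poly)
  ultimately show ?thesis by simp
qed

section \<open>The closed form of the heat kernel\<close>

definition rho :: "real \<Rightarrow> real" where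
  "rho u = 1 / (exp u - 1)"

text \<open>
  The Hille-Hardy closed form with \<open>a = \<alpha> + 1\<close>, where \<open>1 + rho u = 1 / (1 - e\<^bsup>-u\<^esup>)\<close>.
\<close>

definition hh_kernel :: "real \<Rightarrow> real \<Rightarrow> real \<Rightarrow> 'a::{real_normed_field,banach} \<Rightarrow> real \<Rightarrow> 'a" where
  "hh_kernel a m u x y = of_real (exp (- (m * u)) * (1 + rho u) powr a * exp (- (rho u * y))) *
     exp (- (of_real (rho u) * x)) * bessel a (of_real (rho u * (1 + rho u) * y) * x)"

lemma heat_kernel_eq_hh_kernel:
  assumes \<alpha>: "\<alpha> > -1" and L: "normalized_laguerre \<alpha> L" and u: "u > 0"
  shows "heat_kernel m L u x y = hh_kernel (\<alpha> + 1) m u x y"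
proof -
  define a where "a = \<alpha> + 1"
  have a: "a > 0" using \<alpha> by (simp add: a_def)
  define r where "r = exp (- u)"
  have r: "0 \<le> r" "r < 1" "r > 0" using u by (auto simp: r_def)
  have nz: "1 - r \<noteq> 0" using r by simp
  have e: "exp u = 1 / r" by (simp add: r_def exp_minus inverse_eq_divide)
  have rho: "rho u = r / (1 - r)" using r by (simp add: rho_def e field_simps)
  have rho1: "1 + rho u = 1 / (1 - r)" using nz by (simp add: rho field_simps)
  have "(\<lambda>n. exp (- (m * u)) * (fact n / Gamma (real n + a) * laguerre a n x * laguerre a n y * r ^ n)) sums
     (exp (- (m * u)) * ((1 - r) powr (- a) * exp (- ((x + y) * r / (1 - r))) * bessel a (x * y * r / (1 - r)\<^sup>2)))"
    by (intro sums_mult hille_hardy a r)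
  also have "(\<lambda>n. exp (- (m * u)) * (fact n / Gamma (real n + a) * laguerre a n x * laguerre a n y * r ^ n))
     = (\<lambda>n. exp (- (real n + m) * u) * poly (L n) x * poly (L n) y)"
  proof
    fix n
    have "exp (- (real n + m) * u) = exp (- (m * u)) * r ^ n"
      by (simp add: r_def exp_of_nat_mult[symmetric] exp_add[symmetric] algebra_simps)
    moreover have "poly (L n) x * poly (L n) y = fact n / Gamma (real n + a) * laguerre a n x * laguerre a n y"
      using normalized_laguerre_eq[OF \<alpha> L] by (simp add: a_def)
    ultimately show "exp (- (m * u)) * (fact n / Gamma (real n + a) * laguerre a n x * laguerre a n y * r ^ n)
       = exp (- (real n + m) * u) * poly (L n) x * poly (L n) y"
      by (simp add: mult.assoc)
  qed
  finally have "heat_kernel m L u x y = exp (- (m * u)) * ((1 - r) powr (- a) * exp (- ((x + y) * r / (1 - r))) * bessel a (x * y * r / (1 - r)\<^sup>2))"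
    by (simp add: heat_kernel_def sums_iff)
  also have "(1 - r) powr (- a) = (1 + rho u) powr a"
    using r by (simp add: rho1 powr_minus powr_divide inverse_eq_divide)
  also have "exp (- ((x + y) * r / (1 - r))) = exp (- (rho u * y)) * exp (- (rho u * x))"
    by (simp add: rho exp_add[symmetric] ring_distribs add_divide_distrib mult_ac)
  also have "x * y * r / (1 - r)\<^sup>2 = rho u * (1 + rho u) * y * x"
    unfolding rho1 unfolding rho by (simp add: power2_eq_square mult_ac)
  finally show ?thesis by (simp add: hh_kernel_def a_def mult_ac)
qed

section \<open>Differentiation of the integral\<close>

text \<open>Henstock's lemma bounds the total deviation over disjoint small intervals, and a Vitali cover
  of the exceptional set is therefore small.\<close>

lemma negligible_bad_derivative_points:
  fixes f :: "real \<Rightarrow> 'n::euclidean_space"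
  assumes f: "f integrable_on {a..b}" and k: "k > (0::real)"
  shows "negligible {x\<in>{a<..<b}. \<forall>d>0. \<exists>u v. u < v \<and> v - u < d \<and> {u..v} \<subseteq> {a..b} \<and> (x = u \<or> x = v) \<and>
           norm ((v - u) *\<^sub>R f x - integral {u..v} f) > k * (v - u)}" (is "negligible ?E")
proof (rule negligible_outer_le[THEN iffD2], intro allI impI)
  fix e :: real assume e: "e > 0"
  \<comment> \<open>Disjoint bad intervals of radii \<open>ra\<close> satisfy 2 k (sum of radii) <
    \<eta>, while the fivefold enlarged ones have total length 10 (sum of radii) < 5 \<eta> / k. The
    choice of \<eta> makes this e.\<close>
  define \<eta> where "\<eta> = e * k / 5"
  have \<eta>: "\<eta> > 0" using e k by (simp add: \<eta>_def)
  have f': "f integrable_on cbox a b" using f by simp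
  obtain \<gamma> where g: "gauge \<gamma>" and
    hen: "\<And>p. \<lbrakk>p tagged_partial_division_of (cbox a b); \<gamma> fine p\<rbrakk> \<Longrightarrow>
             sum (\<lambda>(x,k). norm(measure lborel k *\<^sub>R f x - integral k f)) p < \<eta>"
    using Henstock_lemma[OF f' \<eta>] by blast
  \<comment> \<open>The tag must be an endpoint, so the intervals are those on which the primitive
    is differentiated from one side. The length bound 2 is the radius bound 1 of the covering lemma,
    and containment in the gauge makes any disjoint finite subfamily admissible in Henstock's
    lemma.\<close>
  define good where "good = (\<lambda>(x,u,v). u < v \<and> v - u \<le> 2 \<and> {u..v} \<subseteq> {a..b} \<and> (x = u \<or> x = v) \<and> {u..v} \<subseteq> \<gamma> x
      \<and> norm ((v - u) *\<^sub>R f x - integral {u..v} f) > k * (v - u))"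
  define K where "K = {i. good i}"
  define ce where "ce = (\<lambda>(x::real,u::real,v::real). (u + v) / 2)"
  define ra where "ra = (\<lambda>(x::real,u::real,v::real). (v - u) / 2)"
  have cb: "cball (ce (x,u,v)) (ra (x,u,v)) = {u..v}" if "u < v" for x u v
    by (simp add: ce_def ra_def cball_eq_atLeastAtMost field_simps)
  have cov: "?E \<subseteq> (\<Union>i\<in>K. cball (ce i) (ra i))"
  proof
    fix x assume x: "x \<in> ?E"
    obtain d where d: "d > 0" "ball x d \<subseteq> \<gamma> x"
      using g unfolding gauge_def by (metis openE)
    from x have "\<forall>d>0. \<exists>u v. u < v \<and> v - u < d \<and> {u..v} \<subseteq> {a..b} \<and> (x = u \<or> x = v) \<and>
           norm ((v - u) *\<^sub>R f x - integral {u..v} f) > k * (v - u)" by blast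
    from this[rule_format, of "min d 1"] d(1) obtain u v where uv: "u < v" "v - u < min d 1" "{u..v} \<subseteq> {a..b}" "x = u \<or> x = v"
      "norm ((v - u) *\<^sub>R f x - integral {u..v} f) > k * (v - u)" by auto
    have "{u..v} \<subseteq> ball x d" using uv by (auto simp: dist_real_def)
    hence "good (x,u,v)" using uv d by (auto simp: good_def)
    moreover have "x \<in> cball (ce (x,u,v)) (ra (x,u,v))" using uv cb[of u v x] by auto
    ultimately show "x \<in> (\<Union>i\<in>K. cball (ce i) (ra i))" by (auto simp: K_def)
  qed
  obtain C where C: "countable C" "C \<subseteq> K"
     "pairwise (\<lambda>i j. disjnt (cball (ce i) (ra i)) (cball (ce j) (ra j))) C"
     "?E \<subseteq> (\<Union>i\<in>C. cball (ce i) (5 * ra i))"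
  proof (rule Vitali_covering_lemma_cballs[OF cov, where B=1])
    show "0 < ra i \<and> ra i \<le> 1" if "i \<in> K" for i using that by (auto simp: K_def good_def ra_def)
  qed
  have fin: "(\<Sum>i\<in>I. measure lebesgue (cball (ce i) (5 * ra i))) \<le> e" if I: "finite I" "I \<subseteq> C" for I
  proof -
    define iv where "iv = (\<lambda>(x::real,u::real,v::real). (x, {u..v}))"
    have gI: "good i" if "i \<in> I" for i using that I C by (auto simp: K_def)
    have inj: "inj_on iv I"
    proof (rule inj_onI)
      fix i j assume ij: "i \<in> I" "j \<in> I" "iv i = iv j"
      obtain x u v where i: "i = (x,u,v)" by (cases i)
      obtain x' u' v' where j: "j = (x',u',v')" by (cases j)
      have "u < v" "u' < v'" using gI[OF ij(1)] gI[OF ij(2)] by (auto simp: good_def i j)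
      thus "i = j" using ij(3) by (auto simp: iv_def i j)
    qed
    have td: "(iv ` I) tagged_partial_division_of (cbox a b)"
      unfolding tagged_partial_division_of_def
    proof (intro conjI allI impI)
      show "finite (iv ` I)" using I by simp
    next
      fix x k assume xk: "(x, k) \<in> iv ` I"
      then obtain u v where uv: "(x,u,v) \<in> I" "k = {u..v}" by (auto simp: iv_def)
      from gI[OF uv(1)] have "u < v" "{u..v} \<subseteq> {a..b}" "x = u \<or> x = v" by (auto simp: good_def)
      thus "x \<in> k" "k \<subseteq> cbox a b" "\<exists>a b. k = cbox a b" using uv by auto
    next
      fix x k x' k'
      assume "(x, k) \<in> iv ` I \<and> (x', k') \<in> iv ` I \<and> (x, k) \<noteq> (x', k')"
      hence xk: "(x, k) \<in> iv ` I" and xk': "(x', k') \<in> iv ` I" "(x, k) \<noteq> (x', k')" by auto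
      from xk obtain u v where uv: "(x,u,v) \<in> I" "k = {u..v}" by (auto simp: iv_def)
      from gI[OF uv(1)] have "u < v" by (auto simp: good_def)
      from xk' obtain u' v' where uv': "(x',u',v') \<in> I" "k' = {u'..v'}" by (auto simp: iv_def)
      have "(x,u,v) \<noteq> (x',u',v')" using xk' uv uv' by auto
      hence "disjnt (cball (ce (x,u,v)) (ra (x,u,v))) (cball (ce (x',u',v')) (ra (x',u',v')))"
        using pairwiseD[OF C(3)] I uv(1) uv'(1) by blast
      moreover have "u' < v'" using gI[OF uv'(1)] by (auto simp: good_def)
      ultimately have "k \<inter> k' = {}" using cb \<open>u < v\<close> uv uv' by (simp add: disjnt_def)
      thus "interior k \<inter> interior k' = {}"
        using interior_subset by blast
    qed
    have "\<gamma> fine (iv ` I)" using gI by (fastforce simp: fine_def iv_def good_def)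
    from hen[OF td this] have "(\<Sum>i\<in>I. case iv i of (x,k) \<Rightarrow> norm(measure lborel k *\<^sub>R f x - integral k f)) < \<eta>"
      by (subst (asm) sum.reindex[OF inj]) (simp add: o_def)
    moreover have "(\<Sum>i\<in>I. k * (2 * ra i)) \<le> (\<Sum>i\<in>I. case iv i of (x,k) \<Rightarrow> norm(measure lborel k *\<^sub>R f x - integral k f))"
    proof (rule sum_mono)
      fix i assume "i \<in> I"
      obtain x u v where i: "i = (x, u, v)" by (cases i)
      have "2 * ra i = v - u" by (simp add: ra_def i)
      thus "k * (2 * ra i) \<le> (case iv i of (x,k) \<Rightarrow> norm(measure lborel k *\<^sub>R f x - integral k f))"
        using gI[OF \<open>i \<in> I\<close>] by (simp add: good_def iv_def i)
    qed
    moreover have "(\<Sum>i\<in>I. k * (2 * ra i)) = 2 * k * (\<Sum>i\<in>I. ra i)"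
      unfolding sum_distrib_left by (simp add: mult_ac)
    ultimately have "2 * k * (\<Sum>i\<in>I. ra i) < \<eta>" by linarith
    moreover have "(\<Sum>i\<in>I. measure lebesgue (cball (ce i) (5 * ra i))) = (\<Sum>i\<in>I. 10 * ra i)"
    proof (rule sum.cong[OF refl])
      fix i assume "i \<in> I"
      from gI[OF this] have "ra i > 0" by (auto simp: good_def ra_def)
      thus "measure lebesgue (cball (ce i) (5 * ra i)) = 10 * ra i"
        by (simp add: cball_eq_atLeastAtMost)
    qed
    moreover have "(\<Sum>i\<in>I. 10 * ra i) = 10 * (\<Sum>i\<in>I. ra i)"
      unfolding sum_distrib_left ..
    moreover have "(\<Sum>i\<in>I. ra i) < e / 10"
      using \<open>2 * k * (\<Sum>i\<in>I. ra i) < \<eta>\<close> k e by (simp add: \<eta>_def field_simps)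
    ultimately show ?thesis by linarith
  qed
  have fin': "measure lebesgue (\<Union>i\<in>I. cball (ce i) (5 * ra i)) \<le> e" if "I \<subseteq> C" "finite I" for I
  proof -
    have "measure lebesgue (\<Union>i\<in>I. cball (ce i) (5 * ra i)) \<le> (\<Sum>i\<in>I. measure lebesgue (cball (ce i) (5 * ra i)))"
      using that by (intro measure_UNION_le) auto
    thus ?thesis using fin[OF that(2,1)] by linarith
  qed
  have "(\<Union>i\<in>C. cball (ce i) (5 * ra i)) \<in> lmeasurable"
    by (rule fmeasurable_UN_bound[OF C(1) _ fin']) simp_all
  have "measure lebesgue (\<Union>i\<in>C. cball (ce i) (5 * ra i)) \<le> e"
    by (rule measure_UN_bound[OF C(1) _ fin']) simp_all
  show "\<exists>T. ?E \<subseteq> T \<and> T \<in> lmeasurable \<and> measure lebesgue T \<le> e"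
    by (intro exI[of _ "\<Union>i\<in>C. cball (ce i) (5 * ra i)"] conjI C(4)) fact+
qed

lemma AE_integral_derivative_Ioo:
  fixes f :: "real \<Rightarrow> 'n::euclidean_space"
  assumes f: "f integrable_on {a..b}"
  shows "AE x in lebesgue. x \<in> {a<..<b} \<longrightarrow> (\<forall>e>0. \<exists>d>0. \<forall>u v. u < v \<longrightarrow> v - u < d \<longrightarrow> (x = u \<or> x = v) \<longrightarrow>
           norm ((v - u) *\<^sub>R f x - integral {u..v} f) \<le> e * (v - u))"
proof -
  have "AE x in lebesgue. \<forall>n::nat. x \<notin> {x\<in>{a<..<b}. \<forall>d>0. \<exists>u v. u < v \<and> v - u < d \<and> {u..v} \<subseteq> {a..b} \<and> (x = u \<or> x = v) \<and>
           norm ((v - u) *\<^sub>R f x - integral {u..v} f) > inverse (real (Suc n)) * (v - u)}"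
    (is "AE x in lebesgue. \<forall>n. x \<notin> ?E n")
    unfolding AE_all_countable
  proof
    fix n :: nat
    show "AE x in lebesgue. x \<notin> ?E n"
      using negligible_bad_derivative_points[OF f, of "inverse (real (Suc n))"]
      by (intro AE_not_in) (simp add: negligible_iff_null_sets)
  qed
  thus ?thesis
  proof eventually_elim
    case (elim x)
    show ?case
    proof (intro impI allI)
      fix e :: real assume x: "x \<in> {a<..<b}" and e: "e > 0"
      obtain n where n: "inverse (real (Suc n)) < e" using reals_Archimedean[OF e] by blast
      from elim[rule_format, of n] x obtain d where d: "d > 0" and
        *: "\<And>u v. u < v \<Longrightarrow> v - u < d \<Longrightarrow> {u..v} \<subseteq> {a..b} \<Longrightarrow> x = u \<or> x = v \<Longrightarrow>
           norm ((v - u) *\<^sub>R f x - integral {u..v} f) \<le> inverse (real (Suc n)) * (v - u)"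
        by (force simp: not_less)
      show "\<exists>d>0. \<forall>u v. u < v \<longrightarrow> v - u < d \<longrightarrow> (x = u \<or> x = v) \<longrightarrow>
           norm ((v - u) *\<^sub>R f x - integral {u..v} f) \<le> e * (v - u)"
      \<comment> \<open>The distances to the endpoints enter the minimum so that every short
        interval with endpoint x automatically lies inside [a, b].\<close>
      proof (intro exI[of _ "Min {d, x - a, b - x}"] conjI allI impI)
        show "0 < Min {d, x - a, b - x}" using d x by auto
        fix u v assume uv: "u < v" "v - u < Min {d, x - a, b - x}" "x = u \<or> x = v"
        have "norm ((v - u) *\<^sub>R f x - integral {u..v} f) \<le> inverse (real (Suc n)) * (v - u)"
          using uv by (intro *) auto
        also have "\<dots> \<le> e * (v - u)" using n uv by (intro mult_right_mono) auto
        finally show "norm ((v - u) *\<^sub>R f x - integral {u..v} f) \<le> e * (v - u)" .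
      qed
    qed
  qed
qed

text \<open>Integrability is asked only on intervals bounded away from 0, since membership in
  \<open>L1_Phi\<close> gives nothing better; the half line is exhausted by countably many such
  intervals.\<close>

lemma AE_integral_derivative_pos:
  fixes f :: "real \<Rightarrow> 'n::euclidean_space"
  assumes f: "\<And>a b. 0 < a \<Longrightarrow> f integrable_on {a..b}"
  shows "AE x in lebesgue. x > 0 \<longrightarrow> (\<forall>e>0. \<exists>d>0. \<forall>u v. u < v \<longrightarrow> v - u < d \<longrightarrow> (x = u \<or> x = v) \<longrightarrow>
           norm ((v - u) *\<^sub>R f x - integral {u..v} f) \<le> e * (v - u))"
proof -
  have "AE x in lebesgue. \<forall>n::nat. x \<in> {inverse (real (Suc n))<..<real (Suc n)} \<longrightarrow>
      (\<forall>e>0. \<exists>d>0. \<forall>u v. u < v \<longrightarrow> v - u < d \<longrightarrow> (x = u \<or> x = v) \<longrightarrow>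
           norm ((v - u) *\<^sub>R f x - integral {u..v} f) \<le> e * (v - u))"
    unfolding AE_all_countable by (intro allI AE_integral_derivative_Ioo f) auto
  thus ?thesis
  proof eventually_elim
    case (elim x)
    show ?case
    proof (intro impI)
      assume x: "x > 0"
      obtain n where n: "inverse (real (Suc n)) < x" using reals_Archimedean[OF x] by blast
      obtain k where k: "x < real k" using reals_Archimedean2 by blast
      have "inverse (real (Suc (max n k))) \<le> inverse (real (Suc n))" by (intro le_imp_inverse_le) auto
      hence "x \<in> {inverse (real (Suc (max n k)))<..<real (Suc (max n k))}" using le_less_trans[OF _ n] k by (auto simp del: of_nat_Suc)
      thus "\<forall>e>0. \<exists>d>0. \<forall>u v. u < v \<longrightarrow> v - u < d \<longrightarrow> (x = u \<or> x = v) \<longrightarrow>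
           norm ((v - u) *\<^sub>R f x - integral {u..v} f) \<le> e * (v - u)"
        using elim by blast
    qed
  qed
qed

section \<open>Smoothness of integrals of holomorphic products\<close>

lemma norm_deriv_le:
  fixes f :: "complex \<Rightarrow> complex"
  assumes "f holomorphic_on S" "open S" "cball z r \<subseteq> S" "r > 0"
    and "\<And>w. w \<in> cball z r \<Longrightarrow> norm (f w) \<le> B"
  shows "norm (deriv f z) \<le> B / r"
proof -
  have "norm ((deriv ^^ 1) f z) \<le> fact 1 * B / r ^ 1"
  proof (rule Cauchy_inequality)
    have "ball z r \<subseteq> S" using assms(3) ball_subset_cball by blast
    thus "f holomorphic_on ball z r" using assms(1) holomorphic_on_subset by blast
    show "continuous_on (cball z r) f"
      using assms(1,3) holomorphic_on_imp_continuous_on continuous_on_subset by blast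
    show "norm (f x) \<le> B" if "norm (z - x) = r" for x
      by (rule assms(5)) (use that in \<open>simp add: dist_norm\<close>)
  qed fact
  thus ?thesis by simp
qed

text \<open>The derivative is the limit of difference quotients along one fixed sequence of
  increments, the same for all w, and hence a sequential limit of measurable functions.\<close>

lemma borel_measurable_deriv_param:
  fixes G :: "complex \<Rightarrow> 'w \<Rightarrow> complex"
  assumes "open S" "z \<in> S" "\<And>w. w \<in> space M \<Longrightarrow> (\<lambda>z. G z w) holomorphic_on S"
    and "\<And>z. z \<in> S \<Longrightarrow> G z \<in> borel_measurable M"
  shows "(\<lambda>w. deriv (\<lambda>z. G z w) z) \<in> borel_measurable M"
proof -
  obtain r where r: "r > 0" "ball z r \<subseteq> S" using assms(1,2) openE by blast
  define h :: "nat \<Rightarrow> complex" where "h n = of_real (r / 2 / real (Suc n))" for n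
  have h: "z + h n \<in> S" "h n \<noteq> 0" for n
  proof -
    have "r / 2 / real (Suc n) \<le> r / 2" using r by (simp add: divide_simps)
    moreover have "norm (h n) = r / 2 / real (Suc n)"
      unfolding h_def norm_of_real by (rule abs_of_nonneg) (use r in simp)
    ultimately have "norm (h n) < r" using r by linarith
    thus "z + h n \<in> S" using r by (auto simp: dist_norm)
    show "h n \<noteq> 0" using r by (simp add: h_def del: of_nat_Suc)
  qed
  have h0: "h \<longlonglongrightarrow> 0"
  proof -
    have "(\<lambda>n. r / 2 / real (Suc n)) \<longlonglongrightarrow> 0"
      by (rule LIMSEQ_Suc[OF lim_const_over_n])
    from tendsto_of_real[OF this] show ?thesis unfolding h_def of_real_0 .
  qed
  show ?thesis
  proof (rule borel_measurable_LIMSEQ_metric)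
    show "(\<lambda>w. (G (z + h n) w - G z w) / h n) \<in> borel_measurable M" for n
      by (intro borel_measurable_divide borel_measurable_diff borel_measurable_const assms(4) h assms(2))
    fix w assume "w \<in> space M"
    hence "((\<lambda>z. G z w) has_field_derivative deriv (\<lambda>z. G z w) z) (at z)"
      using assms(1-3) holomorphic_derivI by blast
    hence "((\<lambda>k. (G (z + k) w - G z w) / k) \<longlongrightarrow> deriv (\<lambda>z. G z w) z) (at 0)"
      by (simp add: DERIV_def)
    thus "(\<lambda>n. (G (z + h n) w - G z w) / h n) \<longlonglongrightarrow> deriv (\<lambda>z. G z w) z"
      unfolding tendsto_at_iff_sequentially using h0 h(2) by (auto simp: comp_def)
  qed
qed

text \<open>A majorant of the functions alone is enough: by Cauchy's estimate the derivative on the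
  ball of radius r / 2 is at most g / (r / 2), and this bounds all difference quotients in that
  ball, so dominated convergence applies.\<close>

lemma DERIV_param_integral:
  fixes G :: "complex \<Rightarrow> 'w \<Rightarrow> complex"
  assumes S: "open S" "cball z r \<subseteq> S" "r > 0"
    and hol: "\<And>w. w \<in> space M \<Longrightarrow> (\<lambda>z. G z w) holomorphic_on S"
    and meas: "\<And>z. z \<in> S \<Longrightarrow> G z \<in> borel_measurable M"
    and g: "integrable M g" "\<And>v w. v \<in> cball z r \<Longrightarrow> w \<in> space M \<Longrightarrow> norm (G v w) \<le> g w"
  shows "((\<lambda>z. \<integral>w. G z w \<partial>M) has_field_derivative (\<integral>w. deriv (\<lambda>z. G z w) z \<partial>M)) (at z)"
    and "integrable M (\<lambda>w. deriv (\<lambda>z. G z w) z)"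
proof -
  have zS: "z \<in> S" using S by auto
  have md: "(\<lambda>w. deriv (\<lambda>z. G z w) z) \<in> borel_measurable M"
    by (rule borel_measurable_deriv_param[OF S(1) zS hol meas])
  have int: "integrable M (G v)" if "v \<in> cball z r" for v
    by (rule Bochner_Integration.integrable_bound[OF g(1)])
       (use that S(2) meas g(2) in \<open>auto intro!: AE_I2 order_trans[OF g(2) abs_ge_self]\<close>)
  have dbound: "norm (deriv (\<lambda>z. G z w) v) \<le> g w / (r / 2)" if "v \<in> cball z (r / 2)" "w \<in> space M" for v w
  proof (rule norm_deriv_le[OF hol[OF that(2)] S(1)])
    have sub: "cball v (r / 2) \<subseteq> cball z r"
    proof
      fix x assume "x \<in> cball v (r / 2)"
      thus "x \<in> cball z r" using that(1) dist_triangle[of z x v] by simp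
    qed
    thus "cball v (r / 2) \<subseteq> S" using S(2) by blast
    show "norm (G x w) \<le> g w" if "x \<in> cball v (r / 2)" for x
      using sub that g(2) \<open>w \<in> space M\<close> by blast
  qed (use S in auto)
  show "integrable M (\<lambda>w. deriv (\<lambda>z. G z w) z)"
  proof (rule Bochner_Integration.integrable_bound[OF _ md AE_I2])
    show "integrable M (\<lambda>w. g w / (r / 2))" using g by simp
    show "norm (deriv (\<lambda>z. G z w) z) \<le> norm (g w / (r / 2))" if "w \<in> space M" for w
      unfolding real_norm_def by (rule order_trans[OF dbound abs_ge_self]) (use S that in auto)
  qed
  show "((\<lambda>z. \<integral>w. G z w \<partial>M) has_field_derivative (\<integral>w. deriv (\<lambda>z. G z w) z \<partial>M)) (at z)"
    unfolding DERIV_def tendsto_at_iff_sequentially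
  proof (intro allI impI)
    fix X :: "nat \<Rightarrow> complex" assume X: "\<forall>i. X i \<in> UNIV - {0}" "X \<longlonglongrightarrow> 0"
    have "eventually (\<lambda>n. dist (X n) 0 < r / 2) sequentially"
      using X(2) S(3) by (intro tendstoD) auto
    then obtain N where N: "\<And>n. n \<ge> N \<Longrightarrow> norm (X n) < r / 2" by (auto simp: eventually_sequentially)
    \<comment> \<open>Dropping finitely many terms keeps all increments within r / 2, where the
      bound on the difference quotients is available.\<close>
    define Y where "Y n = X (n + N)" for n
    have Y: "Y n \<noteq> 0" "norm (Y n) < r / 2" for n using X(1) N by (auto simp: Y_def)
    have Y0: "Y \<longlonglongrightarrow> 0" unfolding Y_def using X(2) by (rule LIMSEQ_ignore_initial_segment)
    have zY: "z + Y n \<in> cball z (r / 2)" "z + Y n \<in> cball z r" for n using Y[of n] S by (auto simp: dist_norm)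
    have "(\<lambda>n. \<integral>w. (G (z + Y n) w - G z w) / Y n \<partial>M) \<longlonglongrightarrow> (\<integral>w. deriv (\<lambda>z. G z w) z \<partial>M)"
    proof (rule integral_dominated_convergence[where w = "\<lambda>w. g w / (r / 2)"])
      show "(\<lambda>w. deriv (\<lambda>z. G z w) z) \<in> borel_measurable M" by (rule md)
      show "(\<lambda>w. (G (z + Y n) w - G z w) / Y n) \<in> borel_measurable M" for n
      proof -
        have "z + Y n \<in> S" using zY(2) S(2) by blast
        thus ?thesis by (intro borel_measurable_divide borel_measurable_diff borel_measurable_const meas zS)
      qed
      show "integrable M (\<lambda>w. g w / (r / 2))" using g by simp
      show "AE w in M. (\<lambda>n. (G (z + Y n) w - G z w) / Y n) \<longlonglongrightarrow> deriv (\<lambda>z. G z w) z"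
      proof (rule AE_I2)
        fix w assume "w \<in> space M"
        hence "((\<lambda>z. G z w) has_field_derivative deriv (\<lambda>z. G z w) z) (at z)"
          using hol S(1) zS holomorphic_derivI by blast
        hence "((\<lambda>k. (G (z + k) w - G z w) / k) \<longlongrightarrow> deriv (\<lambda>z. G z w) z) (at 0)"
          by (simp add: DERIV_def)
        thus "(\<lambda>n. (G (z + Y n) w - G z w) / Y n) \<longlonglongrightarrow> deriv (\<lambda>z. G z w) z"
          unfolding tendsto_at_iff_sequentially using Y0 Y(1) by (auto simp: comp_def)
      qed
      show "AE w in M. norm ((G (z + Y n) w - G z w) / Y n) \<le> g w / (r / 2)" for n
      proof (rule AE_I2)
        fix w assume w: "w \<in> space M"
        have "norm (G (z + Y n) w - G z w) \<le> g w / (r / 2) * norm (z + Y n - z)"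
        proof (rule field_differentiable_bound[where S = "cball z (r / 2)"])
          fix v assume v: "v \<in> cball z (r / 2)"
          hence "v \<in> S" using S by auto
          hence "((\<lambda>z. G z w) has_field_derivative deriv (\<lambda>z. G z w) v) (at v)"
            using hol[OF w] S(1) holomorphic_derivI by blast
          thus "((\<lambda>z. G z w) has_field_derivative deriv (\<lambda>z. G z w) v) (at v within cball z (r / 2))"
            by (rule has_field_derivative_at_within)
          show "norm (deriv (\<lambda>z. G z w) v) \<le> g w / (r / 2)" by (rule dbound[OF v w])
        qed (use zY S in auto)
        thus "norm ((G (z + Y n) w - G z w) / Y n) \<le> g w / (r / 2)"
          using Y[of n] S(3) by (simp add: norm_divide divide_simps)
      qed
    qed
    also have "(\<lambda>n. \<integral>w. (G (z + Y n) w - G z w) / Y n \<partial>M) = (\<lambda>n. ((\<integral>w. G (z + Y n) w \<partial>M) - (\<integral>w. G z w \<partial>M)) / Y n)"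
      using int zY S by simp
    finally have "(\<lambda>n. (\<lambda>h. ((\<integral>w. G (z + h) w \<partial>M) - (\<integral>w. G z w \<partial>M)) / h) (X (n + N))) \<longlonglongrightarrow> (\<integral>w. deriv (\<lambda>z. G z w) z \<partial>M)"
      by (simp add: Y_def)
    thus "((\<lambda>h. ((\<integral>w. G (z + h) w \<partial>M) - (\<integral>w. G z w \<partial>M)) / h) \<circ> X) \<longlonglongrightarrow> (\<integral>w. deriv (\<lambda>z. G z w) z \<partial>M)"
      unfolding comp_def by (rule LIMSEQ_offset)
  qed
qed

text \<open>The majorant is demanded of the product only, because the factors are not separately
  integrable: decay of the first in the parameter space compensates growth of the second. It is
  local in both variables on complex balls, so the property survives differentiation of either
  factor and can carry an induction on the order. \<open>D\<close> is the set of parameter pairs at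
  which a majorant exists.\<close>

definition dominated_product :: "'w measure \<Rightarrow> complex set \<Rightarrow> (complex \<times> complex) set \<Rightarrow>
    (complex \<Rightarrow> 'w \<Rightarrow> complex) \<Rightarrow> (complex \<Rightarrow> 'w \<Rightarrow> complex) \<Rightarrow> bool" where
  "dominated_product M S D A B \<longleftrightarrow> open S \<and>
     (\<forall>w\<in>space M. (\<lambda>t. A t w) holomorphic_on S) \<and> (\<forall>w\<in>space M. (\<lambda>x. B x w) holomorphic_on UNIV) \<and>
     (\<forall>t\<in>S. A t \<in> borel_measurable M) \<and> (\<forall>x. B x \<in> borel_measurable M) \<and>
     (\<forall>t0 x0. (t0, x0) \<in> D \<longrightarrow> (\<exists>r>0. \<exists>g. cball t0 r \<subseteq> S \<and> integrable M g \<and>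
        (\<forall>t\<in>cball t0 r. \<forall>x\<in>cball x0 r. \<forall>w\<in>space M. norm (A t w * B x w) \<le> g w)))"

lemma dominated_product_D:
  assumes "dominated_product M S D A B"
  shows "open S" "w \<in> space M \<Longrightarrow> (\<lambda>t. A t w) holomorphic_on S" "w \<in> space M \<Longrightarrow> (\<lambda>x. B x w) holomorphic_on UNIV"
    "t \<in> S \<Longrightarrow> A t \<in> borel_measurable M" "B x \<in> borel_measurable M"
  using assms by (auto simp: dominated_product_def)

lemma dominated_product_bound:
  assumes "dominated_product M S D A B" "(t0, x0) \<in> D"
  obtains r g where "r > 0" "cball t0 r \<subseteq> S" "integrable M g"
     "\<And>t x w. t \<in> cball t0 r \<Longrightarrow> x \<in> cball x0 r \<Longrightarrow> w \<in> space M \<Longrightarrow> norm (A t w * B x w) \<le> g w"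
  using assms unfolding dominated_product_def by meson

lemma cball_half_subset:
  fixes z :: "'a::metric_space"
  assumes "v \<in> cball z (r / 2)"
  shows "cball v (r / 2) \<subseteq> cball z r"
proof
  fix x assume "x \<in> cball v (r / 2)"
  thus "x \<in> cball z r" using assms dist_triangle[of z x v] by simp
qed

text \<open>Cauchy's estimate is applied to the product as a function of t with x frozen. The radius
  is halved and the majorant multiplied by 2 / r, at every point of D anew.\<close>

lemma dominated_product_deriv1:
  assumes "dominated_product M S D A B"
  shows "dominated_product M S D (\<lambda>t w. deriv (\<lambda>t. A t w) t) B"
  unfolding dominated_product_def
proof (intro conjI ballI allI impI)
  note d = dominated_product_D[OF assms]
  show "open S" by (rule d)
  show "(\<lambda>t. deriv (\<lambda>t. A t w) t) holomorphic_on S" if "w \<in> space M" for w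
    by (intro holomorphic_intros d that)
  show "(\<lambda>x. B x w) holomorphic_on UNIV" if "w \<in> space M" for w by (rule d(3)[OF that])
  show "(\<lambda>w. deriv (\<lambda>t. A t w) t) \<in> borel_measurable M" if "t \<in> S" for t
    by (rule borel_measurable_deriv_param[OF d(1) that d(2,4)])
  show "B x \<in> borel_measurable M" for x by (rule d)
  fix t0 x0 assume "(t0, x0) \<in> D"
  then obtain r g where r: "r > 0" "cball t0 r \<subseteq> S" "integrable M g"
     "\<And>t x w. t \<in> cball t0 r \<Longrightarrow> x \<in> cball x0 r \<Longrightarrow> w \<in> space M \<Longrightarrow> norm (A t w * B x w) \<le> g w"
    by (rule dominated_product_bound[OF assms]) blast
  have "norm (deriv (\<lambda>t. A t w) t * B x w) \<le> g w / (r / 2)"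
    if "t \<in> cball t0 (r / 2)" "x \<in> cball x0 (r / 2)" "w \<in> space M" for t x w
  proof -
    have dA: "((\<lambda>t. A t w) has_field_derivative deriv (\<lambda>t. A t w) t) (at t)"
      using that r d(1) d(2)[OF that(3)] by (intro holomorphic_derivI[of _ S]) auto
    have "norm (deriv (\<lambda>t. A t w * B x w) t) \<le> g w / (r / 2)"
    proof (rule norm_deriv_le[OF _ d(1)])
      show "(\<lambda>t. A t w * B x w) holomorphic_on S" by (intro holomorphic_intros d that)
      show "cball t (r / 2) \<subseteq> S" using cball_half_subset[OF that(1)] r by blast
      show "norm (A v w * B x w) \<le> g w" if "v \<in> cball t (r / 2)" for v
        using cball_half_subset[OF \<open>t \<in> cball t0 (r / 2)\<close>] that r \<open>w \<in> space M\<close> \<open>x \<in> cball x0 (r / 2)\<close>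
        by (intro r(4)) auto
    qed (use r in auto)
    also have "deriv (\<lambda>t. A t w * B x w) t = deriv (\<lambda>t. A t w) t * B x w"
      by (rule DERIV_imp_deriv) (auto intro!: derivative_eq_intros dA)
    finally show ?thesis .
  qed
  moreover have "cball t0 (r / 2) \<subseteq> S" using r by auto
  moreover have "integrable M (\<lambda>w. g w / (r / 2))" using r by simp
  ultimately show "\<exists>r>0. \<exists>g. cball t0 r \<subseteq> S \<and> integrable M g \<and>
        (\<forall>t\<in>cball t0 r. \<forall>x\<in>cball x0 r. \<forall>w\<in>space M. norm (deriv (\<lambda>t. A t w) t * B x w) \<le> g w)"
    using r(1) by (intro exI[of _ "r / 2"] conjI exI[of _ "\<lambda>w. g w / (r / 2)"] ballI) auto
qed

lemma dominated_product_deriv2: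
  assumes "dominated_product M S D A B"
  shows "dominated_product M S D A (\<lambda>x w. deriv (\<lambda>x. B x w) x)"
  unfolding dominated_product_def
proof (intro conjI ballI allI impI)
  note d = dominated_product_D[OF assms]
  show "open S" by (rule d)
  show "(\<lambda>t. deriv (\<lambda>t. B t w) t) holomorphic_on UNIV" if "w \<in> space M" for w
    by (intro holomorphic_intros d that) auto
  show "(\<lambda>x. A x w) holomorphic_on S" if "w \<in> space M" for w by (rule d(2)[OF that])
  show "(\<lambda>w. deriv (\<lambda>t. B t w) t) \<in> borel_measurable M" for t
    by (rule borel_measurable_deriv_param[OF open_UNIV UNIV_I d(3,5)])
  show "A x \<in> borel_measurable M" if "x \<in> S" for x by (rule d(4)[OF that])
  fix t0 x0 assume "(t0, x0) \<in> D"
  then obtain r g where r: "r > 0" "cball t0 r \<subseteq> S" "integrable M g"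
     "\<And>t x w. t \<in> cball t0 r \<Longrightarrow> x \<in> cball x0 r \<Longrightarrow> w \<in> space M \<Longrightarrow> norm (A t w * B x w) \<le> g w"
    by (rule dominated_product_bound[OF assms]) blast
  have "norm (A t w * deriv (\<lambda>x. B x w) x) \<le> g w / (r / 2)"
    if "t \<in> cball t0 (r / 2)" "x \<in> cball x0 (r / 2)" "w \<in> space M" for t x w
  proof -
    have dB: "((\<lambda>x. B x w) has_field_derivative deriv (\<lambda>x. B x w) x) (at x)"
      using d(3)[OF that(3)] by (intro holomorphic_derivI[of _ UNIV]) auto
    have "norm (deriv (\<lambda>x. A t w * B x w) x) \<le> g w / (r / 2)"
    proof (rule norm_deriv_le[OF _ open_UNIV])
      show "(\<lambda>x. A t w * B x w) holomorphic_on UNIV" by (intro holomorphic_intros d that)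
      show "norm (A t w * B v w) \<le> g w" if "v \<in> cball x (r / 2)" for v
        using cball_half_subset[OF \<open>x \<in> cball x0 (r / 2)\<close>] that r \<open>w \<in> space M\<close> \<open>t \<in> cball t0 (r / 2)\<close>
        by (intro r(4)) auto
    qed (use r in auto)
    also have "deriv (\<lambda>x. A t w * B x w) x = A t w * deriv (\<lambda>x. B x w) x"
      by (rule DERIV_imp_deriv) (auto intro!: derivative_eq_intros dB)
    finally show ?thesis .
  qed
  moreover have "cball t0 (r / 2) \<subseteq> S" using r by auto
  moreover have "integrable M (\<lambda>w. g w / (r / 2))" using r by simp
  ultimately show "\<exists>r>0. \<exists>g. cball t0 r \<subseteq> S \<and> integrable M g \<and>
        (\<forall>t\<in>cball t0 r. \<forall>x\<in>cball x0 r. \<forall>w\<in>space M. norm (A t w * deriv (\<lambda>x. B x w) x) \<le> g w)"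
    using r(1) by (intro exI[of _ "r / 2"] conjI exI[of _ "\<lambda>w. g w / (r / 2)"] ballI) auto
qed

lemma dominated_product_integrable:
  assumes "dominated_product M S D A B" "(t, x) \<in> D"
  shows "integrable M (\<lambda>w. A t w * B x w)"
proof -
  note d = dominated_product_D[OF assms(1)]
  obtain r g where r: "r > 0" "cball t r \<subseteq> S" "integrable M g"
     "\<And>t' x' w. t' \<in> cball t r \<Longrightarrow> x' \<in> cball x r \<Longrightarrow> w \<in> space M \<Longrightarrow> norm (A t' w * B x' w) \<le> g w"
    using dominated_product_bound[OF assms] by blast
  show ?thesis
  proof (rule Bochner_Integration.integrable_bound[OF r(3) _ AE_I2])
    show "(\<lambda>w. A t w * B x w) \<in> borel_measurable M"
    proof -
      have "t \<in> S" using r by auto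
      thus ?thesis using d(4)[of t] d(5)[of x] by auto
    qed
    show "norm (A t w * B x w) \<le> norm (g w)" if "w \<in> space M" for w
      using r(4)[of t x w] r(1) that by simp
  qed
qed

lemma dominated_product_DERIV1:
  assumes "dominated_product M S D A B" "(t, x) \<in> D"
  shows "((\<lambda>t. \<integral>w. A t w * B x w \<partial>M) has_field_derivative (\<integral>w. deriv (\<lambda>t. A t w) t * B x w \<partial>M)) (at t)"
proof -
  note d = dominated_product_D[OF assms(1)]
  obtain r g where r: "r > 0" "cball t r \<subseteq> S" "integrable M g"
     "\<And>t' x' w. t' \<in> cball t r \<Longrightarrow> x' \<in> cball x r \<Longrightarrow> w \<in> space M \<Longrightarrow> norm (A t' w * B x' w) \<le> g w"
    using dominated_product_bound[OF assms] by blast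
  have eq: "deriv (\<lambda>t. A t w * B x w) t = deriv (\<lambda>t. A t w) t * B x w" if "w \<in> space M" for w
  proof -
    have "((\<lambda>t. A t w) has_field_derivative deriv (\<lambda>t. A t w) t) (at t)"
      using that r d(1) d(2)[OF that] by (intro holomorphic_derivI[of _ S]) auto
    thus ?thesis by (intro DERIV_imp_deriv) (auto intro!: derivative_eq_intros)
  qed
  have "((\<lambda>t. \<integral>w. A t w * B x w \<partial>M) has_field_derivative (\<integral>w. deriv (\<lambda>t. A t w * B x w) t \<partial>M)) (at t)"
  proof (rule DERIV_param_integral[OF d(1) r(2,1) _ _ r(3)])
    show "(\<lambda>t. A t w * B x w) holomorphic_on S" if "w \<in> space M" for w by (intro holomorphic_intros d that)
    show "(\<lambda>w. A t w * B x w) \<in> borel_measurable M" if "t \<in> S" for t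
      using d(4)[OF that] d(5)[of x] by auto
    show "norm (A v w * B x w) \<le> g w" if "v \<in> cball t r" "w \<in> space M" for v w
      using r(4)[of v x w] that r(1) by auto
  qed
  also have "(\<integral>w. deriv (\<lambda>t. A t w * B x w) t \<partial>M) = (\<integral>w. deriv (\<lambda>t. A t w) t * B x w \<partial>M)"
    by (rule Bochner_Integration.integral_cong[OF refl eq])
  finally show ?thesis .
qed

lemma dominated_product_DERIV2:
  assumes "dominated_product M S D A B" "(t, x) \<in> D"
  shows "((\<lambda>x. \<integral>w. A t w * B x w \<partial>M) has_field_derivative (\<integral>w. A t w * deriv (\<lambda>x. B x w) x \<partial>M)) (at x)"
proof -
  note d = dominated_product_D[OF assms(1)]
  obtain r g where r: "r > 0" "cball t r \<subseteq> S" "integrable M g"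
     "\<And>t' x' w. t' \<in> cball t r \<Longrightarrow> x' \<in> cball x r \<Longrightarrow> w \<in> space M \<Longrightarrow> norm (A t' w * B x' w) \<le> g w"
    using dominated_product_bound[OF assms] by blast
  have eq: "deriv (\<lambda>x. A t w * B x w) x = A t w * deriv (\<lambda>x. B x w) x" if "w \<in> space M" for w
  proof -
    have "((\<lambda>x. B x w) has_field_derivative deriv (\<lambda>x. B x w) x) (at x)"
      using d(3)[OF that] by (intro holomorphic_derivI[of _ UNIV]) auto
    thus ?thesis by (intro DERIV_imp_deriv) (auto intro!: derivative_eq_intros)
  qed
  have tS: "t \<in> S" using r by auto
  have "((\<lambda>x. \<integral>w. A t w * B x w \<partial>M) has_field_derivative (\<integral>w. deriv (\<lambda>x. A t w * B x w) x \<partial>M)) (at x)"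
  proof (rule DERIV_param_integral[OF open_UNIV _ r(1) _ _ r(3)])
    show "(\<lambda>x. A t w * B x w) holomorphic_on UNIV" if "w \<in> space M" for w by (intro holomorphic_intros d that)
    show "(\<lambda>w. A t w * B x w) \<in> borel_measurable M" for x
      using d(4)[OF tS] d(5)[of x] by auto
    show "norm (A t w * B v w) \<le> g w" if "v \<in> cball x r" "w \<in> space M" for v w
      using r(4)[of t v w] that r(1) by auto
  qed auto
  also have "(\<integral>w. deriv (\<lambda>x. A t w * B x w) x \<partial>M) = (\<integral>w. A t w * deriv (\<lambda>x. B x w) x \<partial>M)"
    by (rule Bochner_Integration.integral_cong[OF refl eq])
  finally show ?thesis .
qed

lemma dominated_product_isCont:
  assumes "dominated_product M S D A B" "(t, x) \<in> D"
  shows "isCont (\<lambda>(t, x). \<integral>w. A t w * B x w \<partial>M) (t, x)"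
  unfolding continuous_at_sequentially
proof (intro allI impI)
  note d = dominated_product_D[OF assms(1)]
  obtain r g where r: "r > 0" "cball t r \<subseteq> S" "integrable M g"
     "\<And>t' x' w. t' \<in> cball t r \<Longrightarrow> x' \<in> cball x r \<Longrightarrow> w \<in> space M \<Longrightarrow> norm (A t' w * B x' w) \<le> g w"
    using dominated_product_bound[OF assms] by blast
  fix X assume X: "X \<longlonglongrightarrow> (t, x)"
  hence "eventually (\<lambda>n. dist (X n) (t, x) < r) sequentially" using r(1) by (rule tendstoD)
  then obtain N where N: "\<And>n. n \<ge> N \<Longrightarrow> dist (X n) (t, x) < r" by (auto simp: eventually_sequentially)
  define a b where "a n = fst (X (n + N))" and "b n = snd (X (n + N))" for n
  have ab: "a n \<in> cball t r" "b n \<in> cball x r" for n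
    using N[of "n + N"] dist_fst_le[of "X (n + N)" "(t, x)"] dist_snd_le[of "X (n + N)" "(t, x)"]
    by (auto simp: a_def b_def dist_commute)
  have XN: "(\<lambda>n. X (n + N)) \<longlonglongrightarrow> (t, x)" using X by (rule LIMSEQ_ignore_initial_segment)
  have lim: "a \<longlonglongrightarrow> t" "b \<longlonglongrightarrow> x"
    using tendsto_fst[OF XN] tendsto_snd[OF XN] by (simp_all add: a_def[abs_def] b_def[abs_def])
  have tS: "t \<in> S" using r by auto
  have "(\<lambda>n. \<integral>w. A (a n) w * B (b n) w \<partial>M) \<longlonglongrightarrow> (\<integral>w. A t w * B x w \<partial>M)"
  proof (rule integral_dominated_convergence[OF _ _ r(3)])
    show "(\<lambda>w. A t w * B x w) \<in> borel_measurable M" using d(4)[OF tS] d(5)[of x] by auto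
    show "(\<lambda>w. A (a n) w * B (b n) w) \<in> borel_measurable M" for n
    proof -
      have "a n \<in> S" using ab(1) r(2) by blast
      thus ?thesis using d(4)[of "a n"] d(5)[of "b n"] by auto
    qed
    show "AE w in M. norm (A (a n) w * B (b n) w) \<le> g w" for n
      using r(4) ab by (intro AE_I2) auto
    show "AE w in M. (\<lambda>n. A (a n) w * B (b n) w) \<longlonglongrightarrow> A t w * B x w"
    proof (rule AE_I2)
      fix w assume w: "w \<in> space M"
      have "isCont (\<lambda>t. A t w) t"
        using holomorphic_on_imp_continuous_on[OF d(2)[OF w]] d(1) tS continuous_on_eq_continuous_at by blast
      moreover have "isCont (\<lambda>x. B x w) x"
        using holomorphic_on_imp_continuous_on[OF d(3)[OF w]] continuous_on_eq_continuous_at by blast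
      ultimately show "(\<lambda>n. A (a n) w * B (b n) w) \<longlonglongrightarrow> A t w * B x w"
        using lim by (intro tendsto_mult) (auto intro: isCont_tendsto_compose)
    qed
  qed
  hence "(\<lambda>n. ((\<lambda>(t, x). \<integral>w. A t w * B x w \<partial>M) \<circ> X) (n + N)) \<longlonglongrightarrow> (\<integral>w. A t w * B x w \<partial>M)"
    by (simp add: a_def b_def case_prod_beta)
  thus "((\<lambda>(t, x). \<integral>w. A t w * B x w \<partial>M) \<circ> X) \<longlonglongrightarrow> (case (t, x) of (t, x) \<Rightarrow> \<integral>w. A t w * B x w \<partial>M)"
    by (auto intro: LIMSEQ_offset[of _ N])
qed

section \<open>Differentiability of every finite order\<close>

lemma C_k_on_cong:
  assumes "open S" "\<And>p. p \<in> S \<Longrightarrow> f p = g p" "C_k_on k S f"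
  shows "C_k_on k S g"
  using assms(2,3)
proof (induction k arbitrary: f g)
  case 0
  thus ?case using continuous_on_cong[of S S f g] by simp
next
  case (Suc k)
  have *: "(f has_derivative D) (at p) \<longleftrightarrow> (g has_derivative D) (at p)" if "p \<in> S" for p D
    using that Suc.prems(1) assms(1) by (auto intro: has_derivative_transform_within_open)
  have fr: "frechet_derivative f (at p) = frechet_derivative g (at p)" if "p \<in> S" for p
    unfolding frechet_derivative_def using *[OF that] by simp
  show ?case
    unfolding C_k_on.simps
  proof (intro conjI ballI allI)
    show "g differentiable at p" if "p \<in> S" for p
    proof -
      have "f differentiable at p" using Suc.prems(2) that by simp
      thus ?thesis unfolding differentiable_def *[OF that] .
    qed
    show "C_k_on k S (\<lambda>p. frechet_derivative g (at p) v)" for v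
      by (rule Suc.IH[of "\<lambda>p. frechet_derivative f (at p) v"]) (use fr Suc.prems(2) in auto)
  qed
qed

lemma C_k_on_lincomb:
  fixes f g :: "'a::real_normed_vector \<Rightarrow> 'b::real_normed_vector"
  assumes "open S" "C_k_on k S f" "C_k_on k S g"
  shows "C_k_on k S (\<lambda>p. c *\<^sub>R f p + d *\<^sub>R g p)"
  using assms(2,3)
proof (induction k arbitrary: f g)
  case 0
  thus ?case by (auto intro!: continuous_intros)
next
  case (Suc k)
  have fd: "(f has_derivative frechet_derivative f (at p)) (at p)" if "p \<in> S" for p
    using Suc.prems(1) that frechet_derivative_works by auto
  have gd: "(g has_derivative frechet_derivative g (at p)) (at p)" if "p \<in> S" for p
    using Suc.prems(2) that frechet_derivative_works by auto
  have D: "((\<lambda>p. c *\<^sub>R f p + d *\<^sub>R g p) has_derivative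
      (\<lambda>v. c *\<^sub>R frechet_derivative f (at p) v + d *\<^sub>R frechet_derivative g (at p) v)) (at p)" if "p \<in> S" for p
    by (intro derivative_intros fd gd that)
  show ?case
    unfolding C_k_on.simps
  proof (intro conjI ballI allI)
    show "(\<lambda>p. c *\<^sub>R f p + d *\<^sub>R g p) differentiable at p" if "p \<in> S" for p
      using D[OF that] differentiable_def by blast
    fix v
    show "C_k_on k S (\<lambda>p. frechet_derivative (\<lambda>p. c *\<^sub>R f p + d *\<^sub>R g p) (at p) v)"
    proof (rule C_k_on_cong[OF assms(1)])
      show "C_k_on k S (\<lambda>p. c *\<^sub>R frechet_derivative f (at p) v + d *\<^sub>R frechet_derivative g (at p) v)"
        using Suc by auto
      show "c *\<^sub>R frechet_derivative f (at p) v + d *\<^sub>R frechet_derivative g (at p) v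
          = frechet_derivative (\<lambda>p. c *\<^sub>R f p + d *\<^sub>R g p) (at p) v" if "p \<in> S" for p
        using frechet_derivative_at[OF D[OF that]] by metis
    qed
  qed
qed

text \<open>The induction keeps A and B arbitrary: each partial derivative is an integral of the
  same kind with one factor differentiated, and a directional derivative is a linear combination of
  the two.\<close>

lemma dominated_product_C_k:
  assumes "dominated_product M S D A B" "\<And>t x. t > 0 \<Longrightarrow> x > 0 \<Longrightarrow> (complex_of_real t, complex_of_real x) \<in> D"
  shows "C_k_on k ({0<..} \<times> {0<..}) (\<lambda>(t, x). \<integral>w. A (complex_of_real t) w * B (complex_of_real x) w \<partial>M)"
  using assms(1)
proof (induction k arbitrary: A B)
  have cont: "continuous_on ({0<..} \<times> {0<..}) (\<lambda>(t, x). \<integral>w. A (complex_of_real t) w * B (complex_of_real x) w \<partial>M)"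
    if "dominated_product M S D A B" for A B
  proof (rule continuous_at_imp_continuous_on, safe)
    fix t x :: real assume tx: "t > 0" "x > 0"
    have 1: "isCont (\<lambda>p. (complex_of_real (fst p), complex_of_real (snd p))) (t, x)"
      by (intro continuous_intros)
    have "isCont (\<lambda>(t, x). \<integral>w. A t w * B x w \<partial>M) (complex_of_real (fst (t, x)), complex_of_real (snd (t, x)))"
      using dominated_product_isCont[OF that assms(2)[OF tx]] by simp
    from isCont_o2[OF 1 this]
    show "isCont (\<lambda>(t, x). \<integral>w. A (complex_of_real t) w * B (complex_of_real x) w \<partial>M) (t, x)"
      by (simp add: case_prod_beta')
  qed
  {
    case 0
    thus ?case using cont by simp
  next
    case (Suc k)
    let ?Q = "{0::real<..} \<times> {0::real<..}"
    let ?f = "\<lambda>(t, x). \<integral>w. A (complex_of_real t) w * B (complex_of_real x) w \<partial>M"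
    let ?f1 = "\<lambda>(t, x). \<integral>w. deriv (\<lambda>t. A t w) (complex_of_real t) * B (complex_of_real x) w \<partial>M"
    let ?f2 = "\<lambda>(t, x). \<integral>w. A (complex_of_real t) w * deriv (\<lambda>x. B x w) (complex_of_real x) \<partial>M"
    have d1: "dominated_product M S D (\<lambda>t w. deriv (\<lambda>t. A t w) t) B" by (rule dominated_product_deriv1[OF Suc.prems])
    have d2: "dominated_product M S D A (\<lambda>x w. deriv (\<lambda>x. B x w) x)" by (rule dominated_product_deriv2[OF Suc.prems])
    have oQ: "open ?Q" by (intro open_Times) auto
    have D: "(?f has_derivative (\<lambda>(a, b). a *\<^sub>R ?f1 p + b *\<^sub>R ?f2 p)) (at p)" if "p \<in> ?Q" for p
    proof -
      obtain t x where p: "p = (t, x)" "t > 0" "x > 0" using \<open>p \<in> ?Q\<close> by auto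
      have "((\<lambda>(t, x). \<integral>w. A (complex_of_real t) w * B (complex_of_real x) w \<partial>M) has_derivative
          (\<lambda>(a, b). a *\<^sub>R ?f1 (t, x) + blinfun_apply (blinfun_scaleR_left (?f2 (t, x))) b)) (at (t, x) within ?Q)"
      \<comment> \<open>Total differentiability follows from one partial derivative at the point
        together with the other one in the whole quadrant, continuous at the point; the latter has
        to be presented as a bounded linear map.\<close>
      proof (rule has_derivative_partialsI)
        have "((\<lambda>s. \<integral>w. A (complex_of_real s) w * B (complex_of_real x) w \<partial>M) has_vector_derivative ?f1 (t, x)) (at t)"
          using has_vector_derivative_real_field[OF dominated_product_DERIV1[OF Suc.prems assms(2)[OF p(2,3)]]] by simp
        thus "((\<lambda>s. \<integral>w. A (complex_of_real s) w * B (complex_of_real x) w \<partial>M) has_derivative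
            (\<lambda>a. a *\<^sub>R ?f1 (t, x))) (at t within {0<..})"
          unfolding has_vector_derivative_def by (rule has_derivative_at_withinI)
        fix t' x' :: real assume tx: "t' \<in> {0<..}" "x' \<in> {0<..}"
        have "((\<lambda>s. \<integral>w. A (complex_of_real t') w * B (complex_of_real s) w \<partial>M) has_vector_derivative ?f2 (t', x')) (at x')"
          using has_vector_derivative_real_field[OF dominated_product_DERIV2[OF Suc.prems assms(2)[of t' x']]] tx by simp
        thus "((\<lambda>s. \<integral>w. A (complex_of_real t') w * B (complex_of_real s) w \<partial>M) has_derivative
            blinfun_apply (blinfun_scaleR_left (?f2 (t', x')))) (at x' within {0<..})"
          unfolding has_vector_derivative_def by (auto intro: has_derivative_at_withinI)
      next
        have "continuous (at (t, x) within ?Q) ?f2"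
          using cont[OF d2] p by (simp add: continuous_on_eq_continuous_within)
        hence "continuous (at (t, x) within ?Q) (\<lambda>q. blinfun_scaleR_left (?f2 q))"
          by (intro continuous_intros)
        thus "continuous (at (t, x) within ?Q) (\<lambda>(t, x). blinfun_scaleR_left (?f2 (t, x)))"
          by (simp add: case_prod_beta')
      qed (use p in auto)
      thus ?thesis using at_within_open[OF _ oQ, of p] that by (simp add: p)
    qed
    show ?case
      unfolding C_k_on.simps
    proof (intro conjI ballI allI)
      show "?f differentiable at p" if "p \<in> ?Q" for p
        using D[OF that] differentiable_def by blast
      fix v :: "real \<times> real"
      show "C_k_on k ?Q (\<lambda>p. frechet_derivative ?f (at p) v)"
      proof (rule C_k_on_cong[OF oQ])
        show "C_k_on k ?Q (\<lambda>p. fst v *\<^sub>R ?f1 p + snd v *\<^sub>R ?f2 p)"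
          by (intro C_k_on_lincomb oQ Suc.IH d1 d2)
        show "fst v *\<^sub>R ?f1 p + snd v *\<^sub>R ?f2 p = frechet_derivative ?f (at p) v" if "p \<in> ?Q" for p
          unfolding frechet_derivative_at[OF D[OF that], symmetric] by (simp add: case_prod_beta')
      qed
    qed
  }
qed

section \<open>The Poisson kernel and its comparison with \<open>\<Phi>\<close>\<close>

lemma powr_le_exp_linear:
  assumes "q \<ge> 0" "c > 0"
  obtains C where "C > 0" "\<And>w::real. w \<ge> 0 \<Longrightarrow> (1 + w) powr q \<le> C * exp (c * w)"
proof (rule that)
  \<comment> \<open>The constants come from ln v <= v - 1 at v = (1 + w) d. Using q + 1 instead of q
    keeps the denominators nonzero when q = 0.\<close>
  define d where "d = c / (q + 1)"
  have d: "d > 0" "(q + 1) * d = c" using assms by (auto simp: d_def)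
  show "exp (c - (q + 1) * ln d) > 0" by simp
  fix w :: real assume w: "w \<ge> 0"
  have "ln (1 + w) + ln d = ln ((1 + w) * d)" using w d by (simp add: ln_mult)
  also have "\<dots> \<le> (1 + w) * d" using ln_le_minus_one[of "(1 + w) * d"] w d by simp
  finally have "(q + 1) * (ln (1 + w) + ln d) \<le> (q + 1) * ((1 + w) * d)"
    using assms by (intro mult_left_mono) auto
  also have "\<dots> = c * (1 + w)" using d(2) by (metis mult.assoc mult.commute)
  finally have "(q + 1) * ln (1 + w) \<le> c - (q + 1) * ln d + c * w" by (simp add: algebra_simps)
  moreover have "q * ln (1 + w) \<le> (q + 1) * ln (1 + w)" using w by (intro mult_right_mono) auto
  ultimately have "exp (q * ln (1 + w)) \<le> exp (c - (q + 1) * ln d + c * w)" by simp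
  thus "(1 + w) powr q \<le> exp (c - (q + 1) * ln d) * exp (c * w)"
    using w by (simp add: powr_def exp_add)
qed

section \<open>Pointwise upper bounds for the kernel\<close>

lemma rho_pos: "u > 0 \<Longrightarrow> rho u > 0"
  by (simp add: rho_def)

lemma rho_le: "u > 0 \<Longrightarrow> rho u \<le> 1 / u"
proof -
  assume u: "u > 0"
  have "u \<le> exp u - 1" using exp_ge_add_one_self[of u] by linarith
  thus "rho u \<le> 1 / u" unfolding rho_def using u by (intro divide_left_mono) auto
qed

lemma rho_eq: "u > 0 \<Longrightarrow> rho u = exp (- u) * (1 + rho u)"
proof -
  assume "u > 0"
  hence "exp u - 1 \<noteq> 0" by simp
  thus ?thesis by (simp add: rho_def exp_minus field_simps)
qed

lemma hh_kernel_nonneg: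
  fixes x :: real
  assumes "a > 0" "u > 0" "x \<ge> 0" "y \<ge> 0"
  shows "hh_kernel a m u x y > 0"
  unfolding hh_kernel_def using assms rho_pos[OF assms(2)]
  by (intro mult_pos_pos bessel_pos mult_nonneg_nonneg) (auto simp: add_pos_pos)

text \<open>With R = 1 + rho u, r = exp (-u) and rho u = r R, the three exponents - rho y, - rho x
  and 2 sqrt z complete to a square: the kernel is a Gaussian of width about 1 / sqrt R in the
  variables sqrt (r y) and sqrt x, up to exp x and powers.\<close>

lemma hh_kernel_upper:
  assumes a: "a > 0"
  obtains C where "C > 0" "\<And>m u x y. u > 0 \<Longrightarrow> x \<ge> 0 \<Longrightarrow> y \<ge> 0 \<Longrightarrow>
    hh_kernel a m u x y \<le> C * (exp (- (m * u)) * (1 + rho u) powr a * (1 + rho u * (1 + rho u) * y * x) powr \<bar>1 - a\<bar> *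
      exp (x - (1 + rho u) * (sqrt (exp (- u) * y) - sqrt x)\<^sup>2))"
proof -
  obtain C where C: "C > 0" "\<And>z::real. z \<ge> 0 \<Longrightarrow> bessel a z \<le> C * (1 + z) powr \<bar>1 - a\<bar> * exp (2 * sqrt z)"
    using bessel_upper[OF a] by blast
  show ?thesis
  proof (rule that[OF C(1)])
    fix m u x y :: real assume u: "u > 0" and x: "x \<ge> 0" and y: "y \<ge> 0"
    define r where "r = exp (- u)"
    define R where "R = 1 + rho u"
    have R: "R > 0" "R \<ge> 1" using rho_pos[OF u] by (auto simp: R_def)
    have rho: "rho u = r * R" using rho_eq[OF u] by (simp add: r_def R_def)
    have r: "r > 0" by (simp add: r_def)
    define z where "z = rho u * R * y * x"
    have z: "z \<ge> 0" using rho_pos[OF u] R x y by (simp add: z_def)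
    have sz: "sqrt z = R * (sqrt (r * y) * sqrt x)"
    proof -
      have "z = R\<^sup>2 * ((r * y) * x)" by (simp add: z_def rho power2_eq_square)
      thus ?thesis using R by (simp add: real_sqrt_mult)
    qed
    have "- (rho u * y) - rho u * x + 2 * sqrt z = x - R * (sqrt (r * y) - sqrt x)\<^sup>2"
    proof -
      define P where "P = sqrt (r * y) * sqrt x"
      have P: "(sqrt (r * y) - sqrt x)\<^sup>2 = r * y - 2 * P + x"
        using x y r by (simp add: power2_diff P_def)
      have "x - R * (sqrt (r * y) - sqrt x)\<^sup>2 = x - R * r * y - R * x + 2 * (R * P)"
        unfolding P by (simp add: algebra_simps)
      also have "x - R * r * y - R * x = - (rho u * y) - rho u * x"
        by (simp add: rho[symmetric] mult.commute[of R r]) (simp add: R_def algebra_simps)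
      finally show ?thesis by (simp add: sz P_def)
    qed
    hence e: "exp (- (rho u * y)) * exp (- (rho u * x)) * exp (2 * sqrt z) = exp (x - R * (sqrt (r * y) - sqrt x)\<^sup>2)"
      by (simp add: exp_add[symmetric])
    have "hh_kernel a m u x y = exp (- (m * u)) * R powr a * exp (- (rho u * y)) * exp (- (rho u * x)) * bessel a z"
      by (simp add: hh_kernel_def R_def z_def)
    also have "\<dots> \<le> exp (- (m * u)) * R powr a * exp (- (rho u * y)) * exp (- (rho u * x)) * (C * (1 + z) powr \<bar>1 - a\<bar> * exp (2 * sqrt z))"
      by (intro mult_left_mono C z) auto
    also have "\<dots> = C * (exp (- (m * u)) * R powr a * (1 + z) powr \<bar>1 - a\<bar> * (exp (- (rho u * y)) * exp (- (rho u * x)) * exp (2 * sqrt z)))"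
      by (simp add: mult_ac)
    finally show "hh_kernel a m u x y \<le> C * (exp (- (m * u)) * (1 + rho u) powr a * (1 + rho u * (1 + rho u) * y * x) powr \<bar>1 - a\<bar> *
      exp (x - (1 + rho u) * (sqrt (exp (- u) * y) - sqrt x)\<^sup>2))"
      unfolding e by (simp add: R_def z_def r_def)
  qed
qed

text \<open>For fixed x the Gaussian yields exp (- r y / 2). Half of this decay pays for the power
  of 1 + r y in the Bessel bound; all powers of R are collected into one power of 1 + 1 / u.\<close>

lemma hh_kernel_upper_fixed:
  assumes a: "a > 0" and x: "x > 0"
  obtains C p where "C > 0" "p \<ge> 0" "\<And>m u y. u > 0 \<Longrightarrow> y \<ge> 0 \<Longrightarrow>
    hh_kernel a m u x y \<le> C * (exp (- (m * u)) * (1 + 1 / u) powr p * exp (- (exp (- u) * y / 4)))"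
proof -
  obtain C where C: "C > 0" "\<And>m u x y. u > 0 \<Longrightarrow> x \<ge> 0 \<Longrightarrow> y \<ge> 0 \<Longrightarrow>
    hh_kernel a m u x y \<le> C * (exp (- (m * u)) * (1 + rho u) powr a * (1 + rho u * (1 + rho u) * y * x) powr \<bar>1 - a\<bar> *
      exp (x - (1 + rho u) * (sqrt (exp (- u) * y) - sqrt x)\<^sup>2))"
    using hh_kernel_upper[OF a] by blast
  define q where "q = \<bar>1 - a\<bar>"
  have q: "q \<ge> 0" by (simp add: q_def)
  obtain C' where C': "C' > 0" "\<And>w::real. w \<ge> 0 \<Longrightarrow> (1 + w) powr q \<le> C' * exp (1/4 * w)"
    using powr_le_exp_linear[OF q, of "1/4"] by auto
  show ?thesis
  proof (rule that[of "C * ((1 + x) powr q * C' * exp (2 * x))" "a + 2 * q"])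
    show "C * ((1 + x) powr q * C' * exp (2 * x)) > 0" using C C' x by simp
    show "a + 2 * q \<ge> 0" using a q by simp
    fix m u y :: real assume u: "u > 0" and y: "y \<ge> 0"
    define r where "r = exp (- u)"
    define R where "R = 1 + rho u"
    have R: "R \<ge> 1" "R \<le> 1 + 1 / u" using rho_pos[OF u] rho_le[OF u] by (auto simp: R_def)
    have rho: "rho u = r * R" using rho_eq[OF u] by (simp add: r_def R_def)
    have r: "r > 0" by (simp add: r_def)
    have z: "0 \<le> rho u * R * y * x" using rho_pos[OF u] R x y by simp
    have "1 + rho u * R * y * x \<le> R\<^sup>2 * ((1 + x) * (1 + r * y))"
    proof -
      have "1 \<le> R\<^sup>2" using R by simp
      moreover have "R\<^sup>2 * (1 + (r * y) * x) \<le> R\<^sup>2 * ((1 + x) * (1 + r * y))"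
        using x y r by (intro mult_left_mono) (auto simp: algebra_simps)
      moreover have "R\<^sup>2 * (1 + (r * y) * x) = R\<^sup>2 + rho u * R * y * x"
        by (simp add: rho power2_eq_square algebra_simps)
      ultimately show ?thesis by linarith
    qed
    hence "(1 + rho u * R * y * x) powr q \<le> (R\<^sup>2 * ((1 + x) * (1 + r * y))) powr q"
      using z q by (intro powr_mono2) auto
    also have "\<dots> = R powr (2 * q) * ((1 + x) powr q * (1 + r * y) powr q)"
      using R x y r by (simp add: powr_mult powr_powr[symmetric])
    also have "\<dots> \<le> R powr (2 * q) * ((1 + x) powr q * (C' * exp (1/4 * (r * y))))"
      using y r by (intro mult_left_mono C') auto
    finally have 1: "(1 + rho u * R * y * x) powr q \<le> R powr (2 * q) * ((1 + x) powr q * (C' * exp (1/4 * (r * y))))" .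
    have 2: "x - R * (sqrt (r * y) - sqrt x)\<^sup>2 \<le> 2 * x - r * y / 2"
    proof -
      \<comment> \<open>This square is the inequality (A - B)^2 >= A^2 / 2 - B^2 with A = sqrt (r y)
        and B = sqrt x.\<close>
      have "0 \<le> (sqrt (r * y) - 2 * sqrt x)\<^sup>2 / 2" by simp
      also have "\<dots> = (sqrt (r * y) - sqrt x)\<^sup>2 - (sqrt (r * y))\<^sup>2 / 2 + (sqrt x)\<^sup>2"
        by (simp only: power2_eq_square) (simp add: field_simps)
      finally have "r * y / 2 - x \<le> (sqrt (r * y) - sqrt x)\<^sup>2" using r y x by simp
      also have "\<dots> \<le> R * (sqrt (r * y) - sqrt x)\<^sup>2" using R by (simp add: mult_le_cancel_right1)
      finally show ?thesis by simp
    qed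
    have "hh_kernel a m u x y \<le> C * (exp (- (m * u)) * R powr a * (1 + rho u * R * y * x) powr q * exp (x - R * (sqrt (r * y) - sqrt x)\<^sup>2))"
      using C(2)[OF u _ y, of x m] x by (simp add: R_def r_def q_def)
    also have "\<dots> \<le> C * (exp (- (m * u)) * R powr a * (R powr (2 * q) * ((1 + x) powr q * (C' * exp (1/4 * (r * y))))) * exp (2 * x - r * y / 2))"
      using C(1) 1 2 C'(1) by (intro mult_left_mono mult_mono) auto
    also have "\<dots> = C * ((1 + x) powr q * C' * exp (2 * x)) * (exp (- (m * u)) * (R powr a * R powr (2 * q)) * (exp (1/4 * (r * y)) * exp (- (r * y / 2))))"
    proof -
      have "exp (2 * x - r * y / 2) = exp (2 * x) * exp (- (r * y / 2))" by (simp add: exp_add[symmetric])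
      thus ?thesis by (simp only: mult_ac)
    qed
    also have "exp (1/4 * (r * y)) * exp (- (r * y / 2)) = exp (- (r * y / 4))"
      by (simp add: exp_add[symmetric])
    also have "R powr a * R powr (2 * q) = R powr (a + 2 * q)" by (simp add: powr_add)
    also have "C * ((1 + x) powr q * C' * exp (2 * x)) * (exp (- (m * u)) * R powr (a + 2 * q) * exp (- (r * y / 4)))
      \<le> C * ((1 + x) powr q * C' * exp (2 * x)) * (exp (- (m * u)) * (1 + 1 / u) powr (a + 2 * q) * exp (- (r * y / 4)))"
      using C(1) C'(1) R a q by (intro mult_left_mono mult_right_mono powr_mono2) auto
    finally show "hh_kernel a m u x y \<le> C * ((1 + x) powr q * C' * exp (2 * x)) * (exp (- (m * u)) * (1 + 1 / u) powr (a + 2 * q) * exp (- (exp (- u) * y / 4)))"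
      by (simp add: r_def)
  qed
qed

definition poisson_weight :: "real \<Rightarrow> real \<Rightarrow> real \<Rightarrow> real" where
  "poisson_weight \<nu> t u = exp (- (t\<^sup>2 / (4 * u))) / u powr (1 + \<nu>)"

lemma poisson_weight_nonneg: "poisson_weight \<nu> t u \<ge> 0"
  by (simp add: poisson_weight_def)

text \<open>Near u = 0 the factor exp (- t^2 / 4u) beats any power of 1 / u; for large u the decay
  u^(-1-\<nu>) remains. Writing the power of u as one of 1 + 1/u times one of 1 + u treats both ends
  at once.\<close>

lemma poisson_weight_powr_bound:
  assumes "t > 0" "\<nu> > 0" "p \<ge> 0"
  obtains C where "C > 0" "\<And>u. u > 0 \<Longrightarrow> poisson_weight \<nu> t u * (1 + 1 / u) powr p \<le> C * (1 + u) powr (- 1 - \<nu>)"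
proof -
  obtain C where C: "C > 0" "\<And>w::real. w \<ge> 0 \<Longrightarrow> (1 + w) powr (p + 1 + \<nu>) \<le> C * exp (t\<^sup>2 / 4 * w)"
    using powr_le_exp_linear[of "p + 1 + \<nu>" "t\<^sup>2 / 4"] assms by auto
  show ?thesis
  proof (rule that[OF C(1)])
    fix u :: real assume u: "u > 0"
    have "1 / u powr (1 + \<nu>) = (1 + 1 / u) powr (1 + \<nu>) * (1 + u) powr (- 1 - \<nu>)"
    proof -
      have "1 + 1 / u = (1 + u) / u" using u by (simp add: field_simps)
      hence "(1 + 1 / u) powr (1 + \<nu>) = (1 + u) powr (1 + \<nu>) / u powr (1 + \<nu>)"
        using u by (simp add: powr_divide)
      moreover have "(1 + u) powr (- 1 - \<nu>) = 1 / (1 + u) powr (1 + \<nu>)"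
        by (simp add: powr_minus[symmetric] divide_inverse)
      ultimately show ?thesis using u by simp
    qed
    note eq = this
    have "poisson_weight \<nu> t u * (1 + 1 / u) powr p = exp (- (t\<^sup>2 / (4 * u))) * (1 / u powr (1 + \<nu>)) * (1 + 1 / u) powr p"
      by (simp add: poisson_weight_def)
    also have "\<dots> = exp (- (t\<^sup>2 / (4 * u))) * ((1 + 1 / u) powr (1 + \<nu>) * (1 + 1 / u) powr p) * (1 + u) powr (- 1 - \<nu>)"
      unfolding eq by (simp only: mult_ac)
    also have "(1 + 1 / u) powr (1 + \<nu>) * (1 + 1 / u) powr p = (1 + 1 / u) powr (p + 1 + \<nu>)"
      by (simp add: powr_add[symmetric] add_ac)
    also have "exp (- (t\<^sup>2 / (4 * u))) * (1 + 1 / u) powr (p + 1 + \<nu>) * (1 + u) powr (- 1 - \<nu>)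
      \<le> exp (- (t\<^sup>2 / (4 * u))) * (C * exp (t\<^sup>2 / 4 * (1 / u))) * (1 + u) powr (- 1 - \<nu>)"
      using u by (intro mult_left_mono mult_right_mono C) auto
    also have "\<dots> = C * (1 + u) powr (- 1 - \<nu>) * (exp (- (t\<^sup>2 / (4 * u))) * exp (t\<^sup>2 / 4 * (1 / u)))"
      by (simp add: mult_ac)
    also have "exp (- (t\<^sup>2 / (4 * u))) * exp (t\<^sup>2 / 4 * (1 / u)) = 1"
      by (simp add: exp_add[symmetric])
    finally show "poisson_weight \<nu> t u * (1 + 1 / u) powr p \<le> C * (1 + u) powr (- 1 - \<nu>)" by simp
  qed
qed

lemma poisson_integrand_upper:
  assumes "a > 0" "x > 0" "t > 0" "\<nu> > 0"
  obtains C where "C > 0" "\<And>m u y. u > 0 \<Longrightarrow> y \<ge> 0 \<Longrightarrow>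
    poisson_weight \<nu> t u * hh_kernel a m u x y \<le> C * ((1 + u) powr (- 1 - \<nu>) * exp (- (m * u)) * exp (- (exp (- u) * y / 4)))"
proof -
  obtain C p where C: "C > 0" "p \<ge> 0" "\<And>m u y. u > 0 \<Longrightarrow> y \<ge> 0 \<Longrightarrow>
    hh_kernel a m u x y \<le> C * (exp (- (m * u)) * (1 + 1 / u) powr p * exp (- (exp (- u) * y / 4)))"
    using hh_kernel_upper_fixed[OF assms(1,2)] by blast
  obtain C' where C': "C' > 0" "\<And>u. u > 0 \<Longrightarrow> poisson_weight \<nu> t u * (1 + 1 / u) powr p \<le> C' * (1 + u) powr (- 1 - \<nu>)"
    using poisson_weight_powr_bound[OF assms(3,4) C(2)] by blast
  show ?thesis
  proof (rule that[of "C * C'"])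
    show "C * C' > 0" using C C' by simp
    fix m u y :: real assume u: "u > 0" and y: "y \<ge> 0"
    have "poisson_weight \<nu> t u * hh_kernel a m u x y \<le> poisson_weight \<nu> t u * (C * (exp (- (m * u)) * (1 + 1 / u) powr p * exp (- (exp (- u) * y / 4))))"
      by (intro mult_left_mono C u y poisson_weight_nonneg)
    also have "\<dots> = C * (exp (- (m * u)) * exp (- (exp (- u) * y / 4))) * (poisson_weight \<nu> t u * (1 + 1 / u) powr p)"
      by (simp add: mult_ac)
    also have "\<dots> \<le> C * (exp (- (m * u)) * exp (- (exp (- u) * y / 4))) * (C' * (1 + u) powr (- 1 - \<nu>))"
      using C(1) by (intro mult_left_mono C'(2) u) auto
    finally show "poisson_weight \<nu> t u * hh_kernel a m u x y \<le> C * C' * ((1 + u) powr (- 1 - \<nu>) * exp (- (m * u)) * exp (- (exp (- u) * y / 4)))"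
      by (simp add: mult_ac)
  qed
qed

text \<open>
  The quotient of \<open>\<Phi>\<close> by \<open>y\<^sup>\<alpha> e\<^bsup>-y\<^esup>\<close>.
\<close>

definition Phi_factor :: "real \<Rightarrow> real \<Rightarrow> real \<Rightarrow> real" where
  "Phi_factor m \<nu> y = (if m > 0 then 1 / ((1 + y) powr m * ln (exp 1 + y) powr (1 + \<nu>)) else 1 / ln (exp 1 + y) powr \<nu>)"

lemma ln_exp1_plus_ge: "(y::real) \<ge> 0 \<Longrightarrow> ln (exp 1 + y) \<ge> 1"
proof -
  assume "y \<ge> 0"
  hence "ln (exp 1) \<le> ln (exp 1 + y)" by (subst ln_le_cancel_iff) (auto simp: add_pos_nonneg)
  thus ?thesis by simp
qed

lemma Phi_factor_pos: "y \<ge> 0 \<Longrightarrow> Phi_factor m \<nu> y > 0"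
  using ln_exp1_plus_ge[of y] by (auto simp: Phi_factor_def)

section \<open>Integration in u and comparison with the weight\<close>

lemma nn_integral_exp_decay:
  assumes "k > (0::real)"
  shows "(\<integral>\<^sup>+u. ennreal (exp (- (k * (u - Y)))) * indicator {Y..} u \<partial>lborel) = ennreal (1 / k)"
proof -
  have "(\<integral>\<^sup>+u. ennreal (exp (- (k * (u - Y)))) * indicator {Y..} u \<partial>lborel) = ennreal (0 - (- exp (- (k * (Y - Y))) / k))"
  proof (rule nn_integral_FTC_atLeast[where F = "\<lambda>u. - exp (- (k * (u - Y))) / k"])
    show "((\<lambda>u. - exp (- (k * (u - Y))) / k) has_real_derivative exp (- (k * (u - Y)))) (at u)" for u
      using assms by (auto intro!: derivative_eq_intros)
    show "((\<lambda>u. - exp (- (k * (u - Y))) / k) \<longlongrightarrow> 0) at_top"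
      using assms by real_asymp
  qed auto
  thus ?thesis by simp
qed

lemma nn_integral_exp_growth:
  assumes "k > (0::real)" "Y \<ge> 0"
  shows "(\<integral>\<^sup>+u. ennreal (exp (- (k * (Y - u)))) * indicator {0..Y} u \<partial>lborel) \<le> ennreal (1 / k)"
proof -
  have "(\<integral>\<^sup>+u. ennreal (exp (- (k * (Y - u)))) * indicator {0..Y} u \<partial>lborel) = ennreal (exp (- (k * (Y - Y))) / k - exp (- (k * (Y - 0))) / k)"
  proof (rule nn_integral_FTC_Icc[where F = "\<lambda>u. exp (- (k * (Y - u))) / k"])
    show "((\<lambda>u. exp (- (k * (Y - u))) / k) has_real_derivative exp (- (k * (Y - u)))) (at u)" for u
      using assms by (auto intro!: derivative_eq_intros)
  qed (use assms in auto)
  also have "\<dots> \<le> ennreal (1 / k)" using assms by (intro ennreal_leI) auto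
  finally show ?thesis .
qed

lemma nn_integral_powr_decay:
  assumes "\<nu> > (0::real)" "Y \<ge> 0"
  shows "(\<integral>\<^sup>+u. ennreal ((1 + u) powr (- 1 - \<nu>)) * indicator {Y..} u \<partial>lborel) = ennreal ((1 + Y) powr (- \<nu>) / \<nu>)"
proof -
  have "(\<integral>\<^sup>+u. ennreal ((1 + u) powr (- 1 - \<nu>)) * indicator {Y..} u \<partial>lborel) = ennreal (0 - (- ((1 + Y) powr (- \<nu>)) / \<nu>))"
  proof (rule nn_integral_FTC_atLeast[where F = "\<lambda>u. - ((1 + u) powr (- \<nu>)) / \<nu>"])
    show "((\<lambda>u. - ((1 + u) powr (- \<nu>)) / \<nu>) has_real_derivative (1 + u) powr (- 1 - \<nu>)) (at u)" if "Y \<le> u" for u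
      using assms that by (auto intro!: derivative_eq_intros simp: minus_diff_commute)
    show "((\<lambda>u. - ((1 + u) powr (- \<nu>)) / \<nu>) \<longlongrightarrow> 0) at_top"
      using assms by real_asymp
  qed auto
  thus ?thesis by simp
qed

lemma exp1_plus_nz: "(y::real) > 0 \<Longrightarrow> exp 1 + y \<noteq> 0"
  using add_pos_pos[of "exp 1" y] by simp

lemma nn_integral_Ioi:
  fixes f :: "real \<Rightarrow> ennreal"
  shows "(\<integral>\<^sup>+u. f u \<partial>lebesgue_on {0<..}) = (\<integral>\<^sup>+u\<in>{0<..}. f u \<partial>lebesgue)"
  by (subst nn_integral_restrict_space) auto

lemma nn_integral_Ioi_le_lborel:
  fixes f g :: "real \<Rightarrow> ennreal"
  assumes "g \<in> borel_measurable borel" "\<And>u. u > 0 \<Longrightarrow> f u \<le> g u"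
  shows "(\<integral>\<^sup>+u. f u \<partial>lebesgue_on {0<..}) \<le> (\<integral>\<^sup>+u. g u \<partial>lborel)"
proof -
  have "(\<integral>\<^sup>+u\<in>{0<..}. f u \<partial>lebesgue) \<le> (\<integral>\<^sup>+u. g u \<partial>lebesgue)"
    by (rule nn_integral_mono) (use assms(2) in \<open>auto simp: indicator_def\<close>)
  also have "\<dots> = (\<integral>\<^sup>+u. g u \<partial>lborel)"
    using assms(1) by (intro nn_integral_completion)
  finally show ?thesis by (simp add: nn_integral_Ioi)
qed

lemma nn_integral_Ioi_ge_lborel:
  fixes f g :: "real \<Rightarrow> ennreal"
  assumes "g \<in> borel_measurable borel" "\<And>u. u > 0 \<Longrightarrow> g u \<le> f u" "\<And>u. u \<le> 0 \<Longrightarrow> g u = 0"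
  shows "(\<integral>\<^sup>+u. g u \<partial>lborel) \<le> (\<integral>\<^sup>+u. f u \<partial>lebesgue_on {0<..})"
proof -
  have "(\<integral>\<^sup>+u. g u \<partial>lborel) = (\<integral>\<^sup>+u. g u \<partial>lebesgue)"
    using assms(1) by (intro nn_integral_completion[symmetric])
  also have "\<dots> \<le> (\<integral>\<^sup>+u\<in>{0<..}. f u \<partial>lebesgue)"
    by (rule nn_integral_mono) (use assms(2,3) in \<open>auto simp: indicator_def not_less\<close>)
  finally show ?thesis by (simp add: nn_integral_Ioi)
qed

text \<open>Y is the time at which exp (-u) (e + y) equals 1, and exp (- m Y) = (e + y)^(-m). These
  are the forms in which the estimates of the u-integral produce the weight.\<close>

lemma Phi_factor_ge:
  assumes m: "m \<ge> 0" and \<nu>: "\<nu> > 0" and y: "y > 0"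
  defines "Y \<equiv> ln (exp 1 + y)"
  shows "exp (- (m * Y)) * (1 + Y) powr (- 1 - \<nu>) \<le> Phi_factor m \<nu> y"
    and "m = 0 \<Longrightarrow> (1 + Y) powr (- \<nu>) \<le> Phi_factor m \<nu> y"
proof -
  have Y: "Y \<ge> 1" using ln_exp1_plus_ge[of y] y by (simp add: Y_def)
  have emY: "exp (- (m * Y)) = (exp 1 + y) powr (- m)"
    using exp1_plus_nz[OF y] by (simp add: powr_def Y_def)
  have e1: "(1::real) \<le> exp 1" by simp
  have "(exp 1 + y) powr (- m) \<le> (1 + y) powr (- m)"
    using y m e1 by (intro powr_mono2') auto
  moreover have 1: "(1 + Y) powr (- 1 - \<nu>) \<le> Y powr (- 1 - \<nu>)"
    using Y \<nu> by (intro powr_mono2') auto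
  ultimately have "exp (- (m * Y)) * (1 + Y) powr (- 1 - \<nu>) \<le> (1 + y) powr (- m) * Y powr (- 1 - \<nu>)"
    unfolding emY by (intro mult_mono) auto
  also have "\<dots> \<le> Phi_factor m \<nu> y"
  proof (cases "m > 0")
    case True
    have "Y powr (- 1 - \<nu>) = 1 / Y powr (1 + \<nu>)" using powr_minus_divide[of Y "1 + \<nu>"] by simp
    thus ?thesis using True by (simp add: Phi_factor_def Y_def powr_minus_divide)
  next
    case False
    hence "m = 0" using m by simp
    moreover have "Y powr (- 1 - \<nu>) \<le> Y powr (- \<nu>)" using Y by (intro powr_mono) auto
    ultimately show ?thesis using y by (simp add: Phi_factor_def Y_def powr_minus_divide)
  qed
  finally show "exp (- (m * Y)) * (1 + Y) powr (- 1 - \<nu>) \<le> Phi_factor m \<nu> y" .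
  assume "m = 0"
  moreover have "(1 + Y) powr (- \<nu>) \<le> Y powr (- \<nu>)" using Y \<nu> by (intro powr_mono2') auto
  ultimately show "(1 + Y) powr (- \<nu>) \<le> Phi_factor m \<nu> y" by (simp add: Phi_factor_def Y_def powr_minus_divide)
qed

text \<open>The u-integral is split at Y = ln (e + y). Before Y the factor exp (- exp (-u) y / 4) is
  doubly exponentially small in Y - u, and the integral is comparable to the integrand at Y. After Y
  this factor is harmless: exp (- m u) makes the tail comparable to its value at Y when m > 0, while
  for m = 0 the power alone is integrated and gains one factor 1 + Y.\<close>

lemma poisson_kernel_upper:
  assumes a: "a > 0" and x: "x > 0" and t: "t > 0" and \<nu>: "\<nu> > 0" and m: "m \<ge> 0"
  obtains C where "C > 0" "\<And>y. y > 0 \<Longrightarrow>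
    (\<integral>\<^sup>+u. ennreal (poisson_weight \<nu> t u * hh_kernel a m u x y) \<partial>lebesgue_on {0<..}) \<le> ennreal (C * Phi_factor m \<nu> y)"
proof -
  obtain C where C: "C > 0" "\<And>m u y. u > 0 \<Longrightarrow> y \<ge> 0 \<Longrightarrow>
    poisson_weight \<nu> t u * hh_kernel a m u x y \<le> C * ((1 + u) powr (- 1 - \<nu>) * exp (- (m * u)) * exp (- (exp (- u) * y / 4)))"
    using poisson_integrand_upper[OF a x t \<nu>] by blast
  obtain D where D: "D > 0" "\<And>w::real. w \<ge> 0 \<Longrightarrow> (1 + w) powr (m + 1) \<le> D * exp (1/4 * w)"
    using powr_le_exp_linear[of "m + 1" "1/4"] m by auto
  obtain E where E: "E > 0" "\<And>w::real. w \<ge> 0 \<Longrightarrow> (1 + w) powr (1 + \<nu>) \<le> E * exp (1/2 * w)"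
    using powr_le_exp_linear[of "1 + \<nu>" "1/2"] \<nu> by auto
  define B where "B = exp (exp 1 / 4 :: real)"
  have B: "B > 0" by (simp add: B_def)
  define K where "K = (if m > 0 then 1 / m else 1 / \<nu>)"
  have K: "K > 0" using m \<nu> by (auto simp: K_def)
  show ?thesis
  proof (rule that[of "C * B * (2 * D * E + K)"])
    show "C * B * (2 * D * E + K) > 0" using C B D E K by (simp add: add_pos_pos)
    fix y :: real assume y: "y > 0"
    define Y where "Y = ln (exp 1 + y)"
    have Y: "Y \<ge> 1" using ln_exp1_plus_ge[of y] y by (simp add: Y_def)
    have eY: "exp Y = exp 1 + y" using y by (simp add: Y_def add_pos_pos)
    define g1 where "g1 u = ennreal (C * B * exp (- (m * Y)) * D * E * (1 + Y) powr (- 1 - \<nu>)) * (ennreal (exp (- (1/2 * (Y - u)))) * indicator {0..Y} u)" for u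
    define g2 where "g2 u = (if m > 0 then ennreal (C * B * exp (- (m * Y)) * (1 + Y) powr (- 1 - \<nu>)) * (ennreal (exp (- (m * (u - Y)))) * indicator {Y..} u)
       else ennreal (C * B) * (ennreal ((1 + u) powr (- 1 - \<nu>)) * indicator {Y..} u))" for u
    \<comment> \<open>Since y = exp Y - e, replacing exp (-u) y by exp (Y - u) costs at most e in
      the exponent before the factor 1/4; this is the constant B.\<close>
    have ey: "exp (- (exp (- u) * y / 4)) \<le> B * exp (- (1/4 * exp (Y - u)))" if "u > 0" for u
    proof -
      have "exp (Y - u) = exp (- u) * (exp 1 + y)" using eY by (simp add: exp_diff exp_minus divide_inverse mult.commute)
      hence "exp (Y - u) - exp (- u) * exp 1 = exp (- u) * y" by (simp add: algebra_simps)
      moreover have "exp (- u) * exp 1 \<le> (exp 1 :: real)" using that by simp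
      ultimately have "- (exp (- u) * y / 4) \<le> exp 1 / 4 + - (1/4 * exp (Y - u))" by linarith
      hence "exp (- (exp (- u) * y / 4)) \<le> exp (exp 1 / 4 + - (1/4 * exp (Y - u)))" by simp
      thus ?thesis unfolding exp_add B_def .
    qed
    have "(\<integral>\<^sup>+u. ennreal (poisson_weight \<nu> t u * hh_kernel a m u x y) \<partial>lebesgue_on {0<..}) \<le> (\<integral>\<^sup>+u. g1 u + g2 u \<partial>lborel)"
    proof (rule nn_integral_Ioi_le_lborel)
      show "(\<lambda>u. g1 u + g2 u) \<in> borel_measurable borel" unfolding g1_def g2_def by measurable
      fix u :: real assume u: "u > 0"
      have up: "poisson_weight \<nu> t u * hh_kernel a m u x y \<le> C * ((1 + u) powr (- 1 - \<nu>) * exp (- (m * u)) * (B * exp (- (1/4 * exp (Y - u)))))"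
        using C(1) u y by (intro order_trans[OF C(2)] mult_left_mono ey) auto
      show "ennreal (poisson_weight \<nu> t u * hh_kernel a m u x y) \<le> g1 u + g2 u"
      proof (cases "u \<le> Y")
        case True
        define s where "s = Y - u"
        have s: "s \<ge> 0" using True by (simp add: s_def)
        \<comment> \<open>Of the decay rate m + 1 in s = Y - u, the part m pays for exp (- m u) =
          exp (- m Y) exp (m s), a half pays for moving the power of 1 + u to 1 + Y, and the
          remaining half makes the integral in s converge.\<close>
        have "exp ((m + 1) * s) = exp s powr (m + 1)" by (simp add: powr_def)
        also have "\<dots> \<le> (1 + exp s) powr (m + 1)" using m by (intro powr_mono2) auto
        also have "\<dots> \<le> D * exp (1/4 * exp s)" by (rule D) auto
        finally have *: "exp ((m + 1) * s) \<le> D * exp (1/4 * exp s)" .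
        have 1: "exp (- (1/4 * exp s)) \<le> D * exp (- ((m + 1) * s))"
        proof -
          have inv: "inverse p \<le> D * inverse q" if "p > 0" "q > 0" "q \<le> D * p" for p q :: real
            using that by (simp add: field_simps)
          show ?thesis unfolding exp_minus by (rule inv[OF _ _ *]) auto
        qed
        \<comment> \<open>This submultiplicative splitting transfers the power from u to Y at the
          price of a power of 1 + s, which is absorbed in exp (s / 2).\<close>
        have "1 + Y \<le> (1 + u) * (1 + s)" using u s by (simp add: s_def algebra_simps)
        hence "(1 + Y) powr (1 + \<nu>) \<le> (1 + u) powr (1 + \<nu>) * (1 + s) powr (1 + \<nu>)"
          using \<nu> u s Y by (subst powr_mult[symmetric]) (auto intro!: powr_mono2)
        also have "\<dots> \<le> (1 + u) powr (1 + \<nu>) * (E * exp (1/2 * s))"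
          by (intro mult_left_mono E s) auto
        finally have *: "(1 + Y) powr (1 + \<nu>) \<le> (1 + u) powr (1 + \<nu>) * (E * exp (1/2 * s))" .
        have 2: "(1 + u) powr (- 1 - \<nu>) \<le> E * exp (1/2 * s) * (1 + Y) powr (- 1 - \<nu>)"
        proof -
          have "1 / (1 + u) powr (1 + \<nu>) \<le> E * exp (1/2 * s) * (1 / (1 + Y) powr (1 + \<nu>))"
            using * u Y by (simp add: divide_simps mult_ac)
          thus ?thesis
            using powr_minus_divide[of "1 + u" "1 + \<nu>"] powr_minus_divide[of "1 + Y" "1 + \<nu>"] by simp
        qed
        have "C * ((1 + u) powr (- 1 - \<nu>) * exp (- (m * u)) * (B * exp (- (1/4 * exp s))))
            \<le> C * ((E * exp (1/2 * s) * (1 + Y) powr (- 1 - \<nu>)) * exp (- (m * u)) * (B * (D * exp (- ((m + 1) * s)))))"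
          using C(1) B E D 1 2 by (intro mult_left_mono mult_mono) auto
        also have "\<dots> = C * B * D * E * (1 + Y) powr (- 1 - \<nu>) * (exp (1/2 * s) * exp (- (m * u)) * exp (- ((m + 1) * s)))"
          by (simp add: mult_ac)
        also have "exp (1/2 * s) * exp (- (m * u)) * exp (- ((m + 1) * s)) = exp (- (m * Y)) * exp (- (1/2 * (Y - u)))"
          by (simp add: exp_add[symmetric] s_def algebra_simps)
        finally have "poisson_weight \<nu> t u * hh_kernel a m u x y \<le> (C * B * exp (- (m * Y)) * D * E * (1 + Y) powr (- 1 - \<nu>)) * exp (- (1/2 * (Y - u)))"
          using up by (simp add: s_def mult_ac)
        hence "ennreal (poisson_weight \<nu> t u * hh_kernel a m u x y) \<le> g1 u"
          using C(1) B E(1) D(1) True u by (simp add: g1_def ennreal_mult[symmetric] ennreal_leI)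
        thus ?thesis by (simp add: add_increasing2)
      next
        case False
        have "poisson_weight \<nu> t u * hh_kernel a m u x y \<le> C * ((1 + u) powr (- 1 - \<nu>) * exp (- (m * u)) * (B * 1))"
          using C(1) B by (intro order_trans[OF up] mult_left_mono) auto
        hence up': "poisson_weight \<nu> t u * hh_kernel a m u x y \<le> C * B * ((1 + u) powr (- 1 - \<nu>) * exp (- (m * u)))" by (simp add: mult_ac)
        have "ennreal (poisson_weight \<nu> t u * hh_kernel a m u x y) \<le> g2 u"
        proof (cases "m > 0")
          case True
          have "(1 + u) powr (- 1 - \<nu>) \<le> (1 + Y) powr (- 1 - \<nu>)"
            using False Y \<nu> by (intro powr_mono2') auto
          hence "C * B * ((1 + u) powr (- 1 - \<nu>) * exp (- (m * u))) \<le> C * B * ((1 + Y) powr (- 1 - \<nu>) * exp (- (m * u)))"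
            using C(1) B by (intro mult_left_mono mult_right_mono) auto
          moreover have eq: "exp (- (m * u)) = exp (- (m * Y)) * exp (- (m * (u - Y)))"
            by (simp add: exp_add[symmetric] algebra_simps)
          ultimately have "poisson_weight \<nu> t u * hh_kernel a m u x y \<le> C * B * ((1 + Y) powr (- 1 - \<nu>) * (exp (- (m * Y)) * exp (- (m * (u - Y)))))"
            using up' unfolding eq by linarith
          hence "poisson_weight \<nu> t u * hh_kernel a m u x y \<le> (C * B * exp (- (m * Y)) * (1 + Y) powr (- 1 - \<nu>)) * exp (- (m * (u - Y)))"
            by (simp only: mult_ac)
          thus ?thesis using True False C(1) B by (simp add: g2_def ennreal_mult[symmetric] ennreal_leI)
        next
          case m0: False
          hence "m = 0" using m by simp
          thus ?thesis using up' False C(1) B by (simp add: g2_def ennreal_mult[symmetric] ennreal_leI)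
        qed
        thus ?thesis by (simp add: add_increasing)
      qed
    qed
    also have "\<dots> = (\<integral>\<^sup>+u. g1 u \<partial>lborel) + (\<integral>\<^sup>+u. g2 u \<partial>lborel)"
      unfolding g1_def g2_def by (intro nn_integral_add) measurable
    also have "(\<integral>\<^sup>+u. g1 u \<partial>lborel) \<le> ennreal (C * B * D * E * 2 * Phi_factor m \<nu> y)"
    proof -
      have "(\<integral>\<^sup>+u. g1 u \<partial>lborel) = ennreal (C * B * exp (- (m * Y)) * D * E * (1 + Y) powr (- 1 - \<nu>)) * (\<integral>\<^sup>+u. ennreal (exp (- (1/2 * (Y - u)))) * indicator {0..Y} u \<partial>lborel)"
        unfolding g1_def by (intro nn_integral_cmult) measurable
      also have "\<dots> \<le> ennreal (C * B * exp (- (m * Y)) * D * E * (1 + Y) powr (- 1 - \<nu>)) * ennreal (1 / (1/2))"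
        using Y by (intro mult_left_mono nn_integral_exp_growth) auto
      also have "\<dots> = ennreal (C * B * D * E * 2 * (exp (- (m * Y)) * (1 + Y) powr (- 1 - \<nu>)))"
        using C(1) B D(1) E(1) by (subst ennreal_mult[symmetric]) (auto simp: mult_ac)
      also have "\<dots> \<le> ennreal (C * B * D * E * 2 * Phi_factor m \<nu> y)"
        using C(1) B D(1) E(1) Phi_factor_ge(1)[OF m \<nu> y] by (intro ennreal_leI mult_left_mono) (auto simp: Y_def)
      finally show ?thesis .
    qed
    also have "(\<integral>\<^sup>+u. g2 u \<partial>lborel) \<le> ennreal (C * B * K * Phi_factor m \<nu> y)"
    proof (cases "m > 0")
      case True
      have "(\<integral>\<^sup>+u. g2 u \<partial>lborel) = ennreal (C * B * exp (- (m * Y)) * (1 + Y) powr (- 1 - \<nu>)) * (\<integral>\<^sup>+u. ennreal (exp (- (m * (u - Y)))) * indicator {Y..} u \<partial>lborel)"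
        using True unfolding g2_def by (simp, intro nn_integral_cmult) measurable
      also have "\<dots> = ennreal (C * B * exp (- (m * Y)) * (1 + Y) powr (- 1 - \<nu>)) * ennreal (1 / m)"
        by (simp only: nn_integral_exp_decay[OF True])
      also have "\<dots> = ennreal (C * B * K * (exp (- (m * Y)) * (1 + Y) powr (- 1 - \<nu>)))"
        using C(1) B True by (subst ennreal_mult[symmetric]) (auto simp: K_def mult_ac)
      also have "\<dots> \<le> ennreal (C * B * K * Phi_factor m \<nu> y)"
        using C(1) B K Phi_factor_ge(1)[OF m \<nu> y] by (intro ennreal_leI mult_left_mono) (auto simp: Y_def)
      finally show ?thesis .
    next
      case False
      hence m0: "m = 0" using m by simp
      have "(\<integral>\<^sup>+u. g2 u \<partial>lborel) = ennreal (C * B) * (\<integral>\<^sup>+u. ennreal ((1 + u) powr (- 1 - \<nu>)) * indicator {Y..} u \<partial>lborel)"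
        using False unfolding g2_def by (simp, intro nn_integral_cmult) measurable
      also have "\<dots> = ennreal (C * B) * ennreal ((1 + Y) powr (- \<nu>) / \<nu>)"
        using Y by (simp only: nn_integral_powr_decay[OF \<nu>])
      also have "\<dots> = ennreal (C * B * K * (1 + Y) powr (- \<nu>))"
        using C(1) B \<nu> False by (subst ennreal_mult[symmetric]) (auto simp: K_def mult_ac)
      also have "\<dots> \<le> ennreal (C * B * K * Phi_factor m \<nu> y)"
        using C(1) B K Phi_factor_ge(2)[OF m \<nu> y m0] by (intro ennreal_leI mult_left_mono) (auto simp: Y_def)
      finally show ?thesis .
    qed
    finally show "(\<integral>\<^sup>+u. ennreal (poisson_weight \<nu> t u * hh_kernel a m u x y) \<partial>lebesgue_on {0<..}) \<le> ennreal (C * B * (2 * D * E + K) * Phi_factor m \<nu> y)"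
      using C(1) B D(1) E(1) K Phi_factor_pos[of y m \<nu>] y
      by (simp add: add_mono ennreal_plus[symmetric] algebra_simps del: ennreal_plus)
  qed
qed


text \<open>It is enough to integrate over a window starting at Y. There u >= 1 gives rho u <= 2 exp
  (-u), so rho u * y <= 2 and every factor of the integrand is bounded below, the Bessel factor by
  its value at 0.\<close>

lemma poisson_kernel_lower:
  assumes a: "a > 0" and x: "x > 0" and t: "t > 0" and \<nu>: "\<nu> > 0" and m: "m \<ge> 0"
  obtains c where "c > 0" "\<And>y. y > 0 \<Longrightarrow>
    ennreal (c * Phi_factor m \<nu> y) \<le> (\<integral>\<^sup>+u. ennreal (poisson_weight \<nu> t u * hh_kernel a m u x y) \<partial>lebesgue_on {0<..})"
proof -
  \<comment> \<open>In this order: u >= 1 in the Gaussian factor of the weight, u <= 2 Y in its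
    power, the length of the window in exp (- m u), the bounds 2 and 2 x for rho u * y and rho u *
    x, and \<open>bessel a 0\<close>.\<close>
  define c where "c = exp (- (t\<^sup>2 / 4)) * (1 / 2 powr (1 + \<nu>)) * exp (- m) * exp (- 2 - 2 * x) * (1 / Gamma a)"
  have G: "Gamma a > 0" using a by (rule Gamma_real_pos)
  have c: "c > 0" using G by (simp add: c_def)
  show ?thesis
  \<comment> \<open>The second factor exp (- m) comes from (e + y)^m <= exp m * (1 + y)^m, the
    passage from exp (- m Y) to the power occurring in the weight.\<close>
  proof (rule that[of "c * exp (- m)"])
    show "c * exp (- m) > 0" using c by simp
    fix y :: real assume y: "y > 0"
    define Y where "Y = ln (exp 1 + y)"
    have Y: "Y \<ge> 1" using ln_exp1_plus_ge[of y] y by (simp add: Y_def)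
    have eY: "exp Y = exp 1 + y" using y by (simp add: Y_def add_pos_pos)
    have emY: "exp (- (m * Y)) = (exp 1 + y) powr (- m)"
      using exp1_plus_nz[OF y] by (simp add: powr_def Y_def)
    \<comment> \<open>A window of length 1 suffices for m > 0. For m = 0 it has length Y, comparable
      with the whole tail, which recovers the missing logarithm; m d = m holds in both
      cases.\<close>
    define d where "d = (if m > 0 then 1 else Y)"
    have d: "d > 0" "d \<le> Y" "m * d = m" using Y m by (auto simp: d_def)
    define h where "h = c * exp (- (m * Y)) * Y powr (- 1 - \<nu>)"
    have h: "h \<ge> 0" using c by (simp add: h_def)
    have pw: "Y powr (- 1 - \<nu>) = 1 / Y powr (1 + \<nu>)" using powr_minus_divide[of Y "1 + \<nu>"] by simp
    have "ennreal (c * exp (- m) * Phi_factor m \<nu> y) \<le> ennreal (h * d)"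
    proof (intro ennreal_leI)
      show "c * exp (- m) * Phi_factor m \<nu> y \<le> h * d"
      proof (cases "m > 0")
        case True
        have e1: "(1::real) \<le> exp 1" by simp
        have "y * 1 \<le> y * exp 1" using y e1 by (intro mult_left_mono) auto
        hence "exp 1 + y \<le> exp 1 * (1 + y)" by (simp add: algebra_simps)
        hence "(exp 1 + y) powr m \<le> (exp 1 * (1 + y)) powr m" using y m by (intro powr_mono2) auto
        also have "\<dots> = exp m * (1 + y) powr m" using y by (subst powr_mult) (auto simp: powr_def)
        finally have *: "(exp 1 + y) powr m \<le> exp m * (1 + y) powr m" .
        have "exp (- m) * (1 / (1 + y) powr m) \<le> exp (- (m * Y))"
        proof -
          have "1 / (exp m * (1 + y) powr m) \<le> 1 / (exp 1 + y) powr m"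
            using y exp1_plus_nz[OF y] by (intro divide_left_mono *) auto
          thus ?thesis unfolding emY powr_minus_divide by (simp add: exp_minus divide_inverse)
        qed
        hence "c * (exp (- m) * (1 / (1 + y) powr m)) * Y powr (- 1 - \<nu>) \<le> c * exp (- (m * Y)) * Y powr (- 1 - \<nu>)"
          using c by (intro mult_left_mono mult_right_mono) auto
        moreover have "Phi_factor m \<nu> y = (1 / (1 + y) powr m) * Y powr (- 1 - \<nu>)"
          using True unfolding Phi_factor_def Y_def[symmetric] pw by simp
        ultimately show ?thesis using True by (simp only: h_def d_def if_True mult_ac mult_1_right)
      next
        case False
        hence "m = 0" using m by simp
        moreover have "Y powr (- 1 - \<nu>) * Y = 1 / Y powr \<nu>"
          using Y by (simp add: pw powr_add)
        ultimately show ?thesis by (simp add: h_def d_def Phi_factor_def mult.assoc Y_def[symmetric])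
      qed
    qed
    also have "\<dots> = (\<integral>\<^sup>+u. ennreal h * indicator {Y..Y + d} u \<partial>lborel)"
      using d h by (simp add: nn_integral_cmult_indicator ennreal_mult)
    also have "\<dots> \<le> (\<integral>\<^sup>+u. ennreal (poisson_weight \<nu> t u * hh_kernel a m u x y) \<partial>lebesgue_on {0<..})"
    proof (rule nn_integral_Ioi_ge_lborel)
      show "ennreal h * indicator {Y..Y + d} u = 0" if "u \<le> 0" for u using that Y by (simp add: indicator_def)
      fix u :: real assume u: "u > 0"
      have "h \<le> poisson_weight \<nu> t u * hh_kernel a m u x y" if uY: "u \<in> {Y..Y + d}"
      proof -
        have u1: "u \<ge> 1" "u \<le> 2 * Y" "u \<ge> Y" "u \<le> Y + d" using uY Y d by auto
        have "2 \<le> exp u" using exp_ge_add_one_self[of u] u1 by linarith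
        hence "1 / (exp u - 1) \<le> 1 / (exp u / 2)" using u by (intro divide_left_mono mult_pos_pos) auto
        hence r2: "rho u \<le> 2 * exp (- u)"
          unfolding rho_def exp_minus by (simp add: inverse_eq_divide)
        have "rho u * y \<le> 2 * exp (- u) * (exp 1 + y)"
          using r2 y rho_pos[OF u] by (intro mult_mono) (auto simp: add_pos_pos)
        also have "\<dots> = 2 * exp (Y - u)" using eY by (simp add: exp_diff exp_minus divide_inverse mult_ac)
        also have "\<dots> \<le> 2" using u1 by simp
        finally have ry: "rho u * y \<le> 2" .
        have "rho u \<le> 2" using r2 u1 exp_le_cancel_iff[of "- u" 0] by (simp add: order_trans)
        hence rx: "rho u * x \<le> 2 * x" using x by (intro mult_right_mono) auto
        have "exp (- (m * u)) \<ge> exp (- (m * Y)) * exp (- m)"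
        proof -
          have "m * u \<le> m * Y + m * d" using u1 m by (simp add: distrib_left[symmetric] mult_left_mono)
          thus ?thesis using d by (simp add: exp_add[symmetric])
        qed
        moreover have "(1 + rho u) powr a \<ge> 1" using rho_pos[OF u] a by (intro ge_one_powr_ge_zero) auto
        moreover have "exp (- (rho u * y)) * exp (- (rho u * x)) \<ge> exp (- 2 - 2 * x)"
          using rx ry by (simp add: exp_add[symmetric])
        moreover have "bessel a (rho u * (1 + rho u) * y * x) \<ge> 1 / Gamma a"
        proof -
          have "bessel a 0 \<le> bessel a (rho u * (1 + rho u) * y * x)"
            using rho_pos[OF u] x y by (intro bessel_mono a) auto
          thus ?thesis by (simp add: bessel_0)
        qed
        ultimately have "(exp (- (m * Y)) * exp (- m)) * 1 * exp (- 2 - 2 * x) * (1 / Gamma a)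
           \<le> exp (- (m * u)) * (1 + rho u) powr a * (exp (- (rho u * y)) * exp (- (rho u * x))) * bessel a (rho u * (1 + rho u) * y * x)"
          using G by (intro mult_mono) auto
        hence k: "(exp (- (m * Y)) * exp (- m)) * exp (- 2 - 2 * x) * (1 / Gamma a) \<le> hh_kernel a m u x y"
          by (simp add: hh_kernel_def mult_ac)
        have "t\<^sup>2 / (4 * u) \<le> t\<^sup>2 / 4" using u1 by (simp add: divide_simps mult_le_cancel_left1)
        moreover have "u powr (1 + \<nu>) \<le> (2 * Y) powr (1 + \<nu>)" using u1 \<nu> by (intro powr_mono2) auto
        ultimately have w: "exp (- (t\<^sup>2 / 4)) / (2 * Y) powr (1 + \<nu>) \<le> poisson_weight \<nu> t u"
          unfolding poisson_weight_def using u by (intro frac_le) auto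
        have "h = exp (- (t\<^sup>2 / 4)) / (2 * Y) powr (1 + \<nu>) * ((exp (- (m * Y)) * exp (- m)) * exp (- 2 - 2 * x) * (1 / Gamma a))"
          using Y by (simp add: h_def c_def pw powr_mult mult_ac)
        also have "\<dots> \<le> poisson_weight \<nu> t u * hh_kernel a m u x y"
          using G by (intro mult_mono w k poisson_weight_nonneg) auto
        finally show ?thesis .
      qed
      thus "ennreal h * indicator {Y..Y + d} u \<le> ennreal (poisson_weight \<nu> t u * hh_kernel a m u x y)"
        by (auto simp: indicator_def intro: ennreal_leI)
    qed simp
    finally show "ennreal (c * exp (- m) * Phi_factor m \<nu> y) \<le> (\<integral>\<^sup>+u. ennreal (poisson_weight \<nu> t u * hh_kernel a m u x y) \<partial>lebesgue_on {0<..})" .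
  qed
qed


section \<open>Measurability and Tonelli's theorem\<close>

lemma borel_measurable_id_Ioi [measurable]: "(\<lambda>x. x) \<in> borel_measurable (lebesgue_on {0::real<..})"
  by (intro measurable_restrict_space1 measurable_completion) simp

lemma sigma_finite_Ioi: "sigma_finite_measure (lebesgue_on {0::real<..})"
proof (rule sigma_finite_measure_restrict_space)
  show "sigma_finite_measure (lebesgue :: real measure)"
  proof
    have "(\<Union>n::nat. ball (0::real) (real n)) = UNIV"
      using reals_Archimedean2 by (auto simp: dist_real_def)
    moreover have "emeasure lebesgue (ball (0::real) r) \<noteq> \<infinity>" for r
      using fmeasurableD2[OF lmeasurable_ball[of "0::real" r]] by simp
    ultimately show "\<exists>A::real set set. countable A \<and> A \<subseteq> sets lebesgue \<and> \<Union> A = space lebesgue \<and> (\<forall>a\<in>A. emeasure lebesgue a \<noteq> \<infinity>)"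
      by (intro exI[of _ "range (\<lambda>n::nat. ball 0 (real n))"]) auto
  qed
qed auto

lemma borel_measurable_bessel:
  "a > 0 \<Longrightarrow> (bessel a :: 'a::{real_normed_field,banach} \<Rightarrow> 'a) \<in> borel_measurable borel"
  by (intro borel_measurable_continuous_onI continuous_on_bessel) auto

lemma borel_measurable_rho [measurable]: "rho \<in> borel_measurable borel"
  unfolding rho_def[abs_def] by measurable

lemma borel_measurable_poisson_weight [measurable]: "poisson_weight \<nu> t \<in> borel_measurable borel"
  unfolding poisson_weight_def[abs_def] by measurable

lemma borel_measurable_hh_kernel [measurable]:
  fixes x :: "'a::{real_normed_field,banach,second_countable_topology}"
  assumes "a > 0" and [measurable]: "f \<in> borel_measurable M" "g \<in> borel_measurable M"
  shows "(\<lambda>p. hh_kernel a m (f p) x (g p)) \<in> borel_measurable M"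
proof -
  note [measurable] = borel_measurable_bessel[OF assms(1), where 'a='a]
  show ?thesis unfolding hh_kernel_def by measurable
qed

lemma borel_measurable_fst_Ioi: "(\<lambda>p. fst p) \<in> borel_measurable (lebesgue_on {0::real<..} \<Otimes>\<^sub>M N)"
  by (rule measurable_compose[OF measurable_fst borel_measurable_id_Ioi])

lemma borel_measurable_snd_Ioi: "(\<lambda>p. snd p) \<in> borel_measurable (N \<Otimes>\<^sub>M lebesgue_on {0::real<..})"
  by (rule measurable_compose[OF measurable_snd borel_measurable_id_Ioi])

text \<open>Positivity of the kernel removes the absolute value, and Tonelli moves the u-integral
  inside. The inner integral is then the Poisson kernel, so its two-sided comparison with
  \<open>Phi_factor\<close> settles both the convergence and the converse.\<close>

lemma poisson_abs_convergent_iff: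
  assumes \<alpha>: "\<alpha> > -1" and L: "normalized_laguerre \<alpha> L" and x: "x > 0"
    and f: "f \<in> borel_measurable (lebesgue_on {0<..})"
  shows "poisson_abs_convergent \<alpha> m \<nu> L t f x \<longleftrightarrow>
    (\<integral>\<^sup>+y. ennreal (y powr \<alpha> * exp (- y) * norm (f y)) *
        (\<integral>\<^sup>+u. ennreal (poisson_weight \<nu> t u * hh_kernel (\<alpha> + 1) m u x y) \<partial>lebesgue_on {0<..}) \<partial>lebesgue_on {0<..}) < \<infinity>"
proof -
  let ?R = "lebesgue_on {0::real<..}"
  interpret R: sigma_finite_measure ?R by (rule sigma_finite_Ioi)
  interpret P: pair_sigma_finite ?R ?R ..
  note [measurable] = f borel_measurable_fst_Ioi borel_measurable_snd_Ioi
  have a: "\<alpha> + 1 > 0" using \<alpha> by simp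
  define K where "K = (\<lambda>(u, y). ennreal (poisson_weight \<nu> t u * hh_kernel (\<alpha> + 1) m u x y) * ennreal (y powr \<alpha> * exp (- y) * norm (f y)))"
  have K [measurable]: "K \<in> borel_measurable (?R \<Otimes>\<^sub>M ?R)"
    unfolding K_def case_prod_beta'
    by (intro borel_measurable_times_ennreal measurable_compose[OF _ measurable_ennreal] borel_measurable_times
         measurable_compose[OF _ borel_measurable_poisson_weight] borel_measurable_hh_kernel a) measurable
  have "(\<integral>\<^sup>+u\<in>{0<..}. ennreal (exp (- (t\<^sup>2 / (4 * u))) / u powr (1 + \<nu>)) *
        (\<integral>\<^sup>+y\<in>{0<..}. ennreal (\<bar>heat_kernel m L u x y\<bar> * (y powr \<alpha> * exp (- y)) * norm (f y))
           \<partial>lebesgue) \<partial>lebesgue) = (\<integral>\<^sup>+u. \<integral>\<^sup>+y. K (u, y) \<partial>?R \<partial>?R)"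
    unfolding nn_integral_Ioi[symmetric]
  proof (rule nn_integral_cong)
    fix u :: real assume "u \<in> space ?R"
    hence u: "u > 0" by simp
    have "ennreal (exp (- (t\<^sup>2 / (4 * u))) / u powr (1 + \<nu>)) *
        (\<integral>\<^sup>+y. ennreal (\<bar>heat_kernel m L u x y\<bar> * (y powr \<alpha> * exp (- y)) * norm (f y)) \<partial>?R)
      = ennreal (poisson_weight \<nu> t u) * (\<integral>\<^sup>+y. ennreal (hh_kernel (\<alpha> + 1) m u x y * (y powr \<alpha> * exp (- y) * norm (f y))) \<partial>?R)"
      unfolding poisson_weight_def heat_kernel_eq_hh_kernel[OF \<alpha> L u]
      using hh_kernel_nonneg[OF a u] x by (intro arg_cong2[of _ _ _ _ "(*)"] refl nn_integral_cong)
         (auto simp: abs_of_pos mult.assoc)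
    also have "\<dots> = (\<integral>\<^sup>+y. ennreal (poisson_weight \<nu> t u) * ennreal (hh_kernel (\<alpha> + 1) m u x y * (y powr \<alpha> * exp (- y) * norm (f y))) \<partial>?R)"
      by (intro nn_integral_cmult[symmetric] measurable_compose[OF _ measurable_ennreal] borel_measurable_times borel_measurable_hh_kernel a) measurable
    also have "\<dots> = (\<integral>\<^sup>+y. K (u, y) \<partial>?R)"
    proof (rule nn_integral_cong)
      fix y :: real assume "y \<in> space ?R"
      hence "hh_kernel (\<alpha> + 1) m u x y > 0" using hh_kernel_nonneg[OF a u] x by auto
      thus "ennreal (poisson_weight \<nu> t u) * ennreal (hh_kernel (\<alpha> + 1) m u x y * (y powr \<alpha> * exp (- y) * norm (f y))) = K (u, y)"
        by (simp add: K_def ennreal_mult[symmetric] poisson_weight_nonneg mult_ac)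
    qed
    finally show "ennreal (exp (- (t\<^sup>2 / (4 * u))) / u powr (1 + \<nu>)) *
        (\<integral>\<^sup>+y. ennreal (\<bar>heat_kernel m L u x y\<bar> * (y powr \<alpha> * exp (- y)) * norm (f y)) \<partial>?R) = (\<integral>\<^sup>+y. K (u, y) \<partial>?R)" .
  qed
  also have "\<dots> = (\<integral>\<^sup>+y. \<integral>\<^sup>+u. K (u, y) \<partial>?R \<partial>?R)"
    by (rule P.Fubini'[symmetric]) (simp add: K)
  also have "\<dots> = (\<integral>\<^sup>+y. ennreal (y powr \<alpha> * exp (- y) * norm (f y)) *
        (\<integral>\<^sup>+u. ennreal (poisson_weight \<nu> t u * hh_kernel (\<alpha> + 1) m u x y) \<partial>?R) \<partial>?R)"
    unfolding K_def case_prod_conv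
  proof (rule nn_integral_cong)
    fix y :: real
    have [measurable]: "(\<lambda>u. ennreal (poisson_weight \<nu> t u * hh_kernel (\<alpha> + 1) m u x y)) \<in> borel_measurable ?R"
      by (intro measurable_compose[OF _ measurable_ennreal] borel_measurable_times
          measurable_compose[OF _ borel_measurable_poisson_weight] borel_measurable_hh_kernel a borel_measurable_id_Ioi) auto
    show "(\<integral>\<^sup>+u. ennreal (poisson_weight \<nu> t u * hh_kernel (\<alpha> + 1) m u x y) * ennreal (y powr \<alpha> * exp (- y) * norm (f y)) \<partial>?R)
      = ennreal (y powr \<alpha> * exp (- y) * norm (f y)) * (\<integral>\<^sup>+u. ennreal (poisson_weight \<nu> t u * hh_kernel (\<alpha> + 1) m u x y) \<partial>?R)"
      by (subst nn_integral_multc) (auto intro: mult.commute)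
  qed
  finally show ?thesis unfolding poisson_abs_convergent_def by simp
qed

lemma Phi_eq_Phi_factor: "\<Phi> \<alpha> m \<nu> y = y powr \<alpha> * exp (- y) * Phi_factor m \<nu> y"
  by (simp add: \<Phi>_def Phi_factor_def)

lemma L1_Phi_iff:
  "f \<in> L1_Phi \<alpha> m \<nu> \<longleftrightarrow> f \<in> borel_measurable (lebesgue_on {0<..}) \<and>
     (\<integral>\<^sup>+y. ennreal (y powr \<alpha> * exp (- y) * norm (f y)) * ennreal (Phi_factor m \<nu> y) \<partial>lebesgue_on {0<..}) < \<infinity>"
proof -
  have "(\<integral>\<^sup>+y\<in>{0<..}. ennreal (norm (f y) * \<Phi> \<alpha> m \<nu> y) \<partial>lebesgue)
     = (\<integral>\<^sup>+y. ennreal (y powr \<alpha> * exp (- y) * norm (f y)) * ennreal (Phi_factor m \<nu> y) \<partial>lebesgue_on {0<..})"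
    unfolding nn_integral_Ioi[symmetric]
    by (intro nn_integral_cong) (auto simp: Phi_eq_Phi_factor ennreal_mult[symmetric] Phi_factor_pos less_imp_le mult_ac)
  thus ?thesis unfolding L1_Phi_def by simp
qed

lemma borel_measurable_Phi_factor [measurable]: "Phi_factor m \<nu> \<in> borel_measurable borel"
  unfolding Phi_factor_def[abs_def] by measurable

lemma borel_measurable_Phi_factor_Ioi [measurable]: "Phi_factor m \<nu> \<in> borel_measurable (lebesgue_on {0<..})"
  using measurable_compose[OF borel_measurable_id_Ioi borel_measurable_Phi_factor] .

lemma poisson_abs_convergent_of_L1_Phi:
  assumes \<alpha>: "\<alpha> > -1" and m: "m \<ge> 0" and \<nu>: "\<nu> > 0" and L: "normalized_laguerre \<alpha> L"
    and f: "f \<in> L1_Phi \<alpha> m \<nu>" and t: "t > 0" and x: "x > 0"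
  shows "poisson_abs_convergent \<alpha> m \<nu> L t f x"
proof -
  have fm: "f \<in> borel_measurable (lebesgue_on {0<..})" using f by (simp add: L1_Phi_def)
  obtain C where C: "C > 0" "\<And>y. y > 0 \<Longrightarrow>
    (\<integral>\<^sup>+u. ennreal (poisson_weight \<nu> t u * hh_kernel (\<alpha> + 1) m u x y) \<partial>lebesgue_on {0<..}) \<le> ennreal (C * Phi_factor m \<nu> y)"
    using poisson_kernel_upper[of "\<alpha> + 1" x t \<nu> m] \<alpha> m \<nu> t x by auto
  have "(\<integral>\<^sup>+y. ennreal (y powr \<alpha> * exp (- y) * norm (f y)) *
        (\<integral>\<^sup>+u. ennreal (poisson_weight \<nu> t u * hh_kernel (\<alpha> + 1) m u x y) \<partial>lebesgue_on {0<..}) \<partial>lebesgue_on {0<..})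
     \<le> (\<integral>\<^sup>+y. ennreal C * (ennreal (y powr \<alpha> * exp (- y) * norm (f y)) * ennreal (Phi_factor m \<nu> y)) \<partial>lebesgue_on {0<..})"
  proof (rule nn_integral_mono)
    fix y :: real assume "y \<in> space (lebesgue_on {0<..})"
    hence y: "y > 0" by simp
    have "ennreal (y powr \<alpha> * exp (- y) * norm (f y)) *
        (\<integral>\<^sup>+u. ennreal (poisson_weight \<nu> t u * hh_kernel (\<alpha> + 1) m u x y) \<partial>lebesgue_on {0<..})
      \<le> ennreal (y powr \<alpha> * exp (- y) * norm (f y)) * ennreal (C * Phi_factor m \<nu> y)"
      by (intro mult_left_mono C y) auto
    also have "\<dots> = ennreal C * (ennreal (y powr \<alpha> * exp (- y) * norm (f y)) * ennreal (Phi_factor m \<nu> y))"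
      using C(1) Phi_factor_pos[of y m \<nu>] y by (simp add: ennreal_mult[symmetric] mult_ac)
    finally show "ennreal (y powr \<alpha> * exp (- y) * norm (f y)) *
        (\<integral>\<^sup>+u. ennreal (poisson_weight \<nu> t u * hh_kernel (\<alpha> + 1) m u x y) \<partial>lebesgue_on {0<..}) \<le> \<dots>" .
  qed
  also have "\<dots> = ennreal C * (\<integral>\<^sup>+y. ennreal (y powr \<alpha> * exp (- y) * norm (f y)) * ennreal (Phi_factor m \<nu> y) \<partial>lebesgue_on {0<..})"
    using fm by (intro nn_integral_cmult borel_measurable_times_ennreal
      measurable_compose[OF borel_measurable_Phi_factor_Ioi measurable_ennreal]) measurable
  also have "\<dots> < \<infinity>" using f unfolding L1_Phi_iff by (simp add: ennreal_mult_less_top)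
  finally show ?thesis unfolding poisson_abs_convergent_iff[OF \<alpha> L x fm] .
qed

text \<open>One point (t, x) is enough: the lower bound for the Poisson kernel holds there for all
  y, with a constant that may depend on the point.\<close>

lemma L1_Phi_of_poisson_abs_convergent:
  assumes \<alpha>: "\<alpha> > -1" and m: "m \<ge> 0" and \<nu>: "\<nu> > 0" and L: "normalized_laguerre \<alpha> L"
    and fm: "f \<in> borel_measurable (lebesgue_on {0<..})" and t: "t > 0" and x: "x > 0"
    and conv: "poisson_abs_convergent \<alpha> m \<nu> L t f x"
  shows "f \<in> L1_Phi \<alpha> m \<nu>"
proof -
  obtain c where c: "c > 0" "\<And>y. y > 0 \<Longrightarrow>
    ennreal (c * Phi_factor m \<nu> y) \<le> (\<integral>\<^sup>+u. ennreal (poisson_weight \<nu> t u * hh_kernel (\<alpha> + 1) m u x y) \<partial>lebesgue_on {0<..})"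
    using poisson_kernel_lower[of "\<alpha> + 1" x t \<nu> m] \<alpha> m \<nu> t x by auto
  have "(\<integral>\<^sup>+y. ennreal (y powr \<alpha> * exp (- y) * norm (f y)) * ennreal (Phi_factor m \<nu> y) \<partial>lebesgue_on {0<..})
     \<le> (\<integral>\<^sup>+y. ennreal (1 / c) * (ennreal (y powr \<alpha> * exp (- y) * norm (f y)) *
        (\<integral>\<^sup>+u. ennreal (poisson_weight \<nu> t u * hh_kernel (\<alpha> + 1) m u x y) \<partial>lebesgue_on {0<..})) \<partial>lebesgue_on {0<..})"
  proof (rule nn_integral_mono)
    fix y :: real assume "y \<in> space (lebesgue_on {0<..})"
    hence y: "y > 0" by simp
    have "ennreal (y powr \<alpha> * exp (- y) * norm (f y)) * ennreal (Phi_factor m \<nu> y)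
       = ennreal (1 / c) * (ennreal (y powr \<alpha> * exp (- y) * norm (f y)) * ennreal (c * Phi_factor m \<nu> y))"
      using c(1) Phi_factor_pos[of y m \<nu>] y by (simp add: ennreal_mult[symmetric] mult_ac)
    also have "\<dots> \<le> ennreal (1 / c) * (ennreal (y powr \<alpha> * exp (- y) * norm (f y)) *
        (\<integral>\<^sup>+u. ennreal (poisson_weight \<nu> t u * hh_kernel (\<alpha> + 1) m u x y) \<partial>lebesgue_on {0<..}))"
      by (intro mult_left_mono c y) auto
    finally show "ennreal (y powr \<alpha> * exp (- y) * norm (f y)) * ennreal (Phi_factor m \<nu> y) \<le> \<dots>" .
  qed
  also have "\<dots> = ennreal (1 / c) * (\<integral>\<^sup>+y. ennreal (y powr \<alpha> * exp (- y) * norm (f y)) *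
        (\<integral>\<^sup>+u. ennreal (poisson_weight \<nu> t u * hh_kernel (\<alpha> + 1) m u x y) \<partial>lebesgue_on {0<..}) \<partial>lebesgue_on {0<..})"
  proof (rule nn_integral_cmult)
    let ?R = "lebesgue_on {0::real<..}"
    interpret R: sigma_finite_measure ?R by (rule sigma_finite_Ioi)
    have "(\<lambda>(y, u). ennreal (poisson_weight \<nu> t u * hh_kernel (\<alpha> + 1) m u x y)) \<in> borel_measurable (?R \<Otimes>\<^sub>M ?R)"
      unfolding case_prod_beta' using \<alpha>
      by (intro measurable_compose[OF _ measurable_ennreal] borel_measurable_times
         measurable_compose[OF _ borel_measurable_poisson_weight] borel_measurable_hh_kernel borel_measurable_fst_Ioi borel_measurable_snd_Ioi) auto
    hence "(\<lambda>y. \<integral>\<^sup>+u. ennreal (poisson_weight \<nu> t u * hh_kernel (\<alpha> + 1) m u x y) \<partial>?R) \<in> borel_measurable ?R"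
      by (rule R.borel_measurable_nn_integral)
    thus "(\<lambda>y. ennreal (y powr \<alpha> * exp (- y) * norm (f y)) *
        (\<integral>\<^sup>+u. ennreal (poisson_weight \<nu> t u * hh_kernel (\<alpha> + 1) m u x y) \<partial>?R)) \<in> borel_measurable ?R"
      using fm by measurable
  qed
  also have "\<dots> < \<infinity>" using conv unfolding poisson_abs_convergent_iff[OF \<alpha> L x fm] by (simp add: ennreal_mult_less_top)
  finally show ?thesis unfolding L1_Phi_iff using fm by simp
qed

section \<open>Smoothness and the differential equation\<close>

text \<open>Finiteness of the iterated integral becomes integrability over the product, so that
  dominated convergence and Fubini can treat (u, y) as a single variable.\<close>

lemma poisson_pair_integrable:
  assumes \<alpha>: "\<alpha> > -1" and m: "m \<ge> 0" and \<nu>: "\<nu> > 0" and L: "normalized_laguerre \<alpha> L"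
    and f: "f \<in> L1_Phi \<alpha> m \<nu>" and t: "t > 0" and x: "x > 0"
  shows "integrable (lebesgue_on {0<..} \<Otimes>\<^sub>M lebesgue_on {0<..})
     (\<lambda>(u, y). (poisson_weight \<nu> t u * hh_kernel (\<alpha> + 1) m u x y * (y powr \<alpha> * exp (- y))) *\<^sub>R f y)"
proof -
  let ?R = "lebesgue_on {0::real<..}"
  interpret R: sigma_finite_measure ?R by (rule sigma_finite_Ioi)
  interpret P: pair_sigma_finite ?R ?R ..
  have fm: "f \<in> borel_measurable ?R" using f by (simp add: L1_Phi_def)
  note [measurable] = fm borel_measurable_fst_Ioi borel_measurable_snd_Ioi
  have a: "\<alpha> + 1 > 0" using \<alpha> by simp
  have ms: "(\<lambda>(u, y). (poisson_weight \<nu> t u * hh_kernel (\<alpha> + 1) m u x y * (y powr \<alpha> * exp (- y))) *\<^sub>R f y) \<in> borel_measurable (?R \<Otimes>\<^sub>M ?R)"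
    unfolding case_prod_beta'
    by (intro borel_measurable_scaleR borel_measurable_times measurable_compose[OF _ borel_measurable_poisson_weight] borel_measurable_hh_kernel a) measurable
  have ms2: "(\<lambda>(u, y). ennreal (y powr \<alpha> * exp (- y) * norm (f y)) * ennreal (poisson_weight \<nu> t u * hh_kernel (\<alpha> + 1) m u x y)) \<in> borel_measurable (?R \<Otimes>\<^sub>M ?R)"
    unfolding case_prod_beta'
    by (intro borel_measurable_times_ennreal measurable_compose[OF _ measurable_ennreal] borel_measurable_times
         measurable_compose[OF _ borel_measurable_poisson_weight] borel_measurable_hh_kernel a) measurable
  show ?thesis
  proof (rule integrableI_bounded[OF ms])
    have "(\<integral>\<^sup>+p. ennreal (norm (case p of (u, y) \<Rightarrow> (poisson_weight \<nu> t u * hh_kernel (\<alpha> + 1) m u x y * (y powr \<alpha> * exp (- y))) *\<^sub>R f y)) \<partial>(?R \<Otimes>\<^sub>M ?R))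
      = (\<integral>\<^sup>+p. (case p of (u, y) \<Rightarrow> ennreal (y powr \<alpha> * exp (- y) * norm (f y)) * ennreal (poisson_weight \<nu> t u * hh_kernel (\<alpha> + 1) m u x y)) \<partial>(?R \<Otimes>\<^sub>M ?R))"
    proof (rule nn_integral_cong)
      fix p :: "real \<times> real" assume "p \<in> space (?R \<Otimes>\<^sub>M ?R)"
      then obtain u y where p: "p = (u, y)" "u > 0" "y > 0" by (auto simp: space_pair_measure)
      have "hh_kernel (\<alpha> + 1) m u x y > 0" using p x by (intro hh_kernel_nonneg a) auto
      thus "ennreal (norm (case p of (u, y) \<Rightarrow> (poisson_weight \<nu> t u * hh_kernel (\<alpha> + 1) m u x y * (y powr \<alpha> * exp (- y))) *\<^sub>R f y)) =
        (case p of (u, y) \<Rightarrow> ennreal (y powr \<alpha> * exp (- y) * norm (f y)) * ennreal (poisson_weight \<nu> t u * hh_kernel (\<alpha> + 1) m u x y))"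
        by (simp add: p(1) ennreal_mult[symmetric] poisson_weight_nonneg abs_mult mult_ac)
    qed
    also have "\<dots> = (\<integral>\<^sup>+y. \<integral>\<^sup>+u. ennreal (y powr \<alpha> * exp (- y) * norm (f y)) * ennreal (poisson_weight \<nu> t u * hh_kernel (\<alpha> + 1) m u x y) \<partial>?R \<partial>?R)"
      by (subst P.nn_integral_snd[OF ms2, symmetric]) simp
    also have "\<dots> = (\<integral>\<^sup>+y. ennreal (y powr \<alpha> * exp (- y) * norm (f y)) * (\<integral>\<^sup>+u. ennreal (poisson_weight \<nu> t u * hh_kernel (\<alpha> + 1) m u x y) \<partial>?R) \<partial>?R)"
      by (intro nn_integral_cong nn_integral_cmult measurable_compose[OF _ measurable_ennreal] borel_measurable_times
          measurable_compose[OF _ borel_measurable_poisson_weight] borel_measurable_hh_kernel a borel_measurable_id_Ioi) auto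
    also have "\<dots> < \<infinity>"
      using poisson_abs_convergent_of_L1_Phi[OF \<alpha> m \<nu> L f t x]
      unfolding poisson_abs_convergent_iff[OF \<alpha> L x fm] .
    finally show "(\<integral>\<^sup>+p. ennreal (norm (case p of (u, y) \<Rightarrow> (poisson_weight \<nu> t u * hh_kernel (\<alpha> + 1) m u x y * (y powr \<alpha> * exp (- y))) *\<^sub>R f y)) \<partial>(?R \<Otimes>\<^sub>M ?R)) < \<infinity>" .
  qed
qed

lemma heat_semigroup_eq:
  assumes "\<alpha> > -1" "normalized_laguerre \<alpha> L" "u > 0"
  shows "heat_semigroup \<alpha> m L u f x = (\<integral>y. (hh_kernel (\<alpha> + 1) m u x y * (y powr \<alpha> * exp (- y))) *\<^sub>R f y \<partial>lebesgue_on {0<..})"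
  unfolding heat_semigroup_def LINT_Ioi_eq heat_kernel_eq_hh_kernel[OF assms] ..

lemma poisson_integral_eq_iterated:
  assumes "\<alpha> > -1" "normalized_laguerre \<alpha> L"
  shows "poisson_integral \<alpha> m \<nu> L t f x = (t powr (2 * \<nu>) / (4 powr \<nu> * Gamma \<nu>)) *\<^sub>R
     (\<integral>u. poisson_weight \<nu> t u *\<^sub>R (\<integral>y. (hh_kernel (\<alpha> + 1) m u x y * (y powr \<alpha> * exp (- y))) *\<^sub>R f y \<partial>lebesgue_on {0<..}) \<partial>lebesgue_on {0<..})"
  unfolding poisson_integral_def LINT_Ioi_eq
  by (intro arg_cong2[of _ _ _ _ scaleR] refl Bochner_Integration.integral_cong)
     (auto simp: poisson_weight_def heat_semigroup_eq[OF assms])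

lemma poisson_integral_eq_pair:
  assumes \<alpha>: "\<alpha> > -1" and m: "m \<ge> 0" and \<nu>: "\<nu> > 0" and L: "normalized_laguerre \<alpha> L"
    and f: "f \<in> L1_Phi \<alpha> m \<nu>" and t: "t > 0" and x: "x > 0"
  shows "poisson_integral \<alpha> m \<nu> L t f x = (t powr (2 * \<nu>) / (4 powr \<nu> * Gamma \<nu>)) *\<^sub>R
     (\<integral>(u, y). (poisson_weight \<nu> t u * hh_kernel (\<alpha> + 1) m u x y * (y powr \<alpha> * exp (- y))) *\<^sub>R f y \<partial>(lebesgue_on {0<..} \<Otimes>\<^sub>M lebesgue_on {0<..}))"
proof -
  let ?R = "lebesgue_on {0::real<..}"
  interpret R: sigma_finite_measure ?R by (rule sigma_finite_Ioi)
  interpret P: pair_sigma_finite ?R ?R ..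
  show ?thesis
    unfolding poisson_integral_eq_iterated[OF \<alpha> L]
      P.integral_fst'[OF poisson_pair_integrable[OF \<alpha> m \<nu> L f t x], symmetric]
    by (simp add: scaleR_scaleR[symmetric] mult.assoc del: scaleR_scaleR)
qed

text \<open>The power of t is moved under the integral, so that the integrand is a product in which
  t occurs only here and x only in \<open>poisson_x_factor\<close>. Both variables are complex for
  the sake of the Cauchy estimates.\<close>

definition poisson_t_factor :: "real \<Rightarrow> complex \<Rightarrow> real \<times> real \<Rightarrow> complex" where
  "poisson_t_factor \<nu> t w = t powr of_real (2 * \<nu>) * (exp (- (t\<^sup>2 / (4 * of_real (fst w)))) * of_real (1 / fst w powr (1 + \<nu>)))"

definition poisson_x_factor :: "real \<Rightarrow> real \<Rightarrow> (real \<Rightarrow> complex) \<Rightarrow> complex \<Rightarrow> real \<times> real \<Rightarrow> complex" where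
  "poisson_x_factor \<alpha> m f x w = hh_kernel (\<alpha> + 1) m (fst w) x (snd w) * (of_real (snd w powr \<alpha> * exp (- snd w)) * f (snd w))"

lemma hh_kernel_of_real:
  "a > 0 \<Longrightarrow> hh_kernel a m u (of_real x :: 'a::{real_normed_field,banach}) y = of_real (hh_kernel a m u x y)"
  unfolding hh_kernel_def by (simp add: bessel_of_real exp_of_real flip: of_real_mult of_real_minus)

lemma poisson_t_factor_of_real:
  assumes "t > 0"
  shows "poisson_t_factor \<nu> (of_real t) w = of_real (t powr (2 * \<nu>) * poisson_weight \<nu> t (fst w))"
proof -
  have "complex_of_real t powr of_real (2 * \<nu>) = of_real (t powr (2 * \<nu>))"
    using assms by (intro powr_of_real) auto
  thus ?thesis unfolding poisson_t_factor_def poisson_weight_def by (simp flip: exp_of_real)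
qed

lemma holomorphic_bessel: "a > 0 \<Longrightarrow> bessel a holomorphic_on (S :: complex set)"
  by (auto simp: holomorphic_on_def field_differentiable_def intro: has_field_derivative_at_within DERIV_bessel)

lemma holomorphic_hh_kernel: "a > 0 \<Longrightarrow> (\<lambda>x::complex. hh_kernel a m u x y) holomorphic_on S"
proof -
  assume a: "a > 0"
  have "bessel a \<circ> (*) c holomorphic_on S" for c :: complex
    by (intro holomorphic_on_compose holomorphic_bessel a) (auto intro!: holomorphic_intros)
  hence "(\<lambda>x. bessel a (c * x)) holomorphic_on S" for c :: complex
    by (simp add: o_def)
  thus ?thesis unfolding hh_kernel_def by (intro holomorphic_intros)
qed

lemma norm_hh_kernel_le:
  assumes a: "a > 0" and u: "u > 0" and y: "y \<ge> 0" and b: "norm x \<le> b"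
  shows "norm (hh_kernel a m u (x::complex) y) \<le> exp ((b - Re x) * rho u) * hh_kernel a m u b y"
proof -
  define c where "c = rho u * (1 + rho u) * y"
  have c: "c \<ge> 0" using rho_pos[OF u] y by (simp add: c_def)
  have "norm (bessel a (of_real c * x)) \<le> bessel a (norm (of_real c * x))" by (rule norm_bessel_le[OF a])
  also have "\<dots> \<le> bessel a (c * b)" using c b by (intro bessel_mono a) (auto simp: norm_mult mult_left_mono)
  finally have 1: "norm (bessel a (of_real c * x)) \<le> bessel a (c * b)" .
  have "norm (hh_kernel a m u x y) = exp (- (m * u)) * (1 + rho u) powr a * exp (- (rho u * y)) * exp (- (rho u * Re x)) * norm (bessel a (of_real c * x))"
    unfolding hh_kernel_def c_def by (simp add: norm_mult)
  also have "\<dots> \<le> exp (- (m * u)) * (1 + rho u) powr a * exp (- (rho u * y)) * exp (- (rho u * Re x)) * bessel a (c * b)"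
    by (intro mult_left_mono 1) auto
  also have "exp (- (rho u * Re x)) = exp ((b - Re x) * rho u) * exp (- (rho u * b))"
    by (simp add: exp_add[symmetric] algebra_simps)
  finally show ?thesis unfolding hh_kernel_def c_def by (simp add: mult_ac)
qed

text \<open>
  For complex \<open>x\<close> the kernel is at most \<open>exp ((\<bar>x\<bar> - Re x) rho u)\<close> times its value at \<open>\<bar>x\<bar>\<close>. Since
  \<open>rho u \<le> 1/u\<close>, the factor \<open>exp (- t\<^sup>2 / 4u)\<close> compensates this on the following domain.
\<close>

definition poisson_domain :: "(complex \<times> complex) set" where
  "poisson_domain = {(t, x). Re t > 0 \<and> norm x - Re x < Re (t\<^sup>2) / 4}"

text \<open>Near a point of the domain the integrand is dominated by a constant times the norm of
  the original integrand at one real point (s, b), which is integrable by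
  \<open>poisson_pair_integrable\<close>. No new estimate of the kernel is required.\<close>

lemma dominated_product_poisson:
  assumes \<alpha>: "\<alpha> > -1" and m: "m \<ge> 0" and \<nu>: "\<nu> > 0" and L: "normalized_laguerre \<alpha> L"
    and f: "f \<in> L1_Phi \<alpha> m \<nu>"
  shows "dominated_product (lebesgue_on {0<..} \<Otimes>\<^sub>M lebesgue_on {0<..}) {t. Re t > 0} poisson_domain (poisson_t_factor \<nu>) (poisson_x_factor \<alpha> m f)"
  unfolding dominated_product_def
proof (intro conjI ballI allI impI)
  let ?R = "lebesgue_on {0::real<..}"
  let ?P = "?R \<Otimes>\<^sub>M ?R"
  have a: "\<alpha> + 1 > 0" using \<alpha> by simp
  have fm: "f \<in> borel_measurable ?R" using f by (simp add: L1_Phi_def)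
  note [measurable] = fm borel_measurable_fst_Ioi borel_measurable_snd_Ioi
  show "open {t. Re t > 0}" by (rule open_halfspace_Re_gt)
  show holA: "(\<lambda>t. poisson_t_factor \<nu> t w) holomorphic_on {t. Re t > 0}" if "w \<in> space ?P" for w
  proof -
    have "fst w \<noteq> 0" using that by (auto simp: space_pair_measure)
    thus ?thesis unfolding poisson_t_factor_def by (intro holomorphic_intros) (auto simp: complex_nonpos_Reals_iff)
  qed
  show "(\<lambda>x. poisson_x_factor \<alpha> m f x w) holomorphic_on UNIV" for w
    unfolding poisson_x_factor_def by (intro holomorphic_intros holomorphic_hh_kernel a)
  show "poisson_t_factor \<nu> t \<in> borel_measurable ?P" for t
    unfolding poisson_t_factor_def[abs_def] by measurable
  show "poisson_x_factor \<alpha> m f x \<in> borel_measurable ?P" for x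
    unfolding poisson_x_factor_def[abs_def] by (intro borel_measurable_times borel_measurable_hh_kernel a) measurable
  fix t0 x0 assume "(t0, x0) \<in> poisson_domain"
  hence D: "Re t0 > 0" "norm x0 - Re x0 < Re (t0\<^sup>2) / 4" by (auto simp: poisson_domain_def)
  \<comment> \<open>This is the margin in the inequality that defines the domain; all later choices
    spend fractions of it.\<close>
  define d where "d = Re (t0\<^sup>2) / 4 - (norm x0 - Re x0)"
  have d: "d > 0" using D by (simp add: d_def)
  define b where "b = norm x0 + d / 8"
  have b: "b > 0" using d norm_ge_zero[of x0] by (simp add: b_def add_nonneg_pos)
  have "isCont (\<lambda>t. Re (t\<^sup>2)) t0" by (simp add: continuous_Re continuous_power)
  then obtain r1 where r1: "r1 > 0" "\<And>t. dist t t0 < r1 \<Longrightarrow> dist (Re (t\<^sup>2)) (Re (t0\<^sup>2)) < d"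
    using d unfolding continuous_at_eps_delta by metis
  define r where "r = Min {r1 / 2, d / 8, Re t0 / 2}"
  have r: "r > 0" "r < r1" "r \<le> d / 8" "r < Re t0" using r1 d D by (auto simp: r_def)
  have sub: "cball t0 r \<subseteq> {t. Re t > 0}"
  proof
    fix t assume "t \<in> cball t0 r"
    hence "\<bar>Re (t0 - t)\<bar> \<le> r" using abs_Re_le_cmod[of "t0 - t"] by (auto simp: dist_norm)
    thus "t \<in> {t. Re t > 0}" using r by auto
  qed
  have "compact ((\<lambda>t. t powr of_real (2 * \<nu>)) ` cball t0 r)"
  proof (rule compact_continuous_image)
    have "(\<lambda>t. t powr of_real (2 * \<nu>)) holomorphic_on {t. Re t > 0}"
      by (intro holomorphic_intros) (auto simp: complex_nonpos_Reals_iff)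
    thus "continuous_on (cball t0 r) (\<lambda>t. t powr of_real (2 * \<nu>))"
      using sub by (meson continuous_on_subset holomorphic_on_imp_continuous_on)
  qed auto
  then obtain T where T: "T > 0" "\<And>t. t \<in> cball t0 r \<Longrightarrow> norm (t powr of_real (2 * \<nu>)) \<le> T"
    using compact_imp_bounded bounded_pos by (metis (mono_tags, lifting) imageI)
  \<comment> \<open>Varying t costs d / 4 in Re (t^2) / 4; varying x and enlarging the radius to b
    cost d / 8 each. What remains of the margin is d / 2, which must equal s^2 / 4.\<close>
  define s where "s = sqrt (2 * d)"
  have s: "s > 0" "s\<^sup>2 = 2 * d" using d by (auto simp: s_def)
  define g where "g w = T * norm (case w of (u, y) \<Rightarrow> (poisson_weight \<nu> s u * hh_kernel (\<alpha> + 1) m u b y * (y powr \<alpha> * exp (- y))) *\<^sub>R f y)" for w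
  have "integrable ?P g"
    unfolding g_def by (intro integrable_mult_right integrable_norm poisson_pair_integrable[OF \<alpha> m \<nu> L f s(1) b])
  moreover have "norm (poisson_t_factor \<nu> t w * poisson_x_factor \<alpha> m f x w) \<le> g w"
    if t: "t \<in> cball t0 r" and x: "x \<in> cball x0 r" and w: "w \<in> space ?P" for t x w
  proof -
    obtain u y where uy: "w = (u, y)" "u > 0" "y > 0" using w by (auto simp: space_pair_measure)
    have "dist (Re (t\<^sup>2)) (Re (t0\<^sup>2)) < d" using t r by (intro r1) (auto simp: dist_commute)
    hence t2: "Re (t\<^sup>2) \<ge> Re (t0\<^sup>2) - d" by (auto simp: dist_real_def)
    have "norm (x0 - x) \<le> d / 8" using x r by (auto simp: dist_norm)
    hence xb: "norm x \<le> b" and xr: "Re x \<ge> Re x0 - d / 8"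
      using norm_triangle_ineq2[of x x0] abs_Re_le_cmod[of "x0 - x"] by (auto simp: b_def norm_minus_commute)
    have bx: "0 \<le> b - Re x" using xb complex_Re_le_cmod[of x] by linarith
    have key: "- (Re (t\<^sup>2) / (4 * u)) + (b - Re x) * rho u \<le> - (s\<^sup>2 / (4 * u))"
    proof -
      have "(b - Re x) * rho u \<le> (b - Re x) * (1 / u)" using bx rho_le[OF uy(2)] by (intro mult_left_mono) auto
      moreover have "(b - Re x) - Re (t\<^sup>2) / 4 \<le> - (s\<^sup>2 / 4)" using t2 xr by (simp add: b_def d_def s) (simp add: field_simps)
      hence "((b - Re x) - Re (t\<^sup>2) / 4) / u \<le> - (s\<^sup>2 / 4) / u" using uy by (intro divide_right_mono) auto
      ultimately show ?thesis by (simp add: diff_divide_distrib)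
    qed
    have e: "norm (exp (- (t\<^sup>2 / (4 * of_real u)))) = exp (- (Re (t\<^sup>2) / (4 * u)))"
    proof -
      have "t\<^sup>2 / (4 * of_real u) = t\<^sup>2 / of_real (4 * u)" by simp
      hence "Re (- (t\<^sup>2 / (4 * of_real u))) = - (Re (t\<^sup>2) / (4 * u))"
        by (simp only: uminus_complex.sel Re_divide_of_real)
      thus ?thesis by (simp only: norm_exp_eq_Re)
    qed
    have lb: "hh_kernel (\<alpha> + 1) m u b y > 0" using uy b by (intro hh_kernel_nonneg a) auto
    have "norm (poisson_t_factor \<nu> t w * poisson_x_factor \<alpha> m f x w) = norm (t powr of_real (2 * \<nu>)) * (exp (- (Re (t\<^sup>2) / (4 * u))) * (1 / u powr (1 + \<nu>))) *
        (norm (hh_kernel (\<alpha> + 1) m u x y) * (y powr \<alpha> * exp (- y) * norm (f y)))"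
      unfolding poisson_t_factor_def poisson_x_factor_def uy fst_conv snd_conv norm_mult e by (simp add: norm_mult norm_divide)
    also have "\<dots> \<le> T * (exp (- (Re (t\<^sup>2) / (4 * u))) * (1 / u powr (1 + \<nu>))) *
        ((exp ((b - Re x) * rho u) * hh_kernel (\<alpha> + 1) m u b y) * (y powr \<alpha> * exp (- y) * norm (f y)))"
      using uy T(1) lb by (intro mult_mono mult_right_mono T(2) t norm_hh_kernel_le a xb) auto
    also have "\<dots> = T * ((exp (- (Re (t\<^sup>2) / (4 * u)) + (b - Re x) * rho u)) * (1 / u powr (1 + \<nu>))) *
        (hh_kernel (\<alpha> + 1) m u b y * (y powr \<alpha> * exp (- y) * norm (f y)))"
      by (simp only: exp_add mult_ac)
    also have "\<dots> \<le> T * (exp (- (s\<^sup>2 / (4 * u))) * (1 / u powr (1 + \<nu>))) * (hh_kernel (\<alpha> + 1) m u b y * (y powr \<alpha> * exp (- y) * norm (f y)))"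
      using T(1) lb key by (intro mult_right_mono mult_left_mono) auto
    also have "\<dots> = g w"
      using lb poisson_weight_nonneg[of \<nu> s u] by (simp add: g_def uy abs_mult poisson_weight_def mult_ac)
    finally show ?thesis .
  qed
  ultimately show "\<exists>r>0. \<exists>g. cball t0 r \<subseteq> {t. Re t > 0} \<and> integrable ?P g \<and>
        (\<forall>t\<in>cball t0 r. \<forall>x\<in>cball x0 r. \<forall>w\<in>space ?P. norm (poisson_t_factor \<nu> t w * poisson_x_factor \<alpha> m f x w) \<le> g w)"
    using r(1) sub by (intro exI[of _ r] conjI exI[of _ g] ballI) auto
qed

lemma poisson_domain_of_real: "t > 0 \<Longrightarrow> x > 0 \<Longrightarrow> (complex_of_real t, complex_of_real x) \<in> poisson_domain"
  by (simp add: poisson_domain_def flip: of_real_power)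

lemma poisson_integral_eq_complex:
  assumes \<alpha>: "\<alpha> > -1" and m: "m \<ge> 0" and \<nu>: "\<nu> > 0" and L: "normalized_laguerre \<alpha> L"
    and f: "f \<in> L1_Phi \<alpha> m \<nu>" and t: "t > 0" and x: "x > 0"
  shows "poisson_integral \<alpha> m \<nu> L t f x = (1 / (4 powr \<nu> * Gamma \<nu>)) *\<^sub>R
     (\<integral>w. poisson_t_factor \<nu> (of_real t) w * poisson_x_factor \<alpha> m f (of_real x) w \<partial>(lebesgue_on {0<..} \<Otimes>\<^sub>M lebesgue_on {0<..}))"
proof -
  have a: "\<alpha> + 1 > 0" using \<alpha> by simp
  have "(\<integral>w. poisson_t_factor \<nu> (of_real t) w * poisson_x_factor \<alpha> m f (of_real x) w \<partial>(lebesgue_on {0<..} \<Otimes>\<^sub>M lebesgue_on {0<..}))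
     = (\<integral>w. (t powr (2 * \<nu>)) *\<^sub>R (case w of (u, y) \<Rightarrow> (poisson_weight \<nu> t u * hh_kernel (\<alpha> + 1) m u x y * (y powr \<alpha> * exp (- y))) *\<^sub>R f y) \<partial>(lebesgue_on {0<..} \<Otimes>\<^sub>M lebesgue_on {0<..}))"
    by (intro Bochner_Integration.integral_cong refl)
       (simp add: poisson_t_factor_of_real[OF t] poisson_x_factor_def hh_kernel_of_real[OF a] scaleR_conv_of_real case_prod_beta' mult_ac)
  also have "\<dots> = (t powr (2 * \<nu>)) *\<^sub>R (\<integral>(u, y). (poisson_weight \<nu> t u * hh_kernel (\<alpha> + 1) m u x y * (y powr \<alpha> * exp (- y))) *\<^sub>R f y \<partial>(lebesgue_on {0<..} \<Otimes>\<^sub>M lebesgue_on {0<..}))"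
    by (rule integral_scaleR_right)
  finally show ?thesis
    unfolding poisson_integral_eq_pair[OF assms] by (simp add: divide_inverse mult_ac)
qed

lemma poisson_integral_smooth:
  assumes \<alpha>: "\<alpha> > -1" and m: "m \<ge> 0" and \<nu>: "\<nu> > 0" and L: "normalized_laguerre \<alpha> L"
    and f: "f \<in> L1_Phi \<alpha> m \<nu>"
  shows "C_infinity_on ({0<..} \<times> {0<..}) (\<lambda>(t, x). poisson_integral \<alpha> m \<nu> L t f x)"
  unfolding C_infinity_on_def
proof
  fix k
  let ?Q = "{0::real<..} \<times> {0::real<..}"
  let ?F = "\<lambda>(t, x). \<integral>w. poisson_t_factor \<nu> (of_real t) w * poisson_x_factor \<alpha> m f (of_real x) w \<partial>(lebesgue_on {0<..} \<Otimes>\<^sub>M lebesgue_on {0<..})"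
  have o: "open ?Q" by (intro open_Times) auto
  have "C_k_on k ?Q ?F"
    by (rule dominated_product_C_k[OF dominated_product_poisson[OF assms] poisson_domain_of_real])
  hence "C_k_on k ?Q (\<lambda>p. (1 / (4 powr \<nu> * Gamma \<nu>)) *\<^sub>R ?F p + 0 *\<^sub>R ?F p)"
    by (intro C_k_on_lincomb o)
  thus "C_k_on k ?Q (\<lambda>(t, x). poisson_integral \<alpha> m \<nu> L t f x)"
    by (rule C_k_on_cong[OF o, rotated]) (auto simp: poisson_integral_eq_complex[OF assms])
qed

text \<open>The fundamental theorem on the intervals [1 / (n + 1), n + 1] leaves differences of
  boundary values that tend to 0; integrability of the derivative lets the integrals converge to
  that over the half line.\<close>

lemma integral_deriv_Ioi_zero:
  fixes G G' :: "real \<Rightarrow> real"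
  assumes d: "\<And>u. u > 0 \<Longrightarrow> (G has_real_derivative G' u) (at u)"
    and i: "integrable (lebesgue_on {0<..}) G'"
    and l0: "(G \<longlongrightarrow> 0) (at_right 0)" and l1: "(G \<longlongrightarrow> 0) at_top"
  shows "(\<integral>u. G' u \<partial>lebesgue_on {0<..}) = 0"
proof -
  define S where "S n = {1 / real (Suc n)..real (Suc n)}" for n
  have S: "S n \<subseteq> {0<..}" for n
  proof
    fix u assume "u \<in> S n"
    hence "1 / real (Suc n) \<le> u" by (simp add: S_def)
    moreover have "1 / real (Suc n) > 0" by (simp del: of_nat_Suc)
    ultimately have "u > 0" by linarith
    thus "u \<in> {0<..}" by simp
  qed
  have le: "1 / real (Suc n) \<le> real (Suc n)" for n
  proof -
    have "1 / real (Suc n) \<le> 1" by (simp add: divide_simps)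
    also have "1 \<le> real (Suc n)" by simp
    finally show ?thesis .
  qed
  have si: "set_integrable lebesgue {0<..} G'"
    unfolding set_integrable_def using i by (subst (asm) integrable_restrict_space) auto
  have eq: "(\<integral>u. indicator (S n) u *\<^sub>R G' u \<partial>lebesgue_on {0<..}) = G (real (Suc n)) - G (1 / real (Suc n))" for n
  proof -
    have "(\<integral>u. indicator (S n) u *\<^sub>R G' u \<partial>lebesgue_on {0<..}) = (LINT u:{0<..}|lebesgue. indicator (S n) u *\<^sub>R G' u)"
      by (simp add: set_lebesgue_integral_def integral_restrict_space)
    also have "\<dots> = (LINT u:S n|lebesgue. G' u)"
      unfolding set_lebesgue_integral_def using S[of n]
      by (intro Bochner_Integration.integral_cong refl) (auto simp: indicator_def)
    also have "\<dots> = integral (S n) G'"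
      by (rule set_lebesgue_integral_eq_integral(2), rule set_integrable_subset[OF si _ S]) (simp add: S_def)
    also have "(G' has_integral (G (real (Suc n)) - G (1 / real (Suc n)))) (S n)"
      unfolding S_def
    proof (rule fundamental_theorem_of_calculus[OF le])
      fix u assume "u \<in> {1 / real (Suc n)..real (Suc n)}"
      hence "u > 0" using S[of n] by (auto simp: S_def)
      thus "(G has_vector_derivative G' u) (at u within {1 / real (Suc n)..real (Suc n)})"
        using d[of u] by (auto simp: has_real_derivative_iff_has_vector_derivative intro: has_vector_derivative_at_within)
    qed
    hence "integral (S n) G' = G (real (Suc n)) - G (1 / real (Suc n))" by (rule integral_unique)
    finally show ?thesis .
  qed
  have "(\<lambda>n. \<integral>u. indicator (S n) u *\<^sub>R G' u \<partial>lebesgue_on {0<..}) \<longlonglongrightarrow> (\<integral>u. G' u \<partial>lebesgue_on {0<..})"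
  proof (rule integral_dominated_convergence[where w = "\<lambda>u. norm (G' u)"])
    show "G' \<in> borel_measurable (lebesgue_on {0<..})" using i by auto
    have "S n \<inter> {0<..} \<in> sets (lebesgue_on {0<..})" for n
      by (simp add: sets_restrict_space_iff S_def)
    hence "indicat_real (S n) \<in> borel_measurable (lebesgue_on {0<..})" for n
      by (subst borel_measurable_indicator_iff) (simp add: Int_commute)
    thus "(\<lambda>u. indicator (S n) u *\<^sub>R G' u) \<in> borel_measurable (lebesgue_on {0<..})" for n
      using i by (intro borel_measurable_scaleR) auto
    show "AE u in lebesgue_on {0<..}. (\<lambda>n. indicator (S n) u *\<^sub>R G' u) \<longlonglongrightarrow> G' u"
    proof (rule AE_I2)
      fix u :: real assume "u \<in> space (lebesgue_on {0<..})"
      hence u: "u > 0" by simp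
      obtain k1 k2 where k: "1 / u \<le> real k1" "u \<le> real k2" using real_arch_simple by metis
      have "eventually (\<lambda>n. indicator (S n) u *\<^sub>R G' u = G' u) sequentially"
        using eventually_ge_at_top[of "max k1 k2"]
      proof eventually_elim
        case (elim n)
        have "1 / u \<le> real (Suc n)" "u \<le> real (Suc n)" using k elim by linarith+
        hence "u \<in> S n" using u by (auto simp: S_def divide_le_eq mult.commute simp del: of_nat_Suc)
        thus ?case by simp
      qed
      thus "(\<lambda>n. indicator (S n) u *\<^sub>R G' u) \<longlonglongrightarrow> G' u" by (rule tendsto_eventually)
    qed
  qed (use i in \<open>auto simp: indicator_def\<close>)
  moreover have "(\<lambda>n. G (real (Suc n)) - G (1 / real (Suc n))) \<longlonglongrightarrow> 0 - 0"
  proof (intro tendsto_diff)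
    show "(\<lambda>n. G (real (Suc n))) \<longlonglongrightarrow> 0"
      by (rule filterlim_compose[OF l1 filterlim_compose[OF filterlim_real_sequentially filterlim_Suc]])
    show "(\<lambda>n. G (1 / real (Suc n))) \<longlonglongrightarrow> 0"
    proof (rule filterlim_compose[OF l0])
      show "filterlim (\<lambda>n. 1 / real (Suc n)) (at_right 0) sequentially"
        unfolding filterlim_at using LIMSEQ_Suc[OF lim_const_over_n[of "1::real"]]
        by (auto simp del: of_nat_Suc)
    qed
  qed
  ultimately show ?thesis unfolding eq by (auto dest: LIMSEQ_unique)
qed

section \<open>Derivatives of the two factors and the heat equation\<close>

definition hh_kernel_x :: "real \<Rightarrow> real \<Rightarrow> real \<Rightarrow> 'a::{real_normed_field,banach} \<Rightarrow> real \<Rightarrow> 'a" where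
  "hh_kernel_x a m u x y = of_real (exp (- (m * u)) * (1 + rho u) powr a * exp (- (rho u * y))) *
     exp (- (of_real (rho u) * x)) * (of_real (rho u * (1 + rho u) * y) * bessel (a + 1) (of_real (rho u * (1 + rho u) * y) * x)
       - of_real (rho u) * bessel a (of_real (rho u * (1 + rho u) * y) * x))"

definition hh_kernel_xx :: "real \<Rightarrow> real \<Rightarrow> real \<Rightarrow> 'a::{real_normed_field,banach} \<Rightarrow> real \<Rightarrow> 'a" where
  "hh_kernel_xx a m u x y = of_real (exp (- (m * u)) * (1 + rho u) powr a * exp (- (rho u * y))) *
     exp (- (of_real (rho u) * x)) * ((of_real (rho u))\<^sup>2 * bessel a (of_real (rho u * (1 + rho u) * y) * x)
       - 2 * of_real (rho u) * of_real (rho u * (1 + rho u) * y) * bessel (a + 1) (of_real (rho u * (1 + rho u) * y) * x)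
       + (of_real (rho u * (1 + rho u) * y))\<^sup>2 * bessel (a + 2) (of_real (rho u * (1 + rho u) * y) * x))"

lemma DERIV_hh_kernel:
  fixes x :: "'a::{real_normed_field,banach}"
  assumes a: "a > 0"
  shows "((\<lambda>x. hh_kernel a m u x y) has_field_derivative hh_kernel_x a m u x y) (at x)"
    and "((\<lambda>x. hh_kernel_x a m u x y) has_field_derivative hh_kernel_xx a m u x y) (at x)"
proof -
  define c k E :: 'a where "c = of_real (rho u * (1 + rho u) * y)" and "k = of_real (rho u)"
    and "E = of_real (exp (- (m * u)) * (1 + rho u) powr a * exp (- (rho u * y)))"
  have b0: "((\<lambda>x. bessel a (c * x)) has_field_derivative c * bessel (a + 1) (c * x)) (at x)"
    using a by (auto intro!: derivative_eq_intros)
  have b1: "((\<lambda>x. bessel (a + 1) (c * x)) has_field_derivative c * bessel (a + 2) (c * x)) (at x)"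
    using DERIV_bessel_chain[of "a + 1" "\<lambda>x. c * x" c x UNIV] a by (auto intro!: derivative_eq_intros simp: add_ac mult.commute)
  show "((\<lambda>x. hh_kernel a m u x y) has_field_derivative hh_kernel_x a m u x y) (at x)"
    unfolding hh_kernel_def hh_kernel_x_def c_def[symmetric] k_def[symmetric] E_def[symmetric]
    by (rule derivative_eq_intros b0 refl | simp add: algebra_simps)+
  show "((\<lambda>x. hh_kernel_x a m u x y) has_field_derivative hh_kernel_xx a m u x y) (at x)"
    unfolding hh_kernel_x_def hh_kernel_xx_def c_def[symmetric] k_def[symmetric] E_def[symmetric]
    by (rule derivative_eq_intros b0 b1 refl | simp add: algebra_simps power2_eq_square)+
qed

lemma hh_kernel_x_of_real:
  "a > 0 \<Longrightarrow> hh_kernel_x a m u (of_real x :: 'a::{real_normed_field,banach}) y = of_real (hh_kernel_x a m u x y)"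
  unfolding hh_kernel_x_def by (simp flip: bessel_of_real exp_of_real)

lemma hh_kernel_xx_of_real:
  "a > 0 \<Longrightarrow> hh_kernel_xx a m u (of_real x :: 'a::{real_normed_field,banach}) y = of_real (hh_kernel_xx a m u x y)"
  unfolding hh_kernel_xx_def by (simp flip: bessel_of_real exp_of_real)

lemma DERIV_rho: "u > 0 \<Longrightarrow> (rho has_real_derivative - (rho u * (1 + rho u))) (at u)"
proof -
  assume u: "u > 0"
  have nz: "exp u - 1 \<noteq> 0" using u by simp
  have "(rho has_real_derivative - exp u / (exp u - 1)\<^sup>2) (at u)"
    unfolding rho_def[abs_def] using nz by (auto intro!: derivative_eq_intros simp: power2_eq_square)
  also have "- exp u / (exp u - 1)\<^sup>2 = - (rho u * (1 + rho u))"
    using nz by (simp add: rho_def power2_eq_square field_simps)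
  finally show ?thesis .
qed

text \<open>Apart from exp (- m u), time enters only through rho, and rho' = - rho (1 + rho). After
  a common exponential factor is taken out, the claim is linear in the Bessel values at a, a + 1 and
  a + 2; Bessel's equation eliminates the last one and the other two coefficients agree.\<close>

lemma heat_equation_hh_kernel:
  fixes x :: real
  assumes a: "a > 0" and u: "u > 0"
  shows "((\<lambda>u. hh_kernel a m u x y) has_real_derivative
     x * hh_kernel_xx a m u x y + (a - x) * hh_kernel_x a m u x y - m * hh_kernel a m u x y) (at u)"
proof -
  define R where "R = rho u"
  have R: "R > 0" using rho_pos[OF u] by (simp add: R_def)
  have dR: "(rho has_real_derivative - (R * (1 + R))) (at u)" using DERIV_rho[OF u] by (simp add: R_def)
  define b0 b1 b2 where "b0 = bessel a (R * (1 + R) * y * x)" and "b1 = bessel (a + 1) (R * (1 + R) * y * x)"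
    and "b2 = bessel (a + 2) (R * (1 + R) * y * x)"
  define E where "E = exp (- (m * u)) * (1 + R) powr a * exp (- (R * y)) * exp (- (R * x))"
  have ode: "(R * (1 + R) * y * x) * b2 + a * b1 = b0"
    using bessel_ode[OF a, of "R * (1 + R) * y * x"] by (simp add: b0_def b1_def b2_def)
  have dpow: "((\<lambda>u. (1 + rho u) powr a) has_real_derivative - (a * R * (1 + R) powr a)) (at u)"
  proof -
    have "((\<lambda>u. (1 + rho u) powr a) has_real_derivative a * (1 + R) powr (a - 1) * (- (R * (1 + R)))) (at u)"
      using R by (auto intro!: derivative_eq_intros dR simp: R_def)
    also have "a * (1 + R) powr (a - 1) * (- (R * (1 + R))) = - (a * R * ((1 + R) powr (a - 1) * (1 + R)))" by simp
    also have "(1 + R) powr (a - 1) * (1 + R) = (1 + R) powr a" using R by (simp add: powr_diff)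
    finally show ?thesis .
  qed
  have db: "((\<lambda>u. bessel a (rho u * (1 + rho u) * y * x)) has_real_derivative
      b1 * (- (R * (1 + R)) * (1 + 2 * R) * y * x)) (at u)"
  proof -
    have "((\<lambda>u. rho u * (1 + rho u) * y * x) has_real_derivative (- (R * (1 + R)) * (1 + 2 * R) * y * x)) (at u)"
      by (rule derivative_eq_intros dR refl | simp add: R_def[symmetric] algebra_simps)+
    from DERIV_bessel_chain[OF a this] show ?thesis by (simp add: b1_def R_def)
  qed
  have de: "((\<lambda>u. exp (- (rho u * y)) * exp (- (rho u * x))) has_real_derivative
      (R * (1 + R)) * (x + y) * (exp (- (R * y)) * exp (- (R * x)))) (at u)"
    by (rule derivative_eq_intros dR refl | simp add: R_def[symmetric] algebra_simps)+
  have "((\<lambda>u. exp (- (m * u)) * (1 + rho u) powr a * (exp (- (rho u * y)) * exp (- (rho u * x))) * bessel a (rho u * (1 + rho u) * y * x))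
     has_real_derivative E * ((- m - a * R + R * (1 + R) * (x + y)) * b0 - b1 * (R * (1 + R) * (1 + 2 * R) * y * x))) (at u)"
    by (rule derivative_eq_intros dpow db de refl | simp add: R_def[symmetric] E_def b0_def algebra_simps)+
  also have "(\<lambda>u. exp (- (m * u)) * (1 + rho u) powr a * (exp (- (rho u * y)) * exp (- (rho u * x))) * bessel a (rho u * (1 + rho u) * y * x))
     = (\<lambda>u. hh_kernel a m u x y)"
    by (simp add: hh_kernel_def mult_ac)
  also have "E * ((- m - a * R + R * (1 + R) * (x + y)) * b0 - b1 * (R * (1 + R) * (1 + 2 * R) * y * x))
     = x * hh_kernel_xx a m u x y + (a - x) * hh_kernel_x a m u x y - m * hh_kernel a m u x y"
  proof -
    define c where "c = R * (1 + R) * y"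
    have ode': "c * x * b2 = b0 - a * b1" using ode by (simp add: c_def)
    have "x * hh_kernel_xx a m u x y + (a - x) * hh_kernel_x a m u x y - m * hh_kernel a m u x y
       = E * (x * (R\<^sup>2 * b0 - 2 * R * c * b1 + c\<^sup>2 * b2) + (a - x) * (c * b1 - R * b0) - m * b0)"
      by (simp add: hh_kernel_xx_def hh_kernel_x_def hh_kernel_def R_def[symmetric] E_def b0_def b1_def b2_def c_def algebra_simps)
    also have "x * (R\<^sup>2 * b0 - 2 * R * c * b1 + c\<^sup>2 * b2) = x * (R\<^sup>2 * b0 - 2 * R * c * b1) + c * (c * x * b2)"
      by (simp add: algebra_simps power2_eq_square)
    also have "\<dots> + (a - x) * (c * b1 - R * b0) - m * b0 = (- m - a * R + R * (1 + R) * (x + y)) * b0 - b1 * (R * (1 + R) * (1 + 2 * R) * y * x)"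
      unfolding ode' by (simp add: c_def algebra_simps power2_eq_square)
    finally show ?thesis by simp
  qed
  finally show ?thesis .
qed

lemma DERIV_poisson_weight:
  assumes "u > 0"
  shows "(poisson_weight \<nu> t has_real_derivative (t\<^sup>2 / (4 * u\<^sup>2) - (1 + \<nu>) / u) * poisson_weight \<nu> t u) (at u)"
proof -
  have e: "poisson_weight \<nu> t v = exp (- (t\<^sup>2 / (4 * v))) * v powr (- 1 - \<nu>)" for v
    using powr_minus_divide[of v "1 + \<nu>"] by (simp add: poisson_weight_def)
  have p: "u powr (- 1 - \<nu> - 1) = u powr (- 1 - \<nu>) / u" using assms powr_diff[of u "- 1 - \<nu>" 1] by simp
  have "((\<lambda>v. exp (- (t\<^sup>2 / (4 * v))) * v powr (- 1 - \<nu>)) has_real_derivative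
     exp (- (t\<^sup>2 / (4 * u))) * (t\<^sup>2 / (4 * u\<^sup>2)) * u powr (- 1 - \<nu>) + exp (- (t\<^sup>2 / (4 * u))) * ((- 1 - \<nu>) * u powr (- 1 - \<nu> - 1))) (at u)"
    using assms by (auto intro!: derivative_eq_intros simp: power2_eq_square)
  also have "exp (- (t\<^sup>2 / (4 * u))) * (t\<^sup>2 / (4 * u\<^sup>2)) * u powr (- 1 - \<nu>) + exp (- (t\<^sup>2 / (4 * u))) * ((- 1 - \<nu>) * u powr (- 1 - \<nu> - 1))
    = (t\<^sup>2 / (4 * u\<^sup>2) - (1 + \<nu>) / u) * poisson_weight \<nu> t u"
    unfolding p e using assms by (simp add: field_simps)
  finally show ?thesis unfolding e[abs_def] .
qed

lemma poisson_weight_hh_kernel_limits: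
  assumes a: "a > 0" and x: "x > 0" and t: "t > 0" and \<nu>: "\<nu> > 0" and m: "m \<ge> 0" and y: "y > 0"
  shows "((\<lambda>u. poisson_weight \<nu> t u * hh_kernel a m u x y) \<longlongrightarrow> 0) (at_right 0)"
    and "((\<lambda>u. poisson_weight \<nu> t u * hh_kernel a m u x y) \<longlongrightarrow> 0) at_top"
proof -
  \<comment> \<open>Half of the exponent t^2 / 4u is used for the bound of the integrand with s in
    place of t. The other half stays as exp (- t^2 / 8u) and forces the limit at 0; the power of 1 +
    u handles infinity.\<close>
  define s where "s = t / sqrt 2"
  have s: "s > 0" "s\<^sup>2 = t\<^sup>2 / 2" using t by (auto simp: s_def power_divide)
  obtain C where C: "C > 0" "\<And>m u y. u > 0 \<Longrightarrow> y \<ge> 0 \<Longrightarrow>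
    poisson_weight \<nu> s u * hh_kernel a m u x y \<le> C * ((1 + u) powr (- 1 - \<nu>) * exp (- (m * u)) * exp (- (exp (- u) * y / 4)))"
    using poisson_integrand_upper[OF a x s(1) \<nu>] by blast
  have nn: "poisson_weight \<nu> t u * hh_kernel a m u x y \<ge> 0" if "u > 0" for u
    using hh_kernel_nonneg[OF a that, of x y m] x y poisson_weight_nonneg[of \<nu> t u] by simp
  have up: "poisson_weight \<nu> t u * hh_kernel a m u x y \<le> C * (exp (- (t\<^sup>2 / (8 * u))) * (1 + u) powr (- 1 - \<nu>))" if u: "u > 0" for u
  proof -
    have "poisson_weight \<nu> t u = exp (- (t\<^sup>2 / (8 * u))) * poisson_weight \<nu> s u"
      using u by (simp add: poisson_weight_def s exp_add[symmetric] field_simps)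
    hence "poisson_weight \<nu> t u * hh_kernel a m u x y = exp (- (t\<^sup>2 / (8 * u))) * (poisson_weight \<nu> s u * hh_kernel a m u x y)" by simp
    also have "\<dots> \<le> exp (- (t\<^sup>2 / (8 * u))) * (C * ((1 + u) powr (- 1 - \<nu>) * exp (- (m * u)) * exp (- (exp (- u) * y / 4))))"
      using u y by (intro mult_left_mono C) auto
    also have "\<dots> \<le> exp (- (t\<^sup>2 / (8 * u))) * (C * ((1 + u) powr (- 1 - \<nu>) * 1 * 1))"
      using u y m C(1) by (intro mult_left_mono mult_mono) auto
    finally show ?thesis by (simp add: mult_ac)
  qed
  show "((\<lambda>u. poisson_weight \<nu> t u * hh_kernel a m u x y) \<longlongrightarrow> 0) (at_right 0)"
  proof (rule tendsto_sandwich[OF _ _ tendsto_const])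
    show "eventually (\<lambda>u. 0 \<le> poisson_weight \<nu> t u * hh_kernel a m u x y) (at_right 0)"
      using eventually_at_right_less[of 0] by eventually_elim (rule nn)
    show "eventually (\<lambda>u. poisson_weight \<nu> t u * hh_kernel a m u x y \<le> C * (exp (- (t\<^sup>2 / (8 * u))) * (1 + u) powr (- 1 - \<nu>))) (at_right 0)"
      using eventually_at_right_less[of 0] by eventually_elim (rule up)
    show "((\<lambda>u. C * (exp (- (t\<^sup>2 / (8 * u))) * (1 + u) powr (- 1 - \<nu>))) \<longlongrightarrow> 0) (at_right 0)"
      using t by real_asymp
  qed
  show "((\<lambda>u. poisson_weight \<nu> t u * hh_kernel a m u x y) \<longlongrightarrow> 0) at_top"
  proof (rule tendsto_sandwich[OF _ _ tendsto_const])
    show "eventually (\<lambda>u. 0 \<le> poisson_weight \<nu> t u * hh_kernel a m u x y) at_top"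
      using eventually_gt_at_top[of 0] by eventually_elim (rule nn)
    show "eventually (\<lambda>u. poisson_weight \<nu> t u * hh_kernel a m u x y \<le> C * (exp (- (t\<^sup>2 / (8 * u))) * (1 + u) powr (- 1 - \<nu>))) at_top"
      using eventually_gt_at_top[of 0] by eventually_elim (rule up)
    show "((\<lambda>u. C * (exp (- (t\<^sup>2 / (8 * u))) * (1 + u) powr (- 1 - \<nu>))) \<longlongrightarrow> 0) at_top"
      using t \<nu> by real_asymp
  qed
qed

text \<open>The logarithmic derivative is X = 2 \<nu> / t - t / (2 u), and the second derivative is
  (X^2 + X') times the factor; keeping this form makes the cancellation in the differential equation
  a rational identity.\<close>

lemma DERIV_poisson_t_factor:
  assumes t: "Re t > 0" and u: "fst w > 0"
  shows "((\<lambda>t. poisson_t_factor \<nu> t w) has_field_derivative (of_real (2 * \<nu>) / t - t / (2 * of_real (fst w))) * poisson_t_factor \<nu> t w) (at t)"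
    and "((\<lambda>t. (of_real (2 * \<nu>) / t - t / (2 * of_real (fst w))) * poisson_t_factor \<nu> t w) has_field_derivative
      ((of_real (2 * \<nu>) / t - t / (2 * of_real (fst w)))\<^sup>2 - of_real (2 * \<nu>) / t\<^sup>2 - 1 / (2 * of_real (fst w))) * poisson_t_factor \<nu> t w) (at t)"
proof -
  define U :: complex where "U = of_real (fst w)"
  have U: "U \<noteq> 0" using u by (simp add: U_def)
  have t0: "t \<noteq> 0" "t \<notin> \<real>\<^sub>\<le>\<^sub>0" using t by (auto simp: complex_nonpos_Reals_iff)
  have p: "((\<lambda>t. t powr of_real (2 * \<nu>)) has_field_derivative of_real (2 * \<nu>) / t * t powr of_real (2 * \<nu>)) (at t)"
    using has_field_derivative_powr[OF t0(2), of "of_real (2 * \<nu>)"] t0 by (simp add: powr_diff)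
  have e: "((\<lambda>t. exp (- (t\<^sup>2 / (4 * U)))) has_field_derivative - (t / (2 * U)) * exp (- (t\<^sup>2 / (4 * U)))) (at t)"
    using U by (auto intro!: derivative_eq_intros)
  show 1: "((\<lambda>t. poisson_t_factor \<nu> t w) has_field_derivative (of_real (2 * \<nu>) / t - t / (2 * of_real (fst w))) * poisson_t_factor \<nu> t w) (at t)"
  proof -
    define V where "V = complex_of_real (1 / fst w powr (1 + \<nu>))"
    show ?thesis unfolding poisson_t_factor_def U_def[symmetric] V_def[symmetric]
      by (rule DERIV_cong[OF DERIV_mult[OF p DERIV_cmult_right[OF e]]]) (simp add: algebra_simps)
  qed
  have q: "((\<lambda>t. of_real (2 * \<nu>) / t - t / (2 * of_real (fst w))) has_field_derivative
      (- of_real (2 * \<nu>) / t\<^sup>2 - 1 / (2 * of_real (fst w)))) (at t)"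
    using t0 u by (auto intro!: derivative_eq_intros simp: power2_eq_square)
  show "((\<lambda>t. (of_real (2 * \<nu>) / t - t / (2 * of_real (fst w))) * poisson_t_factor \<nu> t w) has_field_derivative
      ((of_real (2 * \<nu>) / t - t / (2 * of_real (fst w)))\<^sup>2 - of_real (2 * \<nu>) / t\<^sup>2 - 1 / (2 * of_real (fst w))) * poisson_t_factor \<nu> t w) (at t)"
  proof (rule DERIV_cong[OF DERIV_mult[OF q 1]])
    have "(- n / d - k) * z + X * z * X = (X\<^sup>2 - n / d - k) * z" for n d k z X :: complex
      by (simp add: algebra_simps power2_eq_square)
    thus "(- of_real (2 * \<nu>) / t\<^sup>2 - 1 / (2 * of_real (fst w))) * poisson_t_factor \<nu> t w
        + (of_real (2 * \<nu>) / t - t / (2 * of_real (fst w))) * poisson_t_factor \<nu> t w * (of_real (2 * \<nu>) / t - t / (2 * of_real (fst w)))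
        = ((of_real (2 * \<nu>) / t - t / (2 * of_real (fst w)))\<^sup>2 - of_real (2 * \<nu>) / t\<^sup>2 - 1 / (2 * of_real (fst w))) * poisson_t_factor \<nu> t w" .
  qed
qed

lemma deriv_poisson_t_factor:
  assumes t: "Re t > 0" and u: "fst w > 0"
  shows "deriv (\<lambda>t. poisson_t_factor \<nu> t w) t = (of_real (2 * \<nu>) / t - t / (2 * of_real (fst w))) * poisson_t_factor \<nu> t w"
    and "deriv (\<lambda>t. deriv (\<lambda>t. poisson_t_factor \<nu> t w) t) t =
      ((of_real (2 * \<nu>) / t - t / (2 * of_real (fst w)))\<^sup>2 - of_real (2 * \<nu>) / t\<^sup>2 - 1 / (2 * of_real (fst w))) * poisson_t_factor \<nu> t w"
proof -
  show "deriv (\<lambda>t. poisson_t_factor \<nu> t w) t = (of_real (2 * \<nu>) / t - t / (2 * of_real (fst w))) * poisson_t_factor \<nu> t w"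
    by (rule DERIV_imp_deriv[OF DERIV_poisson_t_factor(1)[OF assms]])
  have "((\<lambda>t. deriv (\<lambda>t. poisson_t_factor \<nu> t w) t) has_field_derivative
    ((of_real (2 * \<nu>) / t - t / (2 * of_real (fst w)))\<^sup>2 - of_real (2 * \<nu>) / t\<^sup>2 - 1 / (2 * of_real (fst w))) * poisson_t_factor \<nu> t w) (at t)"
    by (rule has_field_derivative_transform_within_open[OF DERIV_poisson_t_factor(2)[OF assms] open_halfspace_Re_gt[of 0]])
       (use t in \<open>auto simp: DERIV_imp_deriv[OF DERIV_poisson_t_factor(1)[OF _ u]]\<close>)
  thus "deriv (\<lambda>t. deriv (\<lambda>t. poisson_t_factor \<nu> t w) t) t =
      ((of_real (2 * \<nu>) / t - t / (2 * of_real (fst w)))\<^sup>2 - of_real (2 * \<nu>) / t\<^sup>2 - 1 / (2 * of_real (fst w))) * poisson_t_factor \<nu> t w"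
    by (rule DERIV_imp_deriv)
qed

lemma deriv_poisson_x_factor:
  assumes \<alpha>: "\<alpha> > -1"
  shows "deriv (\<lambda>x. poisson_x_factor \<alpha> m f x w) x = hh_kernel_x (\<alpha> + 1) m (fst w) x (snd w) * (of_real (snd w powr \<alpha> * exp (- snd w)) * f (snd w))"
    and "deriv (\<lambda>x. deriv (\<lambda>x. poisson_x_factor \<alpha> m f x w) x) x = hh_kernel_xx (\<alpha> + 1) m (fst w) x (snd w) * (of_real (snd w powr \<alpha> * exp (- snd w)) * f (snd w))"
proof -
  have a: "\<alpha> + 1 > 0" using \<alpha> by simp
  have 1: "deriv (\<lambda>x. poisson_x_factor \<alpha> m f x w) x = hh_kernel_x (\<alpha> + 1) m (fst w) x (snd w) * (of_real (snd w powr \<alpha> * exp (- snd w)) * f (snd w))" for x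
    unfolding poisson_x_factor_def by (rule DERIV_imp_deriv, rule DERIV_cmult_right, rule DERIV_hh_kernel(1)[OF a])
  show "deriv (\<lambda>x. poisson_x_factor \<alpha> m f x w) x = hh_kernel_x (\<alpha> + 1) m (fst w) x (snd w) * (of_real (snd w powr \<alpha> * exp (- snd w)) * f (snd w))" by (rule 1)
  show "deriv (\<lambda>x. deriv (\<lambda>x. poisson_x_factor \<alpha> m f x w) x) x = hh_kernel_xx (\<alpha> + 1) m (fst w) x (snd w) * (of_real (snd w powr \<alpha> * exp (- snd w)) * f (snd w))"
    unfolding 1 by (rule DERIV_imp_deriv, rule DERIV_cmult_right, rule DERIV_hh_kernel(2)[OF a])
qed

text \<open>With all terms on one side, the integrand is the u-derivative of weight times kernel,
  multiplied by a function of y. Integrated in u first, it gives 0 because the product vanishes at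
  both ends.\<close>

lemma poisson_pde_integral:
  fixes t x :: real
  assumes \<alpha>: "\<alpha> > -1" and m: "m \<ge> 0" and \<nu>: "\<nu> > 0" and L: "normalized_laguerre \<alpha> L"
    and f: "f \<in> L1_Phi \<alpha> m \<nu>" and t: "t > 0" and x: "x > 0"
  defines "P \<equiv> lebesgue_on {0::real<..} \<Otimes>\<^sub>M lebesgue_on {0::real<..}"
  defines "A \<equiv> poisson_t_factor \<nu>" and "B \<equiv> poisson_x_factor \<alpha> m f"
  defines "A1 \<equiv> \<lambda>t w. deriv (\<lambda>t. A t w) t" and "B1 \<equiv> \<lambda>x w. deriv (\<lambda>x. B x w) x"
  defines "A2 \<equiv> \<lambda>t w. deriv (\<lambda>t. A1 t w) t" and "B2 \<equiv> \<lambda>x w. deriv (\<lambda>x. B1 x w) x"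
  defines "T \<equiv> complex_of_real t" and "X \<equiv> complex_of_real x"
  shows "(\<integral>w. A2 T w * B X w \<partial>P) + of_real ((1 - 2 * \<nu>) / t) * (\<integral>w. A1 T w * B X w \<partial>P)
    = - (of_real x * (\<integral>w. A T w * B2 X w \<partial>P)) - of_real (\<alpha> + 1 - x) * (\<integral>w. A T w * B1 X w \<partial>P)
      + of_real m * (\<integral>w. A T w * B X w \<partial>P)"
proof -
  let ?R = "lebesgue_on {0::real<..}"
  interpret R: sigma_finite_measure ?R by (rule sigma_finite_Ioi)
  interpret PS: pair_sigma_finite ?R ?R ..
  have a: "\<alpha> + 1 > 0" using \<alpha> by simp
  have D: "(T, X) \<in> poisson_domain" unfolding T_def X_def by (rule poisson_domain_of_real[OF t x])
  have d00: "dominated_product P {t. Re t > 0} poisson_domain A B" unfolding P_def A_def B_def by (rule dominated_product_poisson[OF \<alpha> m \<nu> L f])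
  have d10: "dominated_product P {t. Re t > 0} poisson_domain A1 B" unfolding A1_def by (rule dominated_product_deriv1[OF d00])
  have d20: "dominated_product P {t. Re t > 0} poisson_domain A2 B" unfolding A2_def by (rule dominated_product_deriv1[OF d10])
  have d01: "dominated_product P {t. Re t > 0} poisson_domain A B1" unfolding B1_def by (rule dominated_product_deriv2[OF d00])
  have d02: "dominated_product P {t. Re t > 0} poisson_domain A B2" unfolding B2_def by (rule dominated_product_deriv2[OF d01])
  note int = dominated_product_integrable[OF d00 D] dominated_product_integrable[OF d10 D] dominated_product_integrable[OF d20 D]
     dominated_product_integrable[OF d01 D] dominated_product_integrable[OF d02 D]
  \<comment> \<open>The difference of both sides of the equation before integration. It is
    integrable as a combination of dominated products, which is what allows Fubini; the single
    u-derivative need not be estimated directly.\<close>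
  define H where "H w = A2 T w * B X w + of_real ((1 - 2 * \<nu>) / t) * (A1 T w * B X w)
    + of_real x * (A T w * B2 X w) + of_real (\<alpha> + 1 - x) * (A T w * B1 X w) - of_real m * (A T w * B X w)" for w
  have intH: "integrable P H" unfolding H_def
    by (intro Bochner_Integration.integrable_add Bochner_Integration.integrable_diff integrable_mult_right int)
  have H_int: "(\<integral>w. H w \<partial>P) = (\<integral>w. A2 T w * B X w \<partial>P) + of_real ((1 - 2 * \<nu>) / t) * (\<integral>w. A1 T w * B X w \<partial>P)
    + of_real x * (\<integral>w. A T w * B2 X w \<partial>P) + of_real (\<alpha> + 1 - x) * (\<integral>w. A T w * B1 X w \<partial>P)
      - of_real m * (\<integral>w. A T w * B X w \<partial>P)"
    unfolding H_def
    by (simp only: Bochner_Integration.integral_add Bochner_Integration.integral_diff integral_mult_right_zero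
        Bochner_Integration.integrable_add Bochner_Integration.integrable_diff integrable_mult_right int)
  define G' where "G' u y = (t\<^sup>2 / (4 * u\<^sup>2) - (1 + \<nu>) / u) * poisson_weight \<nu> t u * hh_kernel (\<alpha> + 1) m u x y
     + (x * hh_kernel_xx (\<alpha> + 1) m u x y + (\<alpha> + 1 - x) * hh_kernel_x (\<alpha> + 1) m u x y - m * hh_kernel (\<alpha> + 1) m u x y) * poisson_weight \<nu> t u" for u y
  have H_eq: "H (u, y) = of_real (t powr (2 * \<nu>) * G' u y) * (of_real (y powr \<alpha> * exp (- y)) * f y)" if u: "u > 0" for u y
  proof -
    define k where "k = of_real (y powr \<alpha> * exp (- y)) * f y"
    define q where "q = t powr (2 * \<nu>) * poisson_weight \<nu> t u"
    have A0: "A T (u, y) = of_real q" unfolding A_def T_def q_def poisson_t_factor_of_real[OF t] by simp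
    have A1': "A1 T (u, y) = of_real ((2 * \<nu> / t - t / (2 * u)) * q)"
      using deriv_poisson_t_factor(1)[of T "(u, y)" \<nu>] u t A0 by (simp add: A1_def A_def T_def)
    have A2': "A2 T (u, y) = of_real (((2 * \<nu> / t - t / (2 * u))\<^sup>2 - 2 * \<nu> / t\<^sup>2 - 1 / (2 * u)) * q)"
      using deriv_poisson_t_factor(2)[of T "(u, y)" \<nu>] u t A0 by (simp add: A2_def A1_def A_def T_def)
    have B0: "B X (u, y) = of_real (hh_kernel (\<alpha> + 1) m u x y) * k"
      by (simp add: B_def poisson_x_factor_def X_def hh_kernel_of_real[OF a] k_def)
    have B1': "B1 X (u, y) = of_real (hh_kernel_x (\<alpha> + 1) m u x y) * k"
      using deriv_poisson_x_factor(1)[OF \<alpha>, of m f "(u, y)" X] by (simp add: B1_def B_def X_def hh_kernel_x_of_real[OF a] k_def)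
    have B2': "B2 X (u, y) = of_real (hh_kernel_xx (\<alpha> + 1) m u x y) * k"
      using deriv_poisson_x_factor(2)[OF \<alpha>, of m f "(u, y)" X] by (simp add: B2_def B1_def B_def X_def hh_kernel_xx_of_real[OF a] k_def)
    define l0 l1 l2 where "l0 = hh_kernel (\<alpha> + 1) m u x y" and "l1 = hh_kernel_x (\<alpha> + 1) m u x y" and "l2 = hh_kernel_xx (\<alpha> + 1) m u x y"
    have "H (u, y) = of_real (((2 * \<nu> / t - t / (2 * u))\<^sup>2 - 2 * \<nu> / t\<^sup>2 - 1 / (2 * u)) * q * l0
       + (1 - 2 * \<nu>) / t * ((2 * \<nu> / t - t / (2 * u)) * q * l0)
       + x * (q * l2) + (\<alpha> + 1 - x) * (q * l1) - m * (q * l0)) * k"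
      unfolding H_def A0 A1' A2' B0 B1' B2' l0_def[symmetric] l1_def[symmetric] l2_def[symmetric]
      by (simp only: of_real_add of_real_diff of_real_mult) (simp add: algebra_simps)
    also have "((2 * \<nu> / t - t / (2 * u))\<^sup>2 - 2 * \<nu> / t\<^sup>2 - 1 / (2 * u)) * q * l0
       + (1 - 2 * \<nu>) / t * ((2 * \<nu> / t - t / (2 * u)) * q * l0)
       = (((2 * \<nu> / t - t / (2 * u))\<^sup>2 - 2 * \<nu> / t\<^sup>2 - 1 / (2 * u)) + (1 - 2 * \<nu>) / t * (2 * \<nu> / t - t / (2 * u))) * q * l0"
      by (simp add: algebra_simps)
    \<comment> \<open>The t-operator applied to the weight gives its logarithmic derivative in u.
      The terms in 1 / t^2 cancel exactly because the first-order coefficient is 1 - 2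
      \<nu>.\<close>
    also have "((2 * \<nu> / t - t / (2 * u))\<^sup>2 - 2 * \<nu> / t\<^sup>2 - 1 / (2 * u)) + (1 - 2 * \<nu>) / t * (2 * \<nu> / t - t / (2 * u))
       = t\<^sup>2 / (4 * u\<^sup>2) - (1 + \<nu>) / u"
      using t u by (simp add: field_simps power2_eq_square)
    also have "(t\<^sup>2 / (4 * u\<^sup>2) - (1 + \<nu>) / u) * q * l0 + x * (q * l2) + (\<alpha> + 1 - x) * (q * l1) - m * (q * l0)
       = t powr (2 * \<nu>) * G' u y"
      by (simp add: G'_def q_def l0_def l1_def l2_def algebra_simps)
    finally show ?thesis by (simp add: k_def)
  qed
  \<comment> \<open>Fubini controls the sections only for almost every y. Where a section is not
    integrable its Bochner integral is 0 by convention, so the identity holds for every y > 0. The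
    case f y \<noteq> 0 is needed to pass integrability from the section to the real
    derivative.\<close>
  have inner: "(\<integral>u. H (u, y) \<partial>?R) = 0" if y: "y > 0" for y
  proof (cases "integrable ?R (\<lambda>u. H (u, y)) \<and> f y \<noteq> 0")
    case True
    define k where "k = of_real (t powr (2 * \<nu>)) * (of_real (y powr \<alpha> * exp (- y)) * f y)"
    have k: "k \<noteq> 0" using True t y by (simp add: k_def)
    have eq: "integrable ?R (\<lambda>u. H (u, y)) = integrable ?R (\<lambda>u. k * of_real (G' u y))"
      by (intro Bochner_Integration.integrable_cong refl) (auto simp: H_eq k_def)
    have "integrable ?R (\<lambda>u. (1 / k) * (k * of_real (G' u y)))"
      by (rule integrable_mult_right) (use True eq in blast)
    moreover have "(\<lambda>u. (1 / k) * (k * complex_of_real (G' u y))) = (\<lambda>u. complex_of_real (G' u y))"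
      using k by (simp add: fun_eq_iff)
    ultimately have "integrable ?R (\<lambda>u. complex_of_real (G' u y))" by (simp only:)
    from integrable_Re[OF this] have iG: "integrable ?R (\<lambda>u. G' u y)" by simp
    have "(\<integral>u. G' u y \<partial>?R) = 0"
    proof (rule integral_deriv_Ioi_zero[OF _ iG])
      show "((\<lambda>u. poisson_weight \<nu> t u * hh_kernel (\<alpha> + 1) m u x y) has_real_derivative G' u y) (at u)" if "u > 0" for u
        using DERIV_mult[OF DERIV_poisson_weight[OF that] heat_equation_hh_kernel[OF a that]] by (simp add: G'_def)
    qed (rule poisson_weight_hh_kernel_limits[OF a x t \<nu> m y])+
    moreover have "(\<integral>u. H (u, y) \<partial>?R) = (\<integral>u. k * of_real (G' u y) \<partial>?R)"
      by (intro Bochner_Integration.integral_cong refl) (auto simp: H_eq k_def)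
    ultimately show ?thesis by simp
  next
    case False
    have "f y = 0 \<Longrightarrow> (\<integral>u. H (u, y) \<partial>?R) = (\<integral>u. 0 \<partial>?R)"
      by (intro Bochner_Integration.integral_cong refl) (auto simp: H_eq)
    thus ?thesis using False not_integrable_integral_eq[of ?R "\<lambda>u. H (u, y)"] by auto
  qed
  have "(\<integral>w. H w \<partial>P) = (\<integral>y. (\<integral>u. H (u, y) \<partial>?R) \<partial>?R)"
    using PS.integral_snd[of "\<lambda>u y. H (u, y)"] intH by (simp add: P_def)
  also have "\<dots> = (\<integral>y. 0 \<partial>?R)"
    by (intro Bochner_Integration.integral_cong refl inner) simp
  finally have "(\<integral>w. H w \<partial>P) = 0" by simp
  thus ?thesis unfolding H_int by (simp add: algebra_simps add_eq_0_iff)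
qed

lemma dominated_product_vector_derivatives:
  assumes "dominated_product M S poisson_domain A B" "t > 0" "x > 0"
  shows "((\<lambda>t. \<integral>w. A (of_real t) w * B (of_real x) w \<partial>M) has_vector_derivative
      (\<integral>w. deriv (\<lambda>t. A t w) (of_real t) * B (of_real x) w \<partial>M)) (at t)"
    and "((\<lambda>x. \<integral>w. A (of_real t) w * B (of_real x) w \<partial>M) has_vector_derivative
      (\<integral>w. A (of_real t) w * deriv (\<lambda>x. B x w) (of_real x) \<partial>M)) (at x)"
  using has_vector_derivative_real_field[OF dominated_product_DERIV1[OF assms(1) poisson_domain_of_real[OF assms(2,3)]]]
    has_vector_derivative_real_field[OF dominated_product_DERIV2[OF assms(1) poisson_domain_of_real[OF assms(2,3)]]] by simp_all

lemma vector_derivatives_transform: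
  assumes eq: "\<And>s. s > (0::real) \<Longrightarrow> g s = c *\<^sub>R U s"
    and d1: "\<And>s. s > 0 \<Longrightarrow> (U has_vector_derivative U1 s) (at s)"
    and d2: "\<And>s. s > 0 \<Longrightarrow> (U1 has_vector_derivative U2 s) (at s)" and t: "t > 0"
  shows "vector_derivative g (at t) = c *\<^sub>R U1 t"
    and "vector_derivative (\<lambda>s. vector_derivative g (at s)) (at t) = c *\<^sub>R U2 t"
proof -
  have 1: "(g has_vector_derivative c *\<^sub>R U1 s) (at s)" if "s > 0" for s
    by (rule has_vector_derivative_transform_within_open[of "\<lambda>s. c *\<^sub>R U s" _ _ "{0<..}"])
       (use that eq d1[OF that] in \<open>auto intro!: derivative_eq_intros\<close>)
  hence vd: "vector_derivative g (at s) = c *\<^sub>R U1 s" if "s > 0" for s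
    using that by (intro vector_derivative_at)
  show "vector_derivative g (at t) = c *\<^sub>R U1 t" by (rule vd[OF t])
  have "((\<lambda>s. vector_derivative g (at s)) has_vector_derivative c *\<^sub>R U2 t) (at t)"
    by (rule has_vector_derivative_transform_within_open[of "\<lambda>s. c *\<^sub>R U1 s" _ _ "{0<..}"])
       (use t vd d2[OF t] in \<open>auto intro!: derivative_eq_intros\<close>)
  thus "vector_derivative (\<lambda>s. vector_derivative g (at s)) (at t) = c *\<^sub>R U2 t"
    by (rule vector_derivative_at)
qed

lemma poisson_integral_pde:
  assumes \<alpha>: "\<alpha> > -1" and m: "m \<ge> 0" and \<nu>: "\<nu> > 0" and L: "normalized_laguerre \<alpha> L"
    and f: "f \<in> L1_Phi \<alpha> m \<nu>" and t: "t > 0" and x: "x > 0"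
  shows "vector_derivative (\<lambda>s. vector_derivative (\<lambda>r. poisson_integral \<alpha> m \<nu> L r f x) (at s)) (at t)
           + ((1 - 2 * \<nu>) / t) *\<^sub>R vector_derivative (\<lambda>s. poisson_integral \<alpha> m \<nu> L s f x) (at t)
           = laguerre_op \<alpha> m (\<lambda>z. poisson_integral \<alpha> m \<nu> L t f z) x"
proof -
  define P where "P = lebesgue_on {0::real<..} \<Otimes>\<^sub>M lebesgue_on {0::real<..}"
  define A B where "A = poisson_t_factor \<nu>" and "B = poisson_x_factor \<alpha> m f"
  define A1 B1 where "A1 = (\<lambda>t w. deriv (\<lambda>t. A t w) t)" and "B1 = (\<lambda>x w. deriv (\<lambda>x. B x w) x)"
  define A2 B2 where "A2 = (\<lambda>t w. deriv (\<lambda>t. A1 t w) t)" and "B2 = (\<lambda>x w. deriv (\<lambda>x. B1 x w) x)"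
  define c where "c = 1 / (4 powr \<nu> * Gamma \<nu>)"
  have d00: "dominated_product P {t. Re t > 0} poisson_domain A B" unfolding P_def A_def B_def by (rule dominated_product_poisson[OF \<alpha> m \<nu> L f])
  have d10: "dominated_product P {t. Re t > 0} poisson_domain A1 B" unfolding A1_def by (rule dominated_product_deriv1[OF d00])
  have d01: "dominated_product P {t. Re t > 0} poisson_domain A B1" unfolding B1_def by (rule dominated_product_deriv2[OF d00])
  have eq: "poisson_integral \<alpha> m \<nu> L s f z = c *\<^sub>R (\<integral>w. A (of_real s) w * B (of_real z) w \<partial>P)" if "s > 0" "z > 0" for s z
    using poisson_integral_eq_complex[OF \<alpha> m \<nu> L f that] by (simp add: c_def A_def B_def P_def)
  have T: "vector_derivative (\<lambda>s. poisson_integral \<alpha> m \<nu> L s f x) (at t) = c *\<^sub>R (\<integral>w. A1 (of_real t) w * B (of_real x) w \<partial>P)"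
     "vector_derivative (\<lambda>s. vector_derivative (\<lambda>r. poisson_integral \<alpha> m \<nu> L r f x) (at s)) (at t)
        = c *\<^sub>R (\<integral>w. A2 (of_real t) w * B (of_real x) w \<partial>P)"
    using vector_derivatives_transform[of "\<lambda>s. poisson_integral \<alpha> m \<nu> L s f x" c "\<lambda>s. \<integral>w. A (of_real s) w * B (of_real x) w \<partial>P"
       "\<lambda>s. \<integral>w. A1 (of_real s) w * B (of_real x) w \<partial>P" "\<lambda>s. \<integral>w. A2 (of_real s) w * B (of_real x) w \<partial>P" t]
       eq x t dominated_product_vector_derivatives(1)[OF d00] dominated_product_vector_derivatives(1)[OF d10]
    unfolding A1_def A2_def by blast+
  have X: "vector_derivative (\<lambda>z. poisson_integral \<alpha> m \<nu> L t f z) (at x) = c *\<^sub>R (\<integral>w. A (of_real t) w * B1 (of_real x) w \<partial>P)"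
     "vector_derivative (\<lambda>s. vector_derivative (\<lambda>z. poisson_integral \<alpha> m \<nu> L t f z) (at s)) (at x)
        = c *\<^sub>R (\<integral>w. A (of_real t) w * B2 (of_real x) w \<partial>P)"
    using vector_derivatives_transform[of "\<lambda>z. poisson_integral \<alpha> m \<nu> L t f z" c "\<lambda>s. \<integral>w. A (of_real t) w * B (of_real s) w \<partial>P"
       "\<lambda>s. \<integral>w. A (of_real t) w * B1 (of_real s) w \<partial>P" "\<lambda>s. \<integral>w. A (of_real t) w * B2 (of_real s) w \<partial>P" x]
       eq x t dominated_product_vector_derivatives(2)[OF d00] dominated_product_vector_derivatives(2)[OF d01]
    unfolding B1_def B2_def by blast+
  have "(\<integral>w. A2 (of_real t) w * B (of_real x) w \<partial>P) + of_real ((1 - 2 * \<nu>) / t) * (\<integral>w. A1 (of_real t) w * B (of_real x) w \<partial>P)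
    = - (of_real x * (\<integral>w. A (of_real t) w * B2 (of_real x) w \<partial>P)) - of_real (\<alpha> + 1 - x) * (\<integral>w. A (of_real t) w * B1 (of_real x) w \<partial>P)
      + of_real m * (\<integral>w. A (of_real t) w * B (of_real x) w \<partial>P)"
    unfolding P_def A1_def A2_def B1_def B2_def A_def B_def by (rule poisson_pde_integral[OF \<alpha> m \<nu> L f t x])
  from arg_cong[OF this, of "\<lambda>z. of_real c * z"] show ?thesis
    unfolding laguerre_op_def T X eq[OF t x] scaleR_conv_of_real by (simp only: ring_distribs) (simp add: mult_ac)
qed

section \<open>Boundary values\<close>

text \<open>Expanding the Bessel series shows the kernel, up to exp (- m u), as a mixture of Gamma
  densities of shape k + a and rate 1 + rho u with Poisson weights of mean rho u * x. The
  \<open>pochhammer\<close> is the j-th moment of the Gamma law up to the power of the rate; all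
  terms are nonnegative, so termwise integration is monotone convergence.\<close>

lemma hh_kernel_moment:
  assumes a: "a > 0" and u: "u > 0" and x: "x > 0"
    and S: "(\<lambda>k. (rho u * x) ^ k / fact k * pochhammer (real k + a) j) sums S"
  shows "has_bochner_integral (lebesgue_on {0<..}) (\<lambda>y. hh_kernel a m u x y * (y powr (a - 1) * exp (- y)) * y ^ j)
     (exp (- (m * u)) * exp (- (rho u * x)) / (1 + rho u) ^ j * S)"
proof -
  define R where "R = 1 + rho u"
  have R: "R > 0" using rho_pos[OF u] by (simp add: R_def)
  define E where "E = exp (- (m * u)) * R powr a * exp (- (rho u * x))"
  define d where "d = rho u * R * x"
  have d: "d \<ge> 0" using rho_pos[OF u] R x by (simp add: d_def)
  define T where "T k y = E * bessel_coeff a k * d ^ k * (y powr ((real k + real j + a) - 1) * exp (- (R * y)))" for k y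
  define c where "c = exp (- (m * u)) * exp (- (rho u * x)) / R ^ j"
  have T0: "T k y \<ge> 0" for k y using bessel_coeff_pos[OF a, of k] d by (simp add: T_def E_def)
  have Tm [measurable]: "T k \<in> borel_measurable (lebesgue_on {0<..})" for k
    unfolding T_def by measurable
  have TI: "(\<integral>\<^sup>+y. ennreal (T k y) \<partial>lebesgue_on {0<..}) = ennreal (c * ((rho u * x) ^ k / fact k * pochhammer (real k + a) j))" for k
  proof -
    have hb: "has_bochner_integral (lebesgue_on {0<..}) (T k) (E * bessel_coeff a k * d ^ k * (Gamma (real k + real j + a) * R powr (- (real k + real j + a))))"
      unfolding T_def using a R by (intro has_bochner_integral_mult_right has_bochner_integral_gamma_scaled) auto
    have G: "Gamma (real k + a) > 0" using a by (auto intro!: Gamma_real_pos)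
    have "real k + a \<notin> \<int>\<^sub>\<le>\<^sub>0" using a by (auto elim!: nonpos_Ints_cases)
    hence "Gamma (real k + real j + a) = pochhammer (real k + a) j * Gamma (real k + a)"
      using pochhammer_Gamma[of "real k + a" j] G by (simp add: add_ac)
    moreover have "R powr (- (real k + real j + a)) = R powr (- a) / (R ^ k * R ^ j)"
    proof -
      have "R powr (- (real k + real j + a)) = 1 / R powr (real k + real j + a)" by (rule powr_minus_divide)
      also have "R powr (real k + real j + a) = R ^ k * R ^ j * R powr a" using R by (simp add: powr_add powr_realpow)
      finally show ?thesis by (simp add: powr_minus_divide)
    qed
    moreover have "d ^ k = (rho u * x) ^ k * R ^ k" by (simp add: d_def power_mult_distrib)
    moreover have "R powr a * R powr (- a) = 1" using R by (simp add: powr_minus)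
    ultimately have "E * bessel_coeff a k * d ^ k * (Gamma (real k + real j + a) * R powr (- (real k + real j + a)))
       = c * ((rho u * x) ^ k / fact k * pochhammer (real k + a) j)"
      using G R by (simp add: E_def bessel_coeff_def c_def powr_minus field_simps)
    thus ?thesis using nn_integral_eq_integral[of "lebesgue_on {0<..}" "T k"] hb T0
      by (simp add: has_bochner_integral_iff)
  qed
  have sumT: "(\<lambda>k. T k y) sums (hh_kernel a m u x y * (y powr (a - 1) * exp (- y)) * y ^ j)" if y: "y > 0" for y
  proof -
    have "(\<lambda>k. (E * exp (- (rho u * y))) * (of_real (bessel_coeff a k) * (d * y) ^ k) * ((y powr (a - 1) * exp (- y)) * y ^ j)) sums
       ((E * exp (- (rho u * y))) * bessel a (d * y) * ((y powr (a - 1) * exp (- y)) * y ^ j))"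
      by (intro sums_mult2 sums_mult bessel_sums a)
    also have "(\<lambda>k. (E * exp (- (rho u * y))) * (of_real (bessel_coeff a k) * (d * y) ^ k) * ((y powr (a - 1) * exp (- y)) * y ^ j)) = (\<lambda>k. T k y)"
    proof
      fix k
      have "y powr ((real k + real j + a) - 1) = y ^ k * y ^ j * y powr (a - 1)"
        using y by (simp add: powr_realpow[symmetric] powr_add[symmetric] algebra_simps)
      moreover have "exp (- (R * y)) = exp (- (rho u * y)) * exp (- y)"
        by (simp add: R_def exp_add[symmetric] algebra_simps)
      ultimately show "(E * exp (- (rho u * y))) * (of_real (bessel_coeff a k) * (d * y) ^ k) * ((y powr (a - 1) * exp (- y)) * y ^ j) = T k y"
        by (simp add: T_def power_mult_distrib mult_ac)
    qed
    also have "(E * exp (- (rho u * y))) * bessel a (d * y) = hh_kernel a m u x y"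
      by (simp add: hh_kernel_def E_def R_def d_def mult_ac)
    finally show ?thesis by (simp add: mult_ac)
  qed
  have pos: "hh_kernel a m u x y * (y powr (a - 1) * exp (- y)) * y ^ j \<ge> 0" if "y > 0" for y
    using hh_kernel_nonneg[OF a u, of x y m] x that by simp
  have "(\<integral>\<^sup>+y. ennreal (hh_kernel a m u x y * (y powr (a - 1) * exp (- y)) * y ^ j) \<partial>lebesgue_on {0<..})
      = (\<integral>\<^sup>+y. (\<Sum>k. ennreal (T k y)) \<partial>lebesgue_on {0<..})"
    by (intro nn_integral_cong suminf_ennreal_eq[symmetric] T0 sumT) auto
  also have "\<dots> = (\<Sum>k. \<integral>\<^sup>+y. ennreal (T k y) \<partial>lebesgue_on {0<..})"
    by (rule nn_integral_suminf) measurable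
  also have "\<dots> = (\<Sum>k. ennreal (c * ((rho u * x) ^ k / fact k * pochhammer (real k + a) j)))"
    unfolding TI ..
  also have "\<dots> = ennreal (c * S)"
    using rho_pos[OF u] x a R
    by (intro suminf_ennreal_eq sums_mult S mult_nonneg_nonneg pochhammer_nonneg divide_nonneg_nonneg) (auto simp: c_def)
  finally have nn: "(\<integral>\<^sup>+y. ennreal (hh_kernel a m u x y * (y powr (a - 1) * exp (- y)) * y ^ j) \<partial>lebesgue_on {0<..}) = ennreal (c * S)" .
  have S0: "S \<ge> 0"
    using rho_pos[OF u] x a by (intro sums_le[OF _ sums_zero S] mult_nonneg_nonneg pochhammer_nonneg divide_nonneg_nonneg) auto
  have meas: "(\<lambda>y. hh_kernel a m u x y * (y powr (a - 1) * exp (- y)) * y ^ j) \<in> borel_measurable (lebesgue_on {0<..})"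
    by (intro borel_measurable_times borel_measurable_hh_kernel a) measurable
  have "has_bochner_integral (lebesgue_on {0<..}) (\<lambda>y. hh_kernel a m u x y * (y powr (a - 1) * exp (- y)) * y ^ j) (c * S)"
    by (rule has_bochner_integral_nn_integral[OF meas _ _ nn])
       (use pos S0 R in \<open>auto simp: c_def intro!: AE_I2\<close>)
  thus ?thesis by (simp add: c_def R_def)
qed

lemma exp_sums_real: "(\<lambda>k. s ^ k / fact k) sums exp (s::real)"
  using exp_converges[of s] by (simp add: divide_inverse mult.commute)

lemma exp_moment1: "(\<lambda>k. s ^ k / fact k * real k) sums (s * exp (s::real))"
proof -
  have "(\<lambda>k. s ^ Suc k / fact (Suc k) * real (Suc k)) sums (s * exp s)"
    using sums_mult[OF exp_sums_real[of s], of s] by (simp add: field_simps del: of_nat_Suc)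
  thus ?thesis by (subst (asm) sums_Suc_iff) simp
qed

lemma exp_moment2: "(\<lambda>k. s ^ k / fact k * (real k * (real k - 1))) sums (s\<^sup>2 * exp (s::real))"
proof -
  have "(\<lambda>k. s ^ Suc k / fact (Suc k) * (real (Suc k) * (real (Suc k) - 1))) sums (s * (s * exp s))"
  proof -
    have "s ^ Suc k / fact (Suc k) * (real (Suc k) * (real (Suc k) - 1)) = s * (s ^ k / fact k * real k)" for k
    proof -
      have "real (Suc k) - 1 = real k" by simp
      thus ?thesis by (simp del: of_nat_Suc)
    qed
    thus ?thesis using sums_mult[OF exp_moment1[of s], of s] by simp
  qed
  thus ?thesis by (subst (asm) sums_Suc_iff) (simp add: power2_eq_square mult_ac)
qed

lemma hh_kernel_mass:
  assumes a: "a > 0" and u: "u > 0" and x: "x > 0"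
  shows "has_bochner_integral (lebesgue_on {0<..}) (\<lambda>y. hh_kernel a m u x y * (y powr (a - 1) * exp (- y))) (exp (- (m * u)))"
proof -
  have "(\<lambda>k. (rho u * x) ^ k / fact k * pochhammer (real k + a) 0) sums exp (rho u * x)"
    using exp_sums_real[of "rho u * x"] by simp
  from hh_kernel_moment[OF a u x this, of m] show ?thesis
    by (simp add: mult.assoc flip: exp_add)
qed

text \<open>The mean square distance from x is of order 1 / (1 + rho u), hence of order u. It
  matches the factor 1 + rho u in the bound for the y-derivative of the kernel.\<close>

lemma hh_kernel_second_moment:
  assumes a: "a > 0" and u: "u > 0" and x: "x > 0" and m: "m \<ge> 0"
  shows "integrable (lebesgue_on {0<..}) (\<lambda>y. hh_kernel a m u x y * (y powr (a - 1) * exp (- y)) * (y - x)\<^sup>2)"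
    and "(\<integral>y. hh_kernel a m u x y * (y powr (a - 1) * exp (- y)) * (y - x)\<^sup>2 \<partial>lebesgue_on {0<..}) \<le> (x\<^sup>2 + 2 * x + a * (a + 1)) / (1 + rho u)"
proof -
  define s where "s = rho u * x"
  define q where "q = 1 / (1 + rho u)"
  define e where "e = exp (- (m * u))"
  have R: "rho u > 0" using rho_pos[OF u] .
  have q: "q > 0" "q \<le> 1" "rho u * q = 1 - q" using R by (auto simp: q_def field_simps)
  have e: "e > 0" "e \<le> 1" using m u by (auto simp: e_def)
  have es: "exp (- s) * exp s = 1" by (simp add: exp_minus)
  have "(\<lambda>k. s ^ k / fact k * real k + a * (s ^ k / fact k)) sums (s * exp s + a * exp s)"
    by (intro sums_add sums_mult exp_moment1 exp_sums_real)
  also have "(\<lambda>k. s ^ k / fact k * real k + a * (s ^ k / fact k)) = (\<lambda>k. (rho u * x) ^ k / fact k * pochhammer (real k + a) 1)"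
    by (rule ext) (simp add: s_def algebra_simps add_divide_distrib)
  also have "s * exp s + a * exp s = (s + a) * exp s" by (simp add: algebra_simps)
  finally have s1: "(\<lambda>k. (rho u * x) ^ k / fact k * pochhammer (real k + a) 1) sums ((s + a) * exp s)" .
  \<comment> \<open>This decomposes (k + a) (k + a + 1) into k (k - 1), k and 1, whose Poisson sums
    are known as factorial moments.\<close>
  have "(\<lambda>k. s ^ k / fact k * (real k * (real k - 1)) + (2 * a + 2) * (s ^ k / fact k * real k) + a * (a + 1) * (s ^ k / fact k))
      sums (s\<^sup>2 * exp s + (2 * a + 2) * (s * exp s) + a * (a + 1) * exp s)"
    by (intro sums_add sums_mult exp_moment1 exp_moment2 exp_sums_real)
  also have "(\<lambda>k. s ^ k / fact k * (real k * (real k - 1)) + (2 * a + 2) * (s ^ k / fact k * real k) + a * (a + 1) * (s ^ k / fact k))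
     = (\<lambda>k. (rho u * x) ^ k / fact k * pochhammer (real k + a) 2)"
    by (rule ext) (simp add: s_def numeral_2_eq_2 pochhammer_rec algebra_simps add_divide_distrib diff_divide_distrib)
  also have "s\<^sup>2 * exp s + (2 * a + 2) * (s * exp s) + a * (a + 1) * exp s = (s\<^sup>2 + (2 * a + 2) * s + a * (a + 1)) * exp s"
    by (simp add: algebra_simps)
  finally have s2: "(\<lambda>k. (rho u * x) ^ k / fact k * pochhammer (real k + a) 2) sums ((s\<^sup>2 + (2 * a + 2) * s + a * (a + 1)) * exp s)" .
  note M0 = hh_kernel_mass[OF a u x, of m]
  have M1: "has_bochner_integral (lebesgue_on {0<..}) (\<lambda>y. hh_kernel a m u x y * (y powr (a - 1) * exp (- y)) * y ^ 1) (e * q * (s + a))"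
  proof -
    have "exp (- (m * u)) * exp (- (rho u * x)) / (1 + rho u) ^ 1 * ((s + a) * exp s)
       = e * q * (s + a) * (exp (- s) * exp s)"
      by (simp add: e_def q_def s_def)
    thus ?thesis using hh_kernel_moment[OF a u x s1, of m] es by simp
  qed
  have M2: "has_bochner_integral (lebesgue_on {0<..}) (\<lambda>y. hh_kernel a m u x y * (y powr (a - 1) * exp (- y)) * y ^ 2) (e * q\<^sup>2 * (s\<^sup>2 + (2 * a + 2) * s + a * (a + 1)))"
  proof -
    have "exp (- (m * u)) * exp (- (rho u * x)) / (1 + rho u) ^ 2 * ((s\<^sup>2 + (2 * a + 2) * s + a * (a + 1)) * exp s)
       = e * q\<^sup>2 * (s\<^sup>2 + (2 * a + 2) * s + a * (a + 1)) * (exp (- s) * exp s)"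
      by (simp add: e_def q_def s_def power_divide)
    thus ?thesis using hh_kernel_moment[OF a u x s2, of m] es by simp
  qed
  have "has_bochner_integral (lebesgue_on {0<..})
    (\<lambda>y. hh_kernel a m u x y * (y powr (a - 1) * exp (- y)) * y ^ 2 + (- 2 * x) * (hh_kernel a m u x y * (y powr (a - 1) * exp (- y)) * y ^ 1)
       + x\<^sup>2 * (hh_kernel a m u x y * (y powr (a - 1) * exp (- y))))
    (e * q\<^sup>2 * (s\<^sup>2 + (2 * a + 2) * s + a * (a + 1)) + (- 2 * x) * (e * q * (s + a)) + x\<^sup>2 * e)"
    using M0 unfolding e_def[symmetric]
    by (intro has_bochner_integral_add has_bochner_integral_mult_right M1 M2)
  also have "(\<lambda>y. hh_kernel a m u x y * (y powr (a - 1) * exp (- y)) * y ^ 2 + (- 2 * x) * (hh_kernel a m u x y * (y powr (a - 1) * exp (- y)) * y ^ 1)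
       + x\<^sup>2 * (hh_kernel a m u x y * (y powr (a - 1) * exp (- y))))
     = (\<lambda>y. hh_kernel a m u x y * (y powr (a - 1) * exp (- y)) * (y - x)\<^sup>2)"
    by (rule ext) (simp add: power2_eq_square algebra_simps)
  finally have M: "has_bochner_integral (lebesgue_on {0<..}) (\<lambda>y. hh_kernel a m u x y * (y powr (a - 1) * exp (- y)) * (y - x)\<^sup>2)
     (e * q\<^sup>2 * (s\<^sup>2 + (2 * a + 2) * s + a * (a + 1)) + (- 2 * x) * (e * q * (s + a)) + x\<^sup>2 * e)" .
  show "integrable (lebesgue_on {0<..}) (\<lambda>y. hh_kernel a m u x y * (y powr (a - 1) * exp (- y)) * (y - x)\<^sup>2)"
    using M by (simp add: has_bochner_integral_iff)
  have "(\<integral>y. hh_kernel a m u x y * (y powr (a - 1) * exp (- y)) * (y - x)\<^sup>2 \<partial>lebesgue_on {0<..})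
     = e * (q\<^sup>2 * (s\<^sup>2 + (2 * a + 2) * s + a * (a + 1)) - 2 * x * (q * (s + a)) + x\<^sup>2)"
    using M by (simp add: has_bochner_integral_iff algebra_simps)
  also have "q\<^sup>2 * (s\<^sup>2 + (2 * a + 2) * s + a * (a + 1)) - 2 * x * (q * (s + a)) + x\<^sup>2
     = q * (q * x\<^sup>2 + 2 * x - (2 * a + 2) * x * q + q * (a * (a + 1)))"
  proof -
    \<comment> \<open>With q = 1 / (1 + rho u) the Poisson mean satisfies s q = (1 - q) x. After
      this substitution the terms of order q^0 cancel and a factor q can be taken out.\<close>
    have sq: "s * q = (1 - q) * x" using q(3) by (simp add: s_def mult_ac)
    have "q\<^sup>2 * (s\<^sup>2 + (2 * a + 2) * s + a * (a + 1)) - 2 * x * (q * (s + a)) + x\<^sup>2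
      = (s * q)\<^sup>2 + (2 * a + 2) * q * (s * q) + q\<^sup>2 * (a * (a + 1)) - 2 * x * (s * q) - 2 * x * q * a + x\<^sup>2"
      by (simp add: power2_eq_square algebra_simps)
    also have "\<dots> = q * (q * x\<^sup>2 + 2 * x - (2 * a + 2) * x * q + q * (a * (a + 1)))"
      unfolding sq by (simp add: power2_eq_square algebra_simps)
    finally show ?thesis .
  qed
  also have "e * (q * (q * x\<^sup>2 + 2 * x - (2 * a + 2) * x * q + q * (a * (a + 1)))) \<le> 1 * (q * (1 * x\<^sup>2 + 2 * x - 0 + 1 * (a * (a + 1))))"
  proof -
    have 1: "q * (q * x\<^sup>2 + 2 * x - (2 * a + 2) * x * q + q * (a * (a + 1))) \<le> q * (1 * x\<^sup>2 + 2 * x - 0 + 1 * (a * (a + 1)))"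
      using q a x by (intro mult_left_mono add_mono diff_mono mult_right_mono) auto
    have "e * (q * (q * x\<^sup>2 + 2 * x - (2 * a + 2) * x * q + q * (a * (a + 1)))) \<le> e * (q * (1 * x\<^sup>2 + 2 * x - 0 + 1 * (a * (a + 1))))"
      using e by (intro mult_left_mono 1) auto
    also have "\<dots> \<le> 1 * (q * (1 * x\<^sup>2 + 2 * x - 0 + 1 * (a * (a + 1))))"
      using e q a x by (intro mult_right_mono) auto
    finally show ?thesis .
  qed
  finally show "(\<integral>y. hh_kernel a m u x y * (y powr (a - 1) * exp (- y)) * (y - x)\<^sup>2 \<partial>lebesgue_on {0<..}) \<le> (x\<^sup>2 + 2 * x + a * (a + 1)) / (1 + rho u)"
    by (simp add: q_def)
qed


section \<open>Decay away from the diagonal\<close>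

lemma exp_le_Phi_factor:
  assumes c: "c > 0" and m: "m \<ge> 0" and \<nu>: "\<nu> > 0"
  obtains C where "C > 0" "\<And>y. y \<ge> 0 \<Longrightarrow> exp (- (c * y)) \<le> C * Phi_factor m \<nu> y"
proof -
  obtain C where C: "C > 0" "\<And>w::real. w \<ge> 0 \<Longrightarrow> (1 + w) powr (m + 1 + \<nu>) \<le> C * exp (c * w)"
    using powr_le_exp_linear[of "m + 1 + \<nu>" c] c m \<nu> by auto
  show ?thesis
  proof (rule that[of "exp (1 + \<nu>) * C"])
    show "exp (1 + \<nu>) * C > 0" using C by simp
    fix y :: real assume y: "y \<ge> 0"
    define Y where "Y = ln (exp 1 + y)"
    have Y: "Y \<ge> 1" using ln_exp1_plus_ge[OF y] by (simp add: Y_def)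
    have "Y \<le> exp 1 + y - 1" unfolding Y_def using y by (intro ln_le_minus_one) (simp add: add_pos_nonneg)
    also have "\<dots> \<le> exp 1 * (1 + y)"
    proof -
      have "1 * y \<le> exp 1 * y" using y by (intro mult_right_mono) auto
      thus ?thesis by (simp add: algebra_simps)
    qed
    finally have Y2: "Y \<le> exp 1 * (1 + y)" .
    have Yp: "Y powr (1 + \<nu>) \<le> exp (1 + \<nu>) * (1 + y) powr (1 + \<nu>)"
    proof -
      have "Y powr (1 + \<nu>) \<le> (exp 1 * (1 + y)) powr (1 + \<nu>)" using Y Y2 \<nu> by (intro powr_mono2) auto
      also have "\<dots> = exp (1 + \<nu>) * (1 + y) powr (1 + \<nu>)" using y by (subst powr_mult) (auto simp: powr_def)
      finally show ?thesis .
    qed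
    have "1 \<le> Phi_factor m \<nu> y * ((1 + y) powr m * Y powr (1 + \<nu>))"
    proof (cases "m > 0")
      case True
      thus ?thesis using y Y by (simp add: Phi_factor_def Y_def[symmetric])
    next
      case False
      hence "m = 0" using m by simp
      moreover have "Y powr \<nu> \<le> Y powr (1 + \<nu>)" using Y by (intro powr_mono) auto
      ultimately show ?thesis using y Y by (simp add: Phi_factor_def Y_def[symmetric])
    qed
    also have "\<dots> \<le> Phi_factor m \<nu> y * ((1 + y) powr m * (exp (1 + \<nu>) * (1 + y) powr (1 + \<nu>)))"
      using Phi_factor_pos[OF y, of m \<nu>] Yp by (intro mult_left_mono) auto
    also have "\<dots> = Phi_factor m \<nu> y * exp (1 + \<nu>) * (1 + y) powr (m + 1 + \<nu>)"
      by (simp add: powr_add mult_ac)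
    also have "\<dots> \<le> Phi_factor m \<nu> y * exp (1 + \<nu>) * (C * exp (c * y))"
      using Phi_factor_pos[OF y, of m \<nu>] by (intro mult_left_mono C y) auto
    finally have "exp (- (c * y)) * 1 \<le> exp (- (c * y)) * (Phi_factor m \<nu> y * exp (1 + \<nu>) * (C * exp (c * y)))"
      by (intro mult_left_mono) auto
    also have "\<dots> = exp (1 + \<nu>) * C * Phi_factor m \<nu> y * (exp (- (c * y)) * exp (c * y))" by (simp only: mult_ac)
    also have "exp (- (c * y)) * exp (c * y) = 1" by (simp flip: exp_add)
    finally show "exp (- (c * y)) \<le> exp (1 + \<nu>) * C * Phi_factor m \<nu> y" by simp
  qed
qed

lemma one_plus_rho_ge: "u > 0 \<Longrightarrow> 1 + rho u \<ge> 1 / u"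
proof -
  assume u: "u > 0"
  have "(1 + rho u) * (1 - exp (- u)) = 1" using rho_eq[OF u] by (simp add: algebra_simps)
  moreover have "(1 + rho u) * (1 - exp (- u)) \<le> (1 + rho u) * u"
    using exp_ge_add_one_self[of "- u"] rho_pos[OF u] by (intro mult_left_mono) auto
  ultimately show ?thesis using u by (simp add: field_simps)
qed

text \<open>Off a neighbourhood of x the distance from sqrt y to sqrt x is at least c1 (1 + sqrt y).
  Replacing y by exp (-u) y moves sqrt y by at most u sqrt y, which for small u is half of that
  distance.\<close>

lemma sqrt_diff_far:
  assumes x: "x > 0" and d: "\<delta> > 0"
  obtains c where "c > 0" "\<And>u y. 0 < u \<Longrightarrow> u \<le> c \<Longrightarrow> y \<ge> 0 \<Longrightarrow> \<bar>y - x\<bar> \<ge> \<delta> \<Longrightarrow>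
     c * (1 + y) \<le> (sqrt (exp (- u) * y) - sqrt x)\<^sup>2"
proof -
  define w where "w = sqrt x"
  have w: "w > 0" using x by (simp add: w_def)
  \<comment> \<open>Chosen for the chain (s + w) (1 + s) <= 2 (1 + w) (1 + y) <= K \<bar>y - x\<bar>
    = K (s + w) \<bar>s - w\<bar>, from which s + w cancels; here s = sqrt y and w = sqrt x.\<close>
  define K where "K = 2 * (1 + w) * ((1 + x) / \<delta> + 1)"
  have K: "K > 0" using w x d by (auto simp: K_def intro!: mult_pos_pos add_pos_pos divide_pos_pos)
  define c1 where "c1 = min 1 (1 / K)"
  have c1: "c1 > 0" "c1 \<le> 1" "c1 \<le> 1 / K" using K by (auto simp: c1_def)
  show ?thesis
  \<comment> \<open>One constant serves as threshold for u and as factor in the estimate. Squaring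
    c1 / 2 is forced by the latter and harmless for the former, because c1 <= 1.\<close>
  proof (rule that[of "(c1 / 2)\<^sup>2"])
    show "(c1 / 2)\<^sup>2 > 0" using c1 by simp
    fix u y :: real assume u: "0 < u" "u \<le> (c1 / 2)\<^sup>2" and y: "y \<ge> 0" and yx: "\<bar>y - x\<bar> \<ge> \<delta>"
    have "(c1 / 2)\<^sup>2 = (c1 / 2) * (c1 / 2)" by (simp add: power2_eq_square)
    also have "\<dots> \<le> (c1 / 2) * 1" using c1 by (intro mult_left_mono) auto
    finally have u2: "u \<le> c1 / 2" using u by simp
    define s where "s = sqrt y"
    have s: "s \<ge> 0" "s\<^sup>2 = y" using y by (auto simp: s_def)
    have "1 + y \<le> (1 + x) + \<bar>y - x\<bar>" by simp
    also have "1 + x \<le> (1 + x) / \<delta> * \<bar>y - x\<bar>"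
    proof -
      have "(1 + x) / \<delta> * \<delta> \<le> (1 + x) / \<delta> * \<bar>y - x\<bar>" using x d yx by (intro mult_left_mono) auto
      thus ?thesis using d by simp
    qed
    finally have "1 + y \<le> ((1 + x) / \<delta> + 1) * \<bar>y - x\<bar>" by (simp add: algebra_simps)
    hence "2 * (1 + w) * (1 + y) \<le> 2 * (1 + w) * (((1 + x) / \<delta> + 1) * \<bar>y - x\<bar>)"
      using w by (intro mult_left_mono) auto
    hence 1: "2 * (1 + w) * (1 + y) \<le> K * \<bar>y - x\<bar>" by (simp add: K_def mult.assoc)
    have "(s + w) * (1 + s) \<le> ((1 + w) * (1 + s)) * (1 + s)" using s w by (intro mult_right_mono) (auto simp: algebra_simps)
    also have "\<dots> = (1 + w) * (1 + s)\<^sup>2" by (simp add: power2_eq_square)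
    also have "\<dots> \<le> (1 + w) * (2 * (1 + y))"
    proof (rule mult_left_mono)
      have "0 \<le> (1 - s)\<^sup>2" by simp
      thus "(1 + s)\<^sup>2 \<le> 2 * (1 + y)" using s(2) by (simp add: power2_eq_square algebra_simps)
    qed (use w in auto)
    also have "\<dots> = 2 * (1 + w) * (1 + y)" by (simp add: algebra_simps)
    also note 1
    finally have "(s + w) * (1 + s) \<le> K * \<bar>y - x\<bar>" .
    also have "\<bar>y - x\<bar> = (s + w) * \<bar>s - w\<bar>"
    proof -
      have "y - x = (s + w) * (s - w)" using s(2) x by (simp add: w_def power2_eq_square algebra_simps)
      thus ?thesis using s w by (simp add: abs_mult)
    qed
    finally have "(s + w) * (1 + s) \<le> (s + w) * (K * \<bar>s - w\<bar>)" by (simp add: mult_ac)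
    hence "1 + s \<le> K * \<bar>s - w\<bar>" using s w by simp
    hence "1 / K * (1 + s) \<le> \<bar>s - w\<bar>" using K by (simp add: field_simps)
    moreover have "c1 * (1 + s) \<le> 1 / K * (1 + s)" using c1 s by (intro mult_right_mono) auto
    ultimately have 2: "c1 * (1 + s) \<le> \<bar>s - w\<bar>" by linarith
    define r where "r = exp (- u)"
    have r: "0 < r" "r \<le> 1" "1 - r \<le> u" using u exp_ge_add_one_self[of "- u"] by (auto simp: r_def)
    have "r \<le> sqrt r" using r by (simp add: real_le_rsqrt power2_eq_square mult_le_one)
    hence "s * (1 - sqrt r) \<le> s * u" using s r by (intro mult_left_mono) auto
    also have "\<dots> \<le> s * (c1 / 2)" using s u2 by (intro mult_left_mono) auto
    finally have 3: "s - sqrt r * s \<le> c1 / 2 * s" by (simp add: algebra_simps)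
    have "sqrt r * s \<le> s" using r s by (intro mult_left_le_one_le) auto
    hence "\<bar>sqrt r * s - w\<bar> \<ge> \<bar>s - w\<bar> - (s - sqrt r * s)" by linarith
    hence "\<bar>sqrt r * s - w\<bar> \<ge> c1 / 2 * (1 + s)" using 2 3 c1 by (simp add: algebra_simps)
    hence "\<bar>sqrt r * s - w\<bar>\<^sup>2 \<ge> (c1 / 2 * (1 + s))\<^sup>2" using c1 s by (intro power_mono) auto
    moreover have "(c1 / 2)\<^sup>2 * (1 + y) \<le> (c1 / 2 * (1 + s))\<^sup>2"
    proof -
      have "1 + y \<le> (1 + s)\<^sup>2" using s by (simp add: power2_sum)
      thus ?thesis unfolding power_mult_distrib by (intro mult_left_mono) auto
    qed
    moreover have "sqrt (r * y) = sqrt r * s" by (simp add: real_sqrt_mult s_def)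
    ultimately show "(c1 / 2)\<^sup>2 * (1 + y) \<le> (sqrt (exp (- u) * y) - sqrt x)\<^sup>2"
      unfolding r_def[symmetric] w_def[symmetric] by simp
  qed
qed

text \<open>The exponent is at least k W with W = (1 + rho u) (1 + y). Half of it absorbs all
  powers, each bounded by a power of 1 + W. Since W >= 1 / u + y, the other half splits into a
  factor that vanishes with u and exponential decay in y, which is dominated by the weight.\<close>

lemma hh_kernel_far:
  assumes a: "a > 0" and x: "x > 0" and d: "\<delta> > 0" and m: "m \<ge> 0" and \<nu>: "\<nu> > 0"
  obtains C c where "C > 0" "c > 0" "\<And>u y. 0 < u \<Longrightarrow> u \<le> c \<Longrightarrow> y \<ge> 0 \<Longrightarrow> \<bar>y - x\<bar> \<ge> \<delta> \<Longrightarrow>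
     hh_kernel a m u x y \<le> C * exp (- (c / u)) * Phi_factor m \<nu> y"
proof -
  obtain C0 where C0: "C0 > 0" "\<And>m u x y. u > 0 \<Longrightarrow> x \<ge> 0 \<Longrightarrow> y \<ge> 0 \<Longrightarrow>
    hh_kernel a m u x y \<le> C0 * (exp (- (m * u)) * (1 + rho u) powr a * (1 + rho u * (1 + rho u) * y * x) powr \<bar>1 - a\<bar> *
      exp (x - (1 + rho u) * (sqrt (exp (- u) * y) - sqrt x)\<^sup>2))"
    using hh_kernel_upper[OF a] by blast
  obtain k where k: "k > 0" "\<And>u y. 0 < u \<Longrightarrow> u \<le> k \<Longrightarrow> y \<ge> 0 \<Longrightarrow> \<bar>y - x\<bar> \<ge> \<delta> \<Longrightarrow>
     k * (1 + y) \<le> (sqrt (exp (- u) * y) - sqrt x)\<^sup>2"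
    using sqrt_diff_far[OF x d] by blast
  define q where "q = \<bar>1 - a\<bar>"
  have q: "q \<ge> 0" by (simp add: q_def)
  obtain C1 where C1: "C1 > 0" "\<And>w::real. w \<ge> 0 \<Longrightarrow> (1 + w) powr (a + 2 * q) \<le> C1 * exp (k / 2 * w)"
    using powr_le_exp_linear[of "a + 2 * q" "k / 2"] k a q by auto
  obtain C2 where C2: "C2 > 0" "\<And>y. y \<ge> 0 \<Longrightarrow> exp (- (k / 2 * y)) \<le> C2 * Phi_factor m \<nu> y"
    using exp_le_Phi_factor[of "k / 2" m \<nu>] k m \<nu> by auto
  define C where "C = C0 * exp x * (1 + x) powr q * C1 * C2"
  show ?thesis
  proof (rule that[of C "k / 2"])
    show "C > 0" using C0(1) C1(1) C2(1) x by (simp add: C_def)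
    show "k / 2 > 0" using k by simp
    fix u y :: real assume u: "0 < u" "u \<le> k / 2" and y: "y \<ge> 0" and yx: "\<bar>y - x\<bar> \<ge> \<delta>"
    define Q where "Q = 1 + rho u"
    have Q: "Q \<ge> 1" "Q \<ge> 1 / u" "rho u \<le> Q" "rho u > 0" using rho_pos[OF u(1)] one_plus_rho_ge[OF u(1)] by (auto simp: Q_def)
    define W where "W = Q * (1 + y)"
    have "1 * 1 \<le> Q * (1 + y)" using Q y by (intro mult_mono) auto
    hence W1: "W \<ge> 1" by (simp add: W_def)
    have WQ: "W \<ge> Q" using Q y by (simp add: W_def mult_le_cancel_left1)
    have "1 * y \<le> Q * y" using Q y by (intro mult_right_mono) auto
    hence WQy: "W \<ge> Q + y" by (simp add: W_def algebra_simps)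
    have p1: "Q powr a \<le> (1 + W) powr a" using Q WQ a by (intro powr_mono2) auto
    have "rho u * Q * y * x \<le> Q * Q * y * x" using Q x y by (intro mult_right_mono) auto
    moreover have "Q\<^sup>2 * ((1 + x) * (1 + y)) = Q\<^sup>2 + Q\<^sup>2 * x + Q\<^sup>2 * y + Q * Q * y * x"
      by (simp add: power2_eq_square algebra_simps)
    moreover have "Q\<^sup>2 \<ge> 1" "Q\<^sup>2 * x \<ge> 0" "Q\<^sup>2 * y \<ge> 0" using Q x y by auto
    ultimately have "1 + rho u * Q * y * x \<le> Q\<^sup>2 * ((1 + x) * (1 + y))" by linarith
    also have "\<dots> = (1 + x) * (Q\<^sup>2 * (1 + y))" by simp
    also have "\<dots> \<le> (1 + x) * (1 + W)\<^sup>2"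
    proof (rule mult_left_mono)
      have "Q\<^sup>2 * (1 + y) = Q * W" by (simp add: W_def power2_eq_square)
      also have "\<dots> \<le> (1 + W) * (1 + W)" using Q WQ W1 by (intro mult_mono) auto
      finally show "Q\<^sup>2 * (1 + y) \<le> (1 + W)\<^sup>2" by (simp add: power2_eq_square)
    qed (use x in auto)
    finally have "(1 + rho u * Q * y * x) powr q \<le> ((1 + x) * (1 + W)\<^sup>2) powr q"
      using q Q x y by (intro powr_mono2) auto
    also have "\<dots> = (1 + x) powr q * (1 + W) powr (2 * q)"
      using x W1 by (simp add: powr_mult powr_powr[symmetric])
    finally have p2: "(1 + rho u * Q * y * x) powr q \<le> (1 + x) powr q * (1 + W) powr (2 * q)" .
    have "Q * (k * (1 + y)) \<le> Q * (sqrt (exp (- u) * y) - sqrt x)\<^sup>2"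
      using Q k u y yx by (intro mult_left_mono k(2)) auto
    hence p3: "exp (x - Q * (sqrt (exp (- u) * y) - sqrt x)\<^sup>2) \<le> exp (x - k * W)"
      by (simp add: W_def mult_ac)
    have "hh_kernel a m u x y \<le> C0 * (exp (- (m * u)) * Q powr a * (1 + rho u * Q * y * x) powr q * exp (x - Q * (sqrt (exp (- u) * y) - sqrt x)\<^sup>2))"
      using C0(2)[OF u(1) _ y, of x m] x by (simp add: Q_def q_def)
    also have "\<dots> \<le> C0 * (1 * (1 + W) powr a * ((1 + x) powr q * (1 + W) powr (2 * q)) * exp (x - k * W))"
      using C0(1) p1 p2 p3 m u by (intro mult_left_mono mult_mono) auto
    also have "\<dots> = C0 * exp x * (1 + x) powr q * ((1 + W) powr (a + 2 * q) * exp (- (k * W)))"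
      by (simp add: powr_add exp_diff exp_minus divide_inverse mult_ac)
    also have "\<dots> \<le> C0 * exp x * (1 + x) powr q * ((C1 * exp (k / 2 * W)) * exp (- (k * W)))"
      using C0(1) W1 by (intro mult_left_mono mult_right_mono C1) auto
    also have "\<dots> = C0 * exp x * (1 + x) powr q * (C1 * (exp (k / 2 * W) * exp (- (k * W))))" by (simp only: mult.assoc)
    also have "\<dots> \<le> C0 * exp x * (1 + x) powr q * (C1 * (exp (- (k / 2 / u)) * (C2 * Phi_factor m \<nu> y)))"
    proof (intro mult_left_mono)
      have "k / 2 * (1 / u + y) \<le> k / 2 * W" using k Q WQy by (intro mult_left_mono) auto
      hence "k / 2 / u + k / 2 * y \<le> k / 2 * W" unfolding distrib_left by simp
      hence "k / 2 * W + - (k * W) \<le> - (k / 2 / u) + - (k / 2 * y)" by linarith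
      hence "exp (k / 2 * W) * exp (- (k * W)) \<le> exp (- (k / 2 / u)) * exp (- (k / 2 * y))"
        unfolding exp_add[symmetric] exp_le_cancel_iff .
      also have "\<dots> \<le> exp (- (k / 2 / u)) * (C2 * Phi_factor m \<nu> y)"
        by (intro mult_left_mono C2 y) auto
      finally show "exp (k / 2 * W) * exp (- (k * W)) \<le> exp (- (k / 2 / u)) * (C2 * Phi_factor m \<nu> y)" .
    qed (use C0(1) C1(1) in auto)
    finally show "hh_kernel a m u x y \<le> C * exp (- (k / 2 / u)) * Phi_factor m \<nu> y"
      by (simp add: C_def mult_ac)
  qed
qed

section \<open>The kernel as a density with respect to Lebesgue measure\<close>

definition weighted_kernel :: "real \<Rightarrow> real \<Rightarrow> real \<Rightarrow> real \<Rightarrow> real \<Rightarrow> real" where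
  "weighted_kernel a m u x y = hh_kernel a m u x y * (y powr (a - 1) * exp (- y))"

text \<open>The derivative in y is written as the density times its logarithmic derivative, with the
  Bessel part in the form z J' / J to which the two-sided bounds apply.\<close>

definition weighted_kernel_deriv :: "real \<Rightarrow> real \<Rightarrow> real \<Rightarrow> real \<Rightarrow> real \<Rightarrow> real" where
  "weighted_kernel_deriv a m u x y = weighted_kernel a m u x y * ((a - 1) / y - (1 + rho u)
     + (rho u * (1 + rho u) * y * x) * bessel (a + 1) (rho u * (1 + rho u) * y * x) / bessel a (rho u * (1 + rho u) * y * x) / y)"

lemma weighted_kernel_nonneg: "a > 0 \<Longrightarrow> u > 0 \<Longrightarrow> x \<ge> 0 \<Longrightarrow> y \<ge> 0 \<Longrightarrow> weighted_kernel a m u x y \<ge> 0"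
  unfolding weighted_kernel_def by (intro mult_nonneg_nonneg less_imp_le[OF hh_kernel_nonneg]) auto

lemma DERIV_weighted_kernel:
  assumes a: "a > 0" and u: "u > 0" and x: "x > 0" and y: "y > 0"
  shows "((\<lambda>y. weighted_kernel a m u x y) has_real_derivative weighted_kernel_deriv a m u x y) (at y)"
proof -
  define R where "R = rho u"
  define c where "c = R * (1 + R)"
  have R: "R > 0" using rho_pos[OF u] by (simp add: R_def)
  define E where "E = exp (- (m * u)) * (1 + R) powr a * exp (- (R * x))"
  define b0 b1 where "b0 = bessel a (c * y * x)" and "b1 = bessel (a + 1) (c * y * x)"
  have b0: "b0 > 0" unfolding b0_def using R x y by (intro bessel_pos a) (auto simp: c_def)
  have e: "((\<lambda>y. exp (- (R * y)) * exp (- y)) has_real_derivative - (1 + R) * (exp (- (R * y)) * exp (- y))) (at y)"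
    by (auto intro!: derivative_eq_intros simp: algebra_simps)
  have p: "((\<lambda>y. y powr (a - 1)) has_real_derivative (a - 1) / y * y powr (a - 1)) (at y)"
  proof (rule DERIV_cong[OF has_real_derivative_powr[OF y]])
    have "y powr (a - 1 - 1) = y powr (a - 1) / y" using powr_diff[of y "a - 1" 1] y by simp
    thus "(a - 1) * y powr (a - 1 - 1) = (a - 1) / y * y powr (a - 1)" by simp
  qed
  have b: "((\<lambda>y. bessel a (c * y * x)) has_real_derivative b1 * (c * x)) (at y)"
    unfolding b1_def by (rule DERIV_bessel_chain[OF a]) (auto intro!: derivative_eq_intros)
  have "((\<lambda>y. E * ((exp (- (R * y)) * exp (- y)) * (y powr (a - 1) * bessel a (c * y * x)))) has_real_derivative
      E * ((- (1 + R) * (exp (- (R * y)) * exp (- y))) * (y powr (a - 1) * b0)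
        + ((a - 1) / y * y powr (a - 1) * b0 + b1 * (c * x) * y powr (a - 1)) * (exp (- (R * y)) * exp (- y)))) (at y)"
    unfolding b0_def by (intro DERIV_cmult DERIV_mult e p b)
  also have "(\<lambda>y. E * ((exp (- (R * y)) * exp (- y)) * (y powr (a - 1) * bessel a (c * y * x)))) = (\<lambda>y. weighted_kernel a m u x y)"
    by (rule ext) (simp add: weighted_kernel_def hh_kernel_def E_def c_def R_def mult_ac)
  also have "E * ((- (1 + R) * (exp (- (R * y)) * exp (- y))) * (y powr (a - 1) * b0)
        + ((a - 1) / y * y powr (a - 1) * b0 + b1 * (c * x) * y powr (a - 1)) * (exp (- (R * y)) * exp (- y))) = weighted_kernel_deriv a m u x y"
  proof -
    have k: "weighted_kernel a m u x y = E * (exp (- (R * y)) * exp (- y)) * y powr (a - 1) * b0"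
      by (simp add: weighted_kernel_def hh_kernel_def E_def c_def R_def b0_def mult_ac)
    have "b1 * (c * x) = b0 * ((c * y * x) * b1 / b0 / y)" using b0 y by (simp add: field_simps)
    hence "E * ((- (1 + R) * (exp (- (R * y)) * exp (- y))) * (y powr (a - 1) * b0)
        + ((a - 1) / y * y powr (a - 1) * b0 + b1 * (c * x) * y powr (a - 1)) * (exp (- (R * y)) * exp (- y)))
      = (E * (exp (- (R * y)) * exp (- y)) * y powr (a - 1) * b0) * ((a - 1) / y - (1 + R) + (c * y * x) * b1 / b0 / y)"
      by (simp add: algebra_simps)
    thus ?thesis unfolding weighted_kernel_deriv_def k by (simp add: R_def c_def b0_def b1_def)
  qed
  finally show ?thesis .
qed

lemma continuous_on_weighted_kernel_deriv:
  assumes a: "a > 0" and u: "u > 0" and x: "x > 0" and p: "p > 0"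
  shows "continuous_on {p..q} (weighted_kernel_deriv a m u x)"
proof -
  have nz: "bessel a (rho u * (1 + rho u) * y * x) \<noteq> 0" if "y \<in> {p..q}" for y
    using bessel_pos[OF a, of "rho u * (1 + rho u) * y * x"] that p x rho_pos[OF u] by auto
  have "continuous_on {p..q} (weighted_kernel a m u x)"
    using p by (intro continuous_at_imp_continuous_on ballI DERIV_isCont[OF DERIV_weighted_kernel[OF a u x]]) auto
  thus ?thesis unfolding weighted_kernel_deriv_def using p nz a
    by (intro continuous_intros continuous_on_bessel) auto
qed

text \<open>
  The Bessel quotient is \<open>\<surd>z + O(1)\<close>, and \<open>\<surd>z / y - (1 + rho u)\<close> stays bounded as \<open>u \<rightarrow> 0\<close>
  when \<open>y = x\<close>.
\<close>

lemma weighted_kernel_deriv_bound: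
  assumes a: "a > 0" and u: "u > 0" and x: "x > 0" and y: "y \<ge> x / 2"
  shows "\<bar>weighted_kernel_deriv a m u x y\<bar> \<le> weighted_kernel a m u x y * (2 * (1 + rho u) * \<bar>y - x\<bar> / x + (2 + 2 * (\<bar>a - 1\<bar> + a + \<bar>1 - a\<bar>) / x))"
proof -
  have y0: "y > 0" using x y by simp
  define Q where "Q = 1 + rho u"
  define r where "r = exp (- u)"
  have Q: "Q > 0" using rho_pos[OF u] by (simp add: Q_def)
  have rho: "rho u = r * Q" using rho_eq[OF u] by (simp add: r_def Q_def)
  have r: "r > 0" "r \<le> 1" using u by (auto simp: r_def)
  \<comment> \<open>This identity makes the shift from x to r x harmless: the large factor Q
    multiplies (1 - r) x, and the product is exactly x.\<close>
  have Qr: "Q * (1 - r) = 1" using rho by (simp add: Q_def algebra_simps)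
  define z where "z = rho u * Q * y * x"
  have z: "z > 0" using rho_pos[OF u] Q x y0 by (simp add: z_def)
  define V where "V = z * bessel (a + 1) z / bessel a z"
  have V: "\<bar>V - sqrt z\<bar> \<le> a + \<bar>1 - a\<bar>"
    using bessel_log_deriv_lower[OF a z] bessel_log_deriv_upper[OF a z] a by (auto simp: V_def)
  have sz: "sqrt z / y - Q = Q * (sqrt (r * x) / sqrt y - 1)"
  proof -
    have "z = Q\<^sup>2 * ((r * x) * y)" by (simp add: z_def rho power2_eq_square)
    hence "sqrt z = Q * (sqrt (r * x) * sqrt y)" using Q by (simp add: real_sqrt_mult)
    moreover have "sqrt y / y = 1 / sqrt y" using y0 by (simp add: divide_simps)
    ultimately show ?thesis by (simp add: right_diff_distrib) (metis times_divide_eq_right mult.right_neutral)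
  qed
  have s1: "\<bar>sqrt (r * x) / sqrt y - 1\<bar> \<le> \<bar>r * x - y\<bar> / y"
  proof -
    define p s where "p = sqrt (r * x)" and "s = sqrt y"
    have ps: "p > 0" "s > 0" "p\<^sup>2 = r * x" "s\<^sup>2 = y" using r x y0 by (auto simp: p_def s_def)
    have "\<bar>p - s\<bar> * s \<le> \<bar>p - s\<bar> * (p + s)" using ps by (intro mult_left_mono) auto
    also have "\<dots> = \<bar>p\<^sup>2 - s\<^sup>2\<bar>"
    proof -
      have "p\<^sup>2 - s\<^sup>2 = (p - s) * (p + s)" by (simp add: power2_eq_square algebra_simps)
      thus ?thesis using ps by (simp add: abs_mult)
    qed
    finally have "\<bar>p - s\<bar> * s / s\<^sup>2 \<le> \<bar>p\<^sup>2 - s\<^sup>2\<bar> / s\<^sup>2" by (intro divide_right_mono) auto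
    moreover have "\<bar>p / s - 1\<bar> = \<bar>p - s\<bar> * s / s\<^sup>2"
    proof -
      have "p / s - 1 = (p - s) / s" using ps by (simp add: field_simps)
      thus ?thesis using ps(2) by (simp add: power2_eq_square)
    qed
    ultimately show ?thesis using ps by (simp add: p_def s_def)
  qed
  have "\<bar>r * x - y\<bar> \<le> \<bar>y - x\<bar> + (1 - r) * x"
  proof -
    have "r * x - y = (x - y) - (1 - r) * x" by (simp add: algebra_simps)
    moreover have "(1 - r) * x \<ge> 0" using r x by simp
    ultimately show ?thesis by linarith
  qed
  hence "Q * \<bar>sqrt (r * x) / sqrt y - 1\<bar> \<le> Q * ((\<bar>y - x\<bar> + (1 - r) * x) / y)"
    using Q y0 by (intro mult_left_mono order_trans[OF s1] divide_right_mono) auto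
  also have "\<dots> = (Q * \<bar>y - x\<bar> + (Q * (1 - r)) * x) / y" by (simp add: algebra_simps)
  also have "\<dots> = (Q * \<bar>y - x\<bar> + x) / y" unfolding Qr by simp
  also have "\<dots> \<le> (Q * \<bar>y - x\<bar> + x) / (x / 2)" using Q x y by (intro divide_left_mono) auto
  also have "\<dots> = 2 * Q * \<bar>y - x\<bar> / x + 2" using x by (simp add: field_simps)
  finally have 1: "\<bar>sqrt z / y - Q\<bar> \<le> 2 * Q * \<bar>y - x\<bar> / x + 2" unfolding sz using Q by (simp add: abs_mult)
  have "\<bar>(a - 1) / y + (V - sqrt z) / y\<bar> \<le> (\<bar>a - 1\<bar> + (a + \<bar>1 - a\<bar>)) / y"
  proof -
    have "\<bar>(a - 1) + (V - sqrt z)\<bar> \<le> \<bar>a - 1\<bar> + (a + \<bar>1 - a\<bar>)" using V by linarith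
    hence "\<bar>(a - 1) + (V - sqrt z)\<bar> / y \<le> (\<bar>a - 1\<bar> + (a + \<bar>1 - a\<bar>)) / y" using y0 by (intro divide_right_mono) auto
    thus ?thesis using y0 by (simp add: add_divide_distrib[symmetric])
  qed
  also have "\<dots> \<le> (\<bar>a - 1\<bar> + (a + \<bar>1 - a\<bar>)) / (x / 2)" using a x y by (intro divide_left_mono) auto
  also have "\<dots> = 2 * (\<bar>a - 1\<bar> + a + \<bar>1 - a\<bar>) / x" by (simp add: field_simps)
  finally have 2: "\<bar>(a - 1) / y + (V - sqrt z) / y\<bar> \<le> 2 * (\<bar>a - 1\<bar> + a + \<bar>1 - a\<bar>) / x" .
  have "(a - 1) / y - Q + V / y = (sqrt z / y - Q) + ((a - 1) / y + (V - sqrt z) / y)"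
    by (simp add: diff_divide_distrib)
  hence 3: "\<bar>(a - 1) / y - Q + V / y\<bar> \<le> 2 * Q * \<bar>y - x\<bar> / x + (2 + 2 * (\<bar>a - 1\<bar> + a + \<bar>1 - a\<bar>) / x)"
    using 1 2 by linarith
  have k: "weighted_kernel a m u x y \<ge> 0" using a u x y0 by (intro weighted_kernel_nonneg) auto
  have "weighted_kernel_deriv a m u x y = weighted_kernel a m u x y * ((a - 1) / y - Q + V / y)"
    by (simp add: weighted_kernel_deriv_def Q_def V_def z_def)
  hence "\<bar>weighted_kernel_deriv a m u x y\<bar> = weighted_kernel a m u x y * \<bar>(a - 1) / y - Q + V / y\<bar>" using k by (simp add: abs_mult)
  also have "\<dots> \<le> weighted_kernel a m u x y * (2 * Q * \<bar>y - x\<bar> / x + (2 + 2 * (\<bar>a - 1\<bar> + a + \<bar>1 - a\<bar>) / x))"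
    by (intro mult_left_mono 3 k)
  finally show ?thesis by (simp add: Q_def)
qed

section \<open>Integration by parts against a primitive\<close>

lemma sigma_finite_Icc: "sigma_finite_measure (lebesgue_on {p..q::real})"
proof -
  have "finite_measure (lebesgue_on {p..q})"
    by (rule finite_measureI) (simp add: emeasure_restrict_space space_restrict_space emeasure_lborel_Icc_eq)
  thus ?thesis by (simp add: finite_measure_def)
qed

text \<open>The primitive of a merely integrable g need not be differentiable everywhere, so the
  formula is obtained from Fubini on a triangle: k q - k y is an integral of k' from y to q, and the
  order of integration is exchanged.\<close>

lemma integral_parts_primitive:
  fixes k k' :: "real \<Rightarrow> real" and g :: "real \<Rightarrow> complex"
  assumes dk: "\<And>y. y \<in> {p..q} \<Longrightarrow> (k has_real_derivative k' y) (at y)"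
    and ck: "continuous_on {p..q} k'" and g: "g absolutely_integrable_on {p..q}"
  shows "(\<lambda>y. k y *\<^sub>R g y) absolutely_integrable_on {p..q}"
    and "(\<lambda>s. k' s *\<^sub>R integral {p..s} g) absolutely_integrable_on {p..q}"
    and "integral {p..q} (\<lambda>y. k y *\<^sub>R g y) = k q *\<^sub>R integral {p..q} g - integral {p..q} (\<lambda>s. k' s *\<^sub>R integral {p..s} g)"
proof -
  let ?N = "lebesgue_on {p..q}"
  interpret N: sigma_finite_measure ?N by (rule sigma_finite_Icc)
  interpret P: pair_sigma_finite ?N ?N ..
  have iff: "h absolutely_integrable_on {p..q} \<longleftrightarrow> integrable ?N h" for h :: "real \<Rightarrow> complex"
    by (simp add: absolutely_integrable_on_def set_integrable_def integrable_restrict_space)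
  have LN: "integral\<^sup>L ?N h = integral {p..q} h" if "integrable ?N h" for h :: "real \<Rightarrow> complex"
    using that by (intro lebesgue_integral_eq_integral) auto
  have gN: "integrable ?N g" using g by (simp add: iff)
  have kc: "continuous_on {p..q} k"
    using dk by (intro continuous_at_imp_continuous_on ballI) (auto intro: DERIV_isCont)
  have bdd: "\<exists>B>0. \<forall>y\<in>{p..q}. \<bar>h y\<bar> \<le> B" if "continuous_on {p..q} h" for h :: "real \<Rightarrow> real"
    using compact_continuous_image[OF that compact_Icc, THEN compact_imp_bounded] unfolding bounded_pos by auto
  obtain B where B: "B > 0" "\<And>y. y \<in> {p..q} \<Longrightarrow> \<bar>k' y\<bar> \<le> B" using bdd[OF ck] by blast
  obtain B0 where B0: "B0 > 0" "\<And>y. y \<in> {p..q} \<Longrightarrow> \<bar>k y\<bar> \<le> B0" using bdd[OF kc] by blast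
  have km: "k \<in> borel_measurable ?N" "k' \<in> borel_measurable ?N"
    using continuous_imp_measurable_on_sets_lebesgue[OF kc] continuous_imp_measurable_on_sets_lebesgue[OF ck] by auto
  have gm: "g \<in> borel_measurable ?N" using gN by auto
  have idm: "(\<lambda>x. x) \<in> borel_measurable ?N" by (intro measurable_restrict_space1 measurable_completion) simp
  have kg: "integrable ?N (\<lambda>y. k y *\<^sub>R g y)"
  proof (rule Bochner_Integration.integrable_bound)
    show "integrable ?N (\<lambda>y. B0 * norm (g y))" using gN by auto
    show "(\<lambda>y. k y *\<^sub>R g y) \<in> borel_measurable ?N" using km gm by (intro borel_measurable_scaleR)
    show "AE y in ?N. norm (k y *\<^sub>R g y) \<le> norm (B0 * norm (g y))"
      using B0 by (intro AE_I2) (auto simp: abs_mult intro!: mult_right_mono)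
  qed
  thus "(\<lambda>y. k y *\<^sub>R g y) absolutely_integrable_on {p..q}" by (simp add: iff)
  \<comment> \<open>The indicator restricts to y <= s. Integrating in s first gives k q - k y times
    g y; integrating in y first gives k' s times the primitive at s.\<close>
  define f where "f y s = indicator {y..} s *\<^sub>R (k' s *\<^sub>R g y)" for y s
  have fm: "case_prod f \<in> borel_measurable (?N \<Otimes>\<^sub>M ?N)"
  proof -
    note [measurable] = measurable_compose[OF measurable_fst idm] measurable_compose[OF measurable_snd idm]
      measurable_compose[OF measurable_snd km(2)] measurable_compose[OF measurable_fst gm]
    have "(\<lambda>p. indicator {w. fst w \<le> snd w} p *\<^sub>R (k' (snd p) *\<^sub>R g (fst p))) \<in> borel_measurable (?N \<Otimes>\<^sub>M ?N)"
    proof (rule borel_measurable_scaleR)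
      have "{w \<in> space (?N \<Otimes>\<^sub>M ?N). fst w \<le> snd w} \<in> sets (?N \<Otimes>\<^sub>M ?N)" by measurable
      thus "indicat_real {w. fst w \<le> snd w} \<in> borel_measurable (?N \<Otimes>\<^sub>M ?N)"
      proof (subst borel_measurable_indicator_iff)
        have eq: "{w. fst w \<le> snd w} \<inter> space (?N \<Otimes>\<^sub>M ?N) = {w \<in> space (?N \<Otimes>\<^sub>M ?N). fst w \<le> snd w}" by blast
        assume "{w \<in> space (?N \<Otimes>\<^sub>M ?N). fst w \<le> snd w} \<in> sets (?N \<Otimes>\<^sub>M ?N)"
        thus "{w. fst w \<le> snd w} \<inter> space (?N \<Otimes>\<^sub>M ?N) \<in> sets (?N \<Otimes>\<^sub>M ?N)" unfolding eq .
      qed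
    qed measurable
    also have "(\<lambda>p. indicator {w. fst w \<le> snd w} p *\<^sub>R (k' (snd p) *\<^sub>R g (fst p))) = case_prod f"
      by (auto simp: f_def fun_eq_iff indicator_def)
    finally show ?thesis .
  qed
  have fi: "integrable (?N \<Otimes>\<^sub>M ?N) (case_prod f)"
  proof (rule integrableI_bounded[OF fm])
    have "(\<integral>\<^sup>+w. ennreal (norm (case_prod f w)) \<partial>(?N \<Otimes>\<^sub>M ?N)) = (\<integral>\<^sup>+y. \<integral>\<^sup>+s. ennreal (norm (f y s)) \<partial>?N \<partial>?N)"
      using fm by (subst N.nn_integral_fst[symmetric]) auto
    also have "\<dots> \<le> (\<integral>\<^sup>+y. \<integral>\<^sup>+s. ennreal (B * norm (g y)) \<partial>?N \<partial>?N)"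
      using B by (intro nn_integral_mono ennreal_leI) (auto simp: f_def indicator_def intro!: mult_right_mono)
    also have "\<dots> = (\<integral>\<^sup>+y. ennreal (B * (norm (g y))) * emeasure ?N {p..q} \<partial>?N)"
      by simp
    also have "\<dots> = (\<integral>\<^sup>+y. ennreal (B * (norm (g y))) \<partial>?N) * emeasure ?N {p..q}"
      using gm by (intro nn_integral_multc) measurable
    also have "\<dots> < \<infinity>"
    proof -
      have "integrable ?N (\<lambda>y. B * norm (g y))" using gN by auto
      hence "(\<integral>\<^sup>+y. ennreal (norm (B * norm (g y))) \<partial>?N) < \<infinity>"
        unfolding integrable_iff_bounded by blast
      moreover have "emeasure ?N {p..q} < \<infinity>" by (simp add: emeasure_restrict_space emeasure_lborel_Icc_eq)
      ultimately show ?thesis using B by (simp add: ennreal_mult_less_top abs_mult)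
    qed
    finally show "(\<integral>\<^sup>+w. ennreal (norm (case_prod f w)) \<partial>(?N \<Otimes>\<^sub>M ?N)) < \<infinity>" .
  qed
  have in1: "(\<integral>s. f y s \<partial>?N) = (k q - k y) *\<^sub>R g y" if y: "y \<in> {p..q}" for y
  proof -
    have ft: "(k' has_integral (k q - k y)) {y..q}"
      using y dk by (intro fundamental_theorem_of_calculus)
        (auto simp: has_real_derivative_iff_has_vector_derivative[symmetric] intro: has_field_derivative_at_within)
    have "(\<integral>s. f y s \<partial>?N) = (\<integral>s. (indicator {y..} s * k' s) *\<^sub>R g y \<partial>?N)" by (simp add: f_def)
    also have "\<dots> = (\<integral>s. indicator {y..} s * k' s \<partial>?N) *\<^sub>R g y"
    proof (rule integral_scaleR_left)
      show "integrable ?N (\<lambda>s. indicator {y..} s * k' s)"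
      proof (rule Bochner_Integration.integrable_bound)
        show "integrable ?N (\<lambda>s. B)" by (simp add: integrable_iff_bounded emeasure_restrict_space emeasure_lborel_Icc_eq ennreal_mult_less_top)
        have "indicat_real {y..} \<in> borel_measurable ?N" by (intro measurable_compose[OF idm]) simp
        thus "(\<lambda>s. indicator {y..} s * k' s) \<in> borel_measurable ?N" using km by (intro borel_measurable_times)
        show "AE s in ?N. norm (indicator {y..} s * k' s) \<le> norm B" using B by (intro AE_I2) (auto simp: indicator_def)
      qed
    qed
    also have "(\<integral>s. indicator {y..} s * k' s \<partial>?N) = k q - k y"
    proof -
      have "(\<integral>s. indicator {y..} s * k' s \<partial>?N) = (LINT s:{p..q}|lebesgue. indicator {y..} s * k' s)"
        by (simp add: set_lebesgue_integral_def integral_restrict_space)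
      also have "\<dots> = (LINT s:{y..q}|lebesgue. k' s)"
        unfolding set_lebesgue_integral_def using y
        by (intro Bochner_Integration.integral_cong refl) (auto simp: indicator_def)
      also have "\<dots> = integral {y..q} k'"
      proof (rule set_lebesgue_integral_eq_integral(2))
        have "continuous_on {y..q} k'" using continuous_on_subset[OF ck] y by auto
        thus "set_integrable lebesgue {y..q} k'"
          using absolutely_integrable_continuous_real[of y q k'] by (simp add: absolutely_integrable_on_def)
      qed
      also have "\<dots> = k q - k y" using ft by (rule integral_unique)
      finally show ?thesis .
    qed
    finally show ?thesis .
  qed
  have in2: "(\<integral>y. f y s \<partial>?N) = k' s *\<^sub>R integral {p..s} g" if s: "s \<in> {p..q}" for s
  proof -
    have "(\<integral>y. f y s \<partial>?N) = (\<integral>y. k' s *\<^sub>R (indicator {..s} y *\<^sub>R g y) \<partial>?N)"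
      by (intro Bochner_Integration.integral_cong refl) (auto simp: f_def indicator_def)
    also have "\<dots> = k' s *\<^sub>R (\<integral>y. indicator {..s} y *\<^sub>R g y \<partial>?N)" by (rule integral_scaleR_right)
    also have "(\<integral>y. indicator {..s} y *\<^sub>R g y \<partial>?N) = (LINT y:{p..q}|lebesgue. indicator {..s} y *\<^sub>R g y)"
      by (simp add: set_lebesgue_integral_def integral_restrict_space)
    also have "\<dots> = (LINT y:{p..s}|lebesgue. g y)"
      unfolding set_lebesgue_integral_def using s
      by (intro Bochner_Integration.integral_cong refl) (auto simp: indicator_def)
    also have "\<dots> = integral {p..s} g"
    proof (rule set_lebesgue_integral_eq_integral(2))
      show "set_integrable lebesgue {p..s} g"
        by (rule set_integrable_subset[of _ "{p..q}"]) (use g s in \<open>auto simp: absolutely_integrable_on_def\<close>)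
    qed
    finally show ?thesis .
  qed
  have i1: "integrable ?N (\<lambda>s. k' s *\<^sub>R integral {p..s} g)"
  proof -
    have "integrable ?N (\<lambda>s. \<integral>y. f y s \<partial>?N)" by (rule P.integrable_snd[OF fi])
    thus ?thesis by (subst (asm) Bochner_Integration.integrable_cong[OF refl]) (use in2 in auto)
  qed
  thus "(\<lambda>s. k' s *\<^sub>R integral {p..s} g) absolutely_integrable_on {p..q}" by (simp add: iff)
  have "(\<integral>y. (\<integral>s. f y s \<partial>?N) \<partial>?N) = (\<integral>s. (\<integral>y. f y s \<partial>?N) \<partial>?N)"
    by (rule P.Fubini_integral[OF fi, symmetric])
  moreover have "(\<integral>y. (\<integral>s. f y s \<partial>?N) \<partial>?N) = (\<integral>y. k q *\<^sub>R g y - k y *\<^sub>R g y \<partial>?N)"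
    by (intro Bochner_Integration.integral_cong refl) (simp add: in1 algebra_simps)
  moreover have "(\<integral>s. (\<integral>y. f y s \<partial>?N) \<partial>?N) = (\<integral>s. k' s *\<^sub>R integral {p..s} g \<partial>?N)"
    by (intro Bochner_Integration.integral_cong refl) (simp add: in2)
  ultimately have "k q *\<^sub>R integral {p..q} g - integral {p..q} (\<lambda>y. k y *\<^sub>R g y) = integral {p..q} (\<lambda>s. k' s *\<^sub>R integral {p..s} g)"
    using gN kg i1 by (simp add: LN[symmetric])
  thus "integral {p..q} (\<lambda>y. k y *\<^sub>R g y) = k q *\<^sub>R integral {p..q} g - integral {p..q} (\<lambda>s. k' s *\<^sub>R integral {p..s} g)"
    by (simp add: algebra_simps)
qed

text \<open>The kernel is not small near x, so smallness must come from the primitive of g, at most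
  \<epsilon> times the distance to x. Integration by parts puts it against the derivative of k,
  leaving the weighted integral W and two boundary values.\<close>

lemma integral_near_point_bound:
  fixes k k' :: "real \<Rightarrow> real" and g :: "real \<Rightarrow> complex"
  assumes d: "\<delta> > 0"
    and dk: "\<And>y. y \<in> {x - \<delta>..x + \<delta>} \<Longrightarrow> (k has_real_derivative k' y) (at y)"
    and ck: "continuous_on {x - \<delta>..x + \<delta>} k'" and g: "g absolutely_integrable_on {x - \<delta>..x + \<delta>}"
    and e: "\<epsilon> \<ge> 0"
    and prim: "\<And>u v. u \<le> v \<Longrightarrow> v - u \<le> \<delta> \<Longrightarrow> x = u \<or> x = v \<Longrightarrow> norm (integral {u..v} g) \<le> \<epsilon> * (v - u)"
    and W: "integral {x - \<delta>..x + \<delta>} (\<lambda>s. \<bar>k' s\<bar> * \<bar>s - x\<bar>) \<le> W"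
  shows "norm (integral {x - \<delta>..x + \<delta>} (\<lambda>y. k y *\<^sub>R g y)) \<le> \<epsilon> * ((\<bar>k (x - \<delta>)\<bar> + \<bar>k (x + \<delta>)\<bar>) * \<delta> + W)"
proof -
  define p q where "p = x - \<delta>" and "q = x + \<delta>"
  have pq: "p < x" "x < q" "x - p = \<delta>" "q - x = \<delta>" using d by (auto simp: p_def q_def)
  \<comment> \<open>Subtracting c makes the primitive vanish at x rather than at the left end; the
    two contributions of c are a boundary term and an integral of k', which combine to k p times
    c.\<close>
  define c where "c = integral {p..x} g"
  define G where "G s = integral {p..s} g" for s
  note parts = integral_parts_primitive[OF dk[folded p_def q_def] ck[folded p_def q_def] g[folded p_def q_def], folded G_def]
  have gi: "g integrable_on {r..s}" if "p \<le> r" "s \<le> q" for r s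
    using absolutely_integrable_on_subinterval[OF g, of r s] that
    by (auto simp: p_def q_def intro: set_lebesgue_integral_eq_integral(1))
  have Gc: "norm (G s - c) \<le> \<epsilon> * \<bar>s - x\<bar>" if s: "s \<in> {p..q}" for s
  proof (cases "x \<le> s")
    case True
    have "c + integral {x..s} g = G s" unfolding c_def G_def
      using True s pq by (intro Henstock_Kurzweil_Integration.integral_combine gi) auto
    hence "G s - c = integral {x..s} g" by (simp add: algebra_simps)
    thus ?thesis using prim[of x s] True s pq by auto
  next
    case False
    have "G s + integral {s..x} g = c" unfolding c_def G_def
      using False s pq by (intro Henstock_Kurzweil_Integration.integral_combine gi) auto
    hence "G s - c = - integral {s..x} g" by (simp add: algebra_simps)
    thus ?thesis using prim[of s x] False s pq by auto
  qed
  have ft: "(k' has_integral (k q - k p)) {p..q}"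
    using pq dk by (intro fundamental_theorem_of_calculus)
      (auto simp: has_real_derivative_iff_has_vector_derivative[symmetric] p_def q_def intro: has_field_derivative_at_within)
  have k'c: "((\<lambda>s. k' s *\<^sub>R c) has_integral (k q - k p) *\<^sub>R c) {p..q}"
    using has_integral_linear[OF ft bounded_linear_scaleR_left[of c]] by (simp add: o_def)
  have i1: "(\<lambda>s. k' s *\<^sub>R G s) integrable_on {p..q}"
    using parts(2) by (rule set_lebesgue_integral_eq_integral(1))
  have i2: "(\<lambda>s. k' s *\<^sub>R (G s - c)) integrable_on {p..q}"
    "integral {p..q} (\<lambda>s. k' s *\<^sub>R (G s - c)) = integral {p..q} (\<lambda>s. k' s *\<^sub>R G s) - (k q - k p) *\<^sub>R c"
    using integrable_diff[OF i1 has_integral_integrable[OF k'c]]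
      Henstock_Kurzweil_Integration.integral_diff[OF i1 has_integral_integrable[OF k'c]] integral_unique[OF k'c]
    by (simp_all add: scaleR_diff_right)
  have "continuous_on {p..q} (\<lambda>s. \<bar>k' s\<bar> * \<bar>s - x\<bar>)"
    using ck by (intro continuous_intros) (auto simp: p_def q_def)
  hence ci: "(\<lambda>s. \<bar>k' s\<bar> * \<bar>s - x\<bar>) integrable_on {p..q}" by (rule integrable_continuous_real)
  have "norm (integral {p..q} (\<lambda>s. k' s *\<^sub>R (G s - c))) \<le> integral {p..q} (\<lambda>s. \<epsilon> * (\<bar>k' s\<bar> * \<bar>s - x\<bar>))"
  proof (rule integral_norm_bound_integral[OF i2(1)])
    show "(\<lambda>s. \<epsilon> * (\<bar>k' s\<bar> * \<bar>s - x\<bar>)) integrable_on {p..q}"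
      using integrable_on_cmult_left[OF ci, of \<epsilon>] by simp
    fix s assume s: "s \<in> {p..q}"
    have "norm (k' s *\<^sub>R (G s - c)) \<le> \<bar>k' s\<bar> * (\<epsilon> * \<bar>s - x\<bar>)"
      using Gc[OF s] by (simp add: mult_left_mono)
    thus "norm (k' s *\<^sub>R (G s - c)) \<le> \<epsilon> * (\<bar>k' s\<bar> * \<bar>s - x\<bar>)" by (simp add: mult_ac)
  qed
  also have "\<dots> = \<epsilon> * integral {p..q} (\<lambda>s. \<bar>k' s\<bar> * \<bar>s - x\<bar>)" by simp
  also have "\<dots> \<le> \<epsilon> * W" using W e by (intro mult_left_mono) (auto simp: p_def q_def)
  finally have 1: "norm (integral {p..q} (\<lambda>s. k' s *\<^sub>R (G s - c))) \<le> \<epsilon> * W" .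
  have "integral {p..q} (\<lambda>y. k y *\<^sub>R g y) = k q *\<^sub>R G q - integral {p..q} (\<lambda>s. k' s *\<^sub>R G s)"
    using parts(3) by (simp add: G_def)
  also have "\<dots> = k q *\<^sub>R (G q - c) + k p *\<^sub>R c - integral {p..q} (\<lambda>s. k' s *\<^sub>R (G s - c))"
    unfolding i2(2) by (simp add: algebra_simps)
  finally have eq: "integral {p..q} (\<lambda>y. k y *\<^sub>R g y) = \<dots>" .
  have Gp: "norm c \<le> \<epsilon> * \<delta>" using prim[of p x] pq by (simp add: c_def)
  have Gq: "norm (G q - c) \<le> \<epsilon> * \<delta>" using Gc[of q] pq by simp
  have "norm (integral {p..q} (\<lambda>y. k y *\<^sub>R g y)) \<le> norm (k q *\<^sub>R (G q - c)) + norm (k p *\<^sub>R c) + norm (integral {p..q} (\<lambda>s. k' s *\<^sub>R (G s - c)))"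
    unfolding eq by (intro order_trans[OF norm_triangle_ineq4] add_right_mono norm_triangle_ineq)
  also have "\<dots> \<le> \<bar>k q\<bar> * (\<epsilon> * \<delta>) + \<bar>k p\<bar> * (\<epsilon> * \<delta>) + \<epsilon> * W"
    using Gp Gq 1 by (intro add_mono) (auto intro: mult_left_mono)
  finally show ?thesis by (simp add: p_def q_def algebra_simps)
qed

lemma weighted_kernel_integrable:
  assumes a: "a > 0" and u: "u > 0" and x: "x > 0"
  shows "integrable (lebesgue_on {0<..}) (weighted_kernel a m u x)" "(\<integral>y. weighted_kernel a m u x y \<partial>lebesgue_on {0<..}) = exp (- (m * u))"
  using hh_kernel_mass[OF a u x, of m] unfolding has_bochner_integral_iff weighted_kernel_def[abs_def] by auto

lemma weighted_kernel_second_moment: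
  assumes a: "a > 0" and u: "u > 0" and x: "x > 0" and m: "m \<ge> 0"
  shows "integrable (lebesgue_on {0<..}) (\<lambda>y. weighted_kernel a m u x y * (y - x)\<^sup>2)"
    and "(\<integral>y. weighted_kernel a m u x y * (y - x)\<^sup>2 \<partial>lebesgue_on {0<..}) \<le> (x\<^sup>2 + 2 * x + a * (a + 1)) / (1 + rho u)"
  using hh_kernel_second_moment[OF a u x m] by (simp_all add: weighted_kernel_def)

lemma integral_Icc_le_Ioi:
  fixes h :: "real \<Rightarrow> real"
  assumes "integrable (lebesgue_on {0<..}) h" "\<And>y. y > 0 \<Longrightarrow> h y \<ge> 0" "p > 0"
  shows "h integrable_on {p..q}" "integral {p..q} h \<le> (\<integral>y. h y \<partial>lebesgue_on {0<..})"
proof -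
  have "set_integrable lebesgue {0<..} h"
    using assms(1) by (simp add: set_integrable_def integrable_restrict_space)
  hence i: "h integrable_on {0<..}" "set_integrable lebesgue {p..q} h"
    using assms(3) by (auto intro: set_lebesgue_integral_eq_integral(1) set_integrable_subset)
  show ii: "h integrable_on {p..q}" using i(2) by (rule set_lebesgue_integral_eq_integral(1))
  have "integral {p..q} h \<le> integral {0<..} h"
    using assms by (intro integral_subset_le ii i) auto
  also have "\<dots> = (\<integral>y. h y \<partial>lebesgue_on {0<..})"
    using assms(1) by (intro lebesgue_integral_eq_integral[symmetric]) auto
  finally show "integral {p..q} h \<le> (\<integral>y. h y \<partial>lebesgue_on {0<..})" .
qed

text \<open>The bound is uniform in u: the singular part of the derivative, (1 + rho u) \<bar>s -
  x\<bar> times the kernel, acquires another factor \<bar>s - x\<bar>, and the second moment is of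
  order 1 / (1 + rho u). The bounded part is controlled by the total mass.\<close>

lemma weighted_kernel_deriv_near_bound:
  assumes a: "a > 0" and u: "u > 0" and x: "x > 0" and m: "m \<ge> 0" and d: "0 < \<delta>" "\<delta> \<le> x / 2"
  shows "integral {x - \<delta>..x + \<delta>} (\<lambda>s. \<bar>weighted_kernel_deriv a m u x s\<bar> * \<bar>s - x\<bar>)
     \<le> 2 / x * (x\<^sup>2 + 2 * x + a * (a + 1)) + (2 + 2 * (\<bar>a - 1\<bar> + a + \<bar>1 - a\<bar>) / x) * x"
proof -
  define C where "C = 2 + 2 * (\<bar>a - 1\<bar> + a + \<bar>1 - a\<bar>) / x"
  have C: "C \<ge> 0" using a x by (simp add: C_def)
  define Q where "Q = 1 + rho u"
  have Q: "Q > 0" using rho_pos[OF u] by (simp add: Q_def)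
  have p: "x - \<delta> > 0" using d x by linarith
  define h where "h s = 2 * Q / x * (weighted_kernel a m u x s * (s - x)\<^sup>2) + C * x * weighted_kernel a m u x s" for s
  have hi: "integrable (lebesgue_on {0<..}) h"
    unfolding h_def by (intro Bochner_Integration.integrable_add integrable_mult_right weighted_kernel_integrable weighted_kernel_second_moment a u x m)
  have h0: "h y \<ge> 0" if "y > 0" for y
    using weighted_kernel_nonneg[OF a u, of x y m] x that Q C by (simp add: h_def)
  have "integral {x - \<delta>..x + \<delta>} (\<lambda>s. \<bar>weighted_kernel_deriv a m u x s\<bar> * \<bar>s - x\<bar>) \<le> integral {x - \<delta>..x + \<delta>} h"
  proof (rule integral_le)
    have "continuous_on {x - \<delta>..x + \<delta>} (\<lambda>s. \<bar>weighted_kernel_deriv a m u x s\<bar> * \<bar>s - x\<bar>)"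
      by (intro continuous_intros continuous_on_weighted_kernel_deriv a u x p)
    thus "(\<lambda>s. \<bar>weighted_kernel_deriv a m u x s\<bar> * \<bar>s - x\<bar>) integrable_on {x - \<delta>..x + \<delta>}" by (rule integrable_continuous_real)
    show "h integrable_on {x - \<delta>..x + \<delta>}" by (rule integral_Icc_le_Ioi(1)[OF hi h0 p])
    fix s assume s: "s \<in> {x - \<delta>..x + \<delta>}"
    have s2: "s \<ge> x / 2" "s > 0" "\<bar>s - x\<bar> \<le> x" using s d x p by auto
    have k: "weighted_kernel a m u x s \<ge> 0" using weighted_kernel_nonneg[OF a u, of x s m] x s2 by simp
    define t where "t = \<bar>s - x\<bar>"
    have t2: "(s - x)\<^sup>2 = t\<^sup>2" by (simp add: t_def)
    have "\<bar>weighted_kernel_deriv a m u x s\<bar> * t \<le> (weighted_kernel a m u x s * (2 * Q * t / x + C)) * t"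
      using weighted_kernel_deriv_bound[OF a u x s2(1), of m] by (intro mult_right_mono) (auto simp: Q_def C_def t_def)
    also have "\<dots> = 2 * Q / x * (weighted_kernel a m u x s * t\<^sup>2) + C * weighted_kernel a m u x s * t"
      by (simp add: power2_eq_square algebra_simps)
    also have "\<dots> \<le> 2 * Q / x * (weighted_kernel a m u x s * t\<^sup>2) + C * weighted_kernel a m u x s * x"
      using C k s2 by (intro add_left_mono mult_left_mono) (auto simp: t_def)
    finally show "\<bar>weighted_kernel_deriv a m u x s\<bar> * \<bar>s - x\<bar> \<le> h s" unfolding h_def t2 t_def[symmetric] by (simp add: mult_ac)
  qed
  also have "\<dots> \<le> (\<integral>y. h y \<partial>lebesgue_on {0<..})" by (rule integral_Icc_le_Ioi(2)[OF hi h0 p])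
  also have "\<dots> = 2 * Q / x * (\<integral>y. weighted_kernel a m u x y * (y - x)\<^sup>2 \<partial>lebesgue_on {0<..}) + C * x * (\<integral>y. weighted_kernel a m u x y \<partial>lebesgue_on {0<..})"
    unfolding h_def using weighted_kernel_integrable(1)[OF a u x, of m] weighted_kernel_second_moment(1)[OF a u x m]
    by (subst Bochner_Integration.integral_add) auto
  also have "\<dots> \<le> 2 * Q / x * ((x\<^sup>2 + 2 * x + a * (a + 1)) / Q) + C * x * 1"
    using weighted_kernel_second_moment(2)[OF a u x m] weighted_kernel_integrable(2)[OF a u x, of m] Q x C m u
    by (intro add_mono mult_left_mono) (auto simp: Q_def)
  finally show ?thesis using Q by (simp add: C_def)
qed

section \<open>Integrability against the kernel and the heat limit\<close>

lemma L1_Phi_integrable: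
  assumes "f \<in> L1_Phi \<alpha> m \<nu>"
  shows "integrable (lebesgue_on {0<..}) (\<lambda>y. (y powr \<alpha> * exp (- y) * Phi_factor m \<nu> y) *\<^sub>R f y)"
proof (rule integrableI_bounded)
  have fm: "f \<in> borel_measurable (lebesgue_on {0<..})" using assms by (simp add: L1_Phi_def)
  show "(\<lambda>y. (y powr \<alpha> * exp (- y) * Phi_factor m \<nu> y) *\<^sub>R f y) \<in> borel_measurable (lebesgue_on {0<..})"
    by (intro borel_measurable_scaleR borel_measurable_times borel_measurable_Phi_factor_Ioi fm) measurable
  have "(\<integral>\<^sup>+y. ennreal (norm ((y powr \<alpha> * exp (- y) * Phi_factor m \<nu> y) *\<^sub>R f y)) \<partial>lebesgue_on {0<..})
     = (\<integral>\<^sup>+y. ennreal (y powr \<alpha> * exp (- y) * norm (f y)) * ennreal (Phi_factor m \<nu> y) \<partial>lebesgue_on {0<..})"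
    by (intro nn_integral_cong) (auto simp: ennreal_mult[symmetric] Phi_factor_pos less_imp_le abs_mult mult_ac)
  also have "\<dots> < \<infinity>" using assms by (simp add: L1_Phi_iff)
  finally show "(\<integral>\<^sup>+y. ennreal (norm ((y powr \<alpha> * exp (- y) * Phi_factor m \<nu> y) *\<^sub>R f y)) \<partial>lebesgue_on {0<..}) < \<infinity>" .
qed

lemma L1_Phi_locally_integrable:
  assumes "f \<in> L1_Phi \<alpha> m \<nu>" and p: "p > 0"
  shows "f absolutely_integrable_on {p..q}"
proof -
  have fm: "f \<in> borel_measurable (lebesgue_on {0<..})" using assms by (simp add: L1_Phi_def)
  define h where "h y = y powr \<alpha> * exp (- y) * Phi_factor m \<nu> y" for y
  have h0: "h y > 0" if "y > 0" for y using that Phi_factor_pos[of y m \<nu>] by (simp add: h_def)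
  have nz: "1 + y \<noteq> 0" "exp 1 + y \<noteq> 0" "ln (exp 1 + y) \<noteq> 0" "y \<noteq> 0" "Phi_factor m \<nu> y \<noteq> 0" if "y \<in> {p..q}" for y
    using that p exp1_plus_nz[of y] ln_exp1_plus_ge[of y] Phi_factor_pos[of y m \<nu>] by auto
  have "continuous_on {p..q} (Phi_factor m \<nu>)"
  proof (cases "m > 0")
    case True
    have "continuous_on {p..q} (\<lambda>y. 1 / ((1 + y) powr m * ln (exp 1 + y) powr (1 + \<nu>)))"
      using nz by (intro continuous_intros ballI) auto
    thus ?thesis using True by (simp add: Phi_factor_def[abs_def])
  next
    case False
    have "continuous_on {p..q} (\<lambda>y. 1 / ln (exp 1 + y) powr \<nu>)"
      using nz by (intro continuous_intros ballI) auto
    thus ?thesis using False by (simp add: Phi_factor_def[abs_def])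
  qed
  hence ch: "continuous_on {p..q} (\<lambda>y. 1 / h y)"
    unfolding h_def using nz by (intro continuous_intros ballI) auto
  have "bounded ((\<lambda>y. 1 / h y) ` {p..q})"
    by (rule compact_imp_bounded[OF compact_continuous_image[OF ch compact_Icc]])
  then obtain B where "\<forall>z\<in>(\<lambda>y. 1 / h y) ` {p..q}. norm z \<le> B" unfolding bounded_iff ..
  hence B: "\<bar>1 / h y\<bar> \<le> B" if "y \<in> {p..q}" for y using that by simp
  have "set_integrable lebesgue {0<..} (\<lambda>y. h y *\<^sub>R f y)"
    using L1_Phi_integrable[OF assms(1)] by (simp add: set_integrable_def integrable_restrict_space h_def)
  hence si: "set_integrable lebesgue {p..q} (\<lambda>y. h y *\<^sub>R f y)" using p by (auto intro: set_integrable_subset)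
  have "set_integrable lebesgue {p..q} (\<lambda>y. B *\<^sub>R (h y *\<^sub>R f y))" using si by (rule set_integrable_scaleR_right)
  thus ?thesis
  proof (rule set_integrable_bound)
    have "set_borel_measurable lebesgue {0<..} f"
      using fm by (simp add: set_borel_measurable_def borel_measurable_restrict_space_iff)
    thus "set_borel_measurable lebesgue {p..q} f" using p by (auto intro: set_borel_measurable_subset)
    show "AE y\<in>{p..q} in lebesgue. norm (f y) \<le> norm (B *\<^sub>R (h y *\<^sub>R f y))"
    proof (rule AE_I2, rule impI)
      fix y assume y: "y \<in> {p..q}"
      hence hy: "h y > 0" using p by (intro h0) auto
      hence "1 \<le> B * h y" using B[OF y] by (simp add: field_simps)
      hence "1 \<le> \<bar>B * h y\<bar>" by linarith
      hence "1 * norm (f y) \<le> \<bar>B * h y\<bar> * norm (f y)" by (intro mult_right_mono) auto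
      thus "norm (f y) \<le> norm (B *\<^sub>R (h y *\<^sub>R f y))" by (simp add: abs_mult)
    qed
  qed
qed

text \<open>For each single u > 0 the kernel decays exponentially in y, and
  \<open>Phi_factor\<close> only like a power and a logarithm. The constant E degenerates with u,
  which is why the limit needs the separate estimate away from the diagonal.\<close>

lemma weighted_kernel_f_integrable:
  assumes \<alpha>: "\<alpha> > -1" and m: "m \<ge> 0" and \<nu>: "\<nu> > 0" and f: "f \<in> L1_Phi \<alpha> m \<nu>" and u: "u > 0" and x: "x > 0"
  shows "integrable (lebesgue_on {0<..}) (\<lambda>y. weighted_kernel (\<alpha> + 1) m u x y *\<^sub>R f y)"
proof -
  have a: "\<alpha> + 1 > 0" using \<alpha> by simp
  have fm: "f \<in> borel_measurable (lebesgue_on {0<..})" using f by (simp add: L1_Phi_def)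
  obtain C p where C: "C > 0" "p \<ge> 0" "\<And>m u y. u > 0 \<Longrightarrow> y \<ge> 0 \<Longrightarrow>
    hh_kernel (\<alpha> + 1) m u x y \<le> C * (exp (- (m * u)) * (1 + 1 / u) powr p * exp (- (exp (- u) * y / 4)))"
    using hh_kernel_upper_fixed[OF a x] by blast
  obtain D where D: "D > 0" "\<And>y. y \<ge> 0 \<Longrightarrow> exp (- (exp (- u) / 4 * y)) \<le> D * Phi_factor m \<nu> y"
    using exp_le_Phi_factor[of "exp (- u) / 4" m \<nu>] m \<nu> by auto
  define E where "E = C * (exp (- (m * u)) * (1 + 1 / u) powr p * D)"
  have up: "hh_kernel (\<alpha> + 1) m u x y \<le> E * Phi_factor m \<nu> y" if "y \<ge> 0" for y
  proof -
    have "C * (exp (- (m * u)) * (1 + 1 / u) powr p * exp (- (exp (- u) * y / 4)))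
        \<le> C * (exp (- (m * u)) * (1 + 1 / u) powr p * (D * Phi_factor m \<nu> y))"
      using C(1) D(2)[OF that] by (intro mult_left_mono) auto
    thus ?thesis using C(3)[OF u that, of m] by (simp add: E_def mult_ac)
  qed
  show ?thesis
  proof (rule Bochner_Integration.integrable_bound)
    show "integrable (lebesgue_on {0<..}) (\<lambda>y. E *\<^sub>R ((y powr \<alpha> * exp (- y) * Phi_factor m \<nu> y) *\<^sub>R f y))"
      by (intro integrable_scaleR_right L1_Phi_integrable f)
    show "(\<lambda>y. weighted_kernel (\<alpha> + 1) m u x y *\<^sub>R f y) \<in> borel_measurable (lebesgue_on {0<..})"
      using weighted_kernel_integrable(1)[OF a u x, of m] fm by (intro borel_measurable_scaleR) auto
    show "AE y in lebesgue_on {0<..}. norm (weighted_kernel (\<alpha> + 1) m u x y *\<^sub>R f y) \<le> norm (E *\<^sub>R ((y powr \<alpha> * exp (- y) * Phi_factor m \<nu> y) *\<^sub>R f y))"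
    proof (rule AE_I2)
      fix y :: real assume "y \<in> space (lebesgue_on {0<..})"
      hence y: "y > 0" by simp
      have "1 + 1 / u > 0" using u by (intro add_pos_pos) auto
      hence E: "E > 0" unfolding E_def using C(1) D(1) by (intro mult_pos_pos) auto
      have l: "hh_kernel (\<alpha> + 1) m u x y > 0" using hh_kernel_nonneg[OF a u] x y by auto
      have "hh_kernel (\<alpha> + 1) m u x y * (y powr \<alpha> * exp (- y) * norm (f y)) \<le> E * Phi_factor m \<nu> y * (y powr \<alpha> * exp (- y) * norm (f y))"
        using y by (intro mult_right_mono up) auto
      thus "norm (weighted_kernel (\<alpha> + 1) m u x y *\<^sub>R f y) \<le> norm (E *\<^sub>R ((y powr \<alpha> * exp (- y) * Phi_factor m \<nu> y) *\<^sub>R f y))"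
        using l E Phi_factor_pos[of y m \<nu>] y by (simp add: weighted_kernel_def abs_mult mult_ac)
    qed
  qed
qed

text \<open>The deviation of the semigroup from f x is split into the part near x, handled by parts
  with g = f - f x; the part far from x, where f is controlled by the off-diagonal decay and the
  constant f x by Chebyshev's inequality; and the defect of the mass exp (- m u) from 1.\<close>

lemma heat_limit:
  fixes f :: "real \<Rightarrow> complex"
  assumes \<alpha>: "\<alpha> > -1" and m: "m \<ge> 0" and \<nu>: "\<nu> > 0" and f: "f \<in> L1_Phi \<alpha> m \<nu>" and x: "x > 0"
    and diff: "\<And>e. e > 0 \<Longrightarrow> \<exists>d>0. \<forall>u v. u < v \<longrightarrow> v - u < d \<longrightarrow> (x = u \<or> x = v) \<longrightarrow>
           norm ((v - u) *\<^sub>R f x - integral {u..v} f) \<le> e * (v - u)"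
  shows "((\<lambda>u. \<integral>y. weighted_kernel (\<alpha> + 1) m u x y *\<^sub>R f y \<partial>lebesgue_on {0<..}) \<longlongrightarrow> f x) (at_right 0)"
proof (rule tendstoI)
  fix e :: real assume e: "e > 0"
  let ?R = "lebesgue_on {0::real<..}"
  define a where "a = \<alpha> + 1"
  have a: "a > 0" using \<alpha> by (simp add: a_def)
  define Cm where "Cm = x\<^sup>2 + 2 * x + a * (a + 1)"
  define W where "W = 2 / x * Cm + (2 + 2 * (\<bar>a - 1\<bar> + a + \<bar>1 - a\<bar>) / x) * x"
  have W: "W \<ge> 0" using a x by (simp add: W_def Cm_def)
  \<comment> \<open>W is the bound for the derivative integral, independent of u, so \<epsilon> can
    be fixed first with \<epsilon> W < e; the radius and then u follow.\<close>
  define \<epsilon> where "\<epsilon> = e / (2 * (W + 1))"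
  have \<epsilon>: "\<epsilon> > 0" "\<epsilon> * W < e"
  proof -
    show "\<epsilon> > 0" using e W by (simp add: \<epsilon>_def)
    have "e * W < e * (2 * (W + 1))" using e W by (intro mult_strict_left_mono) auto
    thus "\<epsilon> * W < e" using W by (simp add: \<epsilon>_def divide_less_eq)
  qed
  obtain d where d: "d > 0" "\<And>u v. u < v \<Longrightarrow> v - u < d \<Longrightarrow> (x = u \<or> x = v) \<Longrightarrow>
           norm ((v - u) *\<^sub>R f x - integral {u..v} f) \<le> \<epsilon> * (v - u)"
    using diff[OF \<epsilon>(1)] by blast
  \<comment> \<open>Below x / 2 for the bound on the logarithmic derivative, and strictly below d so
    that every interval in question satisfies the differentiability estimate.\<close>
  define \<delta> where "\<delta> = min (d / 2) (x / 2)"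
  have \<delta>: "\<delta> > 0" "\<delta> \<le> x / 2" "\<delta> < d" using d(1) x by (auto simp: \<delta>_def)
  have p0: "x - \<delta> > 0" using \<delta> x by linarith
  obtain C c where C: "C > 0" "c > 0" "\<And>u y. 0 < u \<Longrightarrow> u \<le> c \<Longrightarrow> y \<ge> 0 \<Longrightarrow> \<bar>y - x\<bar> \<ge> \<delta> \<Longrightarrow>
     hh_kernel a m u x y \<le> C * exp (- (c / u)) * Phi_factor m \<nu> y"
    using hh_kernel_far[OF a x \<delta>(1) m \<nu>] by blast
  define w where "w y = y powr (a - 1) * exp (- y)" for y
  define I0 where "I0 = (\<integral>y. norm ((w y * Phi_factor m \<nu> y) *\<^sub>R f y) \<partial>?R)"
  have iw: "integrable ?R (\<lambda>y. (w y * Phi_factor m \<nu> y) *\<^sub>R f y)"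
    using L1_Phi_integrable[OF f] by (simp add: w_def a_def)
  define b where "b u = C * exp (- (c / u)) * (Phi_factor m \<nu> (x - \<delta>) * w (x - \<delta>)) + C * exp (- (c / u)) * (Phi_factor m \<nu> (x + \<delta>) * w (x + \<delta>))" for u
  \<comment> \<open>An explicit majorant of the error. All its terms vanish as u tends to 0 except
    \<epsilon> W, so eventually it is below e.\<close>
  define Bd where "Bd u = \<epsilon> * (b u * \<delta> + W) + (C * exp (- (c / u)) * I0 + norm (f x) / \<delta>\<^sup>2 * (Cm * u)) + norm (f x) * \<bar>exp (- (m * u)) - 1\<bar>" for u
  have ef: "((\<lambda>u. exp (- (c / u))) \<longlongrightarrow> 0) (at_right 0)" using C(2) by real_asymp
  have "(Bd \<longlongrightarrow> \<epsilon> * ((C * 0 * (Phi_factor m \<nu> (x - \<delta>) * w (x - \<delta>)) + C * 0 * (Phi_factor m \<nu> (x + \<delta>) * w (x + \<delta>))) * \<delta> + W)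
      + (C * 0 * I0 + norm (f x) / \<delta>\<^sup>2 * (Cm * 0)) + norm (f x) * \<bar>exp (- (m * 0)) - 1\<bar>) (at_right 0)"
    unfolding Bd_def b_def by (intro tendsto_intros ef)
  hence "(Bd \<longlongrightarrow> \<epsilon> * W) (at_right 0)" by simp
  hence ev1: "eventually (\<lambda>u. Bd u < e) (at_right 0)" using \<epsilon>(2) by (rule order_tendstoD)
  have ev2: "eventually (\<lambda>u. 0 < u \<and> u < c) (at_right 0)"
    using C(2) eventually_at_right_less[of 0] by (auto simp: eventually_at_right intro!: exI[of _ c])
  show "eventually (\<lambda>u. dist (\<integral>y. weighted_kernel (\<alpha> + 1) m u x y *\<^sub>R f y \<partial>?R) (f x) < e) (at_right 0)"
    using ev1 ev2
  proof eventually_elim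
    case (elim u)
    hence u: "u > 0" "u \<le> c" by auto
    define k where "k = weighted_kernel a m u x"
    define g where "g y = f y - f x" for y
    define S where "S = {x - \<delta>..x + \<delta>}"
    have kf: "integrable ?R (\<lambda>y. k y *\<^sub>R f y)" unfolding k_def a_def by (rule weighted_kernel_f_integrable[OF \<alpha> m \<nu> f u(1) x])
    have k1: "integrable ?R k" "(\<integral>y. k y \<partial>?R) = exp (- (m * u))" unfolding k_def by (rule weighted_kernel_integrable[OF a u(1) x])+
    have k2: "integrable ?R (\<lambda>y. k y * (y - x)\<^sup>2)" "(\<integral>y. k y * (y - x)\<^sup>2 \<partial>?R) \<le> Cm * u"
    proof -
      show "integrable ?R (\<lambda>y. k y * (y - x)\<^sup>2)" unfolding k_def by (rule weighted_kernel_second_moment[OF a u(1) x m])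
      have "(\<integral>y. k y * (y - x)\<^sup>2 \<partial>?R) \<le> Cm / (1 + rho u)"
        unfolding k_def Cm_def by (rule weighted_kernel_second_moment[OF a u(1) x m])
      also have "\<dots> \<le> Cm / (1 / u)"
        using one_plus_rho_ge[OF u(1)] u a x rho_pos[OF u(1)] by (intro divide_left_mono) (auto simp: Cm_def)
      finally show "(\<integral>y. k y * (y - x)\<^sup>2 \<partial>?R) \<le> Cm * u" by simp
    qed
    have k0: "k y \<ge> 0" if "y \<ge> 0" for y unfolding k_def using a u x that by (intro weighted_kernel_nonneg) auto
    have far: "k y \<le> C * exp (- (c / u)) * (Phi_factor m \<nu> y * w y)" if "y > 0" "\<bar>y - x\<bar> \<ge> \<delta>" for y
    proof -
      have "hh_kernel a m u x y * w y \<le> C * exp (- (c / u)) * Phi_factor m \<nu> y * w y"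
        using that u by (intro mult_right_mono C(3)) (auto simp: w_def)
      thus ?thesis by (simp add: k_def weighted_kernel_def w_def mult_ac)
    qed
    have kg: "integrable ?R (\<lambda>y. k y *\<^sub>R g y)"
      unfolding g_def scaleR_diff_right using kf k1(1) by (intro Bochner_Integration.integrable_diff) auto
    have eqg: "(\<integral>y. k y *\<^sub>R g y \<partial>?R) = (\<integral>y. k y *\<^sub>R f y \<partial>?R) - exp (- (m * u)) *\<^sub>R f x"
      unfolding g_def scaleR_diff_right using kf k1 by (subst Bochner_Integration.integral_diff) auto
    have Sm: "S \<inter> {0<..} \<in> sets ?R" by (simp add: S_def sets_restrict_space_iff)
    have iS: "integrable ?R (\<lambda>y. indicator S y *\<^sub>R (k y *\<^sub>R g y))"
    proof -
      have "integrable ?R (\<lambda>y. indicator (S \<inter> {0<..}) y *\<^sub>R (k y *\<^sub>R g y))"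
        by (rule integrable_mult_indicator[OF Sm kg])
      thus ?thesis by (subst (asm) Bochner_Integration.integrable_cong[OF refl]) (auto simp: indicator_def)
    qed
    have split: "(\<integral>y. k y *\<^sub>R g y \<partial>?R) = (\<integral>y. indicator S y *\<^sub>R (k y *\<^sub>R g y) \<partial>?R) + (\<integral>y. k y *\<^sub>R g y - indicator S y *\<^sub>R (k y *\<^sub>R g y) \<partial>?R)"
      using kg iS by (subst Bochner_Integration.integral_diff) auto
    have near: "norm (\<integral>y. indicator S y *\<^sub>R (k y *\<^sub>R g y) \<partial>?R) \<le> \<epsilon> * (b u * \<delta> + W)"
    proof -
      have fS: "f absolutely_integrable_on S" unfolding S_def by (rule L1_Phi_locally_integrable[OF f p0])
      have gS: "g absolutely_integrable_on S"
        unfolding g_def using fS by (intro set_integral_diff(1)) (auto simp: S_def intro: absolutely_integrable_continuous_real)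
      have dk: "(k has_real_derivative weighted_kernel_deriv a m u x y) (at y)" if "y \<in> {x - \<delta>..x + \<delta>}" for y
        unfolding k_def using that p0 by (intro DERIV_weighted_kernel a u x) auto
      have ck: "continuous_on {x - \<delta>..x + \<delta>} (weighted_kernel_deriv a m u x)" by (rule continuous_on_weighted_kernel_deriv[OF a u(1) x p0])
      have "(\<integral>y. indicator S y *\<^sub>R (k y *\<^sub>R g y) \<partial>?R) = (LINT y:{0<..}|lebesgue. indicator S y *\<^sub>R (k y *\<^sub>R g y))"
        by (simp add: LINT_Ioi_eq)
      also have "\<dots> = (LINT y:S|lebesgue. k y *\<^sub>R g y)"
        unfolding set_lebesgue_integral_def using p0
        by (intro Bochner_Integration.integral_cong refl) (auto simp: indicator_def S_def)
      also have "\<dots> = integral S (\<lambda>y. k y *\<^sub>R g y)"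
        unfolding S_def by (rule set_lebesgue_integral_eq_integral(2), rule integral_parts_primitive(1)[OF dk ck])
          (use gS in \<open>auto simp: S_def\<close>)
      also have "norm \<dots> \<le> \<epsilon> * ((\<bar>k (x - \<delta>)\<bar> + \<bar>k (x + \<delta>)\<bar>) * \<delta> + W)"
        unfolding S_def
      proof (rule integral_near_point_bound[OF \<delta>(1) dk ck])
        show "g absolutely_integrable_on {x - \<delta>..x + \<delta>}" using gS by (simp add: S_def)
        show "0 \<le> \<epsilon>" using \<epsilon> by simp
        show "integral {x - \<delta>..x + \<delta>} (\<lambda>s. \<bar>weighted_kernel_deriv a m u x s\<bar> * \<bar>s - x\<bar>) \<le> W"
          unfolding W_def Cm_def by (rule weighted_kernel_deriv_near_bound[OF a u(1) x m \<delta>(1,2)])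
        fix r s assume rs: "r \<le> s" "s - r \<le> \<delta>" "x = r \<or> x = s"
        show "norm (integral {r..s} g) \<le> \<epsilon> * (s - r)"
        proof (cases "r = s")
          case False
          have "f integrable_on {r..s}"
            using L1_Phi_locally_integrable[OF f, of r s] rs \<delta> x set_lebesgue_integral_eq_integral(1) by force
          hence "integral {r..s} g = integral {r..s} f - (s - r) *\<^sub>R f x"
            unfolding g_def using rs(1) by (subst Henstock_Kurzweil_Integration.integral_diff) (auto simp: integral_const_real)
          thus ?thesis using d(2)[of r s] rs False \<delta> by (simp add: norm_minus_commute)
        qed auto
      qed auto
      also have "\<dots> \<le> \<epsilon> * (b u * \<delta> + W)"
      proof -
        have "\<bar>k (x - \<delta>)\<bar> + \<bar>k (x + \<delta>)\<bar> \<le> b u"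
          unfolding b_def using far[of "x - \<delta>"] far[of "x + \<delta>"] k0[of "x - \<delta>"] k0[of "x + \<delta>"] p0 \<delta> by (intro add_mono) auto
        thus ?thesis using \<epsilon> \<delta> by (intro mult_left_mono add_right_mono mult_right_mono) auto
      qed
      finally show ?thesis .
    qed
    have farb: "norm (\<integral>y. k y *\<^sub>R g y - indicator S y *\<^sub>R (k y *\<^sub>R g y) \<partial>?R) \<le> C * exp (- (c / u)) * I0 + norm (f x) / \<delta>\<^sup>2 * (Cm * u)"
    proof -
      have "norm (\<integral>y. k y *\<^sub>R g y - indicator S y *\<^sub>R (k y *\<^sub>R g y) \<partial>?R)
        \<le> (\<integral>y. C * exp (- (c / u)) * norm ((w y * Phi_factor m \<nu> y) *\<^sub>R f y) + norm (f x) / \<delta>\<^sup>2 * (k y * (y - x)\<^sup>2) \<partial>?R)"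
      proof (rule Bochner_Integration.integral_norm_bound_integral)
        show "integrable ?R (\<lambda>y. k y *\<^sub>R g y - indicator S y *\<^sub>R (k y *\<^sub>R g y))"
          by (intro Bochner_Integration.integrable_diff kg iS)
        show "integrable ?R (\<lambda>y. C * exp (- (c / u)) * norm ((w y * Phi_factor m \<nu> y) *\<^sub>R f y) + norm (f x) / \<delta>\<^sup>2 * (k y * (y - x)\<^sup>2))"
          by (intro Bochner_Integration.integrable_add integrable_mult_right integrable_norm iw k2)
        fix y :: real assume "y \<in> space ?R"
        hence y: "y > 0" by simp
        have pw: "0 \<le> w y" "0 \<le> Phi_factor m \<nu> y" using Phi_factor_pos[of y m \<nu>] y by (auto simp: w_def)
        have rhs0: "0 \<le> C * exp (- (c / u)) * norm ((w y * Phi_factor m \<nu> y) *\<^sub>R f y) + norm (f x) / \<delta>\<^sup>2 * (k y * (y - x)\<^sup>2)"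
          using C(1) k0[of y] y by (intro add_nonneg_nonneg mult_nonneg_nonneg) auto
        show "norm (k y *\<^sub>R g y - indicator S y *\<^sub>R (k y *\<^sub>R g y)) \<le> C * exp (- (c / u)) * norm ((w y * Phi_factor m \<nu> y) *\<^sub>R f y) + norm (f x) / \<delta>\<^sup>2 * (k y * (y - x)\<^sup>2)"
        proof (cases "y \<in> S")
          case True
          thus ?thesis using rhs0 by simp
        next
          case False
          hence yd: "\<bar>y - x\<bar> \<ge> \<delta>" by (auto simp: S_def)
          have "norm (k y *\<^sub>R g y) = k y * norm (f y - f x)" using k0[of y] y by (simp add: g_def)
          also have "\<dots> \<le> k y * (norm (f y) + norm (f x))"
            using k0[of y] y by (intro mult_left_mono norm_triangle_ineq4) auto
          also have "\<dots> = k y * norm (f y) + norm (f x) * (k y * 1)" by (simp add: algebra_simps)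
          also have "k y * norm (f y) \<le> (C * exp (- (c / u)) * (Phi_factor m \<nu> y * w y)) * norm (f y)"
            by (intro mult_right_mono far y yd) auto
          \<comment> \<open>Chebyshev: away from x the factor (y - x)^2 / \<delta>^2 is at least 1,
            and the second moment is at most a constant times u.\<close>
          also have "norm (f x) * (k y * 1) \<le> norm (f x) * (k y * ((y - x)\<^sup>2 / \<delta>\<^sup>2))"
          proof (intro mult_left_mono)
            have "\<delta>\<^sup>2 \<le> \<bar>y - x\<bar>\<^sup>2" using yd \<delta> by (intro power_mono) auto
            thus "1 \<le> (y - x)\<^sup>2 / \<delta>\<^sup>2" using \<delta>(1) by simp
          qed (use k0[of y] y in auto)
          finally show ?thesis using False pw by (simp add: abs_mult mult_ac)
        qed
      qed
      also have "\<dots> = C * exp (- (c / u)) * I0 + norm (f x) / \<delta>\<^sup>2 * (\<integral>y. k y * (y - x)\<^sup>2 \<partial>?R)"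
        unfolding I0_def using iw k2(1) by (subst Bochner_Integration.integral_add) (auto simp del: norm_scaleR)
      also have "\<dots> \<le> C * exp (- (c / u)) * I0 + norm (f x) / \<delta>\<^sup>2 * (Cm * u)"
        by (intro add_left_mono mult_left_mono k2) auto
      finally show ?thesis .
    qed
    have "(\<integral>y. k y *\<^sub>R f y \<partial>?R) - f x = (\<integral>y. k y *\<^sub>R g y \<partial>?R) + (exp (- (m * u)) - 1) *\<^sub>R f x"
      unfolding eqg by (simp add: algebra_simps)
    hence "norm ((\<integral>y. k y *\<^sub>R f y \<partial>?R) - f x) \<le> norm (\<integral>y. k y *\<^sub>R g y \<partial>?R) + norm ((exp (- (m * u)) - 1) *\<^sub>R f x)"
      by (simp only: norm_triangle_ineq)
    also have "\<dots> \<le> (\<epsilon> * (b u * \<delta> + W) + (C * exp (- (c / u)) * I0 + norm (f x) / \<delta>\<^sup>2 * (Cm * u))) + norm (f x) * \<bar>exp (- (m * u)) - 1\<bar>"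
      unfolding split using near farb by (intro add_mono order_trans[OF norm_triangle_ineq]) (auto simp: mult.commute)
    also have "\<dots> = Bd u" by (simp add: Bd_def)
    also have "\<dots> < e" using elim by simp
    finally show ?case by (simp add: dist_norm k_def a_def)
  qed
qed

section \<open>Subordination: from the heat limit to the Poisson limit\<close>

lemma poisson_weight_has_integral:
  assumes \<nu>: "\<nu> > 0" and t: "t > 0"
  shows "integrable (lebesgue_on {0<..}) (poisson_weight \<nu> t)"
    and "(\<integral>u. poisson_weight \<nu> t u \<partial>lebesgue_on {0<..}) = 4 powr \<nu> * Gamma \<nu> / t powr (2 * \<nu>)"
proof -
  \<comment> \<open>This substitution is its own inverse on the half line. It exchanges the
    exponential in 1 / u with one in s and turns the integral into Euler's integral for
    \<open>Gamma \<nu>\<close>.\<close>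
  define g where "g s = t\<^sup>2 / (4 * s)" for s :: real
  define h where "h s = - (t\<^sup>2 / (4 * s\<^sup>2))" for s :: real
  define K where "K = 4 powr \<nu> / t powr (2 * \<nu>)"
  have inj: "inj_on g {0<..}" using t by (auto simp: inj_on_def g_def)
  have im: "g ` {0<..} = {0<..}"
  proof
    show "g ` {0<..} \<subseteq> {0<..}" using t by (auto simp: g_def)
    show "{0<..} \<subseteq> g ` {0<..}"
    proof
      fix u :: real assume "u \<in> {0<..}"
      hence "u = g (g u)" "g u \<in> {0<..}" using t by (auto simp: g_def)
      thus "u \<in> g ` {0<..}" by blast
    qed
  qed
  have dg: "(g has_field_derivative h s) (at s within {0<..})" if "s \<in> {0<..}" for s
    unfolding g_def h_def using that by (auto intro!: derivative_eq_intros simp: power2_eq_square)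
  have eq: "\<bar>h s\<bar> * poisson_weight \<nu> t (g s) = K * (s powr (\<nu> - 1) * exp (- (1 * s)))" if s: "s > 0" for s
  proof -
    have e: "t\<^sup>2 / (4 * g s) = s" using s t by (simp add: g_def)
    have 1: "(g s) powr (1 + \<nu>) = g s * (t powr (2 * \<nu>) / (4 powr \<nu> * s powr \<nu>))"
    proof -
      have "(g s) powr \<nu> = (t\<^sup>2) powr \<nu> / (4 * s) powr \<nu>" unfolding g_def using s t by (subst powr_divide) auto
      also have "(t\<^sup>2) powr \<nu> = t powr (2 * \<nu>)" using t by (simp add: powr_powr flip: powr_numeral)
      also have "(4 * s) powr \<nu> = 4 powr \<nu> * s powr \<nu>" using s by (simp add: powr_mult)
      finally show ?thesis using s t by (simp add: powr_add g_def)
    qed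
    have 2: "s powr (\<nu> - 1) = s powr \<nu> / s" using s by (simp add: powr_diff)
    have 3: "g s > 0" "\<bar>h s\<bar> = g s / s" using s t by (simp_all add: g_def h_def power2_eq_square)
    show ?thesis unfolding poisson_weight_def e K_def 1 2 3(2) using 3(1) s t by (simp add: mult_ac)
  qed
  have hb: "has_bochner_integral (lebesgue_on {0<..}) (\<lambda>s. K * (s powr (\<nu> - 1) * exp (- (1 * s)))) (K * (Gamma \<nu> * 1 powr (- \<nu>)))"
    by (intro has_bochner_integral_mult_right has_bochner_integral_gamma_scaled \<nu>) auto
  hence "has_bochner_integral (lebesgue_on {0<..}) (\<lambda>s. \<bar>h s\<bar> * poisson_weight \<nu> t (g s)) (K * Gamma \<nu>)"
    by (subst has_bochner_integral_cong[OF refl eq]) auto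
  hence 1: "integrable (lebesgue_on {0<..}) (\<lambda>s. \<bar>h s\<bar> * poisson_weight \<nu> t (g s))" "(\<integral>s. \<bar>h s\<bar> * poisson_weight \<nu> t (g s) \<partial>lebesgue_on {0<..}) = K * Gamma \<nu>"
    by (auto simp: has_bochner_integral_iff)
  have "(\<lambda>s. \<bar>h s\<bar> * poisson_weight \<nu> t (g s)) absolutely_integrable_on {0<..}"
    using 1(1) by (simp add: set_integrable_def integrable_restrict_space)
  moreover have "integral {0<..} (\<lambda>s. \<bar>h s\<bar> * poisson_weight \<nu> t (g s)) = K * Gamma \<nu>"
    using lebesgue_integral_eq_integral[OF 1(1)] 1(2) by simp
  ultimately have 2: "poisson_weight \<nu> t absolutely_integrable_on {0<..}" "integral {0<..} (poisson_weight \<nu> t) = K * Gamma \<nu>"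
    using has_absolute_integral_change_of_variables_1'[OF _ dg inj, of "poisson_weight \<nu> t" "K * Gamma \<nu>"] unfolding im by auto
  show i: "integrable (lebesgue_on {0<..}) (poisson_weight \<nu> t)"
    using 2(1) by (simp add: set_integrable_def integrable_restrict_space)
  show "(\<integral>u. poisson_weight \<nu> t u \<partial>lebesgue_on {0<..}) = 4 powr \<nu> * Gamma \<nu> / t powr (2 * \<nu>)"
    using lebesgue_integral_eq_integral[OF i] 2(2) by (simp add: K_def)
qed

text \<open>The prefactor normalizes the weight to total mass 1. For u below \<eta> the heat limit
  makes the integrand small; for u above \<eta> the weight without its prefactor is bounded
  uniformly in t, and the prefactor t^(2 \<nu>) tends to 0.\<close>

lemma poisson_limit:
  assumes \<alpha>: "\<alpha> > -1" and m: "m \<ge> 0" and \<nu>: "\<nu> > 0" and L: "normalized_laguerre \<alpha> L"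
    and f: "f \<in> L1_Phi \<alpha> m \<nu>" and x: "x > 0"
    and lim: "((\<lambda>u. \<integral>y. weighted_kernel (\<alpha> + 1) m u x y *\<^sub>R f y \<partial>lebesgue_on {0<..}) \<longlongrightarrow> f x) (at_right 0)"
  shows "((\<lambda>t. poisson_integral \<alpha> m \<nu> L t f x) \<longlongrightarrow> f x) (at_right 0)"
proof (rule tendstoI)
  fix e :: real assume e: "e > 0"
  let ?R = "lebesgue_on {0::real<..}"
  interpret R: sigma_finite_measure ?R by (rule sigma_finite_Ioi)
  interpret P: pair_sigma_finite ?R ?R ..
  define H where "H u = (\<integral>y. weighted_kernel (\<alpha> + 1) m u x y *\<^sub>R f y \<partial>?R)" for u
  define ct where "ct t = t powr (2 * \<nu>) / (4 powr \<nu> * Gamma \<nu>)" for t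
  have G: "Gamma \<nu> > 0" using \<nu> by (rule Gamma_real_pos)
  have PI: "poisson_integral \<alpha> m \<nu> L t f x = ct t *\<^sub>R (\<integral>u. poisson_weight \<nu> t u *\<^sub>R H u \<partial>?R)" for t
    unfolding poisson_integral_eq_iterated[OF \<alpha> L] H_def ct_def weighted_kernel_def by simp
  have iH: "integrable ?R (\<lambda>u. poisson_weight \<nu> t u *\<^sub>R H u)" if "t > 0" for t
  proof -
    have "integrable ?R (\<lambda>u. \<integral>y. (poisson_weight \<nu> t u * hh_kernel (\<alpha> + 1) m u x y * (y powr \<alpha> * exp (- y))) *\<^sub>R f y \<partial>?R)"
      using P.integrable_fst'[OF poisson_pair_integrable[OF \<alpha> m \<nu> L f that x]] by simp
    also have "(\<lambda>u. \<integral>y. (poisson_weight \<nu> t u * hh_kernel (\<alpha> + 1) m u x y * (y powr \<alpha> * exp (- y))) *\<^sub>R f y \<partial>?R) = (\<lambda>u. poisson_weight \<nu> t u *\<^sub>R H u)"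
      unfolding H_def integral_scaleR_right[symmetric] by (simp add: weighted_kernel_def mult.assoc)
    finally show ?thesis .
  qed
  have iHf: "integrable ?R (\<lambda>u. poisson_weight \<nu> t u *\<^sub>R (H u - f x))" if "t > 0" for t
    unfolding scaleR_diff_right using iH[OF that] poisson_weight_has_integral(1)[OF \<nu> that]
    by (intro Bochner_Integration.integrable_diff) auto
  have diff: "poisson_integral \<alpha> m \<nu> L t f x - f x = ct t *\<^sub>R (\<integral>u. poisson_weight \<nu> t u *\<^sub>R (H u - f x) \<partial>?R)" if "t > 0" for t
  proof -
    have "(\<integral>u. poisson_weight \<nu> t u *\<^sub>R (H u - f x) \<partial>?R) = (\<integral>u. poisson_weight \<nu> t u *\<^sub>R H u \<partial>?R) - (4 powr \<nu> * Gamma \<nu> / t powr (2 * \<nu>)) *\<^sub>R f x"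
      unfolding scaleR_diff_right using iH[OF that] poisson_weight_has_integral[OF \<nu> that]
      by (subst Bochner_Integration.integral_diff) auto
    moreover have "ct t * (4 powr \<nu> * Gamma \<nu> / t powr (2 * \<nu>)) = 1" using G that by (simp add: ct_def)
    ultimately show ?thesis unfolding PI by (simp only: scaleR_diff_right scaleR_scaleR scaleR_one)
  qed
  have "eventually (\<lambda>u. dist (H u) (f x) < e / 2) (at_right 0)"
    using lim e unfolding H_def by (intro tendstoD) auto
  then obtain \<eta> where \<eta>: "\<eta> > 0" "\<And>u. 0 < u \<Longrightarrow> u < \<eta> \<Longrightarrow> dist (H u) (f x) < e / 2"
    unfolding eventually_at_right_field by blast
  \<comment> \<open>For u >= \<eta> the weight at any t is at most exp (1 / (4 \<eta>)) times the
    weight at t = 1, against which the deviation is already known to be integrable. So K bounds the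
    tail independently of t.\<close>
  define K where "K = exp (1 / (4 * \<eta>)) * (\<integral>u. norm (poisson_weight \<nu> 1 u *\<^sub>R (H u - f x)) \<partial>?R)"
  have "((\<lambda>t. e / 2 + ct t * K) \<longlongrightarrow> e / 2 + 0 / (4 powr \<nu> * Gamma \<nu>) * K) (at_right 0)"
    unfolding ct_def
  proof (intro tendsto_intros)
    show "((\<lambda>t. t powr (2 * \<nu>)) \<longlongrightarrow> 0) (at_right 0)" using \<nu> by real_asymp
  qed (use G in auto)
  hence "((\<lambda>t. e / 2 + ct t * K) \<longlongrightarrow> e / 2) (at_right 0)" by simp
  from order_tendstoD(2)[OF this, of e] have ev1: "eventually (\<lambda>t. e / 2 + ct t * K < e) (at_right 0)"
    using e by simp
  have ev2: "eventually (\<lambda>t::real. 0 < t \<and> t < 1) (at_right 0)"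
    using eventually_at_right_real[of 0 1] by simp
  show "eventually (\<lambda>t. dist (poisson_integral \<alpha> m \<nu> L t f x) (f x) < e) (at_right 0)"
    using ev1 ev2
  proof eventually_elim
    case (elim t)
    hence t: "t > 0" "t < 1" by auto
    have ct: "ct t > 0" using t G by (simp add: ct_def)
    have "norm (\<integral>u. poisson_weight \<nu> t u *\<^sub>R (H u - f x) \<partial>?R) \<le> (\<integral>u. e / 2 * poisson_weight \<nu> t u + exp (1 / (4 * \<eta>)) * norm (poisson_weight \<nu> 1 u *\<^sub>R (H u - f x)) \<partial>?R)"
    proof (rule Bochner_Integration.integral_norm_bound_integral[OF iHf[OF t(1)]])
      show "integrable ?R (\<lambda>u. e / 2 * poisson_weight \<nu> t u + exp (1 / (4 * \<eta>)) * norm (poisson_weight \<nu> 1 u *\<^sub>R (H u - f x)))"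
        by (intro Bochner_Integration.integrable_add integrable_mult_right integrable_norm poisson_weight_has_integral(1)[OF \<nu> t(1)] iHf) auto
      fix u :: real assume "u \<in> space ?R"
      hence u: "u > 0" by simp
      have nw: "norm (poisson_weight \<nu> t u *\<^sub>R (H u - f x)) = poisson_weight \<nu> t u * norm (H u - f x)"
        using poisson_weight_nonneg[of \<nu> t u] by simp
      show "norm (poisson_weight \<nu> t u *\<^sub>R (H u - f x)) \<le> e / 2 * poisson_weight \<nu> t u + exp (1 / (4 * \<eta>)) * norm (poisson_weight \<nu> 1 u *\<^sub>R (H u - f x))"
      proof (cases "u < \<eta>")
        case True
        have "poisson_weight \<nu> t u * norm (H u - f x) \<le> e / 2 * poisson_weight \<nu> t u"
          using mult_left_mono[of "norm (H u - f x)" "e / 2" "poisson_weight \<nu> t u"] \<eta>(2)[OF u True] poisson_weight_nonneg[of \<nu> t u]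
          by (simp add: dist_norm mult.commute[of "poisson_weight \<nu> t u"])
        moreover have "0 \<le> exp (1 / (4 * \<eta>)) * norm (poisson_weight \<nu> 1 u *\<^sub>R (H u - f x))" by simp
        ultimately show ?thesis unfolding nw by (rule add_increasing2[rotated])
      next
        case False
        have "poisson_weight \<nu> t u \<le> exp (1 / (4 * \<eta>)) * poisson_weight \<nu> 1 u"
        proof -
          have "exp (- (t\<^sup>2 / (4 * u))) \<le> exp (1 / (4 * \<eta>)) * exp (- (1\<^sup>2 / (4 * u)))"
          proof -
            have "1 / (4 * u) \<le> 1 / (4 * \<eta>)" using False \<eta>(1) by (intro divide_left_mono) auto
            moreover have "t\<^sup>2 / (4 * u) \<ge> 0" using u by simp
            ultimately show ?thesis by (simp add: exp_add[symmetric])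
          qed
          hence "exp (- (t\<^sup>2 / (4 * u))) / u powr (1 + \<nu>) \<le> exp (1 / (4 * \<eta>)) * exp (- (1\<^sup>2 / (4 * u))) / u powr (1 + \<nu>)"
            by (intro divide_right_mono) auto
          thus ?thesis by (simp add: poisson_weight_def)
        qed
        hence "poisson_weight \<nu> t u * norm (H u - f x) \<le> (exp (1 / (4 * \<eta>)) * poisson_weight \<nu> 1 u) * norm (H u - f x)"
          by (intro mult_right_mono) auto
        moreover have "0 \<le> e / 2 * poisson_weight \<nu> t u" using e poisson_weight_nonneg[of \<nu> t u] by simp
        ultimately show ?thesis using poisson_weight_nonneg[of \<nu> t u] poisson_weight_nonneg[of \<nu> 1 u] by (simp add: mult.assoc)
      qed
    qed
    also have "\<dots> = e / 2 * (4 powr \<nu> * Gamma \<nu> / t powr (2 * \<nu>)) + K"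
      unfolding K_def using poisson_weight_has_integral[OF \<nu> t(1)] integrable_norm[OF iHf[of 1]]
      by (subst Bochner_Integration.integral_add) (auto simp del: norm_scaleR)
    finally have "ct t * norm (\<integral>u. poisson_weight \<nu> t u *\<^sub>R (H u - f x) \<partial>?R) \<le> ct t * (e / 2 * (4 powr \<nu> * Gamma \<nu> / t powr (2 * \<nu>)) + K)"
      using ct by (intro mult_left_mono) auto
    also have "\<dots> = e / 2 + ct t * K" using G t by (simp add: ct_def field_simps)
    finally have "norm (poisson_integral \<alpha> m \<nu> L t f x - f x) \<le> e / 2 + ct t * K"
      unfolding diff[OF t(1)] using ct by simp
    thus ?case using elim by (simp add: dist_norm)
  qed
qed

lemma poisson_limit_AE:
  assumes \<alpha>: "\<alpha> > -1" and m: "m \<ge> 0" and \<nu>: "\<nu> > 0" and L: "normalized_laguerre \<alpha> L"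
    and f: "f \<in> L1_Phi \<alpha> m \<nu>"
  shows "AE x in lebesgue_on {0<..}. ((\<lambda>t. poisson_integral \<alpha> m \<nu> L t f x) \<longlongrightarrow> f x) (at_right 0)"
proof -
  have int: "\<And>p q. 0 < p \<Longrightarrow> f integrable_on {p..q}"
    using L1_Phi_locally_integrable[OF f] set_lebesgue_integral_eq_integral(1) by blast
  have "AE x in lebesgue. x > 0 \<longrightarrow> (\<forall>e>0. \<exists>d>0. \<forall>u v. u < v \<longrightarrow> v - u < d \<longrightarrow> (x = u \<or> x = v) \<longrightarrow>
           norm ((v - u) *\<^sub>R f x - integral {u..v} f) \<le> e * (v - u))"
    by (rule AE_integral_derivative_pos) (rule int)
  hence "AE x in lebesgue. x \<in> {0<..} \<longrightarrow> ((\<lambda>t. poisson_integral \<alpha> m \<nu> L t f x) \<longlongrightarrow> f x) (at_right 0)"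
  proof eventually_elim
    case (elim x)
    thus ?case
      by (auto intro!: poisson_limit[OF \<alpha> m \<nu> L f] heat_limit[OF \<alpha> m \<nu> f])
  qed
  thus ?thesis by (subst AE_restrict_space_iff) auto
qed

theorem theorem1p1:
  fixes \<alpha> m \<nu> :: real and L :: "nat \<Rightarrow> real poly"
  assumes "\<alpha> > -1" and "m \<ge> 0" and "\<nu> > 0"
    and "normalized_laguerre \<alpha> L"
  shows "(\<forall>f \<in> L1_Phi \<alpha> m \<nu>.
            (\<forall>t>0. \<forall>x>0. poisson_abs_convergent \<alpha> m \<nu> L t f x) \<and>
            C_infinity_on ({0<..} \<times> {0<..}) (\<lambda>(t, x). poisson_integral \<alpha> m \<nu> L t f x) \<and>
            (\<forall>t>0. \<forall>x>0.
               vector_derivative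
                 (\<lambda>s. vector_derivative (\<lambda>r. poisson_integral \<alpha> m \<nu> L r f x) (at s)) (at t)
               + ((1 - 2 * \<nu>) / t) *\<^sub>R
                   vector_derivative (\<lambda>s. poisson_integral \<alpha> m \<nu> L s f x) (at t)
               = laguerre_op \<alpha> m (\<lambda>z. poisson_integral \<alpha> m \<nu> L t f z) x) \<and>
            (AE x in lebesgue_on {0<..}.
               ((\<lambda>t. poisson_integral \<alpha> m \<nu> L t f x) \<longlongrightarrow> f x) (at_right 0)))
       \<and> (\<forall>f :: real \<Rightarrow> real.
            f \<in> borel_measurable (lebesgue_on {0<..}) \<longrightarrow>
            (\<forall>y>0. f y \<ge> 0) \<longrightarrow>
            (\<exists>t>0. \<exists>x>0. poisson_abs_convergent \<alpha> m \<nu> L t (\<lambda>y. complex_of_real (f y)) x) \<longrightarrow>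
            (\<lambda>y. complex_of_real (f y)) \<in> L1_Phi \<alpha> m \<nu>)"
proof (intro conjI ballI allI impI)
  fix f assume f: "f \<in> L1_Phi \<alpha> m \<nu>"
  show "poisson_abs_convergent \<alpha> m \<nu> L t f x" if "t > 0" "x > 0" for t x
    by (rule poisson_abs_convergent_of_L1_Phi[OF assms f that])
  show "C_infinity_on ({0<..} \<times> {0<..}) (\<lambda>(t, x). poisson_integral \<alpha> m \<nu> L t f x)"
    by (rule poisson_integral_smooth[OF assms f])
  show "vector_derivative (\<lambda>s. vector_derivative (\<lambda>r. poisson_integral \<alpha> m \<nu> L r f x) (at s)) (at t)
               + ((1 - 2 * \<nu>) / t) *\<^sub>R vector_derivative (\<lambda>s. poisson_integral \<alpha> m \<nu> L s f x) (at t)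
               = laguerre_op \<alpha> m (\<lambda>z. poisson_integral \<alpha> m \<nu> L t f z) x" if "t > 0" "x > 0" for t x
    by (rule poisson_integral_pde[OF assms f that])
  show "AE x in lebesgue_on {0<..}. ((\<lambda>t. poisson_integral \<alpha> m \<nu> L t f x) \<longlongrightarrow> f x) (at_right 0)"
    by (rule poisson_limit_AE[OF assms f])
next
  fix f :: "real \<Rightarrow> real"
  assume f: "f \<in> borel_measurable (lebesgue_on {0<..})"
    and ex: "\<exists>t>0. \<exists>x>0. poisson_abs_convergent \<alpha> m \<nu> L t (\<lambda>y. complex_of_real (f y)) x"
  have "(\<lambda>y. complex_of_real (f y)) \<in> borel_measurable (lebesgue_on {0<..})" using f by measurable
  thus "(\<lambda>y. complex_of_real (f y)) \<in> L1_Phi \<alpha> m \<nu>"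
    using ex L1_Phi_of_poisson_abs_convergent[OF assms] by blast
qed

end
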